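(* Let $k$ be an algebraically closed field, let $n\ge4$, and let $kD_n$ be the path algebra of a quiver of Dynkin type $D_n$. In any semi-orthogonal decomposition $\mathcal D^b(\operatorname{mod}kD_n)=\mathcal T_1\perp\mathcal T_2$, at least one of $\mathcal T_1,\mathcal T_2$ has no direct summand (as a triangulated category) equivalent to $\mathcal D^b(\operatorname{mod}kD_l)$ for any $l\ge4$.
   Context: A semi-orthogonal decomposition $\mathcal T=\mathcal T_1\perp\mathcal T_2$ of a triangulated category $\mathcal T$ is a pair of thick subcategories $\mathcal T_1,\mathcal T_2\subseteq\mathcal T$ such that (1) $\operatorname{Hom}_{\mathcal T}(X_1,X_2)=0$ for all $X_1\in\mathcal T_1$, $X_2\in\mathcal T_2$, and (2) every $X\in\mathcal T$ fits into an exact triangle $X_1\to X\to X_2\to$ with $X_1\in\mathcal T_1$ and $X_2\in\mathcal T_2$. *)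

theory Defs
  imports
    "HOL-Computational_Algebra.Polynomial"
    "Graph_Theory.Arc_Walk"
    "HOL-Algebra.AbelCoset"
    "HOL-Algebra.Module"
begin

section \<open>Quivers of type D and path algebras\<close>

text \<open>
  A quiver is a \<^typ>\<open>('v, 'e) pre_digraph\<close>: vertices, arrows, and source/target maps
  (\<^const>\<open>tail\<close>, \<^const>\<open>head\<close>).  The graph \<open>D\<^sub>n\<close> has vertices \<open>1, \<dots>, n\<close>, the chain
  \<open>1 - 2 - \<dots> - (n - 1)\<close> and the extra edge \<open>(n - 2) - n\<close>.
\<close>

definition D_edges :: "nat \<Rightarrow> nat set set" where
  "D_edges n = {{i, i + 1} | i. 1 \<le> i \<and> i \<le> n - 2} \<union> {{n - 2, n}}"

text \<open>
  The underlying graph of the quiver is \<open>D\<^sub>n\<close>, the orientation being arbitrary: injectivity of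
  the map sending an arrow to its set of end points excludes multiple edges.
\<close>

definition dynkin_type_D :: "nat \<Rightarrow> ('v, 'e) pre_digraph \<Rightarrow> bool" where
  "dynkin_type_D n Q \<longleftrightarrow>
    (\<exists>\<phi>. bij_betw \<phi> {1..n} (verts Q) \<and>
         bij_betw (\<lambda>e. {tail Q e, head Q e}) (arcs Q) ((\<lambda>E. \<phi> ` E) ` D_edges n))"

text \<open>
  A path is given by its starting vertex and its list of arrows, so that \<open>(u, [])\<close> is the trivial
  path at \<open>u\<close>.
\<close>

definition quiver_paths :: "('v, 'e) pre_digraph \<Rightarrow> ('v \<times> 'e list) set" where
  "quiver_paths Q = {(u, p). \<exists>v. pre_digraph.awalk Q u p v}"

text \<open>
  Elements are finitely supported families of coefficients; the product of two paths is their
  concatenation (first factor traversed first), or zero if they do not compose.  With this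
  convention right modules are the same thing as representations of \<open>Q\<close>.
\<close>

definition path_algebra :: "('v, 'e) pre_digraph \<Rightarrow> ('v \<times> 'e list \<Rightarrow> 'k::field) ring" where
  "path_algebra Q =
    \<lparr> carrier = {a. finite {w. a w \<noteq> 0} \<and> {w. a w \<noteq> 0} \<subseteq> quiver_paths Q},
      mult = (\<lambda>a b (u, p). \<Sum>i\<le>length p.
                a (u, take i p) * b (pre_digraph.awlast Q u (take i p), drop i p)),
      one = (\<lambda>(u, p). if u \<in> verts Q \<and> p = [] then 1 else 0),
      zero = (\<lambda>w. 0),
      add = (\<lambda>a b w. a w + b w) \<rparr>"

lemma awlast_append:
  "pre_digraph.awlast Q u (p @ q) = pre_digraph.awlast Q (pre_digraph.awlast Q u p) q"
proof (induction p arbitrary: u)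
  case (Cons e p)
  then show ?case
    by (simp add: pre_digraph.awalk_verts.simps pre_digraph.awalk_verts_non_Nil)
qed (simp add: pre_digraph.awalk_verts.simps)

lemma quiver_paths_append:
  assumes "(u, p) \<in> quiver_paths Q" and "(pre_digraph.awlast Q u p, q) \<in> quiver_paths Q"
  shows "(u, p @ q) \<in> quiver_paths Q"
proof -
  have "pre_digraph.awlast Q u p = v" if "pre_digraph.cas Q u p v" for u v
    using that
    by (induction p arbitrary: u)
      (auto simp: pre_digraph.cas.simps pre_digraph.awalk_verts.simps pre_digraph.awalk_verts_non_Nil)
  then show ?thesis
    using assms by (auto simp: quiver_paths_def pre_digraph.awalk_def pre_digraph.cas_append_iff)
qed

lemma dynkin_type_D_digraph:
  assumes "4 \<le> n" and "dynkin_type_D n Q"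
  shows "wf_digraph Q" and "finite (verts Q)"
proof -
  obtain \<phi> where v: "bij_betw \<phi> {1..n} (verts Q)"
    and e: "bij_betw (\<lambda>e. {tail Q e, head Q e}) (arcs Q) ((\<lambda>E. \<phi> ` E) ` D_edges n)"
    using assms(2) by (auto simp: dynkin_type_D_def)
  show "finite (verts Q)"
    using v bij_betw_finite by blast
  have "E \<subseteq> {1..n}" if "E \<in> D_edges n" for E
    using that assms(1) by (auto simp: D_edges_def)
  then have "{tail Q x, head Q x} \<subseteq> verts Q" if "x \<in> arcs Q" for x
    using bij_betwE[OF e] bij_betw_imp_surj_on[OF v] that by (fastforce simp del: insert_subset)
  then show "wf_digraph Q"
    by unfold_locales auto
qed

lemma ring_path_algebra:
  assumes wf: "wf_digraph Q" and fin: "finite (verts Q)"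
  shows "ring (path_algebra Q :: ('v \<times> 'e list \<Rightarrow> 'k::field) ring)"
proof (rule ringI)
  let ?A = "path_algebra Q :: ('v \<times> 'e list \<Rightarrow> 'k::field) ring"
  let ?t = "\<lambda>u p. pre_digraph.awlast Q u p"
  have carr: "a \<in> carrier ?A \<longleftrightarrow> finite {w. a w \<noteq> 0} \<and> {w. a w \<noteq> 0} \<subseteq> quiver_paths Q" for a
    by (simp add: path_algebra_def)
  have addc: "(\<lambda>w. a w + b w) \<in> carrier ?A" if "a \<in> carrier ?A" "b \<in> carrier ?A" for a b
  proof -
    have "{w. a w + b w \<noteq> 0} \<subseteq> {w. a w \<noteq> 0} \<union> {w. b w \<noteq> 0}" by auto
    moreover have "finite ({w. a w \<noteq> 0} \<union> {w. b w \<noteq> 0})"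
      and "{w. a w \<noteq> 0} \<union> {w. b w \<noteq> 0} \<subseteq> quiver_paths Q"
      using that by (auto simp: carr)
    ultimately show ?thesis unfolding carr by (meson finite_subset subset_trans)
  qed
  show "abelian_group ?A"
  proof (rule abelian_groupI)
    fix a assume a: "a \<in> carrier ?A"
    have "(\<lambda>w. - a w) \<in> carrier ?A" using a by (simp add: carr)
    then show "\<exists>y\<in>carrier ?A. y \<oplus>\<^bsub>?A\<^esub> a = \<zero>\<^bsub>?A\<^esub>"
      by (intro bexI[of _ "\<lambda>w. - a w"]) (auto simp: path_algebra_def)
  next
    fix a b assume "a \<in> carrier ?A" "b \<in> carrier ?A"
    then show "a \<oplus>\<^bsub>?A\<^esub> b \<in> carrier ?A" using addc[of a b] by (simp add: path_algebra_def)
  qed (auto simp: path_algebra_def add.assoc add.commute)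
  show "monoid ?A"
  proof (rule monoidI)
    fix a b assume a: "a \<in> carrier ?A" and b: "b \<in> carrier ?A"
    let ?S = "{w. a w \<noteq> 0} \<times> {w. b w \<noteq> 0}"
    let ?g = "\<lambda>((u, p), (v, q)). (u, p @ q)"
    have sub: "{w. (a \<otimes>\<^bsub>?A\<^esub> b) w \<noteq> 0} \<subseteq> ?g ` ?S \<inter> quiver_paths Q"
    proof
      fix w assume "w \<in> {w. (a \<otimes>\<^bsub>?A\<^esub> b) w \<noteq> 0}"
      moreover obtain u p where w: "w = (u, p)" by (cases w)
      ultimately have "(\<Sum>i\<le>length p. a (u, take i p) * b (?t u (take i p), drop i p)) \<noteq> 0"
        by (simp add: path_algebra_def)
      then obtain i where i: "a (u, take i p) \<noteq> 0" "b (?t u (take i p), drop i p) \<noteq> 0"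
        by (metis (no_types, lifting) mult_eq_0_iff sum.neutral)
      then have "w \<in> ?g ` ?S"
        unfolding w by (intro image_eqI[of _ _ "((u, take i p), (?t u (take i p), drop i p))"]) auto
      moreover have "w \<in> quiver_paths Q"
        using i a b quiver_paths_append[of u "take i p" Q "drop i p"] by (auto simp: carr w)
      ultimately show "w \<in> ?g ` ?S \<inter> quiver_paths Q" by blast
    qed
    moreover have "finite (?g ` ?S)" using a b by (auto simp: carr)
    ultimately show "a \<otimes>\<^bsub>?A\<^esub> b \<in> carrier ?A" unfolding carr by (meson finite_Int finite_subset le_inf_iff)
  next
    have "{w. \<one>\<^bsub>?A\<^esub> w \<noteq> 0} \<subseteq> (\<lambda>u. (u, [])) ` verts Q"
      by (auto simp: path_algebra_def split: if_splits)
    moreover have "(\<lambda>u. (u, [])) ` verts Q \<subseteq> quiver_paths Q"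
      by (auto simp: quiver_paths_def pre_digraph.awalk_def pre_digraph.cas.simps)
    ultimately show "\<one>\<^bsub>?A\<^esub> \<in> carrier ?A"
      unfolding carr using fin by (meson finite_imageI finite_subset subset_trans)
  next
    fix a b c :: "'v \<times> 'e list \<Rightarrow> 'k"
    show "a \<otimes>\<^bsub>?A\<^esub> b \<otimes>\<^bsub>?A\<^esub> c = a \<otimes>\<^bsub>?A\<^esub> (b \<otimes>\<^bsub>?A\<^esub> c)"
    proof (rule ext, clarify)
      fix u and p :: "'e list"
      let ?n = "length p"
      let ?g = "\<lambda>j k. a (u, take j p) * (b (?t u (take j p), take k (drop j p))
                        * c (?t u (take (j + k) p), drop (j + k) p))"
      have "(a \<otimes>\<^bsub>?A\<^esub> b \<otimes>\<^bsub>?A\<^esub> c) (u, p) = (\<Sum>i\<le>?n. \<Sum>j\<le>i. ?g j (i - j))"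
        by (auto simp: path_algebra_def sum_distrib_right mult.assoc min_def drop_take
            intro!: sum.cong)
      also have "\<dots> = sum (\<lambda>(j, k). ?g j k) {(j, k). j + k \<le> ?n}"
        by (simp only: sum.triangle_reindex_eq)
      also have "{(j, k). j + k \<le> ?n} = Sigma {..?n} (\<lambda>j. {..?n - j})" by auto
      also have "sum (\<lambda>(j, k). ?g j k) \<dots> = (\<Sum>j\<le>?n. \<Sum>k\<le>?n - j. ?g j k)"
        by (subst sum.Sigma) auto
      also have "\<dots> = (a \<otimes>\<^bsub>?A\<^esub> (b \<otimes>\<^bsub>?A\<^esub> c)) (u, p)"
        by (auto simp: path_algebra_def sum_distrib_left take_add awlast_append add.commute
            intro!: sum.cong)
      finally show "(a \<otimes>\<^bsub>?A\<^esub> b \<otimes>\<^bsub>?A\<^esub> c) (u, p) = (a \<otimes>\<^bsub>?A\<^esub> (b \<otimes>\<^bsub>?A\<^esub> c)) (u, p)" .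
    qed
  next
    fix a assume a: "a \<in> carrier ?A"
    have supp: "a (u, p) = 0" if "u \<notin> verts Q" for u p
      using a that by (fastforce simp: carr quiver_paths_def pre_digraph.awalk_def)
    show "\<one>\<^bsub>?A\<^esub> \<otimes>\<^bsub>?A\<^esub> a = a"
    proof (rule ext, clarify)
      fix u and p :: "'e list"
      have "(\<one>\<^bsub>?A\<^esub> \<otimes>\<^bsub>?A\<^esub> a) (u, p) =
          (\<Sum>i\<le>length p. (if u \<in> verts Q \<and> take i p = [] then 1 else 0) *
             a (?t u (take i p), drop i p))"
        by (simp add: path_algebra_def)
      also have "\<dots> = (\<Sum>i\<le>length p. if i = 0 then a (u, p) else 0)"
      proof (rule sum.cong)
        fix i assume "i \<in> {..length p}"
        then show "(if u \<in> verts Q \<and> take i p = [] then 1 else 0) * a (?t u (take i p), drop i p)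
            = (if i = 0 then a (u, p) else 0)"
          using supp[of u p] by (cases "i = 0") (auto simp: pre_digraph.awalk_verts.simps)
      qed simp
      finally have "(\<one>\<^bsub>?A\<^esub> \<otimes>\<^bsub>?A\<^esub> a) (u, p) = (\<Sum>i\<le>length p. if i = 0 then a (u, p) else 0)" .
      then show "(\<one>\<^bsub>?A\<^esub> \<otimes>\<^bsub>?A\<^esub> a) (u, p) = a (u, p)" by (simp add: sum.delta)
    qed
    show "a \<otimes>\<^bsub>?A\<^esub> \<one>\<^bsub>?A\<^esub> = a"
    proof (rule ext, clarify)
      fix u and p :: "'e list"
      have end_in: "?t u p \<in> verts Q" if "a (u, p) \<noteq> 0"
        using a that wf_digraph.awlast_in_verts[OF wf, of u p]
        by (fastforce simp: carr quiver_paths_def pre_digraph.awalk_def)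
      have "(a \<otimes>\<^bsub>?A\<^esub> \<one>\<^bsub>?A\<^esub>) (u, p) =
          (\<Sum>i\<le>length p. a (u, take i p) *
             (if ?t u (take i p) \<in> verts Q \<and> drop i p = [] then 1 else 0))"
        by (simp add: path_algebra_def)
      also have "\<dots> = (\<Sum>i\<le>length p. if i = length p then a (u, p) else 0)"
      proof (rule sum.cong)
        fix i assume "i \<in> {..length p}"
        then show "a (u, take i p) * (if ?t u (take i p) \<in> verts Q \<and> drop i p = [] then 1 else 0)
            = (if i = length p then a (u, p) else 0)"
          using end_in by (cases "i = length p") auto
      qed simp
      finally have "(a \<otimes>\<^bsub>?A\<^esub> \<one>\<^bsub>?A\<^esub>) (u, p) =
          (\<Sum>i\<le>length p. if i = length p then a (u, p) else 0)" .
      then show "(a \<otimes>\<^bsub>?A\<^esub> \<one>\<^bsub>?A\<^esub>) (u, p) = a (u, p)" by (simp add: sum.delta)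
    qed
  qed
qed (auto simp: path_algebra_def algebra_simps sum.distrib fun_eq_iff)


section \<open>Finitely generated right modules\<close>

text \<open>
  The library's locale \<^locale>\<open>module\<close> requires a commutative base ring.  We reuse its record, writing
  \<open>r \<odot> x\<close> for the right action \<open>x r\<close>; the multiplicative fields of the record play no role.
\<close>

locale right_module = R?: ring R + M?: abelian_group M
  for R :: "'a ring" (structure) and M :: "('a, 'm) module" (structure) +
  assumes act_closed: "\<lbrakk>r \<in> carrier R; x \<in> carrier M\<rbrakk> \<Longrightarrow> r \<odot>\<^bsub>M\<^esub> x \<in> carrier M"
    and act_l_distr: "\<lbrakk>r \<in> carrier R; s \<in> carrier R; x \<in> carrier M\<rbrakk> \<Longrightarrow>
      (r \<oplus> s) \<odot>\<^bsub>M\<^esub> x = r \<odot>\<^bsub>M\<^esub> x \<oplus>\<^bsub>M\<^esub> s \<odot>\<^bsub>M\<^esub> x"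
    and act_r_distr: "\<lbrakk>r \<in> carrier R; x \<in> carrier M; y \<in> carrier M\<rbrakk> \<Longrightarrow>
      r \<odot>\<^bsub>M\<^esub> (x \<oplus>\<^bsub>M\<^esub> y) = r \<odot>\<^bsub>M\<^esub> x \<oplus>\<^bsub>M\<^esub> r \<odot>\<^bsub>M\<^esub> y"
    and act_mult: "\<lbrakk>r \<in> carrier R; s \<in> carrier R; x \<in> carrier M\<rbrakk> \<Longrightarrow>
      (r \<otimes> s) \<odot>\<^bsub>M\<^esub> x = s \<odot>\<^bsub>M\<^esub> (r \<odot>\<^bsub>M\<^esub> x)"
    and act_one: "x \<in> carrier M \<Longrightarrow> \<one> \<odot>\<^bsub>M\<^esub> x = x"

definition fg_right_module :: "'a ring \<Rightarrow> ('a, 'm) module \<Rightarrow> bool" where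
  "fg_right_module R M \<longleftrightarrow> right_module R M \<and>
    (\<exists>S. finite S \<and> S \<subseteq> carrier M \<and>
      (\<forall>x\<in>carrier M. \<exists>c\<in>S \<rightarrow> carrier R. x = (\<Oplus>\<^bsub>M\<^esub>s\<in>S. c s \<odot>\<^bsub>M\<^esub> s)))"

text \<open>
  Module homomorphisms are extensional functions, so that equality of homomorphisms is equality of
  HOL functions.
\<close>

definition rmod_hom :: "'a ring \<Rightarrow> ('a, 'm) module \<Rightarrow> ('a, 'n) module \<Rightarrow> ('m \<Rightarrow> 'n) set" where
  "rmod_hom R M N = {f \<in> carrier M \<rightarrow>\<^sub>E carrier N.
    (\<forall>x\<in>carrier M. \<forall>y\<in>carrier M. f (x \<oplus>\<^bsub>M\<^esub> y) = f x \<oplus>\<^bsub>N\<^esub> f y) \<and>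
    (\<forall>r\<in>carrier R. \<forall>x\<in>carrier M. f (r \<odot>\<^bsub>M\<^esub> x) = r \<odot>\<^bsub>N\<^esub> f x)}"

definition module_sum :: "('a, 'm) module \<Rightarrow> ('a, 'n) module \<Rightarrow> ('a, 'm \<times> 'n) module" where
  "module_sum M N =
    \<lparr> carrier = carrier M \<times> carrier N, mult = undefined, one = undefined,
      zero = (\<zero>\<^bsub>M\<^esub>, \<zero>\<^bsub>N\<^esub>), add = (\<lambda>(x, y) (x', y'). (x \<oplus>\<^bsub>M\<^esub> x', y \<oplus>\<^bsub>N\<^esub> y')),
      smult = (\<lambda>r (x, y). (r \<odot>\<^bsub>M\<^esub> x, r \<odot>\<^bsub>N\<^esub> y)) \<rparr>"


section \<open>Bounded complexes\<close>

record ('a, 'm) cochain =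
  term_at :: "int \<Rightarrow> ('a, 'm) module"
  diff_at :: "int \<Rightarrow> 'm \<Rightarrow> 'm"

definition bounded_complex :: "'a ring \<Rightarrow> ('a, 'm) cochain \<Rightarrow> bool" where
  "bounded_complex R X \<longleftrightarrow>
    (\<forall>i. fg_right_module R (term_at X i)) \<and>
    (\<forall>i. diff_at X i \<in> rmod_hom R (term_at X i) (term_at X (i + 1))) \<and>
    (\<forall>i. \<forall>x\<in>carrier (term_at X i).
       diff_at X (i + 1) (diff_at X i x) = \<zero>\<^bsub>term_at X (i + 1 + 1)\<^esub>) \<and>
    (\<exists>a b. \<forall>i. i < a \<or> b < i \<longrightarrow> carrier (term_at X i) = {\<zero>\<^bsub>term_at X i\<^esub>})"

definition chain_maps ::
    "'a ring \<Rightarrow> ('a, 'm) cochain \<Rightarrow> ('a, 'n) cochain \<Rightarrow> (int \<Rightarrow> 'm \<Rightarrow> 'n) set" where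
  "chain_maps R X Y = {f.
    (\<forall>i. f i \<in> rmod_hom R (term_at X i) (term_at Y i)) \<and>
    (\<forall>i. \<forall>x\<in>carrier (term_at X i). f (i + 1) (diff_at X i x) = diff_at Y i (f i x))}"

definition chain_id :: "('a, 'm) cochain \<Rightarrow> int \<Rightarrow> 'm \<Rightarrow> 'm" where
  "chain_id X = (\<lambda>i. \<lambda>x\<in>carrier (term_at X i). x)"

definition chain_zero :: "('a, 'm) cochain \<Rightarrow> ('a, 'n) cochain \<Rightarrow> int \<Rightarrow> 'm \<Rightarrow> 'n" where
  "chain_zero X Y = (\<lambda>i. \<lambda>x\<in>carrier (term_at X i). \<zero>\<^bsub>term_at Y i\<^esub>)"

definition chain_add :: "('a, 'm) cochain \<Rightarrow> ('a, 'n) cochain \<Rightarrow>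
    (int \<Rightarrow> 'm \<Rightarrow> 'n) \<Rightarrow> (int \<Rightarrow> 'm \<Rightarrow> 'n) \<Rightarrow> int \<Rightarrow> 'm \<Rightarrow> 'n" where
  "chain_add X Y f g = (\<lambda>i. \<lambda>x\<in>carrier (term_at X i). f i x \<oplus>\<^bsub>term_at Y i\<^esub> g i x)"

definition chain_comp ::
    "('a, 'm) cochain \<Rightarrow> (int \<Rightarrow> 'n \<Rightarrow> 'p) \<Rightarrow> (int \<Rightarrow> 'm \<Rightarrow> 'n) \<Rightarrow> int \<Rightarrow> 'm \<Rightarrow> 'p" where
  "chain_comp X g f = (\<lambda>i. compose (carrier (term_at X i)) (g i) (f i))"

definition homotopic :: "'a ring \<Rightarrow> ('a, 'm) cochain \<Rightarrow> ('a, 'n) cochain \<Rightarrow>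
    (int \<Rightarrow> 'm \<Rightarrow> 'n) \<Rightarrow> (int \<Rightarrow> 'm \<Rightarrow> 'n) \<Rightarrow> bool" where
  "homotopic R X Y f g \<longleftrightarrow>
    (\<exists>h. (\<forall>i. h i \<in> rmod_hom R (term_at X i) (term_at Y (i - 1))) \<and>
         (\<forall>i. \<forall>x\<in>carrier (term_at X i).
            f i x = g i x \<oplus>\<^bsub>term_at Y i\<^esub>
              (diff_at Y (i - 1) (h i x) \<oplus>\<^bsub>term_at Y i\<^esub> h (i + 1) (diff_at X i x))))"

definition cocycles :: "('a, 'm) cochain \<Rightarrow> int \<Rightarrow> 'm set" where
  "cocycles X i = {x \<in> carrier (term_at X i). diff_at X i x = \<zero>\<^bsub>term_at X (i + 1)\<^esub>}"

definition coboundaries :: "('a, 'm) cochain \<Rightarrow> int \<Rightarrow> 'm set" where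
  "coboundaries X i = diff_at X (i - 1) ` carrier (term_at X (i - 1))"

text \<open>The underlying set of the \<open>i\<close>-th cohomology: cosets of the coboundaries in the cocycles.\<close>

definition cohomology :: "('a, 'm) cochain \<Rightarrow> int \<Rightarrow> 'm set set" where
  "cohomology X i =
    a_rcosets\<^bsub>term_at X i\<lparr>carrier := cocycles X i\<rparr>\<^esub> (coboundaries X i)"

definition cohomology_map ::
    "('a, 'n) cochain \<Rightarrow> (int \<Rightarrow> 'm \<Rightarrow> 'n) \<Rightarrow> int \<Rightarrow> 'm set \<Rightarrow> 'n set" where
  "cohomology_map Y f i C = coboundaries Y i <+>\<^bsub>term_at Y i\<^esub> (f i ` C)"

definition quasi_isos ::
    "'a ring \<Rightarrow> ('a, 'm) cochain \<Rightarrow> ('a, 'n) cochain \<Rightarrow> (int \<Rightarrow> 'm \<Rightarrow> 'n) set" where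
  "quasi_isos R X Y = {f \<in> chain_maps R X Y.
    \<forall>i. bij_betw (cohomology_map Y f i) (cohomology X i) (cohomology Y i)}"

definition cshift :: "('a, 'm) cochain \<Rightarrow> ('a, 'm) cochain" where
  "cshift X =
    \<lparr> term_at = (\<lambda>i. term_at X (i + 1)),
      diff_at = (\<lambda>i. \<lambda>x\<in>carrier (term_at X (i + 1)).
                   \<ominus>\<^bsub>term_at X (i + 1 + 1)\<^esub> diff_at X (i + 1) x) \<rparr>"

text \<open>The mapping cone, with differential \<open>(x, y) \<mapsto> (- d x, f x + d y)\<close>.\<close>

definition cone ::
    "('a, 'm) cochain \<Rightarrow> ('a, 'n) cochain \<Rightarrow> (int \<Rightarrow> 'm \<Rightarrow> 'n) \<Rightarrow> ('a, 'm \<times> 'n) cochain" where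
  "cone X Y f =
    \<lparr> term_at = (\<lambda>i. module_sum (term_at X (i + 1)) (term_at Y i)),
      diff_at = (\<lambda>i. \<lambda>(x, y)\<in>carrier (term_at X (i + 1)) \<times> carrier (term_at Y i).
        (\<ominus>\<^bsub>term_at X (i + 1 + 1)\<^esub> diff_at X (i + 1) x,
         f (i + 1) x \<oplus>\<^bsub>term_at Y (i + 1)\<^esub> diff_at Y i y)) \<rparr>"

text \<open>
  \<open>X \<rightarrow> Y \<rightarrow> C \<rightarrow> X[1]\<close> is isomorphic, as a diagram of complexes and by an isomorphism that is the
  identity on \<open>X\<close> and \<open>Y\<close>, to the mapping cone sequence of \<open>f\<close>.  The isomorphism \<open>\<theta>\<close> is
  needed because the terms of the cone have carriers in a product type.
\<close>

definition cone_sequence :: "'a ring \<Rightarrow> ('a, 'm) cochain \<Rightarrow> ('a, 'm) cochain \<Rightarrow> ('a, 'm) cochain \<Rightarrow>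
    (int \<Rightarrow> 'm \<Rightarrow> 'm) \<Rightarrow> (int \<Rightarrow> 'm \<Rightarrow> 'm) \<Rightarrow> (int \<Rightarrow> 'm \<Rightarrow> 'm) \<Rightarrow> bool" where
  "cone_sequence R X Y C f u p \<longleftrightarrow>
    f \<in> chain_maps R X Y \<and> u \<in> chain_maps R Y C \<and> p \<in> chain_maps R C (cshift X) \<and>
    (\<exists>\<theta>\<in>chain_maps R C (cone X Y f).
      (\<forall>i. bij_betw (\<theta> i) (carrier (term_at C i)) (carrier (term_at (cone X Y f) i))) \<and>
      (\<forall>i. \<forall>y\<in>carrier (term_at Y i). \<theta> i (u i y) = (\<zero>\<^bsub>term_at X (i + 1)\<^esub>, y)) \<and>
      (\<forall>i. \<forall>c\<in>carrier (term_at C i). p i c = fst (\<theta> i c)))"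


section \<open>Categories with shift and distinguished triangles\<close>

text \<open>
  The data of a preadditive category with shift.  Morphisms determine their source and target, so
  composition (\<open>Cmp g f\<close> is \<open>g\<close> after \<open>f\<close>), sum and shift are not indexed by objects.
\<close>

record ('o, 'h) shift_category =
  Obj :: "'o set"
  Hom :: "'o \<Rightarrow> 'o \<Rightarrow> 'h set"
  Idn :: "'o \<Rightarrow> 'h"
  Cmp :: "'h \<Rightarrow> 'h \<Rightarrow> 'h"
  Zro :: "'o \<Rightarrow> 'o \<Rightarrow> 'h"
  Pls :: "'h \<Rightarrow> 'h \<Rightarrow> 'h"
  Sh :: "'o \<Rightarrow> 'o"
  ShM :: "'h \<Rightarrow> 'h"

text \<open>\<open>(X, Y, Z, f, g, h) \<in> Tri T\<close> is an exact triangle \<open>X \<rightarrow> Y \<rightarrow> Z \<rightarrow> X[1]\<close> with maps \<open>f, g, h\<close>.\<close>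

record ('o, 'h) tri_category = "('o, 'h) shift_category" +
  Tri :: "('o \<times> 'o \<times> 'o \<times> 'h \<times> 'h \<times> 'h) set"

definition is_iso :: "('o, 'h, 'z) shift_category_scheme \<Rightarrow> 'o \<Rightarrow> 'o \<Rightarrow> 'h \<Rightarrow> bool" where
  "is_iso T X Y f \<longleftrightarrow> f \<in> Hom T X Y \<and>
    (\<exists>g\<in>Hom T Y X. Cmp T g f = Idn T X \<and> Cmp T f g = Idn T Y)"

definition is_direct_sum :: "('o, 'h, 'z) shift_category_scheme \<Rightarrow> 'o \<Rightarrow> 'o \<Rightarrow> 'o \<Rightarrow> bool" where
  "is_direct_sum T Z X Y \<longleftrightarrow>
    (\<exists>i\<in>Hom T X Z. \<exists>j\<in>Hom T Y Z. \<exists>p\<in>Hom T Z X. \<exists>q\<in>Hom T Z Y.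
      Cmp T p i = Idn T X \<and> Cmp T q j = Idn T Y \<and>
      Cmp T p j = Zro T Y X \<and> Cmp T q i = Zro T X Y \<and>
      Pls T (Cmp T i p) (Cmp T j q) = Idn T Z)"

text \<open>
  Subcategories are full and given by their sets of objects.  Closure under direct summands
  includes closure under isomorphism.
\<close>

definition thick_subcategory :: "('o, 'h) tri_category \<Rightarrow> 'o set \<Rightarrow> bool" where
  "thick_subcategory T S \<longleftrightarrow>
    S \<subseteq> Obj T \<and> S \<noteq> {} \<and>
    (\<forall>X\<in>Obj T. Sh T X \<in> S \<longleftrightarrow> X \<in> S) \<and>
    (\<forall>X Y Z f g h. (X, Y, Z, f, g, h) \<in> Tri T \<longrightarrow>
       (X \<in> S \<and> Y \<in> S \<longrightarrow> Z \<in> S) \<and> (Y \<in> S \<and> Z \<in> S \<longrightarrow> X \<in> S) \<and> (X \<in> S \<and> Z \<in> S \<longrightarrow> Y \<in> S)) \<and>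
    (\<forall>X\<in>Obj T. \<forall>Y\<in>Obj T. \<forall>Z\<in>S. is_direct_sum T Z X Y \<longrightarrow> X \<in> S \<and> Y \<in> S)"

definition full_subcategory :: "('o, 'h) tri_category \<Rightarrow> 'o set \<Rightarrow> ('o, 'h) tri_category" where
  "full_subcategory T S =
    T\<lparr>Obj := S, Tri := {(X, Y, Z, f, g, h) \<in> Tri T. X \<in> S \<and> Y \<in> S \<and> Z \<in> S}\<rparr>"

definition hom_vanish :: "('o, 'h) tri_category \<Rightarrow> 'o set \<Rightarrow> 'o set \<Rightarrow> bool" where
  "hom_vanish T U V \<longleftrightarrow> (\<forall>X\<in>U. \<forall>Y\<in>V. Hom T X Y = {Zro T X Y})"

definition semi_orthogonal_decomposition ::
    "('o, 'h) tri_category \<Rightarrow> 'o set \<Rightarrow> 'o set \<Rightarrow> bool" where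
  "semi_orthogonal_decomposition T S1 S2 \<longleftrightarrow>
    thick_subcategory T S1 \<and> thick_subcategory T S2 \<and> hom_vanish T S1 S2 \<and>
    (\<forall>X\<in>Obj T. \<exists>X1\<in>S1. \<exists>X2\<in>S2. \<exists>f g h. (X1, X, X2, f, g, h) \<in> Tri T)"

text \<open>\<open>T = U \<oplus> V\<close> as a triangulated category.\<close>

definition orthogonal_decomposition ::
    "('o, 'h) tri_category \<Rightarrow> 'o set \<Rightarrow> 'o set \<Rightarrow> bool" where
  "orthogonal_decomposition T U V \<longleftrightarrow>
    thick_subcategory T U \<and> thick_subcategory T V \<and> hom_vanish T U V \<and> hom_vanish T V U \<and>
    (\<forall>X\<in>Obj T. \<exists>Y\<in>U. \<exists>Z\<in>V. is_direct_sum T X Y Z)"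

text \<open>
  An equivalence of triangulated categories: an additive, fully faithful and essentially surjective
  functor \<open>(F, F')\<close> with a natural isomorphism \<open>\<eta>\<^sub>X : F (X[1]) \<rightarrow> (F X)[1]\<close> such that exact triangles
  are mapped to exact triangles.
\<close>

definition triangle_equivalence :: "('o, 'h) tri_category \<Rightarrow> ('p, 'l) tri_category \<Rightarrow>
    ('o \<Rightarrow> 'p) \<Rightarrow> ('h \<Rightarrow> 'l) \<Rightarrow> ('o \<Rightarrow> 'l) \<Rightarrow> bool" where
  "triangle_equivalence T T' F F' \<eta> \<longleftrightarrow>
    F \<in> Obj T \<rightarrow> Obj T' \<and>
    (\<forall>X\<in>Obj T. F' (Idn T X) = Idn T' (F X)) \<and>
    (\<forall>X\<in>Obj T. \<forall>Y\<in>Obj T. \<forall>Z\<in>Obj T. \<forall>f\<in>Hom T X Y. \<forall>g\<in>Hom T Y Z.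
       F' (Cmp T g f) = Cmp T' (F' g) (F' f)) \<and>
    (\<forall>X\<in>Obj T. \<forall>Y\<in>Obj T. \<forall>f\<in>Hom T X Y. \<forall>g\<in>Hom T X Y.
       F' (Pls T f g) = Pls T' (F' f) (F' g)) \<and>
    (\<forall>X\<in>Obj T. \<forall>Y\<in>Obj T. bij_betw F' (Hom T X Y) (Hom T' (F X) (F Y))) \<and>
    (\<forall>Y\<in>Obj T'. \<exists>X\<in>Obj T. \<exists>f. is_iso T' (F X) Y f) \<and>
    (\<forall>X\<in>Obj T. is_iso T' (F (Sh T X)) (Sh T' (F X)) (\<eta> X)) \<and>
    (\<forall>X\<in>Obj T. \<forall>Y\<in>Obj T. \<forall>f\<in>Hom T X Y.
       Cmp T' (\<eta> Y) (F' (ShM T f)) = Cmp T' (ShM T' (F' f)) (\<eta> X)) \<and>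
    (\<forall>X Y Z f g h. (X, Y, Z, f, g, h) \<in> Tri T \<longrightarrow>
       (F X, F Y, F Z, F' f, F' g, Cmp T' (\<eta> X) (F' h)) \<in> Tri T')"

definition triangle_equivalent :: "('o, 'h) tri_category \<Rightarrow> ('p, 'l) tri_category \<Rightarrow> bool" where
  "triangle_equivalent T T' \<longleftrightarrow> (\<exists>F F' \<eta>. triangle_equivalence T T' F F' \<eta>)"

definition has_direct_summand_equivalent_to ::
    "('o, 'h) tri_category \<Rightarrow> ('p, 'l) tri_category \<Rightarrow> bool" where
  "has_direct_summand_equivalent_to T T' \<longleftrightarrow>
    (\<exists>U V. orthogonal_decomposition T U V \<and> triangle_equivalent (full_subcategory T U) T')"


section \<open>The bounded derived category\<close>

text \<open>
  Verdier's construction: morphisms \<open>X \<rightarrow> Y\<close> are classes of roofs \<open>X \<leftarrow> Z \<rightarrow> Y\<close> whose left leg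
  (\<open>den\<close>) is a quasi-isomorphism, in the homotopy category of bounded complexes of finitely generated
  right modules.  All complexes involved have carriers in one fixed type.
\<close>

record ('a, 'm) roof =
  src :: "('a, 'm) cochain"
  tgt :: "('a, 'm) cochain"
  apex :: "('a, 'm) cochain"
  den :: "int \<Rightarrow> 'm \<Rightarrow> 'm"
  num :: "int \<Rightarrow> 'm \<Rightarrow> 'm"

definition is_roof :: "'a ring \<Rightarrow> ('a, 'm) roof \<Rightarrow> bool" where
  "is_roof R r \<longleftrightarrow>
    bounded_complex R (src r) \<and> bounded_complex R (tgt r) \<and> bounded_complex R (apex r) \<and>
    den r \<in> quasi_isos R (apex r) (src r) \<and> num r \<in> chain_maps R (apex r) (tgt r)"

definition roof_equiv :: "'a ring \<Rightarrow> ('a, 'm) roof \<Rightarrow> ('a, 'm) roof \<Rightarrow> bool" where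
  "roof_equiv R r r' \<longleftrightarrow> is_roof R r \<and> is_roof R r' \<and> src r = src r' \<and> tgt r = tgt r' \<and>
    (\<exists>W :: ('a, 'm) cochain. bounded_complex R W \<and>
      (\<exists>u\<in>chain_maps R W (apex r). \<exists>u'\<in>chain_maps R W (apex r').
        chain_comp W (den r) u \<in> quasi_isos R W (src r) \<and>
        homotopic R W (src r) (chain_comp W (den r) u) (chain_comp W (den r') u') \<and>
        homotopic R W (tgt r) (chain_comp W (num r) u) (chain_comp W (num r') u')))"

definition roof_class :: "'a ring \<Rightarrow> ('a, 'm) roof \<Rightarrow> ('a, 'm) roof set" where
  "roof_class R r = {r'. roof_equiv R r r'}"

text \<open>The image of a chain map \<open>f : X \<rightarrow> Y\<close> in the derived category.\<close>

definition of_chain_map :: "'a ring \<Rightarrow> ('a, 'm) cochain \<Rightarrow> ('a, 'm) cochain \<Rightarrow>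
    (int \<Rightarrow> 'm \<Rightarrow> 'm) \<Rightarrow> ('a, 'm) roof set" where
  "of_chain_map R X Y f =
    roof_class R \<lparr>src = X, tgt = Y, apex = X, den = chain_id X, num = f\<rparr>"

text \<open>
  The composite of \<open>X \<leftarrow> Z \<rightarrow> Y\<close> and \<open>Y \<leftarrow> Z' \<rightarrow> Y'\<close> is represented by \<open>X \<leftarrow> W \<rightarrow> Y'\<close> for any completion
  \<open>Z \<leftarrow> W \<rightarrow> Z'\<close> to a square commuting up to homotopy; the sum of two morphisms is formed on a
  common denominator.  Both are defined as the union of the classes of all such roofs.
\<close>

definition derived_comp ::
    "'a ring \<Rightarrow> ('a, 'm) roof set \<Rightarrow> ('a, 'm) roof set \<Rightarrow> ('a, 'm) roof set" where
  "derived_comp R \<psi> \<phi> = \<Union> {roof_class R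
      \<lparr>src = src r, tgt = tgt r', apex = W,
       den = chain_comp W (den r) u, num = chain_comp W (num r') v\<rparr>
    | r r' W u v. r \<in> \<phi> \<and> r' \<in> \<psi> \<and> tgt r = src r' \<and> bounded_complex R W \<and>
        u \<in> quasi_isos R W (apex r) \<and> v \<in> chain_maps R W (apex r') \<and>
        homotopic R W (tgt r) (chain_comp W (num r) u) (chain_comp W (den r') v)}"

definition derived_add ::
    "'a ring \<Rightarrow> ('a, 'm) roof set \<Rightarrow> ('a, 'm) roof set \<Rightarrow> ('a, 'm) roof set" where
  "derived_add R \<phi> \<psi> = \<Union> {roof_class R (r\<lparr>num := chain_add (apex r) (tgt r) (num r) (num r')\<rparr>)
    | r r'. r \<in> \<phi> \<and> r' \<in> \<psi> \<and> src r = src r' \<and> tgt r = tgt r' \<and>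
        apex r = apex r' \<and> den r = den r'}"

definition derived_shift :: "'a ring \<Rightarrow> ('a, 'm) roof set \<Rightarrow> ('a, 'm) roof set" where
  "derived_shift R \<phi> = \<Union> {roof_class R
      \<lparr>src = cshift (src r), tgt = cshift (tgt r), apex = cshift (apex r),
       den = (\<lambda>i. den r (i + 1)), num = (\<lambda>i. num r (i + 1))\<rparr> | r. r \<in> \<phi>}"

definition derived_shift_category ::
    "'a ring \<Rightarrow> (('a, 'm) cochain, ('a, 'm) roof set) shift_category" where
  "derived_shift_category R =
    \<lparr> Obj = {X. bounded_complex R X},
      Hom = (\<lambda>X Y. {roof_class R r | r. is_roof R r \<and> src r = X \<and> tgt r = Y}),
      Idn = (\<lambda>X. of_chain_map R X X (chain_id X)),
      Cmp = derived_comp R,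
      Zro = (\<lambda>X Y. of_chain_map R X Y (chain_zero X Y)),
      Pls = derived_add R,
      Sh = cshift,
      ShM = derived_shift R \<rparr>"

text \<open>The triangles isomorphic to the image of some mapping cone sequence.\<close>

definition derived_triangles :: "'a ring \<Rightarrow>
    (('a, 'm) cochain \<times> ('a, 'm) cochain \<times> ('a, 'm) cochain \<times>
     ('a, 'm) roof set \<times> ('a, 'm) roof set \<times> ('a, 'm) roof set) set" where
  "derived_triangles R = (let T = derived_shift_category R in
    {(X, Y, Z, f, g, h).
      X \<in> Obj T \<and> Y \<in> Obj T \<and> Z \<in> Obj T \<and>
      f \<in> Hom T X Y \<and> g \<in> Hom T Y Z \<and> h \<in> Hom T Z (Sh T X) \<and>
      (\<exists>X' Y' C m u p \<alpha> \<beta> \<gamma>.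
        X' \<in> Obj T \<and> Y' \<in> Obj T \<and> C \<in> Obj T \<and> cone_sequence R X' Y' C m u p \<and>
        is_iso T X X' \<alpha> \<and> is_iso T Y Y' \<beta> \<and> is_iso T Z C \<gamma> \<and>
        Cmp T \<beta> f = Cmp T (of_chain_map R X' Y' m) \<alpha> \<and>
        Cmp T \<gamma> g = Cmp T (of_chain_map R Y' C u) \<beta> \<and>
        Cmp T (ShM T \<alpha>) h = Cmp T (of_chain_map R C (Sh T X') p) \<gamma>)})"

definition bounded_derived_category ::
    "'a ring \<Rightarrow> (('a, 'm) cochain, ('a, 'm) roof set) tri_category" where
  "bounded_derived_category R =
    shift_category.extend (derived_shift_category R) \<lparr>Tri = derived_triangles R\<rparr>"

text \<open>
  The bounded derived category of \<open>mod kQ\<close>.  To have a set of objects, the carriers are taken to be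
  subsets of the type \<^typ>\<open>nat \<Rightarrow> 'k\<close>.  For a finite acyclic quiver every finitely generated module is
  finite dimensional over \<open>k\<close>, hence isomorphic to one of this form.
\<close>

type_synonym ('v, 'e, 'k) derived_object =
  "('v \<times> 'e list \<Rightarrow> 'k, nat \<Rightarrow> 'k) cochain"

type_synonym ('v, 'e, 'k) derived_morphism =
  "('v \<times> 'e list \<Rightarrow> 'k, nat \<Rightarrow> 'k) roof set"

definition D_b_mod :: "('v, 'e) pre_digraph \<Rightarrow>
    (('v, 'e, 'k::field) derived_object, ('v, 'e, 'k) derived_morphism) tri_category" where
  "D_b_mod Q = bounded_derived_category (path_algebra Q)"

end

theory Submission
  imports Defs "HOL-Library.Function_Algebras"
begin

text \<open>
  Morphisms in the derived category of a hereditary algebra are computed by an explicit differential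
  graded category of complexes of representations in coordinates. Hence vanishing of all morphisms
  between two subcategories closed under shifts makes the Euler form vanish on the classes of their
  objects. An equivalence with the derived category of type \<open>D\<close> turns the simple modules at the
  branch vertex and its three neighbours into objects whose classes are roots in the root lattice
  of type \<open>D\<close>. Three pairwise orthogonal roots that are not orthogonal to a fourth one include two
  with the same support, so their span contains twice two different standard basis vectors. With
  the exception of one basis vector, the Euler form is nonzero on all pairs of such vectors.
\<close>

section \<open>Matrices and signs\<close>

text \<open>An equivalence of triangulated categories is additive but not assumed linear over the
  field, so dimensions of spaces of morphisms cannot be compared along it. What it does transport is
  vanishing in each degree and the property that every endomorphism is zero or invertible. Over an
  algebraically closed field the latter forces endomorphism rings to be one-dimensional, which gives
  the value one of the Euler form and hence roots. For adjacent simples only the sign of the Euler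
  form is recovered, and this suffices for non-orthogonality.

  Two leaf roots share a support by the pigeonhole principle, since each of them meets the
  two-element support of the central root. A doubled basis vector, written in simple roots, has even
  coefficients along the chain and odd ones at the two ends of the fork, so modulo 4 the Euler form
  only sees the fork, where it is 2. One basis vector breaks the symmetry behind this, depending on
  the orientation of the fork; as each subcategory offers two basis vectors, it can be avoided in
  both.\<close>

definition sg :: "int => 'k::comm_ring_1" where
 "sg i = (if even i then 1 else - 1)"

lemma sg_add: "sg (i + j) = sg i * sg j"
 by (simp add: sg_def)

lemma sg_simps [simp]: "sg 0 = 1" "sg 1 = - 1" "sg (- 1) = - 1" "sg i * sg i = 1"
  "sg (- i) = sg i" "sg i * (sg i * a) = a"
 by (simp_all add: sg_def)

lemma sg_shift: "sg (i + 1) = - sg i" "sg (1 + i) = - sg i" "sg (i - 1) = - sg i"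
 by (simp_all add: sg_def)

text \<open>The summation range is an argument because matrices are functions on whole label types,
  of which only the finite label set of a complex carries meaning.\<close>

definition mm :: "'y set => ('z => 'y => 'k::comm_ring_1) => ('y => 'x => 'k) => 'z => 'x => 'k" where
 "mm B f g = (\<lambda>z x. \<Sum>y\<in>B. f z y * g y x)"

lemma mm_assoc: "mm C (mm B f g) h = mm B f (mm C g h)"
proof (intro ext)
 fix z x
 have "mm C (mm B f g) h z x = (\<Sum>y\<in>C. \<Sum>w\<in>B. f z w * g w y * h y x)"
  by (simp add: mm_def sum_distrib_right)
 also have "\<dots> = (\<Sum>w\<in>B. \<Sum>y\<in>C. f z w * g w y * h y x)"
  by (rule sum.swap)
 also have "\<dots> = mm B f (mm C g h) z x"
  by (simp add: mm_def sum_distrib_left mult.assoc)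
 finally show "mm C (mm B f g) h z x = mm B f (mm C g h) z x" .
qed

lemma mm_add_left: "mm B (f + f') g = mm B f g + mm B f' g"
 and mm_add_right: "mm B f (g + g') = mm B f g + mm B f g'"
 and mm_minus_left: "mm B (- f) g = - mm B f g"
 and mm_minus_right: "mm B f (- g) = - mm B f g"
 and mm_diff_left: "mm B (f - f') g = mm B f g - mm B f' g"
 and mm_diff_right: "mm B f (g - g') = mm B f g - mm B f g'"
 and mm_zero_left: "mm B 0 g = 0"
 and mm_zero_right: "mm B f 0 = 0"
 by (auto simp: mm_def fun_eq_iff algebra_simps sum.distrib sum_negf sum_subtractf)

lemmas mm_linear = mm_add_left mm_add_right mm_minus_left mm_minus_right mm_diff_left mm_diff_right
 mm_zero_left mm_zero_right

section \<open>The differential graded category of complexes of representations\<close>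

text \<open>
 A complex of representations of a quiver in coordinates: a set of basis elements with their degrees
 and vertices, the matrix of the differential, and the matrices of the arrows.
\<close>

record ('b, 'v, 'e, 'k) qcx =
 lab :: "'b set"
 dg :: "'b => int"
 vx :: "'b => 'v"
 dd :: "'b => 'b => 'k"
 aa :: "'e => 'b => 'b => 'k"

text \<open>
 A cochain \<open>\<phi>\<close> has a component \<open>\<phi> None\<close> at the vertices and components \<open>\<phi> (Some e)\<close>, of degree one less,
 from the tail to the head of \<open>e\<close>; products of two components at arrows vanish. The cochains compute
 the derived homomorphisms because path algebras are hereditary. The sign in \<open>dl\<close> makes the
 differential and the arrows anticommute, so that \<open>dl\<close> squares to zero.
\<close>

type_synonym ('c, 'b, 'e, 'k) cochn = "'e option => 'c => 'b => 'k"

definition dl :: "('b, 'v, 'e, 'k::comm_ring_1) qcx => ('b, 'b, 'e, 'k) cochn" where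
 "dl C = (\<lambda>p. case p of None => dd C | Some e => (\<lambda>y x. sg (dg C x) * aa C e y x))"

definition cm :: "'y set => ('z, 'y, 'e, 'k::comm_ring_1) cochn => ('y, 'x, 'e, 'k) cochn => ('z, 'x, 'e, 'k) cochn"
 where "cm B \<phi> \<psi> = (\<lambda>p. case p of None => mm B (\<phi> None) (\<psi> None)
  | Some e => mm B (\<phi> (Some e)) (\<psi> None) + mm B (\<phi> None) (\<psi> (Some e)))"

definition sc :: "'k::comm_ring_1 => ('c, 'b, 'e, 'k) cochn => ('c, 'b, 'e, 'k) cochn" where
 "sc c \<phi> = (\<lambda>p y x. c * \<phi> p y x)"

definition un :: "('b, 'v, 'e, 'k::comm_ring_1) qcx => ('b, 'b, 'e, 'k) cochn" where
 "un C = (\<lambda>p y x. if p = None \<and> y = x \<and> x \<in> lab C then 1 else 0)"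

lemma cm_simps [simp]:
 "cm B \<phi> \<psi> None = mm B (\<phi> None) (\<psi> None)"
 "cm B \<phi> \<psi> (Some e) = mm B (\<phi> (Some e)) (\<psi> None) + mm B (\<phi> None) (\<psi> (Some e))"
 by (simp_all add: cm_def)

lemma dl_simps [simp]: "dl C None = dd C" "dl C (Some e) y x = sg (dg C x) * aa C e y x"
 by (simp_all add: dl_def)

lemma cochn_eqI: "\<phi> None = \<psi> None ==> (\<And>e. \<phi> (Some e) = \<psi> (Some e)) ==> \<phi> = \<psi>"
 by (rule ext) (metis not_None_eq)

lemma cm_assoc: "cm C (cm B \<phi> \<psi>) \<chi> = cm B \<phi> (cm C \<psi> \<chi>)"
 by (rule cochn_eqI) (simp_all add: mm_linear mm_assoc add.assoc)

lemma cm_add_left: "cm B (f + f') g = cm B f g + cm B f' g"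
 and cm_add_right: "cm B f (g + g') = cm B f g + cm B f g'"
 and cm_minus_left: "cm B (- f) g = - cm B f g"
 and cm_minus_right: "cm B f (- g) = - cm B f g"
 and cm_diff_left: "cm B (f - f') g = cm B f g - cm B f' g"
 and cm_diff_right: "cm B f (g - g') = cm B f g - cm B f g'"
 and cm_zero_left: "cm B 0 g = 0"
 and cm_zero_right: "cm B f 0 = 0"
 by (rule cochn_eqI; simp add: mm_linear)+

lemma cm_sc_left: "cm B (sc c f) g = sc c (cm B f g)"
 and cm_sc_right: "cm B f (sc c g) = sc c (cm B f g)"
 by (rule cochn_eqI; auto simp: sc_def mm_def fun_eq_iff sum_distrib_left algebra_simps)+

lemmas cm_linear = cm_add_left cm_add_right cm_minus_left cm_minus_right cm_diff_left cm_diff_right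
 cm_zero_left cm_zero_right cm_sc_left cm_sc_right

lemma sc_add: "sc c (f + g) = sc c f + sc c g" and sc_diff: "sc c (f - g) = sc c f - sc c g"
 and sc_minus: "sc c (- f) = - sc c f" and sc_zero: "sc c 0 = 0"
 and sc_sc: "sc c (sc d f) = sc (c * d) f" and sc_one: "sc 1 f = f" and sc_neg: "sc (- c) f = - sc c f"
 by (auto simp: sc_def fun_eq_iff algebra_simps)

lemmas sc_linear = sc_add sc_diff sc_minus sc_zero sc_sc sc_one sc_neg

definition allowed :: "('v, 'e) pre_digraph => ('b, 'v, 'e, 'k) qcx => ('c, 'v, 'e, 'k) qcx => int =>
  'e option => 'c => 'b => bool" where
 "allowed Q X Y i p y x \<longleftrightarrow> y \<in> lab Y \<and> x \<in> lab X \<and> (case p of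
   None => vx Y y = vx X x \<and> dg Y y = dg X x + i
  | Some e => e \<in> arcs Q \<and> tail Q e = vx X x \<and> head Q e = vx Y y \<and> dg Y y = dg X x + i - 1)"

definition Tot :: "('v, 'e) pre_digraph => ('b, 'v, 'e, 'k) qcx => ('c, 'v, 'e, 'k) qcx => int =>
  ('c, 'b, 'e, 'k::comm_ring_1) cochn set" where
 "Tot Q X Y i = {\<phi>. \<forall>p y x. \<phi> p y x \<noteq> 0 --> allowed Q X Y i p y x}"

definition D :: "('b, 'v, 'e, 'k) qcx => ('c, 'v, 'e, 'k) qcx => int =>
  ('c, 'b, 'e, 'k::comm_ring_1) cochn => ('c, 'b, 'e, 'k) cochn" where
 "D X Y i \<phi> = cm (lab Y) (dl Y) \<phi> - sc (sg i) (cm (lab X) \<phi> (dl X))"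

text \<open>One cochain of degree one packs the whole structure. That \<open>dl\<close> squares to
  zero says at the vertices that the differential squares to zero, and at the arrows that it
  commutes with the matrices of the arrows.\<close>

definition wfc :: "('v, 'e) pre_digraph => ('b, 'v, 'e, 'k::comm_ring_1) qcx => bool" where
 "wfc Q C \<longleftrightarrow> finite (lab C) \<and> (\<forall>x\<in>lab C. vx C x \<in> verts Q) \<and> dl C \<in> Tot Q C C 1 \<and>
  cm (lab C) (dl C) (dl C) = 0"

definition Z :: "('v, 'e) pre_digraph => ('b, 'v, 'e, 'k) qcx => ('c, 'v, 'e, 'k) qcx => int =>
  ('c, 'b, 'e, 'k::comm_ring_1) cochn set" where
 "Z Q X Y i = {\<phi> \<in> Tot Q X Y i. D X Y i \<phi> = 0}"

definition Bd :: "('v, 'e) pre_digraph => ('b, 'v, 'e, 'k) qcx => ('c, 'v, 'e, 'k) qcx => int =>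
  ('c, 'b, 'e, 'k::comm_ring_1) cochn set" where
 "Bd Q X Y i = D X Y (i - 1) ` Tot Q X Y (i - 1)"

lemma wfc_simps: "wfc Q C ==> finite (lab C)" "wfc Q C ==> dl C \<in> Tot Q C C 1"
  "wfc Q C ==> cm (lab C) (dl C) (dl C) = 0"
 by (simp_all add: wfc_def)

lemma Tot_iff: "\<phi> \<in> Tot Q X Y i \<longleftrightarrow> (\<forall>p y x. \<not> allowed Q X Y i p y x --> \<phi> p y x = 0)"
 by (auto simp: Tot_def)

lemma Tot_add: "\<phi> \<in> Tot Q X Y i ==> \<psi> \<in> Tot Q X Y i ==> \<phi> + \<psi> \<in> Tot Q X Y i"
 and Tot_diff: "\<phi> \<in> Tot Q X Y i ==> \<psi> \<in> Tot Q X Y i ==> \<phi> - \<psi> \<in> Tot Q X Y i"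
 and Tot_minus: "\<phi> \<in> Tot Q X Y i ==> - \<phi> \<in> Tot Q X Y i"
 and Tot_zero: "0 \<in> Tot Q X Y i"
 and Tot_sc: "\<phi> \<in> Tot Q X Y i ==> sc c \<phi> \<in> Tot Q X Y i"
 by (auto simp: Tot_iff sc_def)

lemma mm_nonzero: "mm B f g z x \<noteq> 0 ==> \<exists>y\<in>B. f z y \<noteq> 0 \<and> g y x \<noteq> 0"
 unfolding mm_def by (rule ccontr) (auto intro!: sum.neutral)

lemma Tot_cm:
 assumes "\<phi> \<in> Tot Q Y W i" "\<psi> \<in> Tot Q X Y j"
 shows "cm B \<phi> \<psi> \<in> Tot Q X W (i + j)"
proof -
 have "allowed Q X W (i + j) p z x" if nz: "cm B \<phi> \<psi> p z x \<noteq> 0" for p z x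
 proof (cases p)
  case None
  then obtain y where "\<phi> None z y \<noteq> 0" "\<psi> None y x \<noteq> 0"
   using nz mm_nonzero[of B "\<phi> None" "\<psi> None" z x] by auto
  then have "allowed Q Y W i None z y" "allowed Q X Y j None y x"
   using assms by (auto simp: Tot_def)
  then show ?thesis by (auto simp: allowed_def None)
 next
  case (Some e)
  then have "mm B (\<phi> (Some e)) (\<psi> None) z x \<noteq> 0 \<or> mm B (\<phi> None) (\<psi> (Some e)) z x \<noteq> 0"
   using nz by auto
  then show ?thesis
  proof
   assume "mm B (\<phi> (Some e)) (\<psi> None) z x \<noteq> 0"
   then obtain y where "\<phi> (Some e) z y \<noteq> 0" "\<psi> None y x \<noteq> 0"
    using mm_nonzero[of B "\<phi> (Some e)" "\<psi> None" z x] by auto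
   then have "allowed Q Y W i (Some e) z y" "allowed Q X Y j None y x"
    using assms by (auto simp: Tot_def)
   then show ?thesis by (auto simp: allowed_def Some)
  next
   assume "mm B (\<phi> None) (\<psi> (Some e)) z x \<noteq> 0"
   then obtain y where "\<phi> None z y \<noteq> 0" "\<psi> (Some e) y x \<noteq> 0"
    using mm_nonzero[of B "\<phi> None" "\<psi> (Some e)" z x] by auto
   then have "allowed Q Y W i None z y" "allowed Q X Y j (Some e) y x"
    using assms by (auto simp: Tot_def)
   then show ?thesis by (auto simp: allowed_def Some)
  qed
 qed
 then show ?thesis by (auto simp: Tot_def)
qed

lemma un_Tot: "un X \<in> Tot Q X X 0"
 by (auto simp: Tot_def un_def allowed_def split: if_splits)

lemma cm_un_left:
 assumes "finite (lab Y)" "\<phi> \<in> Tot Q X Y i"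
 shows "cm (lab Y) (un Y) \<phi> = \<phi>"
proof -
 have z: "\<phi> p z x = 0" if "z \<notin> lab Y" for p z x
  using assms that by (auto simp: Tot_def allowed_def)
 have "(\<Sum>y\<in>lab Y. (if z = y \<and> y \<in> lab Y then 1 else 0) * \<phi> p y x) = \<phi> p z x" for p z x
 proof -
  have "(\<Sum>y\<in>lab Y. (if z = y \<and> y \<in> lab Y then 1 else 0) * \<phi> p y x) = (\<Sum>y\<in>lab Y. if z = y then \<phi> p z x else 0)"
   by (rule sum.cong) auto
  then show ?thesis using assms(1) z by (simp add: sum.delta')
 qed
 then show ?thesis
  by (intro cochn_eqI) (auto simp: mm_def un_def fun_eq_iff)
qed

lemma cm_un_right:
 assumes "finite (lab X)" "\<phi> \<in> Tot Q X Y i"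
 shows "cm (lab X) \<phi> (un X) = \<phi>"
proof -
 have z: "\<phi> p z x = 0" if "x \<notin> lab X" for p z x
  using assms that by (auto simp: Tot_def allowed_def)
 have "(\<Sum>y\<in>lab X. \<phi> p z y * (if y = x \<and> x \<in> lab X then 1 else 0)) = \<phi> p z x" for p z x
  using assms(1) by (cases "x \<in> lab X") (auto simp: z if_distrib sum.delta cong: if_cong)
 then show ?thesis
  by (intro cochn_eqI) (auto simp: mm_def un_def fun_eq_iff)
qed

lemma D_linear: "D X Y i (\<phi> + \<psi>) = D X Y i \<phi> + D X Y i \<psi>" "D X Y i (\<phi> - \<psi>) = D X Y i \<phi> - D X Y i \<psi>"
  "D X Y i (- \<phi>) = - D X Y i \<phi>" "D X Y i 0 = 0" "D X Y i (sc c \<phi>) = sc c (D X Y i \<phi>)"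
 by (simp_all add: D_def cm_linear sc_linear algebra_simps)

lemma D_Tot: "wfc Q X ==> wfc Q Y ==> \<phi> \<in> Tot Q X Y i ==> D X Y i \<phi> \<in> Tot Q X Y (i + 1)"
 unfolding D_def
 using Tot_cm[OF wfc_simps(2), of Q Y \<phi> X i "lab Y"] Tot_cm[OF _ wfc_simps(2), of \<phi> Q X Y i "lab X"]
 by (intro Tot_diff Tot_sc) (simp_all add: add.commute)

text \<open>\<open>D\<close> is the graded commutator with \<open>dl\<close>, and \<open>dl\<close>
  squares to zero.\<close>

lemma D_D: "wfc Q X ==> wfc Q Y ==> D X Y (i + 1) (D X Y i \<phi>) = 0"
 by (simp add: D_def cm_linear sc_linear cm_assoc wfc_simps sg_shift)
   (simp add: cm_assoc[symmetric] wfc_simps cm_linear sc_linear)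

lemma D_cm: "D X W (i + j) (cm (lab Y) \<phi> \<psi>) =
  cm (lab Y) (D Y W i \<phi>) \<psi> + sc (sg i) (cm (lab Y) \<phi> (D X Y j \<psi>))"
 by (simp add: D_def cm_linear sc_linear cm_assoc sg_add)

lemma D_un: "wfc Q X ==> D X X 0 (un X) = 0"
 by (simp add: D_def sc_linear cm_un_left[OF wfc_simps(1) wfc_simps(2)] cm_un_right[OF wfc_simps(1) wfc_simps(2)])

lemma Bd_subset_Z: "wfc Q X ==> wfc Q Y ==> Bd Q X Y i \<subseteq> Z Q X Y i"
 using D_Tot[of Q X Y _ "i - 1"] D_D[of Q X Y "i - 1"] by (auto simp: Bd_def Z_def)

lemma BdI: "\<beta> \<in> Tot Q X Y (i - 1) ==> D X Y (i - 1) \<beta> = \<phi> ==> \<phi> \<in> Bd Q X Y i"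
 by (auto simp: Bd_def)

lemma Bd0I: "\<beta> \<in> Tot Q X Y (- 1) ==> D X Y (- 1) \<beta> = \<phi> ==> \<phi> \<in> Bd Q X Y 0"
 by (auto simp: Bd_def)

lemma Z_add: "\<phi> \<in> Z Q X Y i ==> \<psi> \<in> Z Q X Y i ==> \<phi> + \<psi> \<in> Z Q X Y i"
 and Z_diff: "\<phi> \<in> Z Q X Y i ==> \<psi> \<in> Z Q X Y i ==> \<phi> - \<psi> \<in> Z Q X Y i"
 and Z_minus: "\<phi> \<in> Z Q X Y i ==> - \<phi> \<in> Z Q X Y i"
 and Z_zero: "0 \<in> Z Q X Y i"
 and Z_sc: "\<phi> \<in> Z Q X Y i ==> sc c \<phi> \<in> Z Q X Y i"
 by (simp_all add: Z_def D_linear Tot_add Tot_diff Tot_minus Tot_zero Tot_sc sc_linear)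

lemma Bd_add: "\<phi> \<in> Bd Q X Y i ==> \<psi> \<in> Bd Q X Y i ==> \<phi> + \<psi> \<in> Bd Q X Y i"
 and Bd_diff: "\<phi> \<in> Bd Q X Y i ==> \<psi> \<in> Bd Q X Y i ==> \<phi> - \<psi> \<in> Bd Q X Y i"
 and Bd_minus: "\<phi> \<in> Bd Q X Y i ==> - \<phi> \<in> Bd Q X Y i"
 and Bd_zero: "0 \<in> Bd Q X Y i"
 and Bd_sc: "\<phi> \<in> Bd Q X Y i ==> sc c \<phi> \<in> Bd Q X Y i"
proof -
 assume "\<phi> \<in> Bd Q X Y i" "\<psi> \<in> Bd Q X Y i"
 then obtain a b where "a \<in> Tot Q X Y (i - 1)" "\<phi> = D X Y (i - 1) a" "b \<in> Tot Q X Y (i - 1)" "\<psi> = D X Y (i - 1) b"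
  by (auto simp: Bd_def)
 then show "\<phi> + \<psi> \<in> Bd Q X Y i" "\<phi> - \<psi> \<in> Bd Q X Y i"
  by (auto simp: D_linear intro: BdI[of "a + b"] BdI[of "a - b"] Tot_add Tot_diff)
next
 assume "\<phi> \<in> Bd Q X Y i"
 then obtain a where "a \<in> Tot Q X Y (i - 1)" "\<phi> = D X Y (i - 1) a" by (auto simp: Bd_def)
 then show "- \<phi> \<in> Bd Q X Y i" "sc c \<phi> \<in> Bd Q X Y i"
  by (auto simp: D_linear intro: BdI[of "- a"] BdI[of "sc c a"] Tot_minus Tot_sc)
next
 show "0 \<in> Bd Q X Y i" by (rule BdI[OF Tot_zero D_linear(4)])
qed

lemma Z_cm: "\<phi> \<in> Z Q Y W i ==> \<psi> \<in> Z Q X Y j ==> cm (lab Y) \<phi> \<psi> \<in> Z Q X W (i + j)"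
 by (auto simp: Z_def D_cm cm_linear sc_linear intro: Tot_cm)

lemma Bd_cm_right: "\<phi> \<in> Z Q Y W i ==> \<psi> \<in> Bd Q X Y j ==> cm (lab Y) \<phi> \<psi> \<in> Bd Q X W (i + j)"
proof -
 assume a: "\<phi> \<in> Z Q Y W i" "\<psi> \<in> Bd Q X Y j"
 then obtain \<beta> where b: "\<beta> \<in> Tot Q X Y (j - 1)" "\<psi> = D X Y (j - 1) \<beta>" by (auto simp: Bd_def)
 \<comment> \<open>The sign compensates the one in the graded Leibniz rule
   \<open>D_cm\<close>.\<close>
 have "D X W (i + (j - 1)) (sc (sg i) (cm (lab Y) \<phi> \<beta>)) = cm (lab Y) \<phi> \<psi>"
  using a b by (simp only: D_linear D_cm) (simp add: Z_def cm_linear sc_linear)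
 moreover have "sc (sg i) (cm (lab Y) \<phi> \<beta>) \<in> Tot Q X W (i + (j - 1))"
  using a b by (auto simp: Z_def intro: Tot_cm Tot_sc simp del: add_diff_eq)
 ultimately show ?thesis by (metis BdI add_diff_eq)
qed

lemma Bd_cm_left: "\<phi> \<in> Bd Q Y W i ==> \<psi> \<in> Z Q X Y j ==> cm (lab Y) \<phi> \<psi> \<in> Bd Q X W (i + j)"
proof -
 assume a: "\<phi> \<in> Bd Q Y W i" "\<psi> \<in> Z Q X Y j"
 then obtain \<beta> where b: "\<beta> \<in> Tot Q Y W (i - 1)" "\<phi> = D Y W (i - 1) \<beta>" by (auto simp: Bd_def)
 have "D X W ((i - 1) + j) (cm (lab Y) \<beta> \<psi>) = cm (lab Y) \<phi> \<psi>"
  using a b by (simp only: D_cm) (simp add: Z_def cm_linear sc_linear)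
 moreover have "cm (lab Y) \<beta> \<psi> \<in> Tot Q X W ((i - 1) + j)"
  using a b unfolding Z_def by (blast intro: Tot_cm)
 moreover have "(i - 1) + j = i + j - 1" by simp
 ultimately show ?thesis by (metis BdI)
qed

lemmas Z0_cm = Z_cm[of _ _ _ _ 0 _ _ 0, simplified]
lemmas Bd0_cm_right = Bd_cm_right[of _ _ _ _ 0 _ _ 0, simplified]
lemmas Bd0_cm_left = Bd_cm_left[of _ _ _ _ 0 _ _ 0, simplified]

lemma un_Z: "wfc Q X ==> un X \<in> Z Q X X 0"
 by (simp add: Z_def un_Tot D_un)

section \<open>Invertible classes\<close>

text \<open>Isomorphisms of the category whose morphisms are the cohomology classes of degree zero.
  Over a field they turn out to be the quasi-isomorphisms.\<close>

definition hinv :: "('v, 'e) pre_digraph => ('b, 'v, 'e, 'k) qcx => ('c, 'v, 'e, 'k) qcx =>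
  ('c, 'b, 'e, 'k::comm_ring_1) cochn => bool" where
 "hinv Q X Y \<phi> \<longleftrightarrow> \<phi> \<in> Z Q X Y 0 \<and> (\<exists>\<psi>\<in>Z Q Y X 0.
   cm (lab Y) \<psi> \<phi> - un X \<in> Bd Q X X 0 \<and> cm (lab X) \<phi> \<psi> - un Y \<in> Bd Q Y Y 0)"

lemma hinvE:
 assumes "hinv Q X Y \<phi>"
 obtains \<psi> where "\<phi> \<in> Z Q X Y 0" "\<psi> \<in> Z Q Y X 0" "cm (lab Y) \<psi> \<phi> - un X \<in> Bd Q X X 0"
  "cm (lab X) \<phi> \<psi> - un Y \<in> Bd Q Y Y 0"
 using assms by (auto simp: hinv_def)

lemma Z_wf_un: "wfc Q Y ==> \<phi> \<in> Z Q X Y i ==> cm (lab Y) (un Y) \<phi> = \<phi>"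
  "wfc Q X ==> \<phi> \<in> Z Q X Y i ==> cm (lab X) \<phi> (un X) = \<phi>"
 by (auto simp: Z_def intro: cm_un_left cm_un_right wfc_simps(1))

text \<open>A left and a right inverse agree up to a coboundary: evaluating
  \<open>l \<phi> r\<close> in two ways shows that \<open>r - l\<close> is one. So they may be
  produced separately.\<close>

lemma hinvI:
 assumes wf: "wfc Q X" "wfc Q Y" and p: "\<phi> \<in> Z Q X Y 0"
  and l: "l \<in> Z Q Y X 0" "cm (lab Y) l \<phi> - un X \<in> Bd Q X X 0"
  and r: "r \<in> Z Q Y X 0" "cm (lab X) \<phi> r - un Y \<in> Bd Q Y Y 0"
 shows "hinv Q X Y \<phi>"
proof -
 have "cm (lab Y) l (cm (lab X) \<phi> r - un Y) - cm (lab X) (cm (lab Y) l \<phi> - un X) r \<in> Bd Q Y X 0"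
  by (rule Bd_diff[OF Bd0_cm_right[OF l(1) r(2)] Bd0_cm_left[OF l(2) r(1)]])
 moreover have "cm (lab Y) l (cm (lab X) \<phi> r - un Y) - cm (lab X) (cm (lab Y) l \<phi> - un X) r = r - l"
  using l r wf by (simp add: cm_linear cm_assoc Z_wf_un)
 ultimately have "r - l \<in> Bd Q Y X 0" by simp
 then have "cm (lab Y) (r - l) \<phi> + (cm (lab Y) l \<phi> - un X) \<in> Bd Q X X 0"
  using l p by (intro Bd_add Bd0_cm_left)
 then have "cm (lab Y) r \<phi> - un X \<in> Bd Q X X 0" by (simp add: cm_linear)
 then show ?thesis using p r by (auto simp: hinv_def)
qed

lemma hinv_un: "wfc Q X ==> hinv Q X X (un X)"
 by (rule hinvI[OF _ _ un_Z un_Z _ un_Z]) (auto simp: Z_wf_un[OF _ un_Z] Bd_zero)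

lemma hinv_cm:
 assumes wf: "wfc Q X" "wfc Q Y" "wfc Q W" and "hinv Q Y W \<psi>" "hinv Q X Y \<phi>"
 shows "hinv Q X W (cm (lab Y) \<psi> \<phi>)"
proof -
 obtain \<phi>' where f: "\<phi> \<in> Z Q X Y 0" "\<phi>' \<in> Z Q Y X 0" "cm (lab Y) \<phi>' \<phi> - un X \<in> Bd Q X X 0"
  "cm (lab X) \<phi> \<phi>' - un Y \<in> Bd Q Y Y 0" by (rule hinvE[OF assms(5)])
 obtain \<psi>' where g: "\<psi> \<in> Z Q Y W 0" "\<psi>' \<in> Z Q W Y 0" "cm (lab W) \<psi>' \<psi> - un Y \<in> Bd Q Y Y 0"
  "cm (lab Y) \<psi> \<psi>' - un W \<in> Bd Q W W 0" by (rule hinvE[OF assms(4)])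
 have "cm (lab Y) \<phi>' (cm (lab Y) (cm (lab W) \<psi>' \<psi> - un Y) \<phi>) + (cm (lab Y) \<phi>' \<phi> - un X) \<in> Bd Q X X 0"
  using f g by (intro Bd_add Bd0_cm_right Bd0_cm_left)
 then have 1: "cm (lab W) (cm (lab Y) \<phi>' \<psi>') (cm (lab Y) \<psi> \<phi>) - un X \<in> Bd Q X X 0"
  using f g wf by (simp add: cm_linear cm_assoc Z_wf_un)
 have "cm (lab Y) \<psi> (cm (lab Y) (cm (lab X) \<phi> \<phi>' - un Y) \<psi>') + (cm (lab Y) \<psi> \<psi>' - un W) \<in> Bd Q W W 0"
  using f g by (intro Bd_add Bd0_cm_right Bd0_cm_left)
 then have 2: "cm (lab X) (cm (lab Y) \<psi> \<phi>) (cm (lab Y) \<phi>' \<psi>') - un W \<in> Bd Q W W 0"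
  using f g wf by (simp add: cm_linear cm_assoc Z_wf_un)
 show ?thesis
  by (rule hinvI[OF wf(1,3) _ _ 1 _ 2]) (use f g in \<open>auto intro: Z0_cm\<close>)
qed

lemma hinv_cong:
 assumes wf: "wfc Q X" "wfc Q Y" and "hinv Q X Y \<phi>" "\<phi> - \<psi> \<in> Bd Q X Y 0"
 shows "hinv Q X Y \<psi>"
proof -
 obtain \<phi>' where f: "\<phi> \<in> Z Q X Y 0" "\<phi>' \<in> Z Q Y X 0" "cm (lab Y) \<phi>' \<phi> - un X \<in> Bd Q X X 0"
  "cm (lab X) \<phi> \<phi>' - un Y \<in> Bd Q Y Y 0" by (rule hinvE[OF assms(3)])
 have "\<phi> - (\<phi> - \<psi>) \<in> Z Q X Y 0"
  using Z_diff[OF f(1)] assms(4) Bd_subset_Z[OF wf] by blast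
 then have p: "\<psi> \<in> Z Q X Y 0" by simp
 have "(cm (lab Y) \<phi>' \<phi> - un X) - cm (lab Y) \<phi>' (\<phi> - \<psi>) \<in> Bd Q X X 0"
  by (rule Bd_diff[OF f(3) Bd0_cm_right[OF f(2) assms(4)]])
 moreover have "(cm (lab X) \<phi> \<phi>' - un Y) - cm (lab X) (\<phi> - \<psi>) \<phi>' \<in> Bd Q Y Y 0"
  by (rule Bd_diff[OF f(4) Bd0_cm_left[OF assms(4) f(2)]])
 ultimately show ?thesis using p f by (auto simp: hinv_def cm_linear)
qed

text \<open>Composition with an invertible class is injective on cohomology in every degree. The
  degree is kept general because vanishing is later needed in all degrees.\<close>

lemma hinv_cancel_right:
 assumes wf: "wfc Q X" "wfc Q Y" and "hinv Q X Y \<phi>" "\<psi> \<in> Z Q Y W i" "cm (lab Y) \<psi> \<phi> \<in> Bd Q X W i"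
 shows "\<psi> \<in> Bd Q Y W i"
proof -
 obtain \<phi>' where f: "\<phi> \<in> Z Q X Y 0" "\<phi>' \<in> Z Q Y X 0" "cm (lab Y) \<phi>' \<phi> - un X \<in> Bd Q X X 0"
  "cm (lab X) \<phi> \<phi>' - un Y \<in> Bd Q Y Y 0" by (rule hinvE[OF assms(3)])
 have "cm (lab X) (cm (lab Y) \<psi> \<phi>) \<phi>' - cm (lab Y) \<psi> (cm (lab X) \<phi> \<phi>' - un Y) \<in> Bd Q Y W i"
  using f assms Bd_cm_left[of "cm (lab Y) \<psi> \<phi>" Q X W i \<phi>' Y 0]
   Bd_cm_right[of \<psi> Q Y W i "cm (lab X) \<phi> \<phi>' - un Y" Y 0]
  by (intro Bd_diff) auto
 then show ?thesis using assms f by (simp add: cm_linear cm_assoc Z_wf_un)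
qed

lemma hinv_cancel_left:
 assumes wf: "wfc Q X" "wfc Q Y" and "hinv Q X Y \<phi>" "\<psi> \<in> Z Q W X i" "cm (lab X) \<phi> \<psi> \<in> Bd Q W Y i"
 shows "\<psi> \<in> Bd Q W X i"
proof -
 obtain \<phi>' where f: "\<phi> \<in> Z Q X Y 0" "\<phi>' \<in> Z Q Y X 0" "cm (lab Y) \<phi>' \<phi> - un X \<in> Bd Q X X 0"
  "cm (lab X) \<phi> \<phi>' - un Y \<in> Bd Q Y Y 0" by (rule hinvE[OF assms(3)])
 have "cm (lab Y) \<phi>' (cm (lab X) \<phi> \<psi>) - cm (lab X) (cm (lab Y) \<phi>' \<phi> - un X) \<psi> \<in> Bd Q W X i"
  using f assms Bd_cm_right[of \<phi>' Q Y X 0 "cm (lab X) \<phi> \<psi>" W i]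
   Bd_cm_left[of "cm (lab Y) \<phi>' \<phi> - un X" Q X X 0 \<psi> W i]
  by (intro Bd_diff) auto
 then show ?thesis using assms f by (simp add: cm_linear cm_assoc Z_wf_un)
qed

text \<open>
 Cochains with vanishing vertex component form a square-zero ideal, so the obstructions to lifting a
 homotopy inverse from the vertices can be removed in one step.
\<close>

lemma cm_square_zero: "\<phi> None = 0 ==> \<psi> None = 0 ==> cm B \<phi> \<psi> = 0"
 by (rule cochn_eqI) (simp_all add: mm_linear)

lemma hinv_of_vertices:
 fixes \<phi> :: "('c, 'b, 'e, 'k::comm_ring_1) cochn"
 assumes wf: "wfc Q X" "wfc Q Y" and p: "\<phi> \<in> Z Q X Y 0"
  and t: "t \<in> Tot Q Y X 0" "(D Y X 0 t) None = 0"
  and e: "\<eta> \<in> Tot Q Y Y (- 1)" "(cm (lab X) \<phi> t - un Y - D Y Y (- 1) \<eta>) None = 0"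
  and z: "\<zeta> \<in> Tot Q X X (- 1)" "(cm (lab Y) t \<phi> - un X - D X X (- 1) \<zeta>) None = 0"
 shows "hinv Q X Y \<phi>"
proof -
 define ob where "ob = D Y X 0 t"
 define j1 where "j1 = cm (lab X) \<phi> t - un Y - D Y Y (- 1) \<eta>"
 define j2 where "j2 = cm (lab Y) t \<phi> - un X - D X X (- 1) \<zeta>"
 have pT: "\<phi> \<in> Tot Q X Y 0" and pD: "D X Y 0 \<phi> = 0" using p by (auto simp: Z_def)
 have obT: "ob \<in> Tot Q Y X 1" and obZ: "D Y X 1 ob = 0"
  using D_Tot[OF wf(2,1) t(1)] D_D[OF wf(2,1), of 0 t] by (auto simp: ob_def)
 have De: "D Y Y (- 1) \<eta> \<in> Bd Q Y Y 0" "D X X (- 1) \<zeta> \<in> Bd Q X X 0"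
  using e z by (auto intro: Bd0I)
 have j1T: "j1 \<in> Tot Q Y Y 0" and j2T: "j2 \<in> Tot Q X X 0"
  using Tot_cm[OF pT t(1), of "lab X"] Tot_cm[OF t(1) pT, of "lab Y"] De Bd_subset_Z[OF wf(1,1)] Bd_subset_Z[OF wf(2,2)]
  by (auto simp: j1_def j2_def Z_def intro!: Tot_diff un_Tot)
 have N: "j1 None = 0" "j2 None = 0" "ob None = 0"
  using e z t by (auto simp: j1_def j2_def ob_def)
 have "D Y Y 0 (cm (lab X) \<phi> t) = cm (lab X) \<phi> ob"
  using D_cm[of Y Y 0 0 X \<phi> t] by (simp add: pD cm_linear sc_linear ob_def)
 then have j1D: "D Y Y 0 j1 = cm (lab X) \<phi> ob"
  using D_D[OF wf(2,2), of "-1" \<eta>] by (simp add: j1_def D_linear D_un[OF wf(2)])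
 have tj: "D Y X 0 (cm (lab Y) t j1) = cm (lab Y) t (cm (lab X) \<phi> ob)"
  using D_cm[of Y X 0 0 Y t j1] cm_square_zero[of ob j1, OF N(3) N(1)]
  by (simp add: ob_def[symmetric] j1D sc_linear cm_linear)
 have zo: "D Y X 0 (cm (lab X) \<zeta> ob) = cm (lab X) (D X X (- 1) \<zeta>) ob"
  using D_cm[of Y X "-1" 1 X \<zeta> ob] by (simp add: obZ cm_linear sc_linear)
 \<comment> \<open>Both factors vanish at the vertices, so their product is zero. Expanding
   \<open>j2\<close> expresses the obstruction \<open>ob\<close> by \<open>t \<phi> ob\<close> and
   \<open>D \<zeta>\<close> times \<open>ob\<close>, and by the Leibniz rule both are coboundaries
   of cochains vanishing at the vertices.\<close>
 have "cm (lab X) j2 ob = 0" using cm_square_zero[of j2 ob, OF N(2) N(3)] .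
 then have "cm (lab Y) t (cm (lab X) \<phi> ob) - ob - cm (lab X) (D X X (- 1) \<zeta>) ob = 0"
  using cm_un_left[OF wfc_simps(1)[OF wf(1)] obT] by (simp add: j2_def cm_linear cm_assoc)
 then have ob_eq: "ob = D Y X 0 (cm (lab Y) t j1 - cm (lab X) \<zeta> ob)"
  by (simp add: D_linear tj zo algebra_simps)
 define h where "h = - (cm (lab Y) t j1 - cm (lab X) \<zeta> ob)"
 have hN: "h None = 0" by (simp add: h_def N mm_linear)
 have hT: "h \<in> Tot Q Y X 0"
  using Tot_cm[OF t(1) j1T, of "lab Y"] Tot_cm[OF z(1) obT, of "lab X"] by (auto simp: h_def intro!: Tot_diff Tot_minus)
 have s: "t + h \<in> Z Q Y X 0"
 proof -
  have "D Y X 0 h = - ob"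
   unfolding h_def D_linear(3) using ob_eq by simp
  then show ?thesis
   using hT t by (simp add: Z_def Tot_add D_linear(1) ob_def)
 qed
 \<comment> \<open>The corrected cochain \<open>t + h\<close> is a cocycle and inverts
   \<open>\<phi>\<close> up to coboundaries and the errors \<open>u\<close> and \<open>w\<close>.
   These vanish at the vertices and so have square zero, whence \<open>1 - u\<close> inverts
   \<open>1 + u\<close>, and similarly for \<open>w\<close>.\<close>
 define u where "u = j2 + cm (lab Y) h \<phi>"
 define w where "w = j1 + cm (lab X) \<phi> h"
 have uN: "u None = 0" "w None = 0" by (simp_all add: u_def w_def N hN mm_linear)
 have ue: "u = cm (lab Y) (t + h) \<phi> - un X - D X X (- 1) \<zeta>"
  and we: "w = cm (lab X) \<phi> (t + h) - un Y - D Y Y (- 1) \<eta>"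
  by (simp_all add: u_def w_def j1_def j2_def cm_linear)
 have uZ: "u \<in> Z Q X X 0" and wZ: "w \<in> Z Q Y Y 0"
  using De s p Bd_subset_Z[OF wf(1,1)] Bd_subset_Z[OF wf(2,2)] wf
  by (auto simp: ue we intro!: Z_diff Z0_cm un_Z)
 have "cm (lab X) (un X - u) (un X + u) = un X"
  using cm_square_zero[of u u, OF uN(1) uN(1)] uZ wf by (simp add: cm_linear Z_wf_un un_Z Z_wf_un(1)[OF _ un_Z])
 moreover have "cm (lab Y) (cm (lab X) (un X - u) (t + h)) \<phi> =
   cm (lab X) (un X - u) (un X + u) + cm (lab X) (un X - u) (D X X (- 1) \<zeta>)"
  by (simp only: cm_assoc cm_add_right[symmetric]) (simp add: ue)
 ultimately have 1: "cm (lab Y) (cm (lab X) (un X - u) (t + h)) \<phi> - un X \<in> Bd Q X X 0"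
  using De(2) uZ wf by (simp add: Bd0_cm_right un_Z Z_diff)
 have "cm (lab Y) (un Y + w) (un Y - w) = un Y"
  using cm_square_zero[of w w, OF uN(2) uN(2)] wZ wf by (simp add: cm_linear Z_wf_un un_Z Z_wf_un(1)[OF _ un_Z])
 moreover have "cm (lab X) \<phi> (cm (lab Y) (t + h) (un Y - w)) =
   cm (lab Y) (un Y + w) (un Y - w) + cm (lab Y) (D Y Y (- 1) \<eta>) (un Y - w)"
  by (simp only: cm_assoc[symmetric] cm_add_left[symmetric]) (simp add: we)
 ultimately have 2: "cm (lab X) \<phi> (cm (lab Y) (t + h) (un Y - w)) - un Y \<in> Bd Q Y Y 0"
  using De(1) wZ wf by (simp add: Bd0_cm_left un_Z Z_diff)
 show ?thesis
  by (rule hinvI[OF wf p _ 1 _ 2]) (use s uZ wZ wf in \<open>auto intro!: Z0_cm Z_diff un_Z\<close>)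
qed

section \<open>Quasi-isomorphisms are invertible\<close>

definition vec :: "('b, 'v, 'e, 'k) qcx => int => ('b => 'k::zero) set" where
 "vec C i = {c. \<forall>x. c x \<noteq> 0 --> x \<in> lab C \<and> dg C x = i}"

definition mv :: "'b set => ('c => 'b => 'k::comm_ring_1) => ('b => 'k) => 'c => 'k" where
 "mv B M c = (\<lambda>y. \<Sum>x\<in>B. M y x * c x)"

definition HM :: "('b, 'v, 'e, 'k) qcx => ('c, 'v, 'e, 'k) qcx => int => ('c => 'b => 'k::comm_ring_1) set" where
 "HM X Y i = {M. \<forall>y x. M y x \<noteq> 0 --> y \<in> lab Y \<and> x \<in> lab X \<and> vx Y y = vx X x \<and> dg Y y = dg X x + i}"

definition nm :: "('c => 'b => 'k::comm_ring_1) => ('c, 'b, 'e, 'k) cochn" where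
 "nm M = (\<lambda>p. case p of None => M | Some e => 0)"

lemma nm_simps [simp]: "nm M None = M" "nm M (Some e) = 0"
 by (simp_all add: nm_def)

lemma nm_Tot: "nm M \<in> Tot Q X Y i \<longleftrightarrow> M \<in> HM X Y i"
 by (auto simp: Tot_def HM_def allowed_def nm_def split: option.splits)

lemma Tot_HM: "\<phi> \<in> Tot Q X Y i ==> \<phi> None \<in> HM X Y i"
 by (fastforce simp: Tot_def HM_def allowed_def split: option.splits)

lemma nm_mm: "nm (mm B f g) = cm B (nm f) (nm g)"
 by (rule cochn_eqI) (simp_all add: mm_linear)

lemma nm_add: "nm (f + g) = nm f + nm g" and nm_diff: "nm (f - g) = nm f - nm g"
 and nm_minus: "nm (- f) = - nm f" and nm_zero: "nm 0 = 0"
 by (rule cochn_eqI; simp)+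

lemma HM_mm:
 fixes Y :: "('c, 'v, 'e, 'k::comm_ring_1) qcx"
 shows "f \<in> HM Y W i ==> g \<in> HM X Y j ==> mm B f g \<in> HM X W (i + j)"
 \<comment> \<open>Components at the vertices do not refer to the arrows, so any digraph
   serves.\<close>
 using Tot_cm[of "nm f" "undefined :: ('v, 'e) pre_digraph" Y W i "nm g" X j B]
 by (simp add: nm_Tot nm_mm[symmetric])

lemma HM_linear:
 fixes X :: "('b, 'v, 'e, 'k::comm_ring_1) qcx"
 shows "f \<in> HM X Y i ==> g \<in> HM X Y i ==> f + g \<in> HM X Y i"
  "f \<in> HM X Y i ==> g \<in> HM X Y i ==> f - g \<in> HM X Y i"
  "f \<in> HM X Y i ==> - f \<in> HM X Y i"
 using Tot_add[of "nm f" "undefined :: ('v, 'e) pre_digraph" X Y i "nm g"]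
  Tot_diff[of "nm f" "undefined :: ('v, 'e) pre_digraph" X Y i "nm g"]
  Tot_minus[of "nm f" "undefined :: ('v, 'e) pre_digraph" X Y i]
 by (simp_all add: nm_Tot nm_add[symmetric] nm_diff[symmetric] nm_minus[symmetric])

lemma HM_un: "un X None \<in> HM X X 0"
 by (rule Tot_HM[OF un_Tot])

lemma mm_un_left: "finite (lab Y) ==> f \<in> HM X Y i ==> mm (lab Y) (un Y None) f = f"
 using cm_un_left[of Y "nm f" undefined X i] by (metis cm_simps(1) nm_Tot nm_simps(1))

lemma mm_un_right: "finite (lab X) ==> f \<in> HM X Y i ==> mm (lab X) f (un X None) = f"
 using cm_un_right[of X "nm f" undefined Y i] by (metis cm_simps(1) nm_Tot nm_simps(1))

lemma D_None: "D X Y 0 \<phi> None = mm (lab Y) (dd Y) (\<phi> None) - mm (lab X) (\<phi> None) (dd X)"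
  "D X Y (- 1) \<phi> None = mm (lab Y) (dd Y) (\<phi> None) + mm (lab X) (\<phi> None) (dd X)"
 by (auto simp: D_def sc_def fun_eq_iff)

lemma wfc_dd: "wfc Q C ==> dd C \<in> HM C C 1" "wfc Q C ==> mm (lab C) (dd C) (dd C) = 0"
 using Tot_HM[OF wfc_simps(2), of Q C] fun_cong[OF wfc_simps(3), of Q C None] by auto

lemma mv_col: "mv B M (\<lambda>y. N y x) = (\<lambda>z. mm B M N z x)"
 by (simp add: mv_def mm_def)

lemma HM_vx: "M \<in> HM X Y i ==> vx Y y \<noteq> vx X x ==> M y x = 0"
 by (auto simp: HM_def)

lemma HM_col: "M \<in> HM X Y i ==> (\<lambda>y. M y x) \<in> vec Y (dg X x + i)"
 by (auto simp: HM_def vec_def)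

lemma fun_sum_apply: "(\<Sum>z\<in>A. f z) x = (\<Sum>z\<in>A. f z x)"
 by (induction A rule: infinite_finite_induct) auto

interpretation fun_vs: vector_space "\<lambda>(c::'k::field) f (x::'b). c * f x"
 by unfold_locales (auto simp: fun_eq_iff algebra_simps)

interpretation fun_vs_pair: vector_space_pair "\<lambda>(c::'k::field) f (x::'b). c * f x" "\<lambda>(c::'k::field) f (x::'b). c * f x" ..

text \<open>Linear maps over a field split. The splitting is chosen separately on the part of each
  degree and vertex, so that \<open>g\<close> is homogeneous and preserves vertices.\<close>

lemma generalized_inverse:
 fixes C :: "('b, 'v, 'e, 'k::field) qcx"
 assumes wf: "wfc Q C"
 shows "\<exists>g\<in>HM C C (- 1). mm (lab C) (dd C) (mm (lab C) g (dd C)) = dd C"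
proof -
 let ?s = "\<lambda>(c::'k) f (x::'b). c * f x"
 let ?T = "mv (lab C) (dd C)"
 define V where "V i v = {c :: 'b => 'k. \<forall>x. c x \<noteq> 0 --> x \<in> lab C \<and> dg C x = i \<and> vx C x = v}" for i v
 have sub: "fun_vs.subspace (V i v)" for i v
  unfolding fun_vs.subspace_def V_def by (auto; metis add_0)
 have lin: "Vector_Spaces.linear ?s ?s ?T"
  unfolding Vector_Spaces.linear_def module_hom_iff
  by (intro conjI fun_vs.module_axioms fun_vs.vector_space_axioms) (auto simp: mv_def fun_eq_iff algebra_simps sum.distrib sum_distrib_left)
 have "\<exists>g. g ` UNIV \<subseteq> V i v \<and> Vector_Spaces.linear ?s ?s g \<and> (\<forall>y\<in>?T ` V i v. ?T (g y) = y)" for i v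
  by (rule fun_vs_pair.linear_exists_right_inverse_on[OF lin sub])
 then obtain G where G: "\<And>i v y. G i v y \<in> V i v" "\<And>i v. Vector_Spaces.linear ?s ?s (G i v)"
  "\<And>i v y. y \<in> ?T ` V i v ==> ?T (G i v y) = y"
  by (metis rangeI subsetD)
 have GL: "module_hom ?s ?s (G i v)" for i v
  using G(2) by (simp add: Vector_Spaces.linear_def)
 define u where "u x = (\<lambda>y. if y = x then 1 else 0 :: 'k)" for x :: 'b
 \<comment> \<open>A basis vector of degree \<open>dg C x\<close> is lifted along the differential,
   hence to degree one less and at the same vertex.\<close>
 define g where "g y x = (if x \<in> lab C then G (dg C x - 1) (vx C x) (u x) y else 0)" for y x
 have gH: "g \<in> HM C C (- 1)"
  unfolding HM_def using G(1) by (auto simp: g_def V_def split: if_splits)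
 have "(\<lambda>z. mm (lab C) (dd C) (mm (lab C) g (dd C)) z x) = (\<lambda>z. dd C z x)" for x
 proof (cases "x \<in> lab C")
  case False
  then have "dd C z x = 0" for z using wfc_dd(1)[OF wf] by (auto simp: HM_def)
  then show ?thesis by (simp add: mm_def)
 next
  case True
  have dz: "z \<in> lab C \<and> dg C z = dg C x + 1 \<and> vx C z = vx C x" if "dd C z x \<noteq> 0" for z
   using wfc_dd(1)[OF wf] that by (auto simp: HM_def)
  let ?d = "\<lambda>z. dd C z x"
  have d: "?d = (\<Sum>z\<in>lab C. ?s (?d z) (u z))"
   using wfc_simps(1)[OF wf] dz by (auto simp: fun_eq_iff u_def fun_sum_apply if_distrib sum.delta cong: if_cong)
  have "G (dg C x) (vx C x) ?d = (\<Sum>z\<in>lab C. ?s (?d z) (G (dg C x) (vx C x) (u z)))"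
   by (subst d) (simp add: module_hom.sum[OF GL]
     module_hom.scale[OF GL])
  also have "\<dots> = (\<lambda>y. mm (lab C) g (dd C) y x)"
  proof
   fix y
   have "dd C z x * G (dg C x) (vx C x) (u z) y = g y z * dd C z x" for z
    using dz[of z] by (cases "dd C z x = 0") (auto simp: g_def)
   then show "(\<Sum>z\<in>lab C. ?s (?d z) (G (dg C x) (vx C x) (u z))) y = mm (lab C) g (dd C) y x"
    unfolding fun_sum_apply mm_def by (intro sum.cong refl)
  qed
  finally have e: "(\<lambda>y. mm (lab C) g (dd C) y x) = G (dg C x) (vx C x) ?d" ..
  have "?T (u x) = ?d"
   using True wfc_simps(1)[OF wf] by (auto simp: mv_def u_def fun_eq_iff if_distrib sum.delta cong: if_cong)
  moreover have "u x \<in> V (dg C x) (vx C x)" using True by (auto simp: u_def V_def)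
  ultimately have "?T (G (dg C x) (vx C x) ?d) = ?d" by (intro G(3)) (metis imageI)
  then show ?thesis by (metis (no_types) e mv_col)
 qed
 then have "mm (lab C) (dd C) (mm (lab C) g (dd C)) = dd C" by (auto simp: fun_eq_iff)
 then show ?thesis using gH by blast
qed

text \<open>The map on cohomology induced by the matrix \<open>f\<close> is injective, respectively surjective.\<close>

definition inj_on_coho :: "('b, 'v, 'e, 'k) qcx => ('c, 'v, 'e, 'k) qcx => ('c => 'b => 'k::comm_ring_1) => bool" where
 "inj_on_coho X Y f \<longleftrightarrow> (\<forall>i. \<forall>c\<in>vec X i. mv (lab X) (dd X) c = 0 -->
   (\<exists>y\<in>vec Y (i - 1). mv (lab X) f c = mv (lab Y) (dd Y) y) --> (\<exists>x\<in>vec X (i - 1). c = mv (lab X) (dd X) x))"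

definition surj_on_coho :: "('b, 'v, 'e, 'k) qcx => ('c, 'v, 'e, 'k) qcx => ('c => 'b => 'k::comm_ring_1) => bool" where
 "surj_on_coho X Y f \<longleftrightarrow> (\<forall>i. \<forall>c\<in>vec Y i. mv (lab Y) (dd Y) c = 0 -->
   (\<exists>x\<in>vec X i. mv (lab X) (dd X) x = 0 \<and> (\<exists>y\<in>vec Y (i - 1). c = mv (lab X) f x + mv (lab Y) (dd Y) y)))"

lemma mv_mv: "mv B M (mv C N c) = mv C (mm B M N) c"
proof
 fix z
 have "mv B M (mv C N c) z = (\<Sum>y\<in>B. \<Sum>x\<in>C. M z y * N y x * c x)"
  by (simp add: mv_def sum_distrib_left mult.assoc)
 also have "\<dots> = (\<Sum>x\<in>C. \<Sum>y\<in>B. M z y * N y x * c x)"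
  by (rule sum.swap)
 finally show "mv B M (mv C N c) z = mv C (mm B M N) c z"
  by (simp add: mv_def mm_def sum_distrib_right)
qed

lemma mv_linear: "mv B (M + N) c = mv B M c + mv B N c" "mv B (M - N) c = mv B M c - mv B N c"
  "mv B (- M) c = - mv B M c" "mv B 0 c = 0"
  "mv B M (c + c') = mv B M c + mv B M c'" "mv B M (c - c') = mv B M c - mv B M c'"
  "mv B M (- c) = - mv B M c" "mv B M 0 = 0"
 by (auto simp: mv_def fun_eq_iff algebra_simps sum.distrib sum_negf sum_subtractf)

lemma mv_un: "finite (lab X) ==> c \<in> vec X i ==> mv (lab X) (un X None) c = c"
proof
 fix y assume a: "finite (lab X)" "c \<in> vec X i"
 have "mv (lab X) (un X None) c y = (\<Sum>x\<in>lab X. if y = x then c y else 0)"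
  by (auto simp: mv_def un_def intro: sum.cong)
 then show "mv (lab X) (un X None) c y = c y" using a by (auto simp: sum.delta' vec_def)
qed

lemma mv_vec: "M \<in> HM X Y i ==> c \<in> vec X j ==> mv (lab X) M c \<in> vec Y (j + i)"
proof -
 assume a: "M \<in> HM X Y i" "c \<in> vec X j"
 have "y \<in> lab Y \<and> dg Y y = j + i" if "mv (lab X) M c y \<noteq> 0" for y
 proof -
  obtain x where "x \<in> lab X" "M y x * c x \<noteq> 0"
   using \<open>mv (lab X) M c y \<noteq> 0\<close> unfolding mv_def by (meson sum.neutral)
  then have "M y x \<noteq> 0" "c x \<noteq> 0" by auto
  then show ?thesis using a unfolding HM_def vec_def by fastforce
 qed
 then show ?thesis by (auto simp: vec_def)
qed

lemma vec_linear: "c \<in> vec X i ==> c' \<in> vec X i ==> c + c' \<in> vec X i"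
  "c \<in> vec X i ==> c' \<in> vec X i ==> c - c' \<in> vec X i"
  "c \<in> vec X i ==> - c \<in> vec X i" "0 \<in> vec X i"
 for c :: "_ => 'k::comm_ring_1"
 by (auto simp: vec_def) (metis add_0 diff_0_right)+

lemma Z0_None: "\<phi> \<in> Z Q X Y 0 ==> mm (lab Y) (dd Y) (\<phi> None) = mm (lab X) (\<phi> None) (dd X)"
 using D_None(1)[of X Y \<phi>] by (simp add: Z_def)

lemma diff_swap: "a - c = b ==> c = a - b" for a :: "'a::ab_group_add"
 by auto

lemma hinv_imp_coho:
 assumes wf: "wfc Q X" "wfc Q Y" and h: "hinv Q X Y \<phi>"
 shows "inj_on_coho X Y (\<phi> None)" and "surj_on_coho X Y (\<phi> None)"
proof -
 obtain \<psi> where f: "\<phi> \<in> Z Q X Y 0" "\<psi> \<in> Z Q Y X 0" "cm (lab Y) \<psi> \<phi> - un X \<in> Bd Q X X 0"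
  "cm (lab X) \<phi> \<psi> - un Y \<in> Bd Q Y Y 0" by (rule hinvE[OF h])
 obtain \<eta> where e: "\<eta> \<in> Tot Q Y Y (- 1)" "cm (lab X) \<phi> \<psi> - un Y = D Y Y (- 1) \<eta>"
  using f(4) by (auto simp: Bd_def)
 obtain \<zeta> where z: "\<zeta> \<in> Tot Q X X (- 1)" "cm (lab Y) \<psi> \<phi> - un X = D X X (- 1) \<zeta>"
  using f(3) by (auto simp: Bd_def)
 have e': "mm (lab X) (\<phi> None) (\<psi> None) - un Y None = mm (lab Y) (dd Y) (\<eta> None) + mm (lab Y) (\<eta> None) (dd Y)"
  using fun_cong[OF e(2), of None] by (simp add: D_None)
 have z': "mm (lab Y) (\<psi> None) (\<phi> None) - un X None = mm (lab X) (dd X) (\<zeta> None) + mm (lab X) (\<zeta> None) (dd X)"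
  using fun_cong[OF z(2), of None] by (simp add: D_None)
 note fin = wfc_simps(1)[OF wf(1)] wfc_simps(1)[OF wf(2)]
 have hm: "\<phi> None \<in> HM X Y 0" "\<psi> None \<in> HM Y X 0" "\<zeta> None \<in> HM X X (- 1)" "\<eta> None \<in> HM Y Y (- 1)"
  using f e z by (auto simp: Z_def intro: Tot_HM)
 show "inj_on_coho X Y (\<phi> None)"
  unfolding inj_on_coho_def
 proof (intro allI ballI impI, elim bexE)
  fix i c y assume c: "c \<in> vec X i" "mv (lab X) (dd X) c = 0" "y \<in> vec Y (i - 1)"
   and eq: "mv (lab X) (\<phi> None) c = mv (lab Y) (dd Y) y"
  have "mv (lab X) (mm (lab Y) (\<psi> None) (\<phi> None) - un X None) c = mv (lab X) (dd X) (mv (lab X) (\<zeta> None) c)"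
   unfolding z' by (simp add: mv_linear mv_mv[symmetric] c)
  then have "mv (lab Y) (\<psi> None) (mv (lab Y) (dd Y) y) - c = mv (lab X) (dd X) (mv (lab X) (\<zeta> None) c)"
   by (simp add: mv_linear mv_mv[symmetric] mv_un[OF fin(1) c(1)] eq)
  then have "c = mv (lab Y) (\<psi> None) (mv (lab Y) (dd Y) y) - mv (lab X) (dd X) (mv (lab X) (\<zeta> None) c)"
   by (rule diff_swap)
  also have "mv (lab Y) (\<psi> None) (mv (lab Y) (dd Y) y) = mv (lab X) (dd X) (mv (lab Y) (\<psi> None) y)"
   by (simp add: mv_mv Z0_None[OF f(2)])
  finally have "c = mv (lab X) (dd X) (mv (lab Y) (\<psi> None) y - mv (lab X) (\<zeta> None) c)"
   unfolding mv_linear(6) .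
  moreover have "mv (lab Y) (\<psi> None) y - mv (lab X) (\<zeta> None) c \<in> vec X (i - 1)"
   using mv_vec[OF hm(2) c(3)] mv_vec[OF hm(3) c(1)] by (simp add: vec_linear)
  ultimately show "\<exists>x\<in>vec X (i - 1). c = mv (lab X) (dd X) x" by (rule bexI)
 qed
 show "surj_on_coho X Y (\<phi> None)"
  unfolding surj_on_coho_def
 proof (intro allI ballI impI)
  fix i c assume c: "c \<in> vec Y i" "mv (lab Y) (dd Y) c = 0"
  have "mv (lab Y) (mm (lab X) (\<phi> None) (\<psi> None) - un Y None) c = mv (lab Y) (dd Y) (mv (lab Y) (\<eta> None) c)"
   unfolding e' by (simp add: mv_linear mv_mv[symmetric] c)
  then have "mv (lab X) (\<phi> None) (mv (lab Y) (\<psi> None) c) - c = mv (lab Y) (dd Y) (mv (lab Y) (\<eta> None) c)"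
   by (simp add: mv_linear mv_mv[symmetric] mv_un[OF fin(2) c(1)])
  from diff_swap[OF this] have "c = mv (lab X) (\<phi> None) (mv (lab Y) (\<psi> None) c) + mv (lab Y) (dd Y) (- mv (lab Y) (\<eta> None) c)"
   unfolding mv_linear(7) diff_conv_add_uminus .
  moreover have "mv (lab Y) (\<psi> None) c \<in> vec X i" "- mv (lab Y) (\<eta> None) c \<in> vec Y (i - 1)"
   using mv_vec[OF hm(2) c(1)] mv_vec[OF hm(4) c(1)] by (simp_all add: vec_linear)
  moreover have "mv (lab X) (dd X) (mv (lab Y) (\<psi> None) c) = 0"
   unfolding mv_mv Z0_None[OF f(2)] unfolding mv_mv[symmetric] c mv_linear ..
  ultimately show "\<exists>x\<in>vec X i. mv (lab X) (dd X) x = 0 \<and>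
    (\<exists>y\<in>vec Y (i - 1). c = mv (lab X) (\<phi> None) x + mv (lab Y) (dd Y) y)"
   by (intro bexI conjI)
 qed
qed

text \<open>At the vertices these are complexes of vector spaces, where a quasi-isomorphism has a
  homotopy inverse built from splittings of the two differentials. It need not commute with the
  arrows, and \<open>hinv_of_vertices\<close> repairs this.\<close>

lemma hinv_of_coho:
 fixes \<phi> :: "('c, 'b, 'e, 'k::field) cochn"
 assumes wf: "wfc Q W" "wfc Q X" and p: "\<phi> \<in> Z Q W X 0"
  and inj: "inj_on_coho W X (\<phi> None)" and surj: "surj_on_coho W X (\<phi> None)"
 shows "hinv Q W X \<phi>"
proof -
 define f where "f = \<phi> None"
 let ?W = "lab W" and ?X = "lab X" and ?d = "dd W" and ?e = "dd X"
 note fin = wfc_simps(1)[OF wf(1)] wfc_simps(1)[OF wf(2)]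
 note dH = wfc_dd(1)[OF wf(1)] wfc_dd(1)[OF wf(2)]
 have dd0: "mm ?W ?d ?d = 0" "mm ?X ?e ?e = 0" using wfc_dd(2) wf by auto
 have fH: "f \<in> HM W X 0" using p by (auto simp: Z_def f_def intro: Tot_HM)
 have fd: "mm ?X ?e f = mm ?W f ?d" using Z0_None[OF p] by (simp add: f_def)
 obtain g where g: "g \<in> HM W W (- 1)" "mm ?W ?d (mm ?W g ?d) = ?d"
  using generalized_inverse[OF wf(1)] by blast
 obtain k where k: "k \<in> HM X X (- 1)" "mm ?X ?e (mm ?X k ?e) = ?e"
  using generalized_inverse[OF wf(2)] by blast
 \<comment> \<open>\<open>P\<close> and \<open>R\<close> are homotopic to the identity, take values
   in cocycles and kill coboundaries, so they factor through cohomology. They need not be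
   idempotent, since \<open>g\<close> and \<open>k\<close> are inverses on one side only.\<close>
 define P where "P = un W None - mm ?W ?d g - mm ?W g ?d"
 define R where "R = un X None - mm ?X ?e k - mm ?X k ?e"
 have PH: "P \<in> HM W W 0" and RH: "R \<in> HM X X 0"
  using HM_mm[OF dH(1) g(1), of ?W] HM_mm[OF g(1) dH(1), of ?W] HM_mm[OF dH(2) k(1), of ?X] HM_mm[OF k(1) dH(2), of ?X]
  by (auto simp: P_def R_def intro!: HM_linear HM_un)
 have dP: "mm ?W ?d P = 0" "mm ?X ?e R = 0"
  unfolding P_def R_def using mm_un_right[OF fin(1) dH(1)] mm_un_right[OF fin(2) dH(2)]
  by (simp_all add: mm_linear g k) (simp_all add: mm_assoc[symmetric] dd0 mm_linear)
 have Pd: "mm ?W P ?d = 0" "mm ?X R ?e = 0"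
  unfolding P_def R_def using mm_un_left[OF fin(1) dH(1)] mm_un_left[OF fin(2) dH(2)]
  by (simp_all add: mm_linear mm_assoc g k dd0)
 have "\<exists>w y. x \<in> ?X --> w \<in> vec W (dg X x) \<and> mv ?W ?d w = 0 \<and> y \<in> vec X (dg X x - 1) \<and>
   (\<lambda>z. R z x) = mv ?W f w + mv ?X ?e y" for x
 proof (cases "x \<in> ?X")
  case True
  have "(\<lambda>z. R z x) \<in> vec X (dg X x)" using HM_col[OF RH, of x] by simp
  moreover have "mv ?X ?e (\<lambda>z. R z x) = 0" using dP(2) by (simp add: mv_col fun_eq_iff)
  ultimately show ?thesis using surj unfolding surj_on_coho_def f_def[symmetric] by blast
 qed auto
 then have "\<forall>x. \<exists>w y. x \<in> ?X --> w \<in> vec W (dg X x) \<and> mv ?W ?d w = 0 \<and> y \<in> vec X (dg X x - 1) \<and>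
   (\<lambda>z. R z x) = mv ?W f w + mv ?X ?e y" ..
 from choice[OF this] obtain w where
  "\<forall>x. \<exists>y. x \<in> ?X --> w x \<in> vec W (dg X x) \<and> mv ?W ?d (w x) = 0 \<and> y \<in> vec X (dg X x - 1) \<and>
   (\<lambda>z. R z x) = mv ?W f (w x) + mv ?X ?e y" by blast
 from choice[OF this] obtain y where
  y: "\<forall>x. x \<in> ?X --> w x \<in> vec W (dg X x) \<and> mv ?W ?d (w x) = 0 \<and> y x \<in> vec X (dg X x - 1) \<and>
   (\<lambda>z. R z x) = mv ?W f (w x) + mv ?X ?e (y x)" by blast
 have wy: "w x \<in> vec W (dg X x)" "mv ?W ?d (w x) = 0" "y x \<in> vec X (dg X x - 1)"
   "R z x = mv ?W f (w x) z + mv ?X ?e (y x) z" if "x \<in> ?X" for x z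
  using y[rule_format, OF that] fun_cong[of "\<lambda>z. R z x" "mv ?W f (w x) + mv ?X ?e (y x)" z] by auto
 \<comment> \<open>The preimages supplied by surjectivity have the right degree but may spread over
   several vertices. Cutting them down to the vertex of \<open>x\<close> is harmless because all
   matrices involved preserve vertices.\<close>
 define t0 where "t0 z x = (if x \<in> ?X \<and> vx W z = vx X x then w x z else 0)" for z x
 define r where "r z x = (if x \<in> ?X \<and> vx X z = vx X x then y x z else 0)" for z x
 have t0H: "t0 \<in> HM X W 0" and rH: "r \<in> HM X X (- 1)"
  using wy(1,3) by (auto simp: HM_def vec_def t0_def r_def split: if_splits)
 have dt0: "mm ?W ?d t0 = 0"
 proof (intro ext)
  fix z x
  have "mm ?W ?d t0 z x = (if x \<in> ?X \<and> vx W z = vx X x then mv ?W ?d (w x) z else 0)"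
  proof -
   have "?d z u * t0 u x = (if x \<in> ?X \<and> vx W z = vx X x then ?d z u * w x u else 0)" for u
    using HM_vx[OF dH(1), of z u] by (auto simp: t0_def)
   then show ?thesis by (auto simp: mm_def mv_def)
  qed
  then show "mm ?W ?d t0 z x = (0 :: 'b => 'c => 'k) z x" using wy(2) by auto
 qed
 have R_eq: "mm ?W f t0 + mm ?X ?e r = R"
 proof (intro ext)
  fix z x
  have 1: "mm ?W f t0 z x = (if x \<in> ?X \<and> vx X z = vx X x then mv ?W f (w x) z else 0)"
  proof -
   have "f z u * t0 u x = (if x \<in> ?X \<and> vx X z = vx X x then f z u * w x u else 0)" for u
    using HM_vx[OF fH, of z u] by (auto simp: t0_def)
   then show ?thesis by (auto simp: mm_def mv_def)
  qed
  have 2: "mm ?X ?e r z x = (if x \<in> ?X \<and> vx X z = vx X x then mv ?X ?e (y x) z else 0)"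
  proof -
   have "?e z u * r u x = (if x \<in> ?X \<and> vx X z = vx X x then ?e z u * y x u else 0)" for u
    using HM_vx[OF dH(2), of z u] by (auto simp: r_def)
   then show ?thesis by (auto simp: mm_def mv_def)
  qed
  have "R z x = mv ?W f (w x) z + mv ?X ?e (y x) z" if "x \<in> ?X"
   by (rule wy(4)[OF that])
  moreover have "R z x = 0" if "\<not> (x \<in> ?X \<and> vx X z = vx X x)"
   using RH that by (auto simp: HM_def)
  ultimately show "(mm ?W f t0 + mm ?X ?e r) z x = R z x" by (simp add: 1 2)
 qed
 \<comment> \<open>Composing with \<open>R\<close> makes \<open>t\<close> vanish on coboundaries,
   while its values remain cocycles; so \<open>t\<close> commutes with the differentials for trivial
   reasons.\<close>
 define t where "t = mm ?X t0 R"
 have tH: "t \<in> HM X W 0" using HM_mm[OF t0H RH] by (simp add: t_def)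
 have dt: "mm ?W ?d t = 0" by (simp add: t_def mm_assoc[symmetric] dt0 mm_linear)
 have td: "mm ?X t ?e = 0" by (simp add: t_def mm_assoc Pd mm_linear)
 define \<eta> where "\<eta> = - (k + mm ?X R k + mm ?X r R)"
 have \<eta>H: "\<eta> \<in> HM X X (- 1)"
  using HM_mm[OF RH k(1), of ?X] HM_mm[OF rH RH, of ?X] k by (auto simp: \<eta>_def intro!: HM_linear)
 have Rke: "mm ?X R (mm ?X k ?e) = R - mm ?X R R"
 proof -
  have "mm ?X R (mm ?X ?e k) = 0" by (simp add: mm_assoc[symmetric] Pd mm_linear)
  moreover have "mm ?X R (un X None - mm ?X ?e k - mm ?X k ?e) = mm ?X R R" by (simp add: R_def)
  ultimately have e: "mm ?X R R = R - mm ?X R (mm ?X k ?e)"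
   using mm_un_right[OF fin(2) RH] by (simp only: mm_diff_right diff_zero)
  show ?thesis unfolding e by (rule ext)+ simp
 qed
 have ft: "mm ?W f t = mm ?X R R - mm ?X ?e (mm ?X r R)"
 proof -
  have "mm ?W f t0 = R - mm ?X ?e r" using R_eq by (simp add: eq_diff_eq)
  then show ?thesis by (simp add: t_def mm_assoc[symmetric]) (simp add: mm_linear mm_assoc)
 qed
 have \<eta>: "mm ?W f t - un X None = mm ?X ?e \<eta> + mm ?X \<eta> ?e"
 proof -
  have a: "mm ?X ?e (mm ?X R k) = 0" by (simp add: mm_assoc[symmetric] dP mm_linear)
  have b: "mm ?X (mm ?X R k) ?e = R - mm ?X R R" by (simp only: mm_assoc Rke)
  have c: "mm ?X (mm ?X r R) ?e = 0" by (simp add: mm_assoc Pd mm_linear)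
  have "mm ?X ?e \<eta> + mm ?X \<eta> ?e =
    - (mm ?X ?e k + mm ?X ?e (mm ?X r R)) - (mm ?X k ?e + (R - mm ?X R R))"
   unfolding \<eta>_def by (simp only: mm_minus_left mm_minus_right mm_add_left mm_add_right a b c) simp
  also have "\<dots> = mm ?W f t - un X None"
   unfolding ft by (subst (2) R_def) simp
  finally show ?thesis ..
 qed
 define v where "v = mm ?X t f - un W None"
 have vH: "v \<in> HM W W 0" using HM_mm[OF tH fH, of ?X] by (auto simp: v_def intro: HM_linear HM_un)
 have dv: "mm ?W ?d v = - ?d" using mm_un_right[OF fin(1) dH(1)]
  by (simp add: v_def mm_linear mm_assoc[symmetric] dt)
 have vd: "mm ?W v ?d = - ?d"
 proof -
  have "mm ?X t (mm ?W f ?d) = 0" by (simp add: fd[symmetric]) (simp add: mm_assoc[symmetric] td mm_linear)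
  then show ?thesis using mm_un_left[OF fin(1) dH(1)] by (simp add: v_def mm_linear mm_assoc)
 qed
 \<comment> \<open>\<open>v\<close> is the defect of the other composite and \<open>q\<close> its
   part seen by cohomology. As \<open>f q\<close> consists of coboundaries, injectivity makes the
   columns of \<open>q\<close> coboundaries, and \<open>g\<close> lifts them; this yields the
   homotopy \<open>\<zeta>\<close>.\<close>
 define q where "q = mm ?W v P"
 have qH: "q \<in> HM W W 0" using HM_mm[OF vH PH] by (simp add: q_def)
 have dq: "mm ?W ?d q = 0" by (simp add: q_def mm_assoc[symmetric] dv mm_linear dP)
 have qd: "mm ?W q ?d = 0" by (simp add: q_def mm_assoc Pd mm_linear)
 have fq: "mm ?W f q = mm ?X ?e (mm ?X \<eta> (mm ?W f P))"
 proof -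
  have "mm ?W f v = mm ?X (mm ?W f t - un X None) f"
   using mm_un_left[OF fin(2) fH] mm_un_right[OF fin(1) fH] by (simp add: v_def mm_linear mm_assoc)
  then have "mm ?W f q = mm ?X (mm ?X ?e \<eta> + mm ?X \<eta> ?e) (mm ?W f P)"
   by (simp add: q_def mm_assoc[symmetric] \<eta>)
  moreover have "mm ?X ?e (mm ?W f P) = 0"
   by (simp add: mm_assoc[symmetric] fd) (simp add: mm_assoc dP mm_linear)
  ultimately show ?thesis by (simp add: mm_linear mm_assoc)
 qed
 have dgq: "mm ?W ?d (mm ?W g q) = q"
 proof (intro ext)
  fix z x
  have "(\<lambda>z. q z x) \<in> vec W (dg W x)" using HM_col[OF qH, of x] by simp
  moreover have "mv ?W ?d (\<lambda>z. q z x) = 0" using dq by (simp add: mv_col fun_eq_iff)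
  moreover have "mv ?W f (\<lambda>z. q z x) = mv ?X ?e (\<lambda>z. mm ?X \<eta> (mm ?W f P) z x)"
   using fq by (simp add: mv_col)
  moreover have "(\<lambda>z. mm ?X \<eta> (mm ?W f P) z x) \<in> vec X (dg W x - 1)"
   using HM_col[OF HM_mm[OF \<eta>H HM_mm[OF fH PH]], of ?X ?W x] by simp
  ultimately obtain c where c: "(\<lambda>z. q z x) = mv ?W ?d c"
   using inj unfolding inj_on_coho_def f_def[symmetric] by blast
  have "(\<lambda>z. mm ?W ?d (mm ?W g q) z x) = mv ?W (mm ?W ?d g) (\<lambda>z. q z x)"
   by (simp add: mv_col mm_assoc)
  also have "\<dots> = mv ?W (mm ?W ?d (mm ?W g ?d)) c"
   by (simp add: c mv_mv mm_assoc)
  also have "\<dots> = (\<lambda>z. q z x)" by (simp add: g c)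
  finally show "mm ?W ?d (mm ?W g q) z x = q z x" by (rule fun_cong)
 qed
 define \<zeta> where "\<zeta> = mm ?W g q + mm ?W v g"
 have \<zeta>H: "\<zeta> \<in> HM W W (- 1)"
  using HM_mm[OF g(1) qH, of ?W] HM_mm[OF vH g(1), of ?W] by (auto simp: \<zeta>_def intro!: HM_linear)
 have "mm ?W v (mm ?W ?d g) = - mm ?W ?d g" by (simp add: mm_assoc[symmetric] vd mm_linear)
 moreover have "mm ?W ?d (mm ?W v g) = - mm ?W ?d g" by (simp add: mm_assoc[symmetric] dv mm_linear)
 moreover have "mm ?W ?d \<zeta> + mm ?W \<zeta> ?d = q + mm ?W ?d (mm ?W v g) + mm ?W v (mm ?W g ?d)"
  by (simp add: \<zeta>_def mm_linear mm_assoc dgq qd)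
 moreover have "q + mm ?W v (mm ?W ?d g) + mm ?W v (mm ?W g ?d) = v"
  unfolding q_def P_def using mm_un_right[OF fin(1) vH] by (simp add: mm_linear)
 ultimately have \<zeta>: "v = mm ?W ?d \<zeta> + mm ?W \<zeta> ?d" by (simp only:)
 show ?thesis
 proof (rule hinv_of_vertices[OF wf p, of "nm t" "nm \<eta>" "nm \<zeta>"])
  show "D X W 0 (nm t) None = 0" by (simp add: D_None dt td)
  show "(cm (lab W) \<phi> (nm t) - un X - D X X (- 1) (nm \<eta>)) None = 0"
   using \<eta> by (simp add: D_None f_def)
  show "(cm (lab X) (nm t) \<phi> - un W - D W W (- 1) (nm \<zeta>)) None = 0"
   using \<zeta> by (simp add: D_None f_def v_def)
 qed (simp_all add: nm_Tot tH \<eta>H \<zeta>H)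
qed

section \<open>Dimensions and the Euler form\<close>

lemma (in vector_space) inter_span_independent:
 assumes "independent (B \<union> E)" "finite B" "finite E" "B \<inter> E = {}" "x \<in> span B" "x \<in> span E"
 shows "x = 0"
proof -
 obtain u where u: "x = (\<Sum>v\<in>B. scale (u v) v)" using assms span_finite[of B] by auto
 obtain w where w: "x = (\<Sum>v\<in>E. scale (w v) v)" using assms span_finite[of E] by auto
 let ?c = "\<lambda>v. if v \<in> B then u v else - w v"
 have "(\<Sum>v\<in>B \<union> E. scale (?c v) v) = (\<Sum>v\<in>B. scale (?c v) v) + (\<Sum>v\<in>E. scale (?c v) v)"
  using assms by (intro sum.union_disjoint)
 also have "(\<Sum>v\<in>B. scale (?c v) v) = x" by (simp add: u)
 also have "(\<Sum>v\<in>E. scale (?c v) v) = (\<Sum>v\<in>E. - scale (w v) v)"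
  using assms by (intro sum.cong) auto
 also have "\<dots> = - x" by (simp add: w sum_negf)
 finally have "(\<Sum>v\<in>B \<union> E. scale (?c v) v) = 0" by simp
 then have "?c v = 0" if "v \<in> B" for v
  using independentD[OF assms(1), of "B \<union> E" ?c v] assms that by auto
 then have "u v = 0" if "v \<in> B" for v using that by fastforce
 then show ?thesis by (simp add: u)
qed

lemma (in vector_space) dim_less_of_proper:
 assumes V: "subspace V" "V \<subseteq> W" "W \<subseteq> span F" "finite F" "z \<in> W" "z \<notin> V"
 shows "dim V < dim W"
proof -
 obtain B where B: "B \<subseteq> V" "independent B" "V \<subseteq> span B" by (rule maximal_independent_subset)
 have sB: "span B = V" using B V(1) span_minimal by blast
 have ins: "insert z B \<subseteq> W" "independent (insert z B)"
  using B(1) V(2,5) independent_insertI[of z B] B(2) V(6) sB by auto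
 obtain C where C: "insert z B \<subseteq> C" "C \<subseteq> W" "independent C" "W \<subseteq> span C"
  by (rule maximal_independent_subset_extend[OF ins])
 have fC: "finite C" using independent_span_bound[OF V(4) C(3)] C V by blast
 have "z \<notin> B" using sB V(6) span_base by blast
 then have "card B < card C" using C(1) fC by (intro psubset_card_mono) auto
 then show ?thesis using basis_card_eq_dim[OF B(1,3,2)] basis_card_eq_dim[OF C(2,4,3)] by simp
qed

lemma (in vector_space) dim_Suc_of_one:
 assumes V: "subspace V" "V \<subseteq> W" "W \<subseteq> span F" "finite F" "z \<in> W" "z \<notin> V"
  and one: "\<And>w. w \<in> W ==> \<exists>c. w - scale c z \<in> V"
 shows "dim W = Suc (dim V)"
proof -
 obtain B where B: "B \<subseteq> V" "independent B" "V \<subseteq> span B" by (rule maximal_independent_subset)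
 have sB: "span B = V" using B V(1) span_minimal by blast
 have i: "independent (insert z B)" using B V(6) sB by (intro independent_insertI) auto
 have s: "insert z B \<subseteq> W" using B V by auto
 have "w \<in> span (insert z B)" if w: "w \<in> W" for w
 proof -
  obtain c where "w - scale c z \<in> span B" using one[OF w] sB by auto
  then have "w - scale c z \<in> span (insert z B)" using span_mono[of B "insert z B"] by auto
  then have "(w - scale c z) + scale c z \<in> span (insert z B)"
   by (rule span_add) (intro span_scale span_base insertI1)
  then show ?thesis by simp
 qed
 then have "card (insert z B) = dim W" by (intro basis_card_eq_dim[OF s _ i]) auto
 moreover have "z \<notin> B" using sB V(6) span_base by blast
 moreover have "finite B" using independent_span_bound[OF V(4) B(2)] B(1) V by blast
 ultimately show ?thesis using basis_card_eq_dim[OF B(1,3,2)] by simp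
qed

text \<open>The space of all cochains may be infinite-dimensional, so finiteness enters through a
  finite set whose span contains the subspace.\<close>

lemma (in vector_space_pair) rank_nullity:
 assumes lf: "Vector_Spaces.linear s1 s2 f" and V: "vs1.subspace V" "V \<subseteq> vs1.span F" "finite F"
 shows "vs1.dim V = vs1.dim {v\<in>V. f v = 0} + vs2.dim (f ` V)"
proof -
 let ?K = "{v\<in>V. f v = 0}"
 have hom: "module_hom s1 s2 f" using lf by (simp add: Vector_Spaces.linear_def)
 obtain B where B: "B \<subseteq> ?K" "vs1.independent B" "?K \<subseteq> vs1.span B"
  by (rule vs1.maximal_independent_subset)
 have BV: "B \<subseteq> V" using B(1) by auto
 obtain C where C: "B \<subseteq> C" "C \<subseteq> V" "vs1.independent C" "V \<subseteq> vs1.span C"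
  by (rule vs1.maximal_independent_subset_extend[OF BV B(2)])
 have fC: "finite C" using vs1.independent_span_bound[OF V(3) C(3) order_trans[OF C(2) V(2)]] by simp
 have fB: "finite B" using finite_subset[OF C(1) fC] .
 have VC: "V = vs1.span C" using C(4) vs1.span_minimal[OF C(2) V(1)] by (rule equalityI)
 define E where "E = C - B"
 have E: "vs1.independent E" "finite E" using vs1.independent_mono[OF C(3), of E] fC by (auto simp: E_def)
 have CE: "C = B \<union> E" "B \<inter> E = {}" using C by (auto simp: E_def)
 have inj: "inj_on f (vs1.span E)"
  unfolding linear_inj_on_iff_eq_0[OF lf vs1.subspace_span]
 proof (intro ballI impI)
  fix x assume x: "x \<in> vs1.span E" "f x = 0"
  then have "x \<in> V" using VC vs1.span_mono[of E C] CE by auto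
  then have "x \<in> vs1.span B" using x B by auto
  then show "x = 0" using vs1.inter_span_independent[of B E x] x C(3) CE fB E by auto
 qed
 have ind: "vs2.independent (f ` E)" by (rule linear_independent_injective_image[OF lf E(1) inj])
 have "f ` V = vs2.span (f ` C)" unfolding VC by (rule linear_span_image[OF lf, symmetric])
 also have "\<dots> \<subseteq> vs2.span (f ` E)"
 proof (rule vs2.span_minimal)
  show "f ` C \<subseteq> vs2.span (f ` E)"
  proof (rule image_subsetI)
   fix x assume "x \<in> C"
   then have "f x = 0 \<or> x \<in> E" using B(1) by (auto simp: E_def)
   then show "f x \<in> vs2.span (f ` E)" by (auto intro: vs2.span_base vs2.span_zero)
  qed
 qed (rule vs2.subspace_span)
 finally have sp: "f ` V \<subseteq> vs2.span (f ` E)" .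
 have "f ` E \<subseteq> f ` V" using CE C by auto
 then have "vs2.dim (f ` V) = card (f ` E)" using vs2.basis_card_eq_dim[OF _ sp ind] by simp
 also have "\<dots> = card E" using inj vs1.span_superset by (intro card_image inj_on_subset[OF inj]) auto
 finally have "vs2.dim (f ` V) = card E" .
 moreover have "vs1.dim V = card C" using vs1.basis_card_eq_dim[OF C(2,4,3)] by simp
 moreover have "vs1.dim ?K = card B" using vs1.basis_card_eq_dim[OF B(1,3,2)] by simp
 moreover have "card C = card B + card E" using CE fB E by (simp add: card_Un_disjoint)
 ultimately show ?thesis by simp
qed

lemma sc_add_left: "sc (a + b) f = sc a f + sc b f"
 by (intro ext) (simp add: sc_def distrib_right)

interpretation cs: vector_space "sc :: 'k::field => ('c, 'b, 'e, 'k) cochn => _"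
 by unfold_locales (simp_all only: sc_add sc_add_left sc_sc sc_one)

interpretation cs_pair: vector_space_pair "sc :: 'k::field => ('c, 'b, 'e, 'k) cochn => _" "sc :: 'k::field => ('c, 'b, 'e, 'k) cochn => _" ..

lemma D_is_linear: "Vector_Spaces.linear sc sc (D X Y i :: ('c, 'b, 'e, 'k::field) cochn => _)"
 unfolding Vector_Spaces.linear_def module_hom_iff
 by (simp add: cs.module_axioms cs.vector_space_axioms D_linear(1,5))

lemma Tot_subspace: "cs.subspace (Tot Q X Y i :: ('c, 'b, 'e, 'k::field) cochn set)"
 and Z_subspace: "cs.subspace (Z Q X Y i :: ('c, 'b, 'e, 'k::field) cochn set)"
 and Bd_subspace: "cs.subspace (Bd Q X Y i :: ('c, 'b, 'e, 'k::field) cochn set)"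
 by (simp_all add: cs.subspace_def Tot_zero Tot_add Tot_sc Z_zero Z_add Z_sc Bd_zero Bd_add Bd_sc)

section \<open>Counting positions: the Euler characteristic of the cochain complexes\<close>

definition pos :: "('v, 'e) pre_digraph => ('b, 'v, 'e, 'k) qcx => ('c, 'v, 'e, 'k) qcx => int => ('e option \<times> 'c \<times> 'b) set"
 where "pos Q X Y i = {(p, y, x). allowed Q X Y i p y x}"

definition mun :: "'e option \<times> 'c \<times> 'b => ('c, 'b, 'e, 'k::comm_ring_1) cochn" where
 "mun t = (\<lambda>p y x. if t = (p, y, x) then 1 else 0)"

lemma finite_pos:
 assumes "wfc Q X" "wfc Q Y" "finite (arcs Q)"
 shows "finite (pos Q X Y i)"
proof (rule finite_subset)
 show "pos Q X Y i \<subseteq> insert None (Some ` arcs Q) \<times> lab Y \<times> lab X"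
  by (auto simp: pos_def allowed_def split: option.splits)
 show "finite (insert None (Some ` arcs Q) \<times> lab Y \<times> lab X)"
  using wfc_simps(1)[OF assms(1)] wfc_simps(1)[OF assms(2)] assms(3) by auto
qed

lemma Tot_basis:
 fixes X :: "('b, 'v, 'e, 'k::field) qcx" and Y :: "('c, 'v, 'e, 'k) qcx"
 assumes wf: "wfc Q X" "wfc Q Y" "finite (arcs Q)"
 shows "Tot Q X Y i \<subseteq> cs.span (mun ` pos Q X Y i)" and "cs.dim (Tot Q X Y i) = card (pos Q X Y i)"
proof -
 let ?S = "pos Q X Y i" and ?m = "mun :: _ => ('c, 'b, 'e, 'k) cochn"
 have fS: "finite ?S" using finite_pos[OF assms] .
 have comb: "(\<Sum>t\<in>?S. sc (c t) (?m t)) p y x = (if (p, y, x) \<in> ?S then c (p, y, x) else 0)" for c p y x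
 proof -
  have "(\<Sum>t\<in>?S. sc (c t) (?m t)) p y x = (\<Sum>t\<in>?S. sc (c t) (?m t) p y x)"
   by (simp add: fun_sum_apply)
  also have "\<dots> = (\<Sum>t\<in>?S. if t = (p, y, x) then c t else 0)"
   by (intro sum.cong) (auto simp: sc_def mun_def)
  finally show ?thesis using fS by (simp add: sum.delta)
 qed
 have inj: "inj ?m" 
 proof (rule injI)
  fix s t :: "'e option \<times> 'c \<times> 'b"
  assume e: "?m s = ?m t"
  obtain p y x where t: "t = (p, y, x)" by (cases t)
  have "?m s p y x = ?m t p y x" by (simp only: e)
  also have "\<dots> = 1" by (simp add: mun_def t)
  finally have "?m s p y x = 1" .
  then show "s = t" unfolding mun_def t by (auto split: if_splits)
 qed
 have "\<phi> \<in> cs.span (?m ` ?S)" if "\<phi> \<in> Tot Q X Y i" for \<phi>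
 proof -
  have "\<phi> = (\<Sum>t\<in>?S. sc ((\<lambda>(p, y, x). \<phi> p y x) t) (?m t))"
  proof (intro ext)
   fix p y x
   show "\<phi> p y x = (\<Sum>t\<in>?S. sc ((\<lambda>(p, y, x). \<phi> p y x) t) (?m t)) p y x"
    unfolding comb using that by (auto simp: pos_def Tot_def)
  qed
  also have "\<dots> \<in> cs.span (?m ` ?S)" by (intro cs.span_sum cs.span_scale cs.span_base) auto
  finally show ?thesis .
 qed
 then show sp: "Tot Q X Y i \<subseteq> cs.span (?m ` ?S)" by (rule subsetI)
 have "cs.independent (?m ` ?S)"
 proof (rule cs.independent_if_scalars_zero)
  fix f w assume "(\<Sum>w\<in>?m ` ?S. sc (f w) w) = 0" "w \<in> ?m ` ?S"
  then have s: "(\<Sum>t\<in>?S. sc (f (?m t)) (?m t)) = 0"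
   by (subst (asm) sum.reindex) (simp_all add: inj_on_subset[OF inj])
  obtain p y x where t: "(p, y, x) \<in> ?S" "w = ?m (p, y, x)" using \<open>w \<in> _\<close> by auto
  have "(\<Sum>t\<in>?S. sc (f (?m t)) (?m t)) p y x = 0" unfolding s by simp
  then show "f w = 0" unfolding comb using t by simp
 qed (use fS in auto)
 moreover have "?m ` ?S \<subseteq> Tot Q X Y i" by (auto simp: Tot_def mun_def pos_def split: if_splits)
 ultimately have "card (?m ` ?S) = cs.dim (Tot Q X Y i)" by (intro cs.basis_card_eq_dim sp)
 then show "cs.dim (Tot Q X Y i) = card ?S" using inj by (simp add: card_image inj_on_subset)
qed

text \<open>The class in the Grothendieck group: the alternating sum over all degrees of the
  dimension vectors.\<close>

definition Kc :: "('b, 'v, 'e, 'k) qcx => 'v => int" where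
 "Kc X v = (\<Sum>x\<in>{x\<in>lab X. vx X x = v}. sg (dg X x))"

text \<open>Ringel's formula for the homological Euler form in terms of dimension vectors.\<close>

definition chi :: "('v, 'e) pre_digraph => ('v => int) => ('v => int) => int" where
 "chi Q a b = (\<Sum>v\<in>verts Q. a v * b v) - (\<Sum>e\<in>arcs Q. a (tail Q e) * b (head Q e))"

text \<open>The sign of a position at a vertex is the product of the signs of its two labels. A
  position at an arrow has degree one higher for the same labels and counts with the opposite sign,
  which produces the two sums of the Euler form.\<close>

lemma sum_pos_chi:
 fixes X :: "('b, 'v, 'e, 'k::field) qcx" and Y :: "('c, 'v, 'e, 'k) qcx"
 assumes wf: "wfc Q X" "wfc Q Y" "finite (arcs Q)" "finite (verts Q)"
 shows "\<exists>N\<ge>1. (\<forall>i. i \<notin> {- N..N} --> pos Q X Y i = {}) \<and>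
  (\<Sum>i\<in>{- N..N}. sg i * int (card (pos Q X Y i))) = chi Q (Kc X) (Kc Y)"
proof -
 note fin = wfc_simps(1)[OF wf(1)] wfc_simps(1)[OF wf(2)]
 have vX: "vx X x \<in> verts Q" if "x \<in> lab X" for x using wf that by (auto simp: wfc_def)
 \<comment> \<open>\<open>U\<close> collects the positions of all degrees at once and
   \<open>dt\<close> is the degree of a position.\<close>
 define ok where "ok = (\<lambda>(p, y, x). case p of None => vx Y y = vx X x | Some e => tail Q e = vx X x \<and> head Q e = vx Y y)"
 define U where "U = {t \<in> insert None (Some ` arcs Q) \<times> lab Y \<times> lab X. ok t}"
 define dt where "dt = (\<lambda>(p :: 'e option, y, x). dg Y y - dg X x + (if p = None then 0 else 1))"
 have fU: "finite U" using fin wf by (auto simp: U_def)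
 have pos: "pos Q X Y i = {t \<in> U. dt t = i}" for i
  by (auto simp: pos_def allowed_def U_def ok_def dt_def split: option.splits)
 \<comment> \<open>Inserting \<open>1\<close> keeps the degrees zero and one inside the range of
   summation, where later arguments evaluate single terms.\<close>
 define N where "N = Max (insert 1 ((\<lambda>t. \<bar>dt t\<bar>) ` U))"
 have N1: "N \<ge> 1" using fU by (auto simp: N_def)
 have N: "\<bar>dt t\<bar> \<le> N" if "t \<in> U" for t using fU that by (auto simp: N_def)
 have out: "pos Q X Y i = {}" if "i \<notin> {- N..N}" for i
  using N that by (force simp: pos)
 have "(\<Sum>i\<in>{- N..N}. sg i * int (card (pos Q X Y i))) = (\<Sum>i\<in>{- N..N}. \<Sum>t\<in>{t \<in> U. dt t = i}. sg (dt t))"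
  by (intro sum.cong) (auto simp: pos)
 also have "\<dots> = (\<Sum>t\<in>U. sg (dt t))"
 proof (rule sum.group)
  show "dt ` U \<subseteq> {- N..N}"
  proof (rule image_subsetI)
   fix t assume "t \<in> U"
   then show "dt t \<in> {- N..N}" using N[of t] by (simp add: abs_le_iff)
  qed
 qed (use fU in auto)
 also have "\<dots> = (\<Sum>t\<in>insert None (Some ` arcs Q) \<times> lab Y \<times> lab X. if ok t then sg (dt t) else 0)"
  unfolding U_def using fin wf by (intro sum.inter_filter) auto
 also have "\<dots> = (\<Sum>p\<in>insert None (Some ` arcs Q). \<Sum>y\<in>lab Y. \<Sum>x\<in>lab X. if ok (p, y, x) then sg (dt (p, y, x)) else 0)"
  unfolding sum.cartesian_product by (intro sum.cong refl) (auto simp: case_prod_unfold)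
 also have "\<dots> = (\<Sum>y\<in>lab Y. \<Sum>x\<in>lab X. if vx Y y = vx X x then sg (dg X x) * sg (dg Y y) else 0)
   - (\<Sum>e\<in>arcs Q. \<Sum>y\<in>lab Y. \<Sum>x\<in>lab X. if tail Q e = vx X x \<and> head Q e = vx Y y then sg (dg X x) * sg (dg Y y) else 0)"
 proof -
  have s: "sg (dg Y y - dg X x) = sg (dg X x) * (sg (dg Y y) :: int)" for y x
   using sg_add[of "dg Y y" "- dg X x"] by (simp add: mult.commute)
  have n: "(\<Sum>y\<in>lab Y. \<Sum>x\<in>lab X. if ok (Some e, y, x) then sg (dt (Some e, y, x)) else 0) =
    - (\<Sum>y\<in>lab Y. \<Sum>x\<in>lab X. if tail Q e = vx X x \<and> head Q e = vx Y y then sg (dg X x) * sg (dg Y y) else (0::int))" for e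
   unfolding sum_negf[symmetric] by (intro sum.cong refl) (simp add: ok_def dt_def sg_shift s)
  have "(\<Sum>p\<in>insert None (Some ` arcs Q). \<Sum>y\<in>lab Y. \<Sum>x\<in>lab X. if ok (p, y, x) then sg (dt (p, y, x)) else 0)
   = (\<Sum>y\<in>lab Y. \<Sum>x\<in>lab X. if ok (None, y, x) then sg (dt (None, y, x)) else 0)
    + (\<Sum>e\<in>arcs Q. \<Sum>y\<in>lab Y. \<Sum>x\<in>lab X. if ok (Some e, y, x) then sg (dt (Some e, y, x)) else (0::int))"
   using wf(3) by (subst sum.insert) (auto simp: sum.reindex)
  also have "(\<Sum>y\<in>lab Y. \<Sum>x\<in>lab X. if ok (None, y, x) then sg (dt (None, y, x)) else 0) =
    (\<Sum>y\<in>lab Y. \<Sum>x\<in>lab X. if vx Y y = vx X x then sg (dg X x) * sg (dg Y y) else (0::int))"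
   by (intro sum.cong refl) (simp add: ok_def dt_def s)
  finally show ?thesis unfolding n sum_negf by simp
 qed
 also have "(\<Sum>y\<in>lab Y. \<Sum>x\<in>lab X. if vx Y y = vx X x then sg (dg X x) * sg (dg Y y) else 0) = (\<Sum>v\<in>verts Q. Kc X v * Kc Y v)"
 proof -
  have "(\<Sum>v\<in>verts Q. Kc X v * Kc Y v) = (\<Sum>v\<in>verts Q. \<Sum>y\<in>lab Y. \<Sum>x\<in>lab X. if vx X x = v \<and> vx Y y = v then sg (dg X x) * sg (dg Y y) else 0)"
   unfolding Kc_def sum.inter_filter[OF fin(1)] sum.inter_filter[OF fin(2)] sum_product
   by (subst (2) sum.swap) (auto intro!: sum.cong)
  also have "\<dots> = (\<Sum>y\<in>lab Y. \<Sum>x\<in>lab X. \<Sum>v\<in>verts Q. if vx X x = v \<and> vx Y y = v then sg (dg X x) * sg (dg Y y) else 0)"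
   by (subst sum.swap, intro sum.cong refl, subst sum.swap) simp
  also have "\<dots> = (\<Sum>y\<in>lab Y. \<Sum>x\<in>lab X. if vx Y y = vx X x then sg (dg X x) * sg (dg Y y) else 0)"
  proof (intro sum.cong refl)
   fix y x assume "y \<in> lab Y" "x \<in> lab X"
   have "(\<Sum>v\<in>verts Q. if vx X x = v \<and> vx Y y = v then sg (dg X x) * sg (dg Y y) else 0) =
     (\<Sum>v\<in>verts Q. if vx X x = v then if vx Y y = vx X x then sg (dg X x) * sg (dg Y y) else (0::int) else 0)"
    by (intro sum.cong) auto
   then show "(\<Sum>v\<in>verts Q. if vx X x = v \<and> vx Y y = v then sg (dg X x) * sg (dg Y y) else 0) =
     (if vx Y y = vx X x then sg (dg X x) * sg (dg Y y) else (0::int))"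
    using wf(4) vX[OF \<open>x \<in> lab X\<close>] by (simp add: sum.delta')
  qed
  finally show ?thesis ..
 qed
 also have "(\<Sum>e\<in>arcs Q. \<Sum>y\<in>lab Y. \<Sum>x\<in>lab X. if tail Q e = vx X x \<and> head Q e = vx Y y then sg (dg X x) * sg (dg Y y) else 0)
   = (\<Sum>e\<in>arcs Q. Kc X (tail Q e) * Kc Y (head Q e))"
  unfolding Kc_def sum.inter_filter[OF fin(1)] sum.inter_filter[OF fin(2)] sum_product
  by (subst (2) sum.swap) (auto intro!: sum.cong)
 finally show ?thesis using N1 out by (auto simp: chi_def)
qed

text \<open>The Euler-Poincare principle: rank-nullity splits each cochain group into cocycles and
  the coboundaries one degree higher, and the boundary terms at both ends of the range vanish
  because no cochains exist outside it.\<close>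

lemma euler:
 fixes X :: "('b, 'v, 'e, 'k::field) qcx" and Y :: "('c, 'v, 'e, 'k) qcx"
 assumes wf: "wfc Q X" "wfc Q Y" "finite (arcs Q)" "finite (verts Q)"
 shows "\<exists>N\<ge>1. chi Q (Kc X) (Kc Y) =
  (\<Sum>i\<in>{- N..N}. sg i * (int (cs.dim (Z Q X Y i)) - int (cs.dim (Bd Q X Y i))))"
proof -
 obtain N where N: "N \<ge> 1" "\<And>i. i \<notin> {- N..N} ==> pos Q X Y i = {}"
  "(\<Sum>i\<in>{- N..N}. sg i * int (card (pos Q X Y i))) = chi Q (Kc X) (Kc Y)"
  using sum_pos_chi[OF assms] by blast
 let ?z = "\<lambda>i. int (cs.dim (Z Q X Y i))" and ?b = "\<lambda>i. int (cs.dim (Bd Q X Y i))"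
 have rn: "int (card (pos Q X Y i)) = ?z i + ?b (i + 1)" for i
  using cs_pair.rank_nullity[OF D_is_linear[of X Y i] Tot_subspace Tot_basis(1)[OF wf(1-3)] finite_imageI[OF finite_pos[OF wf(1-3)]]]
   Tot_basis(2)[OF wf(1-3), of i]
  by (simp add: Z_def Bd_def)
 have b0: "?b i = 0" if "i \<notin> {- N + 1..N}" for i
 proof -
  have "Bd Q X Y i \<subseteq> {0}"
  proof (cases "i \<le> - N")
   case True
   then have "Tot Q X Y (i - 1) = {0}"
    using N(2)[of "i - 1"] by (auto simp: Tot_def pos_def fun_eq_iff)
   then show ?thesis by (auto simp: Bd_def D_linear)
  next
   case False
   then have "Tot Q X Y i = {0}"
    using that N(2)[of i] by (auto simp: Tot_def pos_def fun_eq_iff)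
   then show ?thesis using Bd_subset_Z[OF wf(1,2), of i] by (auto simp: Z_def)
  qed
  then have "cs.dim (Bd Q X Y i) \<le> card ({} :: ('c, 'b, 'e, 'k) cochn set)"
   by (intro cs.dim_le_card) auto
  then show ?thesis by simp
 qed
 have "chi Q (Kc X) (Kc Y) = (\<Sum>i\<in>{- N..N}. sg i * ?z i) + (\<Sum>i\<in>{- N..N}. sg i * ?b (i + 1))"
  unfolding N(3)[symmetric] rn by (simp add: algebra_simps sum.distrib)
 also have "(\<Sum>i\<in>{- N..N}. sg i * ?b (i + 1)) = (\<Sum>i\<in>{- N + 1..N + 1}. - sg i * ?b i)"
  by (rule sum.reindex_bij_witness[of _ "\<lambda>i. i - 1" "\<lambda>i. i + 1"]) (auto simp: sg_shift)
 also have "\<dots> = (\<Sum>i\<in>{- N + 1..N}. - sg i * ?b i)"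
  using b0 by (intro sum.mono_neutral_right) auto
 also have "\<dots> = (\<Sum>i\<in>{- N..N}. - sg i * ?b i)"
  using b0 by (intro sum.mono_neutral_left) auto
 also have "(\<Sum>i\<in>{- N..N}. sg i * ?z i) + (\<Sum>i\<in>{- N..N}. - sg i * ?b i) = (\<Sum>i\<in>{- N..N}. sg i * (?z i - ?b i))"
  unfolding sum.distrib[symmetric] by (intro sum.cong refl) (simp add: right_diff_distrib)
 finally show ?thesis using N(1) by (intro exI[of _ N] conjI)
qed

lemma chi_zero:
 fixes X :: "('b, 'v, 'e, 'k::field) qcx" and Y :: "('c, 'v, 'e, 'k) qcx"
 assumes wf: "wfc Q X" "wfc Q Y" "finite (arcs Q)" "finite (verts Q)"
  and "\<And>i. Z Q X Y i \<subseteq> Bd Q X Y i"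
 shows "chi Q (Kc X) (Kc Y) = 0"
proof -
 have "Z Q X Y i = Bd Q X Y i" for i using assms(5) Bd_subset_Z[OF wf(1,2)] by blast
 then show ?thesis using euler[OF wf] by auto
qed

text \<open>Only a sign results: the cohomology is concentrated in the odd degree one and is nonzero
  there, but its dimension is unknown.\<close>

lemma chi_neg:
 fixes X :: "('b, 'v, 'e, 'k::field) qcx" and Y :: "('c, 'v, 'e, 'k) qcx"
 assumes wf: "wfc Q X" "wfc Q Y" "finite (arcs Q)" "finite (verts Q)"
  and "\<And>i. i \<noteq> 1 ==> Z Q X Y i \<subseteq> Bd Q X Y i" and "\<not> Z Q X Y 1 \<subseteq> Bd Q X Y 1"
 shows "chi Q (Kc X) (Kc Y) < 0"
proof -
 have eq: "Z Q X Y i = Bd Q X Y i" if "i \<noteq> 1" for i using assms(5)[OF that] Bd_subset_Z[OF wf(1,2)] by blast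
 obtain z where "z \<in> Z Q X Y 1" "z \<notin> Bd Q X Y 1" using assms(6) by blast
 moreover have "Z Q X Y 1 \<subseteq> cs.span (mun ` pos Q X Y 1)"
  using Tot_basis(1)[OF wf(1-3)] by (auto simp: Z_def)
 ultimately have less: "cs.dim (Bd Q X Y 1) < cs.dim (Z Q X Y 1)"
  using cs.dim_less_of_proper[OF Bd_subspace Bd_subset_Z[OF wf(1,2)], of 1 "mun ` pos Q X Y 1" z]
   finite_pos[OF wf(1-3)] by auto
 obtain N where N: "N \<ge> 1" "chi Q (Kc X) (Kc Y) =
  (\<Sum>i\<in>{- N..N}. sg i * (int (cs.dim (Z Q X Y i)) - int (cs.dim (Bd Q X Y i))))"
  using euler[OF wf] by blast
 note N(2)
 also have "(\<Sum>i\<in>{- N..N}. sg i * (int (cs.dim (Z Q X Y i)) - int (cs.dim (Bd Q X Y i)))) =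
   (\<Sum>i\<in>{- N..N}. if i = 1 then sg 1 * (int (cs.dim (Z Q X Y 1)) - int (cs.dim (Bd Q X Y 1))) else 0)"
  by (intro sum.cong) (auto simp: eq)
 also have "\<dots> = int (cs.dim (Bd Q X Y 1)) - int (cs.dim (Z Q X Y 1))"
  using N(1) by (simp add: sum.delta)
 finally show ?thesis using less by simp
qed

text \<open>Such an object is exceptional. The value one is what makes its class a root.\<close>

lemma chi_one:
 fixes X :: "('b, 'v, 'e, 'k::field) qcx"
 assumes wf: "wfc Q X" "finite (arcs Q)" "finite (verts Q)"
  and "\<And>i. i \<noteq> 0 ==> Z Q X X i \<subseteq> Bd Q X X i" and "un X \<notin> Bd Q X X 0"
  and "\<And>\<phi>. \<phi> \<in> Z Q X X 0 ==> \<exists>c. \<phi> - sc c (un X) \<in> Bd Q X X 0"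
 shows "chi Q (Kc X) (Kc X) = 1"
proof -
 have eq: "Z Q X X i = Bd Q X X i" if "i \<noteq> 0" for i using assms(4)[OF that] Bd_subset_Z[OF wf(1,1)] by blast
 have "Z Q X X 0 \<subseteq> cs.span (mun ` pos Q X X 0)"
  using Tot_basis(1)[OF wf(1,1,2)] by (auto simp: Z_def)
 then have d: "cs.dim (Z Q X X 0) = Suc (cs.dim (Bd Q X X 0))"
  using cs.dim_Suc_of_one[OF Bd_subspace Bd_subset_Z[OF wf(1,1)], of 0 "mun ` pos Q X X 0" "un X"]
   finite_pos[OF wf(1,1,2)] un_Z[OF wf(1)] assms(5,6) by auto
 obtain N where N: "N \<ge> 1" "chi Q (Kc X) (Kc X) =
  (\<Sum>i\<in>{- N..N}. sg i * (int (cs.dim (Z Q X X i)) - int (cs.dim (Bd Q X X i))))"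
  using euler[OF wf(1,1,2,3)] by blast
 note N(2)
 also have "(\<Sum>i\<in>{- N..N}. sg i * (int (cs.dim (Z Q X X i)) - int (cs.dim (Bd Q X X i)))) =
   (\<Sum>i\<in>{- N..N}. if i = 0 then sg 0 * (int (cs.dim (Z Q X X 0)) - int (cs.dim (Bd Q X X 0))) else 0)"
  by (intro sum.cong) (auto simp: eq)
 also have "\<dots> = 1" using N(1) by (simp add: sum.delta d)
 finally show ?thesis .
qed

section \<open>Endomorphism rings over an algebraically closed field\<close>

text \<open>The value of a polynomial at an endomorphism cochain, by Horner's scheme.\<close>

definition pe :: "('b, 'v, 'e, 'k::field) qcx => ('b, 'b, 'e, 'k) cochn => 'k poly => ('b, 'b, 'e, 'k) cochn" where
 "pe X \<phi> p = fold_coeffs (\<lambda>a f. sc a (un X) + cm (lab X) \<phi> f) p 0"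

lemma sc_0 [simp]: "sc 0 f = 0"
 by (auto simp: sc_def fun_eq_iff)

lemma pe_0 [simp]: "pe X \<phi> 0 = 0"
 by (simp add: pe_def)

lemma pe_pCons: "pe X \<phi> (pCons a p) = sc a (un X) + cm (lab X) \<phi> (pe X \<phi> p)"
 by (cases "p = 0"; cases "a = 0") (simp_all add: pe_def cm_linear)

lemma pe_add: "pe X \<phi> (p + q) = pe X \<phi> p + pe X \<phi> q"
proof (induction p q rule: poly_induct2)
 case (pCons a p b q)
 show ?case
  unfolding add_pCons pe_pCons pCons sc_add_left cm_linear by (simp only: add_ac)
qed simp

lemma pe_smult: "pe X \<phi> (Polynomial.smult c p) = sc c (pe X \<phi> p)"
proof (induction p)
 case (pCons a p)
 show ?case
  unfolding smult_pCons pe_pCons pCons sc_add sc_sc cm_linear ..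
qed (simp only: smult_0_right pe_0 sc_zero)

lemma pe_sum: "pe X \<phi> (\<Sum>i\<in>A. f i) = (\<Sum>i\<in>A. pe X \<phi> (f i))"
 by (induction A rule: infinite_finite_induct) (simp_all add: pe_add)

lemma pe_Z: "wfc Q X ==> \<phi> \<in> Z Q X X 0 ==> pe X \<phi> p \<in> Z Q X X 0"
 by (induction p) (auto simp: pe_pCons intro: Z_zero Z_add Z_sc un_Z Z0_cm)

lemma pe_root: "wfc Q X ==> \<phi> \<in> Z Q X X 0 ==> pe X \<phi> ([:- r, 1:] * q) = cm (lab X) (\<phi> - sc r (un X)) (pe X \<phi> q)"
proof -
 assume a: "wfc Q X" "\<phi> \<in> Z Q X X 0"
 have e: "[:- r, 1:] * q = Polynomial.smult (- r) q + pCons 0 q" by simp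
 show ?thesis
  using Z_wf_un(1)[OF a(1) pe_Z[OF a]] unfolding e pe_add pe_smult pe_pCons by (simp add: cm_linear sc_neg)
qed

text \<open>The powers of \<open>\<phi>\<close> lie in a finite-dimensional space. If no polynomial
  annihilated \<open>\<phi>\<close>, then more of them would be linearly independent than a spanning
  set has elements.\<close>

lemma pe_annihilated:
 fixes X :: "('b, 'v, 'e, 'k::field) qcx"
 assumes wf: "wfc Q X" "finite (arcs Q)" and p: "\<phi> \<in> Z Q X X 0"
 shows "\<exists>p. p \<noteq> 0 \<and> pe X \<phi> p = 0"
proof (rule ccontr)
 assume "\<not> ?thesis"
 then have nz: "pe X \<phi> p = 0 ==> p = 0" for p by blast
 define m where "m i = pe X \<phi> (monom 1 i)" for i
 let ?F = "mun ` pos Q X X 0 :: ('b, 'b, 'e, 'k) cochn set"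
 have F: "finite ?F" "Z Q X X 0 \<subseteq> cs.span ?F"
  using Tot_basis(1)[OF wf(1,1,2)] finite_pos[OF wf(1,1,2)] by (auto simp: Z_def)
 have inj: "inj m"
 proof (rule injI)
  fix i j assume "m i = m j"
  moreover have "pe X \<phi> (monom 1 i + Polynomial.smult (- 1) (monom 1 j)) = m i - m j"
   unfolding pe_add pe_smult m_def by (simp add: sc_neg sc_one)
  ultimately have "monom 1 i + Polynomial.smult (- 1) (monom 1 j) = (0 :: 'k poly)" by (intro nz) simp
  then have "monom (1::'k) i = monom 1 j" by simp
  then show "i = j" by (metis degree_monom_eq zero_neq_one)
 qed
 let ?A = "m ` {..card ?F}"
 have "cs.independent ?A"
 proof (rule cs.independent_if_scalars_zero)
  fix f w assume s: "(\<Sum>w\<in>?A. sc (f w) w) = 0" and w: "w \<in> ?A"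
  have "(\<Sum>w\<in>?A. sc (f w) w) = (\<Sum>i\<in>{..card ?F}. sc (f (m i)) (m i))"
   using inj by (subst sum.reindex) (auto intro: inj_on_subset)
  also have "\<dots> = pe X \<phi> (\<Sum>i\<in>{..card ?F}. Polynomial.smult (f (m i)) (monom 1 i))"
   by (simp add: pe_sum pe_smult m_def del: smult_monom)
  finally have "(\<Sum>i\<in>{..card ?F}. Polynomial.smult (f (m i)) (monom 1 i)) = 0" using s by (intro nz) simp
  then have c0: "coeff (\<Sum>i\<in>{..card ?F}. Polynomial.smult (f (m i)) (monom 1 i)) j = 0" for j by simp
  obtain j where j: "j \<le> card ?F" "w = m j" using w by auto
  have "coeff (\<Sum>i\<in>{..card ?F}. Polynomial.smult (f (m i)) (monom 1 i)) j = (\<Sum>i\<in>{..card ?F}. if i = j then f (m i) else 0)"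
   unfolding coeff_sum by (intro sum.cong refl) simp
  then show "f w = 0" using c0[of j] j by (simp add: sum.delta)
 qed auto
 moreover have "?A \<subseteq> cs.span ?F" using F(2) pe_Z[OF wf(1) p] by (auto simp: m_def)
 ultimately have "card ?A \<le> card ?F" using cs.independent_span_bound[OF F(1)] by blast
 moreover have "card ?A = Suc (card ?F)" using inj by (subst card_image) (auto intro: inj_on_subset)
 ultimately show False by simp
qed

text \<open>A form of Schur's lemma, by induction on the degree of a polynomial that sends
  \<open>\<phi>\<close> to a coboundary. Such a polynomial has a root \<open>r\<close>; either
  \<open>\<phi> - r\<close> is a coboundary, or it is invertible and can be cancelled. A nonzero
  constant would make the identity a coboundary.\<close>

lemma division_end_scalar:
 fixes X :: "('b, 'v, 'e, 'k::alg_closed_field) qcx"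
 assumes wf: "wfc Q X" "finite (arcs Q)" and p: "\<phi> \<in> Z Q X X 0" and nb: "un X \<notin> Bd Q X X 0"
  and div: "\<And>\<psi>. \<psi> \<in> Z Q X X 0 ==> \<psi> \<in> Bd Q X X 0 \<or> hinv Q X X \<psi>"
 shows "\<exists>c. \<phi> - sc c (un X) \<in> Bd Q X X 0"
proof -
 have "p \<noteq> 0 ==> pe X \<phi> p \<in> Bd Q X X 0 ==> ?thesis" for p
 proof (induction "degree p" arbitrary: p rule: less_induct)
  case less
  show ?case
  proof (cases "degree p = 0")
   case True
   then obtain a where a: "p = [:a:]" "a \<noteq> 0" using less(2) by (metis degree_eq_zeroE pCons_0_0)
   then have "sc (inverse a) (pe X \<phi> p) \<in> Bd Q X X 0" using less(3) by (intro Bd_sc)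
   then have "un X \<in> Bd Q X X 0" using a by (simp add: pe_pCons cm_linear sc_linear)
   then show ?thesis using nb by blast
  next
   case False
   then obtain r where "poly p r = 0" using alg_closed_imp_poly_has_root[of p] by auto
   then obtain q where q: "p = [:- r, 1:] * q" by (metis dvdE poly_eq_0_iff_dvd)
   then have q0: "q \<noteq> 0" using less(2) by auto
   have dq: "degree q < degree p" using q0 unfolding q by (subst degree_mult_eq) auto
   have s: "\<phi> - sc r (un X) \<in> Z Q X X 0" using p wf by (intro Z_diff Z_sc un_Z)
   show ?thesis
   proof (cases "\<phi> - sc r (un X) \<in> Bd Q X X 0")
    case False
    then have "hinv Q X X (\<phi> - sc r (un X))" using div[OF s] by blast
    then have "pe X \<phi> q \<in> Bd Q X X 0"
     using less(3) pe_root[OF wf(1) p, of r q] by (intro hinv_cancel_left[OF wf(1,1) _ pe_Z[OF wf(1) p]]) (auto simp: q)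
    then show ?thesis using less(1)[OF dq q0] by blast
   qed auto
  qed
 qed
 then show ?thesis using pe_annihilated[OF wf p] Bd_zero by metis
qed

section \<open>The standard resolution\<close>

text \<open>Finitely many paths mean a finite-dimensional path algebra, so the resolution below has
  finitely many labels and all sums over paths are finite.\<close>

locale fin_quiver = wf_digraph Q for Q :: "('v, 'e) pre_digraph" +
 assumes fin_verts: "finite (verts Q)" and fin_arcs: "finite (arcs Q)"
  and fin_paths: "finite (quiver_paths Q)"
begin

lemma awlast_Nil [simp]: "awlast u [] = u"
 and awlast_Cons [simp]: "awlast u (e # p) = awlast (head Q e) p"
 by (simp_all add: awalk_verts.simps awalk_verts_non_Nil)

lemma path_Nil [simp]: "(u, []) \<in> quiver_paths Q \<longleftrightarrow> u \<in> verts Q"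
 by (auto simp: quiver_paths_def awalk_def cas.simps)

lemma path_Cons: "(u, e # p) \<in> quiver_paths Q \<longleftrightarrow> e \<in> arcs Q \<and> tail Q e = u \<and> (head Q e, p) \<in> quiver_paths Q"
 by (auto simp: quiver_paths_def awalk_Cons_iff)

lemma path_snoc: "(u, p @ [e]) \<in> quiver_paths Q \<longleftrightarrow> (u, p) \<in> quiver_paths Q \<and> e \<in> arcs Q \<and> tail Q e = awlast u p"
 by (induction p arbitrary: u) (auto simp: path_Cons)

lemma awlast_snoc [simp]: "awlast u (p @ [e]) = head Q e"
 by (induction p arbitrary: u) auto

lemma awlast_path_verts: "(u, p) \<in> quiver_paths Q ==> awlast u p \<in> verts Q"
 by (induction p arbitrary: u) (auto simp: path_Cons)

primrec pm :: "('b, 'v, 'e, 'k::comm_ring_1) qcx => 'e list => 'b => 'b => 'k" where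
 "pm X [] = un X None"
| "pm X (e # p) = mm (lab X) (pm X p) (aa X e)"

end

text \<open>Graded maps of representations, which are the matrices of actual module homomorphisms.
  Nothing is asked about the differential, so that chain maps and homotopies are both
  covered.\<close>

definition ST :: "('b, 'v, 'e, 'k) qcx => ('c, 'v, 'e, 'k) qcx => int => ('c => 'b => 'k::comm_ring_1) set" where
 "ST X Y i = {M \<in> HM X Y i. \<forall>e. mm (lab Y) (aa Y e) M = mm (lab X) M (aa X e)}"

lemma sg_nonzero [simp]: "sg i \<noteq> (0 :: 'k::comm_ring_1)"
 by (simp add: sg_def)

lemma sg_mult_eq_0 [simp]: "sg i * a = 0 \<longleftrightarrow> a = (0 :: 'k::comm_ring_1)"
 by (simp add: sg_def)

lemma wfc_aa:
 assumes "wfc Q C" "aa C e y x \<noteq> 0"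
 shows "y \<in> lab C" "x \<in> lab C" "e \<in> arcs Q" "tail Q e = vx C x" "head Q e = vx C y" "dg C y = dg C x"
proof -
 have "dl C (Some e) y x \<noteq> 0" using assms(2) by simp
 then have "allowed Q C C 1 (Some e) y x" using wfc_simps(2)[OF assms(1)] by (auto simp: Tot_def)
 then show "y \<in> lab C" "x \<in> lab C" "e \<in> arcs Q" "tail Q e = vx C x" "head Q e = vx C y" "dg C y = dg C x"
  by (auto simp: allowed_def)
qed

lemma wfc_dd_simps:
 assumes "wfc Q C" "dd C y x \<noteq> 0"
 shows "y \<in> lab C" "x \<in> lab C" "vx C y = vx C x" "dg C y = dg C x + 1"
 using wfc_dd(1)[OF assms(1)] assms(2) by (auto simp: HM_def)

lemma wfc_comm:
 assumes wf: "wfc Q C"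
 shows "mm (lab C) (dd C) (aa C e) = mm (lab C) (aa C e) (dd C)"
proof (intro ext)
 fix z x
 have "cm (lab C) (dl C) (dl C) (Some e) z x = 0" using wfc_simps(3)[OF wf] by simp
 then have "(\<Sum>y\<in>lab C. sg (dg C y) * aa C e z y * dd C y x) + (\<Sum>y\<in>lab C. dd C z y * (sg (dg C x) * aa C e y x)) = 0"
  by (simp add: mm_def)
 moreover have "(\<Sum>y\<in>lab C. sg (dg C y) * aa C e z y * dd C y x) = (\<Sum>y\<in>lab C. - (sg (dg C x) * (aa C e z y * dd C y x)))"
 proof (intro sum.cong refl)
  fix y
  show "sg (dg C y) * aa C e z y * dd C y x = - (sg (dg C x) * (aa C e z y * dd C y x))"
   using wfc_dd_simps(4)[OF wf, of y x] by (cases "dd C y x = 0") (auto simp: sg_shift mult.assoc)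
 qed
 moreover have "(\<Sum>y\<in>lab C. dd C z y * (sg (dg C x) * aa C e y x)) = (\<Sum>y\<in>lab C. sg (dg C x) * (dd C z y * aa C e y x))"
  by (intro sum.cong refl) (rule mult.left_commute)
 ultimately have "sg (dg C x) * (mm (lab C) (dd C) (aa C e) z x - mm (lab C) (aa C e) (dd C) z x) = 0"
  by (simp add: mm_def sum_distrib_left sum_negf right_diff_distrib)
 then show "mm (lab C) (dd C) (aa C e) z x = mm (lab C) (aa C e) (dd C) z x" by simp
qed

lemma wfcI:
 assumes fin: "finite (lab C)" and vx: "\<And>x. x \<in> lab C ==> vx C x \<in> verts Q"
  and dd: "dd C \<in> HM C C 1" "mm (lab C) (dd C) (dd C) = 0"
  and aa: "\<And>e y x. aa C e y x \<noteq> 0 ==> y \<in> lab C \<and> x \<in> lab C \<and> e \<in> arcs Q \<and> tail Q e = vx C x \<and> head Q e = vx C y \<and> dg C y = dg C x"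
  and comm: "\<And>e. mm (lab C) (dd C) (aa C e) = mm (lab C) (aa C e) (dd C)"
 shows "wfc Q C"
proof -
 have "dl C \<in> Tot Q C C 1"
  unfolding Tot_def allowed_def using dd(1) aa by (auto simp: HM_def split: option.splits)
 moreover have "cm (lab C) (dl C) (dl C) = 0"
 proof (rule cochn_eqI)
  fix e
  show "cm (lab C) (dl C) (dl C) (Some e) = (0 :: _ => _) (Some e)"
  proof (intro ext)
   fix z x
   have "(\<Sum>y\<in>lab C. sg (dg C y) * aa C e z y * dd C y x) = (\<Sum>y\<in>lab C. - (sg (dg C x) * (aa C e z y * dd C y x)))"
   proof (intro sum.cong refl)
    fix y
    have "dg C y = dg C x + 1" if "dd C y x \<noteq> 0" using dd(1) that by (auto simp: HM_def)
    then show "sg (dg C y) * aa C e z y * dd C y x = - (sg (dg C x) * (aa C e z y * dd C y x))"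
     by (cases "dd C y x = 0") (auto simp: sg_shift mult.assoc)
   qed
   moreover have "(\<Sum>y\<in>lab C. dd C z y * (sg (dg C x) * aa C e y x)) = (\<Sum>y\<in>lab C. sg (dg C x) * (dd C z y * aa C e y x))"
    by (intro sum.cong refl) (rule mult.left_commute)
   ultimately have "cm (lab C) (dl C) (dl C) (Some e) z x =
     sg (dg C x) * (mm (lab C) (dd C) (aa C e) z x - mm (lab C) (aa C e) (dd C) z x)"
    by (simp add: mm_def sum_distrib_left sum_negf right_diff_distrib)
   then show "cm (lab C) (dl C) (dl C) (Some e) z x = (0 :: _ => _ => _ => _) (Some e) z x" by (simp add: comm)
  qed
 qed (simp add: dd(2))
 ultimately show ?thesis using fin vx by (simp add: wfc_def)
qed

text \<open>By the sign in \<open>dl\<close>, the graded commutator at an arrow is, up to a sign,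
  the plain commutator with the matrix of the arrow, and this vanishes for a strict matrix.\<close>

lemma ST_D:
 assumes M: "M \<in> ST X Y i"
 shows "D X Y i (nm M) = nm (D X Y i (nm M) None)"
proof (rule cochn_eqI)
 fix e
 have e: "mm (lab Y) (aa Y e) M = mm (lab X) M (aa X e)" and h: "M \<in> HM X Y i" using M by (auto simp: ST_def)
 show "D X Y i (nm M) (Some e) = nm (D X Y i (nm M) None) (Some e)"
 proof (intro ext)
  fix z x
  have 1: "sg (dg Y y) * aa Y e z y * M y x = sg i * sg (dg X x) * (aa Y e z y * M y x)" for y
  proof (cases "M y x = 0")
   case False
   then have "dg Y y = dg X x + i" using h by (auto simp: HM_def)
   then show ?thesis by (simp add: sg_add mult_ac)
  qed simp
  have "(\<Sum>y\<in>lab Y. sg (dg Y y) * aa Y e z y * M y x) = sg i * sg (dg X x) * mm (lab Y) (aa Y e) M z x"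
   by (simp only: 1 mm_def sum_distrib_left)
  moreover have "(\<Sum>y\<in>lab X. M z y * (sg (dg X x) * aa X e y x)) = sg (dg X x) * mm (lab X) M (aa X e) z x"
   unfolding mm_def sum_distrib_left by (intro sum.cong refl) (rule mult.left_commute)
  ultimately have "D X Y i (nm M) (Some e) z x = sg i * sg (dg X x) * (mm (lab Y) (aa Y e) M z x - mm (lab X) M (aa X e) z x)"
   unfolding D_def by (simp add: sc_def mm_def[of _ "dl Y (Some e)"] mm_def[of _ M "dl X (Some e)"] mm_linear right_diff_distrib mult.assoc)
  then show "D X Y i (nm M) (Some e) z x = nm (D X Y i (nm M) None) (Some e) z x" by (simp add: e)
 qed
qed simp

lemma ST_Z0: "M \<in> ST X Y 0 ==> nm M \<in> Z Q X Y 0 \<longleftrightarrow> mm (lab Y) (dd Y) M = mm (lab X) M (dd X)"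
proof -
 assume M: "M \<in> ST X Y 0"
 have D: "D X Y 0 (nm M) = nm (mm (lab Y) (dd Y) M - mm (lab X) M (dd X))"
  using ST_D[OF M] by (simp add: D_None)
 have "D X Y 0 (nm M) = 0 \<longleftrightarrow> mm (lab Y) (dd Y) M = mm (lab X) M (dd X)"
 proof
  assume "D X Y 0 (nm M) = 0"
  then have "D X Y 0 (nm M) None = 0" by simp
  then show "mm (lab Y) (dd Y) M = mm (lab X) M (dd X)" unfolding D nm_simps by (rule eq_iff_diff_eq_0[THEN iffD2])
 next
  assume "mm (lab Y) (dd Y) M = mm (lab X) M (dd X)"
  then show "D X Y 0 (nm M) = 0" unfolding D by (simp only: diff_self nm_zero)
 qed
 then show ?thesis using M unfolding Z_def by (simp only: mem_Collect_eq nm_Tot ST_def simp_thms)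
qed

context fin_quiver
begin

lemma pm_nonzero:
 assumes wf: "wfc Q X" and nz: "pm X p y x \<noteq> 0"
 shows "y \<in> lab X \<and> x \<in> lab X \<and> dg X y = dg X x \<and> (vx X x, p) \<in> quiver_paths Q \<and> vx X y = awlast (vx X x) p"
 using nz
proof (induction p arbitrary: x)
 case Nil
 then show ?case using wf by (auto simp: un_def wfc_def split: if_splits)
next
 case (Cons e p)
 then obtain z where z: "pm X p y z \<noteq> 0" "aa X e z x \<noteq> 0"
  using mm_nonzero[of "lab X" "pm X p" "aa X e" y x] by auto
 then show ?case using Cons.IH[OF z(1)] wfc_aa[OF wf z(2)] by (auto simp: path_Cons)
qed

lemma aa_un:
 assumes wf: "wfc Q X"
 shows "mm (lab X) (un X None) (aa X e) = aa X e" "mm (lab X) (aa X e) (un X None) = aa X e"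
proof -
 have "(\<Sum>y\<in>lab X. un X None z y * aa X e y x) = (\<Sum>y\<in>lab X. if z = y then aa X e z x else 0)" for z x
  by (intro sum.cong) (auto simp: un_def)
 then show "mm (lab X) (un X None) (aa X e) = aa X e"
  using wfc_simps(1)[OF wf] wfc_aa(1)[OF wf] by (fastforce simp: mm_def fun_eq_iff sum.delta')
 have "(\<Sum>y\<in>lab X. aa X e z y * un X None y x) = (\<Sum>y\<in>lab X. if y = x then aa X e z x else 0)" for z x
  by (intro sum.cong) (auto simp: un_def)
 then show "mm (lab X) (aa X e) (un X None) = aa X e"
  using wfc_simps(1)[OF wf] wfc_aa(2)[OF wf] by (fastforce simp: mm_def fun_eq_iff sum.delta)
qed

lemma pm_snoc: "wfc Q X ==> pm X (p @ [e]) = mm (lab X) (aa X e) (pm X p)"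
 by (induction p) (simp_all add: aa_un mm_assoc)

lemma pm_un:
 assumes wf: "wfc Q X"
 shows "mm (lab X) (pm X p) (un X None) = pm X p"
 by (cases p) (simp_all add: mm_assoc aa_un[OF wf] mm_un_left[OF wfc_simps(1)[OF wf] HM_un])

lemma pm_append: "wfc Q X ==> pm X (p @ q) = mm (lab X) (pm X q) (pm X p)"
 by (induction p) (simp_all add: mm_assoc pm_un)

lemma pm_dd:
 assumes wf: "wfc Q X"
 shows "mm (lab X) (dd X) (pm X p) = mm (lab X) (pm X p) (dd X)"
proof (induction p)
 case Nil
 then show ?case using wfc_dd(1)[OF wf] wfc_simps(1)[OF wf] by (simp add: mm_un_left mm_un_right)
next
 case (Cons e p)
 have "mm (lab X) (dd X) (pm X (e # p)) = mm (lab X) (mm (lab X) (pm X p) (dd X)) (aa X e)"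
  by (simp add: mm_assoc[symmetric] Cons)
 then show ?case by (simp add: mm_assoc wfc_comm[OF wf])
qed

lemma pm_ST:
 assumes "M \<in> ST X Y i" "wfc Q X" "wfc Q Y"
 shows "mm (lab Y) (pm Y p) M = mm (lab X) M (pm X p)"
proof (induction p)
 case Nil
 have "M \<in> HM X Y i" using assms(1) by (simp add: ST_def)
 then show ?case using wfc_simps(1)[OF assms(2)] wfc_simps(1)[OF assms(3)] by (simp add: mm_un_left mm_un_right)
next
 case (Cons e p)
 have "mm (lab Y) (pm Y (e # p)) M = mm (lab Y) (pm Y p) (mm (lab X) M (aa X e))"
  using assms(1) by (simp add: mm_assoc ST_def)
 then show ?case by (simp add: mm_assoc[symmetric] Cons)
qed

text \<open>
 The basis element \<open>(b, p, False)\<close> stands for \<open>b \<otimes> p\<close> in \<open>X \<otimes> kQ\<close>, and \<open>(b, e # p, True)\<close> for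
 \<open>b \<otimes> e \<otimes> p\<close> in \<open>X \<otimes> kQ\<^sub>1 \<otimes> kQ\<close>, tensor products being taken over the semisimple algebra of the vertices.
\<close>

definition res :: "('b, 'v, 'e, 'k::comm_ring_1) qcx => ('b \<times> 'e list \<times> bool, 'v, 'e, 'k) qcx" where
 "res X = (let L = {(b, p, f). b \<in> lab X \<and> (vx X b, p) \<in> quiver_paths Q \<and> (f --> p \<noteq> [])} in
  \<lparr>lab = L,
   dg = (\<lambda>(b, p, f). dg X b - (if f then 1 else 0)),
   vx = (\<lambda>(b, p, f). awlast (vx X b) p),
   dd = (\<lambda>(b', p', f') (b, p, f). if (b', p', f') \<in> L \<and> (b, p, f) \<in> L then
    if f = f' then if p' = p then dd X b' b else 0
    else if f then sg (dg X b) * ((if b' = b \<and> p' = p then 1 else 0) - (if p' = tl p then aa X (hd p) b' b else 0))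
    else 0 else 0),
   aa = (\<lambda>e (b', p', f') (b, p, f). if (b', p', f') \<in> L \<and> (b, p, f) \<in> L \<and> b' = b \<and> f' = f \<and> p' = p @ [e] then 1 else 0)\<rparr>)"

text \<open>Flagged labels sit one degree lower, so this is the mapping cone of the two-term
  standard resolution. Up to the sign of \<open>b\<close>, the mixed entries of the differential
  send \<open>b \<otimes> e \<otimes> p\<close> to the difference of \<open>b \<otimes> e p\<close>
  and \<open>b e \<otimes> p\<close>.\<close>

lemma lab_res: "(b, p, f) \<in> lab (res X) \<longleftrightarrow> b \<in> lab X \<and> (vx X b, p) \<in> quiver_paths Q \<and> (f --> p \<noteq> [])"
 and dg_res [simp]: "dg (res X) (b, p, f) = dg X b - (if f then 1 else 0)"
 and vx_res [simp]: "vx (res X) (b, p, f) = awlast (vx X b) p"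
 and dd_res: "dd (res X) (b', p', f') (b, p, f) = (if (b', p', f') \<in> lab (res X) \<and> (b, p, f) \<in> lab (res X) then
    if f = f' then if p' = p then dd X b' b else 0
    else if f then sg (dg X b) * ((if b' = b \<and> p' = p then 1 else 0) - (if p' = tl p then aa X (hd p) b' b else 0))
    else 0 else 0)"
 and aa_res: "aa (res X) e (b', p', f') (b, p, f) =
   (if (b', p', f') \<in> lab (res X) \<and> (b, p, f) \<in> lab (res X) \<and> b' = b \<and> f' = f \<and> p' = p @ [e] then 1 else 0)"
 by (simp_all add: res_def Let_def)

lemma mem_paths: "(u, p) \<in> quiver_paths Q ==> p \<in> snd ` quiver_paths Q"
 by (metis image_eqI snd_conv)

lemma lab_res_subset: "lab (res X) \<subseteq> lab X \<times> snd ` quiver_paths Q \<times> UNIV"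
 by (auto simp: lab_res intro: mem_paths)

lemma finite_res: "wfc Q X ==> finite (lab (res X))"
 using finite_subset[OF lab_res_subset[of X]] wfc_simps(1)[of Q X] fin_paths by auto

lemma sum_res:
 assumes wf: "wfc Q X" and z: "\<And>t. t \<notin> lab (res X) ==> g t = 0"
 shows "(\<Sum>t\<in>lab (res X). g t) =
  (\<Sum>b\<in>lab X. \<Sum>p\<in>snd ` quiver_paths Q. g (b, p, False) + g (b, p, True))"
proof -
 have "(\<Sum>t\<in>lab (res X). g t) = (\<Sum>t\<in>lab X \<times> snd ` quiver_paths Q \<times> UNIV. g t)"
 proof (rule sum.mono_neutral_left)
  show "lab (res X) \<subseteq> lab X \<times> snd ` quiver_paths Q \<times> UNIV" by (rule lab_res_subset)
 qed (use wfc_simps(1)[OF wf] fin_paths z in auto)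
 also have "\<dots> = (\<Sum>b\<in>lab X. \<Sum>p\<in>snd ` quiver_paths Q. \<Sum>f\<in>UNIV. g (b, p, f))"
  unfolding sum.cartesian_product by (simp add: case_prod_unfold)
 finally show ?thesis by (simp add: UNIV_bool)
qed

text \<open>The differential of the resolution written out on one column. Together with the
  analogous row formula it reduces all identities in the resolution to sums over the labels of
  \<open>X\<close>.\<close>

lemma res_col_dd:
 assumes wf: "wfc Q X" and z: "\<And>t. t \<notin> lab (res X) ==> M y t = 0" and t: "(b, p, f) \<in> lab (res X)"
 shows "mm (lab (res X)) M (dd (res X)) y (b, p, f) =
  (\<Sum>b'\<in>lab X. M y (b', p, f) * dd X b' b) + (if f then sg (dg X b) * (M y (b, p, False)
   - (\<Sum>b'\<in>lab X. M y (b', tl p, False) * aa X (hd p) b' b)) else 0)"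
proof -
 let ?P = "snd ` quiver_paths Q"
 have fP: "finite ?P" using fin_paths by simp
 have p: "p \<in> ?P" "b \<in> lab X" using t mem_paths by (auto simp: lab_res)
 have tp: "tl p \<in> ?P" if f
  using t that mem_paths[of _ "tl p"] by (cases p) (auto simp: lab_res path_Cons)
 have "mm (lab (res X)) M (dd (res X)) y (b, p, f) = (\<Sum>b'\<in>lab X. \<Sum>p'\<in>?P.
   M y (b', p', False) * dd (res X) (b', p', False) (b, p, f) + M y (b', p', True) * dd (res X) (b', p', True) (b, p, f))"
  unfolding mm_def by (rule sum_res[OF wf]) (simp add: z)
 also have "\<dots> = (\<Sum>b'\<in>lab X. M y (b', p, f) * dd X b' b + (if f then sg (dg X b) * ((if b' = b then M y (b, p, False) else 0)
   - M y (b', tl p, False) * aa X (hd p) b' b) else 0))"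
 proof (intro sum.cong refl)
  fix b' assume "b' \<in> lab X"
  have "(\<Sum>p'\<in>?P. M y (b', p', False) * dd (res X) (b', p', False) (b, p, f) + M y (b', p', True) * dd (res X) (b', p', True) (b, p, f))
   = (\<Sum>p'\<in>?P. (if p' = p then M y (b', p, f) * dd X b' b + (if f then sg (dg X b) * (if b' = b then M y (b, p, False) else 0) else 0) else 0)
     - (if p' = tl p then if f then sg (dg X b) * (M y (b', tl p, False) * aa X (hd p) b' b) else 0 else 0))"
  proof (intro sum.cong refl)
   fix p'
   have F: "M y (b', p', False) * dd (res X) (b', p', False) (b, p, f) =
    M y (b', p', False) * (if f then sg (dg X b) * ((if b' = b \<and> p' = p then 1 else 0) - (if p' = tl p then aa X (hd p) b' b else 0))
     else if p' = p then dd X b' b else 0)"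
    using t z[of "(b', p', False)"] by (cases "(b', p', False) \<in> lab (res X)") (auto simp: dd_res)
   have T: "M y (b', p', True) * dd (res X) (b', p', True) (b, p, f) = M y (b', p', True) * (if f \<and> p' = p then dd X b' b else 0)"
    using t z[of "(b', p', True)"] by (cases "(b', p', True) \<in> lab (res X)") (auto simp: dd_res)
   show "M y (b', p', False) * dd (res X) (b', p', False) (b, p, f) + M y (b', p', True) * dd (res X) (b', p', True) (b, p, f)
    = (if p' = p then M y (b', p, f) * dd X b' b + (if f then sg (dg X b) * (if b' = b then M y (b, p, False) else 0) else 0) else 0)
     - (if p' = tl p then if f then sg (dg X b) * (M y (b', tl p, False) * aa X (hd p) b' b) else 0 else 0)"
    unfolding F T by (auto simp: right_diff_distrib mult.left_commute)
  qed
  also have "\<dots> = M y (b', p, f) * dd X b' b + (if f then sg (dg X b) * ((if b' = b then M y (b, p, False) else 0)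
   - M y (b', tl p, False) * aa X (hd p) b' b) else 0)"
   using p tp fP by (auto simp: sum_subtractf sum.delta right_diff_distrib)
  finally show "(\<Sum>p'\<in>?P. M y (b', p', False) * dd (res X) (b', p', False) (b, p, f) + M y (b', p', True) * dd (res X) (b', p', True) (b, p, f))
   = M y (b', p, f) * dd X b' b + (if f then sg (dg X b) * ((if b' = b then M y (b, p, False) else 0)
   - M y (b', tl p, False) * aa X (hd p) b' b) else 0)" .
 qed
 also have "\<dots> = (\<Sum>b'\<in>lab X. M y (b', p, f) * dd X b' b) + (if f then sg (dg X b) * (M y (b, p, False)
   - (\<Sum>b'\<in>lab X. M y (b', tl p, False) * aa X (hd p) b' b)) else 0)"
  using p(2) wfc_simps(1)[OF wf]
  by (cases f) (simp_all add: sum.distrib sum_subtractf sum.delta sum_distrib_left[symmetric])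
 finally show ?thesis .
qed

lemma res_row_dd:
 assumes wf: "wfc Q X" and z: "\<And>t. t \<notin> lab (res X) ==> N t c = 0" and t: "(b, q, f) \<in> lab (res X)"
 shows "mm (lab (res X)) (dd (res X)) N (b, q, f) c =
  (\<Sum>b'\<in>lab X. dd X b b' * N (b', q, f) c) + (if f then 0 else sg (dg X b) * N (b, q, True) c
   - (\<Sum>e\<in>arcs Q. \<Sum>b'\<in>lab X. sg (dg X b') * aa X e b b' * N (b', e # q, True) c))"
proof -
 let ?P = "snd ` quiver_paths Q"
 have fP: "finite ?P" using fin_paths by simp
 have q: "q \<in> ?P" "b \<in> lab X" using t mem_paths by (auto simp: lab_res)
 have qT: "N (b', [], True) c = 0" for b' using z by (simp add: lab_res)
 \<comment> \<open>The nonempty paths with remainder \<open>q\<close> are the extensions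
   \<open>e # q\<close>. Those arrows for which this is not a path from the given label contribute
   zero, so the sum may run over all arrows.\<close>
 have tl: "(\<Sum>p'\<in>?P. if q = tl p' then sg (dg X b') * aa X (hd p') b b' * N (b', p', True) c else 0) =
   (\<Sum>e\<in>arcs Q. sg (dg X b') * aa X e b b' * N (b', e # q, True) c)" for b'
 proof -
  have "(\<Sum>e\<in>arcs Q. sg (dg X b') * aa X e b b' * N (b', e # q, True) c) =
    (\<Sum>p'\<in>(\<lambda>e. e # q) ` arcs Q. if q = tl p' then sg (dg X b') * aa X (hd p') b b' * N (b', p', True) c else 0)"
   by (subst sum.reindex) (auto simp: inj_on_def)
  also have "\<dots> = (\<Sum>p'\<in>(\<lambda>e. e # q) ` arcs Q \<union> ?P. if q = tl p' then sg (dg X b') * aa X (hd p') b b' * N (b', p', True) c else 0)"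
  proof (rule sum.mono_neutral_left)
   show "\<forall>p'\<in>(\<lambda>e. e # q) ` arcs Q \<union> ?P - (\<lambda>e. e # q) ` arcs Q.
    (if q = tl p' then sg (dg X b') * aa X (hd p') b b' * N (b', p', True) c else 0) = 0"
   proof
    fix p' assume p': "p' \<in> (\<lambda>e. e # q) ` arcs Q \<union> ?P - (\<lambda>e. e # q) ` arcs Q"
    show "(if q = tl p' then sg (dg X b') * aa X (hd p') b b' * N (b', p', True) c else 0) = 0"
    proof (cases p')
     case Nil
     then show ?thesis using qT by auto
    next
     case (Cons e r)
     then have "q = r ==> e \<notin> arcs Q" using p' by auto
     then show ?thesis using z[of "(b', e # r, True)"] by (auto simp: Cons lab_res path_Cons)
    qed
   qed
  qed (use fP fin_arcs in auto)
  also have "\<dots> = (\<Sum>p'\<in>?P. if q = tl p' then sg (dg X b') * aa X (hd p') b b' * N (b', p', True) c else 0)"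
  proof (rule sum.mono_neutral_right)
   show "\<forall>p'\<in>(\<lambda>e. e # q) ` arcs Q \<union> ?P - ?P.
    (if q = tl p' then sg (dg X b') * aa X (hd p') b b' * N (b', p', True) c else 0) = 0"
   proof
    fix p' assume p': "p' \<in> (\<lambda>e. e # q) ` arcs Q \<union> ?P - ?P"
    then have "(b', p', True) \<notin> lab (res X)" using lab_res_subset[of X] by auto
    then show "(if q = tl p' then sg (dg X b') * aa X (hd p') b b' * N (b', p', True) c else 0) = 0"
     using z[of "(b', p', True)"] by simp
   qed
  qed (use fP fin_arcs in auto)
  finally show ?thesis ..
 qed
 have "mm (lab (res X)) (dd (res X)) N (b, q, f) c = (\<Sum>b'\<in>lab X. \<Sum>p'\<in>?P.
   dd (res X) (b, q, f) (b', p', False) * N (b', p', False) c + dd (res X) (b, q, f) (b', p', True) * N (b', p', True) c)"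
  unfolding mm_def by (rule sum_res[OF wf]) (simp add: z)
 also have "\<dots> = (\<Sum>b'\<in>lab X. dd X b b' * N (b', q, f) c + (if f then 0 else
   (if b' = b then sg (dg X b) * N (b, q, True) c else 0)
   - (\<Sum>e\<in>arcs Q. sg (dg X b') * aa X e b b' * N (b', e # q, True) c)))"
 proof (intro sum.cong refl)
  fix b' assume "b' \<in> lab X"
  have "(\<Sum>p'\<in>?P. dd (res X) (b, q, f) (b', p', False) * N (b', p', False) c + dd (res X) (b, q, f) (b', p', True) * N (b', p', True) c)
   = (\<Sum>p'\<in>?P. (if p' = q then dd X b b' * N (b', q, f) c + (if f then 0 else if b' = b then sg (dg X b) * N (b, q, True) c else 0) else 0)
     - (if f then 0 else if q = tl p' then sg (dg X b') * aa X (hd p') b b' * N (b', p', True) c else 0))"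
  proof (intro sum.cong refl)
   fix p'
   have F: "dd (res X) (b, q, f) (b', p', False) * N (b', p', False) c = (if \<not> f \<and> p' = q then dd X b b' else 0) * N (b', p', False) c"
    using t z[of "(b', p', False)"] by (cases "(b', p', False) \<in> lab (res X)") (auto simp: dd_res)
   have T: "dd (res X) (b, q, f) (b', p', True) * N (b', p', True) c =
    (if f then if p' = q then dd X b b' else 0 else
     sg (dg X b') * ((if b = b' \<and> q = p' then 1 else 0) - (if q = tl p' then aa X (hd p') b b' else 0))) * N (b', p', True) c"
    using t z[of "(b', p', True)"] by (cases "(b', p', True) \<in> lab (res X)") (auto simp: dd_res)
   show "dd (res X) (b, q, f) (b', p', False) * N (b', p', False) c + dd (res X) (b, q, f) (b', p', True) * N (b', p', True) c
    = (if p' = q then dd X b b' * N (b', q, f) c + (if f then 0 else if b' = b then sg (dg X b) * N (b, q, True) c else 0) else 0)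
     - (if f then 0 else if q = tl p' then sg (dg X b') * aa X (hd p') b b' * N (b', p', True) c else 0)"
    unfolding F T by (auto simp: algebra_simps)
  qed
  also have "\<dots> = dd X b b' * N (b', q, f) c + (if f then 0 else (if b' = b then sg (dg X b) * N (b, q, True) c else 0)
   - (\<Sum>e\<in>arcs Q. sg (dg X b') * aa X e b b' * N (b', e # q, True) c))"
   using q fP tl[of b'] by (cases f) (simp_all add: sum_subtractf sum.delta)
  finally show "(\<Sum>p'\<in>?P. dd (res X) (b, q, f) (b', p', False) * N (b', p', False) c + dd (res X) (b, q, f) (b', p', True) * N (b', p', True) c)
   = dd X b b' * N (b', q, f) c + (if f then 0 else (if b' = b then sg (dg X b) * N (b, q, True) c else 0)
   - (\<Sum>e\<in>arcs Q. sg (dg X b') * aa X e b b' * N (b', e # q, True) c))" .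
 qed
 also have "\<dots> = (\<Sum>b'\<in>lab X. dd X b b' * N (b', q, f) c) + (if f then 0 else sg (dg X b) * N (b, q, True) c
   - (\<Sum>b'\<in>lab X. \<Sum>e\<in>arcs Q. sg (dg X b') * aa X e b b' * N (b', e # q, True) c))"
  using q(2) wfc_simps(1)[OF wf] by (cases f) (simp_all add: sum.distrib sum_subtractf sum.delta)
 also have "(\<Sum>b'\<in>lab X. \<Sum>e\<in>arcs Q. sg (dg X b') * aa X e b b' * N (b', e # q, True) c) =
   (\<Sum>e\<in>arcs Q. \<Sum>b'\<in>lab X. sg (dg X b') * aa X e b b' * N (b', e # q, True) c)"
  by (rule sum.swap)
 finally show ?thesis .
qed

lemma res_col_aa:
 assumes wf: "wfc Q X" and z: "\<And>t. t \<notin> lab (res X) ==> M y t = 0"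
 shows "mm (lab (res X)) M (aa (res X) e) y (b, p, f) = (if (b, p, f) \<in> lab (res X) then M y (b, p @ [e], f) else 0)"
proof -
 have "M y t * aa (res X) e t (b, p, f) = (if t = (b, p @ [e], f) then if (b, p, f) \<in> lab (res X) then M y t else 0 else 0)" for t
  using z[of t] by (cases t) (auto simp: aa_res)
 then show ?thesis using z[of "(b, p @ [e], f)"] finite_res[OF wf] by (auto simp: mm_def sum.delta)
qed

end

section \<open>The resolution as a complex of representations\<close>

context fin_quiver
begin

lemma path_append: "(u, p @ q) \<in> quiver_paths Q \<longleftrightarrow> (u, p) \<in> quiver_paths Q \<and> (awlast u p, q) \<in> quiver_paths Q"
proof (induction p arbitrary: u)
 case Nil
 then show ?case by (cases q) (auto simp: path_Cons)
qed (auto simp: path_Cons)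

lemma awlast_append' [simp]: "awlast u (p @ q) = awlast (awlast u p) q"
 by (induction p arbitrary: u) auto

text \<open>The mixed terms cancel because the differential of \<open>X\<close> commutes with the
  arrows, while the sign of a label changes under the differential.\<close>

lemma res_dd_dd:
 fixes X :: "('b, 'v, 'e, 'k::comm_ring_1) qcx"
 assumes wf: "wfc Q X"
 shows "mm (lab (res X)) (dd (res X)) (dd (res X)) = 0"
proof (intro ext)
 fix t c :: "'b \<times> 'e list \<times> bool"
 obtain b'' p'' f'' where t: "t = (b'', p'', f'')" by (cases t)
 obtain b p f where c: "c = (b, p, f)" by (cases c)
 have z: "dd (res X) t u = 0" if "u \<notin> lab (res X)" for u using that by (cases u) (auto simp: t dd_res)
 show "mm (lab (res X)) (dd (res X)) (dd (res X)) t c = (0 :: _ => _ => _) t c"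
 proof (cases "t \<in> lab (res X) \<and> c \<in> lab (res X)")
  case False
  then have "dd (res X) t u * dd (res X) u c = 0" for u by (cases u) (auto simp: t c dd_res)
  then show ?thesis by (simp add: mm_def)
 next
  case True
  have L: "(b', p, g) \<in> lab (res X)" if "dd X b' b \<noteq> 0" "g --> p \<noteq> []" for b' g
   using True that wfc_dd_simps[OF wf that(1)] by (auto simp: c lab_res)
  have La: "(b', tl p, False) \<in> lab (res X)" if "aa X (hd p) b' b \<noteq> 0" f for b'
   using True that wfc_aa[OF wf that(1)] by (cases p) (auto simp: c lab_res path_Cons)
  have dd0: "(\<Sum>b'\<in>lab X. dd X b'' b' * dd X b' b) = 0"
   using fun_cong[OF fun_cong[OF wfc_dd(2)[OF wf], of b''], of b] by (simp add: mm_def)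
  have da: "(\<Sum>b'\<in>lab X. dd X b'' b' * aa X (hd p) b' b) = (\<Sum>b'\<in>lab X. aa X (hd p) b'' b' * dd X b' b)"
   using fun_cong[OF fun_cong[OF wfc_comm[OF wf, of "hd p"], of b''], of b] by (simp add: mm_def)
  have 1: "dd (res X) t (b', p, f) * dd X b' b = (if f'' = f then if p'' = p then dd X b'' b' * dd X b' b else 0
    else if f then - sg (dg X b) * ((if b'' = b' \<and> p'' = p then dd X b'' b else 0)
     - (if p'' = tl p then aa X (hd p) b'' b' * dd X b' b else 0)) else 0)" for b'
  proof (cases "dd X b' b = 0")
   case False
   have g: "dg X b' = dg X b + 1" using wfc_dd_simps(4)[OF wf False] .
   have "(b', p, f) \<in> lab (res X)" using L[OF False, of f] True by (auto simp: c lab_res)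
   then have "dd (res X) t (b', p, f) = (if f'' = f then if p'' = p then dd X b'' b' else 0
    else if f then - sg (dg X b) * ((if b'' = b' \<and> p'' = p then 1 else 0) - (if p'' = tl p then aa X (hd p) b'' b' else 0)) else 0)"
    using True unfolding t dd_res g by (simp only: sg_shift simp_thms if_True cong: if_cong) auto
   then show ?thesis by (auto simp: mult.assoc left_diff_distrib)
  qed auto
  have 2: "dd (res X) t (b', tl p, False) * aa X (hd p) b' b =
    (if f'' = False \<and> p'' = tl p then dd X b'' b' * aa X (hd p) b' b else 0)" if f for b'
  proof (cases "aa X (hd p) b' b = 0")
   case False
   then show ?thesis using La[OF False that] True by (auto simp: t dd_res)
  qed auto
  have b: "b'' \<in> lab X" "b \<in> lab X" using True by (auto simp: t c lab_res)
  have 3: "(\<Sum>b'\<in>lab X. dd (res X) t (b', p, f) * dd X b' b) = (if f'' = f then 0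
    else if f then - sg (dg X b) * ((if p'' = p then dd X b'' b else 0)
     - (if p'' = tl p then \<Sum>b'\<in>lab X. aa X (hd p) b'' b' * dd X b' b else 0)) else 0)"
   unfolding 1 using dd0 b wfc_simps(1)[OF wf]
   by (auto simp: sum_distrib_left[symmetric] sum_subtractf sum_negf sum.delta' simp del: mult_minus_left)
  have 4: "dd (res X) t (b, p, False) = (if f'' = False \<and> p'' = p then dd X b'' b else 0)" if f
   using True that by (auto simp: t c dd_res lab_res)
  have 5: "(\<Sum>b'\<in>lab X. dd (res X) t (b', tl p, False) * aa X (hd p) b' b) =
     (if f'' = False \<and> p'' = tl p then \<Sum>b'\<in>lab X. aa X (hd p) b'' b' * dd X b' b else 0)" if f
   unfolding 2[OF that] da[symmetric] by auto
  have "mm (lab (res X)) (dd (res X)) (dd (res X)) t (b, p, f) =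
   (\<Sum>b'\<in>lab X. dd (res X) t (b', p, f) * dd X b' b) + (if f then sg (dg X b) * (dd (res X) t (b, p, False)
   - (\<Sum>b'\<in>lab X. dd (res X) t (b', tl p, False) * aa X (hd p) b' b)) else 0)"
   using True by (intro res_col_dd[OF wf] z) (auto simp: c)
  also have "\<dots> = 0"
   unfolding 3 by (auto simp: 4 5 right_diff_distrib)
  finally show ?thesis by (simp add: c)
 qed
qed

text \<open>Arrows act at the end of a path and the differential works at its beginning.\<close>

lemma res_dd_aa:
 fixes X :: "('b, 'v, 'e, 'k::comm_ring_1) qcx"
 assumes wf: "wfc Q X"
 shows "mm (lab (res X)) (dd (res X)) (aa (res X) e) = mm (lab (res X)) (aa (res X) e) (dd (res X))"
proof (intro ext)
 fix t c :: "'b \<times> 'e list \<times> bool"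
 obtain b'' p'' f'' where t: "t = (b'', p'', f'')" by (cases t)
 obtain b p f where c: "c = (b, p, f)" by (cases c)
 have z: "dd (res X) t u = 0" if "u \<notin> lab (res X)" for u using that by (cases u) (auto simp: t dd_res)
 have za: "aa (res X) e t u = 0" if "u \<notin> lab (res X)" for u using that by (cases u) (auto simp: t aa_res)
 show "mm (lab (res X)) (dd (res X)) (aa (res X) e) t c = mm (lab (res X)) (aa (res X) e) (dd (res X)) t c"
 proof (cases "t \<in> lab (res X) \<and> c \<in> lab (res X)")
  case False
  then have "dd (res X) t u * aa (res X) e u c = 0" "aa (res X) e t u * dd (res X) u c = 0" for u
   by (cases u, auto simp: t c dd_res aa_res)+
  then show ?thesis by (simp add: mm_def)
 next
  case True
  have b: "b'' \<in> lab X" "b \<in> lab X" using True by (auto simp: t c lab_res)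
  have l: "mm (lab (res X)) (dd (res X)) (aa (res X) e) t c = dd (res X) t (b, p @ [e], f)"
   using res_col_aa[of X "dd (res X)" t e b p f, OF wf z] True by (simp add: c)
  have L: "(b', p, f) \<in> lab (res X)" if "dd X b' b \<noteq> 0" for b'
   using True wfc_dd_simps[OF wf that] by (auto simp: c lab_res)
  have La: "(b', tl p, False) \<in> lab (res X)" if "aa X (hd p) b' b \<noteq> 0" f for b'
   using True that wfc_aa[OF wf that(1)] by (cases p) (auto simp: c lab_res path_Cons)
  have 1: "aa (res X) e t (b', p, f) * dd X b' b = (if b' = b'' then if f'' = f \<and> p'' = p @ [e] then dd X b'' b else 0 else 0)" for b'
   using L[of b'] True by (cases "dd X b' b = 0") (auto simp: t aa_res)
  have 2: "aa (res X) e t (b', tl p, False) * aa X (hd p) b' b =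
    (if b' = b'' then if f'' = False \<and> p'' = tl p @ [e] then aa X (hd p) b'' b else 0 else 0)" if f for b'
   using La[OF _ that, of b'] True by (cases "aa X (hd p) b' b = 0") (auto simp: t aa_res)
  have 3: "aa (res X) e t (b, p, False) = (if b'' = b \<and> f'' = False \<and> p'' = p @ [e] then 1 else 0)" if f
   using True that by (auto simp: t c aa_res lab_res)
  have S1: "(\<Sum>b'\<in>lab X. aa (res X) e t (b', p, f) * dd X b' b) = (if f'' = f \<and> p'' = p @ [e] then dd X b'' b else 0)"
   unfolding 1 using b wfc_simps(1)[OF wf] by (simp add: sum.delta)
  have S2: "(\<Sum>b'\<in>lab X. aa (res X) e t (b', tl p, False) * aa X (hd p) b' b) =
    (if f'' = False \<and> p'' = tl p @ [e] then aa X (hd p) b'' b else 0)" if f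
   unfolding 2[OF that] using b wfc_simps(1)[OF wf] by (simp add: sum.delta)
  have "mm (lab (res X)) (aa (res X) e) (dd (res X)) t (b, p, f) =
   (\<Sum>b'\<in>lab X. aa (res X) e t (b', p, f) * dd X b' b) + (if f then sg (dg X b) * (aa (res X) e t (b, p, False)
   - (\<Sum>b'\<in>lab X. aa (res X) e t (b', tl p, False) * aa X (hd p) b' b)) else 0)"
   using True by (intro res_col_dd[OF wf] za) (auto simp: c)
  then have r: "mm (lab (res X)) (aa (res X) e) (dd (res X)) t c = (if f'' = f \<and> p'' = p @ [e] then dd X b'' b else 0)
    + (if f then sg (dg X b) * ((if b'' = b \<and> f'' = False \<and> p'' = p @ [e] then 1 else 0)
     - (if f'' = False \<and> p'' = tl p @ [e] then aa X (hd p) b'' b else 0)) else 0)"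
   unfolding c S1 by (auto simp: S2 3)
  have "f ==> p \<noteq> []" using True by (auto simp: c lab_res)
  then have tl: "f ==> tl (p @ [e]) = tl p @ [e] \<and> hd (p @ [e]) = hd p" by auto
  show ?thesis
  proof (cases "(b, p @ [e], f) \<in> lab (res X)")
   case L': True
   show ?thesis unfolding l r using L' True tl by (auto simp: t dd_res)
  next
   case False
   then have e: "\<not> (e \<in> arcs Q \<and> tail Q e = awlast (vx X b) p)" using True by (auto simp: c lab_res path_snoc)
   \<comment> \<open>If the extended path does not exist then the left side is zero. The right side
     vanishes too, as no label of the resolution can carry that path.\<close>
   have "p'' \<noteq> p @ [e]" if "b'' = b \<or> dd X b'' b \<noteq> 0"
    using True e that wfc_dd_simps(3)[OF wf, of b'' b] by (auto simp: t lab_res path_snoc)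
   moreover have "p'' \<noteq> tl p @ [e]" if f "aa X (hd p) b'' b \<noteq> 0"
    using True e that wfc_aa(5)[OF wf that(2)] by (cases p) (auto simp: t c lab_res path_snoc)
   ultimately show ?thesis unfolding l r using False by (auto simp: t dd_res)
  qed
 qed
qed

lemma wfc_res:
 fixes X :: "('b, 'v, 'e, 'k::comm_ring_1) qcx"
 assumes wf: "wfc Q X"
 shows "wfc Q (res X)"
proof (rule wfcI)
 show "finite (lab (res X))" by (rule finite_res[OF wf])
 show "mm (lab (res X)) (dd (res X)) (dd (res X)) = 0" by (rule res_dd_dd[OF wf])
 show "mm (lab (res X)) (dd (res X)) (aa (res X) e) = mm (lab (res X)) (aa (res X) e) (dd (res X))" for e
  by (rule res_dd_aa[OF wf])
 show "vx (res X) x \<in> verts Q" if "x \<in> lab (res X)" for x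
  using that by (cases x) (auto simp: lab_res awlast_path_verts)
 show "dd (res X) \<in> HM (res X) (res X) 1"
  unfolding HM_def
 proof (intro CollectI allI impI)
  fix t c :: "'b \<times> 'e list \<times> bool" assume nz: "dd (res X) t c \<noteq> 0"
  obtain b' p' f' where t: "t = (b', p', f')" by (cases t)
  obtain b p f where c: "c = (b, p, f)" by (cases c)
  have L: "t \<in> lab (res X)" "c \<in> lab (res X)" using nz by (auto simp: t c dd_res split: if_splits)
  show "t \<in> lab (res X) \<and> c \<in> lab (res X) \<and> vx (res X) t = vx (res X) c \<and> dg (res X) t = dg (res X) c + 1"
  proof (cases "f = f'")
   case True
   then have "p' = p" "dd X b' b \<noteq> 0" using nz by (auto simp: t c dd_res split: if_splits)
   then show ?thesis using L True wfc_dd_simps[OF wf, of b' b] by (simp add: t c)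
  next
   case False
   then have f: "f" "\<not> f'" "(b' = b \<and> p' = p) \<or> (p' = tl p \<and> aa X (hd p) b' b \<noteq> 0)"
    using nz by (auto simp: t c dd_res split: if_splits)
   then obtain e q where "p = e # q" using L by (cases p) (auto simp: c lab_res)
   then show ?thesis using L f wfc_aa[OF wf, of "hd p" b' b] by (auto simp: t c)
  qed
 qed
 show "t \<in> lab (res X) \<and> c \<in> lab (res X) \<and> e \<in> arcs Q \<and> tail Q e = vx (res X) c \<and> head Q e = vx (res X) t \<and> dg (res X) t = dg (res X) c"
  if "aa (res X) e t c \<noteq> 0" for e and t c :: "'b \<times> 'e list \<times> bool"
  using that by (cases t; cases c) (auto simp: aa_res lab_res path_snoc split: if_splits)
qed

text \<open>The adjunction for induced modules: a map on \<open>X\<close> at the vertices extends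
  uniquely to a map of representations on \<open>X \<otimes> kQ\<close> by letting the path act
  afterwards. The flagged part does the same for the components at arrows, with the sign that
  matches \<open>rsec\<close>.\<close>

definition rmap :: "('b, 'v, 'e, 'k::comm_ring_1) qcx => ('c, 'v, 'e, 'k) qcx => ('c, 'b, 'e, 'k) cochn =>
  'c => 'b \<times> 'e list \<times> bool => 'k" where
 "rmap X Y \<phi> = (\<lambda>y (b, p, f). if (b, p, f) \<in> lab (res X) then
   if f then - mm (lab Y) (pm Y (tl p)) (\<phi> (Some (hd p))) y b else mm (lab Y) (pm Y p) (\<phi> None) y b else 0)"

lemma rmap_simps: "rmap X Y \<phi> y (b, p, f) = (if (b, p, f) \<in> lab (res X) then
   if f then - mm (lab Y) (pm Y (tl p)) (\<phi> (Some (hd p))) y b else mm (lab Y) (pm Y p) (\<phi> None) y b else 0)"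
 by (simp add: rmap_def)

lemma rmap_HM:
 fixes X :: "('b, 'v, 'e, 'k::comm_ring_1) qcx" and Y :: "('c, 'v, 'e, 'k) qcx"
 assumes wf: "wfc Q X" "wfc Q Y" and p: "\<phi> \<in> Tot Q X Y i"
 shows "rmap X Y \<phi> \<in> HM (res X) Y i"
 unfolding HM_def
proof (intro CollectI allI impI)
 fix y c assume nz: "rmap X Y \<phi> y c \<noteq> 0"
 obtain b p f where c: "c = (b, p, f)" by (cases c)
 have L: "c \<in> lab (res X)" using nz by (auto simp: c rmap_simps split: if_splits)
 show "y \<in> lab Y \<and> c \<in> lab (res X) \<and> vx Y y = vx (res X) c \<and> dg Y y = dg (res X) c + i"
 proof (cases f)
  case True
  then obtain e q where p': "p = e # q" using L by (cases p) (auto simp: c lab_res)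
  have "mm (lab Y) (pm Y q) (\<phi> (Some e)) y b \<noteq> 0" using nz True L by (auto simp: c rmap_simps p')
  then obtain z where z: "pm Y q y z \<noteq> 0" "\<phi> (Some e) z b \<noteq> 0"
   using mm_nonzero[of "lab Y" "pm Y q" "\<phi> (Some e)" y b] by auto
  have "allowed Q X Y i (Some e) z b" using p z by (auto simp: Tot_def)
  then show ?thesis using pm_nonzero[OF wf(2) z(1)] L True by (auto simp: c p' allowed_def)
 next
  case False
  have "mm (lab Y) (pm Y p) (\<phi> None) y b \<noteq> 0" using nz False L by (auto simp: c rmap_simps)
  then obtain z where z: "pm Y p y z \<noteq> 0" "\<phi> None z b \<noteq> 0"
   using mm_nonzero[of "lab Y" "pm Y p" "\<phi> None" y b] by auto
  have "allowed Q X Y i None z b" using p z by (auto simp: Tot_def)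
  then show ?thesis using pm_nonzero[OF wf(2) z(1)] L False by (auto simp: c allowed_def)
 qed
qed

text \<open>This makes the test for valid labels in \<open>rmap\<close> harmless: the matrix
  products are zero on the excluded paths anyway.\<close>

lemma mm_pm_outside:
 fixes X :: "('b, 'v, 'e, 'k::comm_ring_1) qcx" and Y :: "('c, 'v, 'e, 'k) qcx"
 assumes wf: "wfc Q Y" and p: "\<phi> \<in> Tot Q X Y i"
 shows "(vx X b, p) \<notin> quiver_paths Q ==> mm (lab Y) (pm Y p) (\<phi> None) y b = 0"
  and "(vx X b, e # p) \<notin> quiver_paths Q ==> mm (lab Y) (pm Y p) (\<phi> (Some e)) y b = 0"
proof -
 assume n: "(vx X b, p) \<notin> quiver_paths Q"
 show "mm (lab Y) (pm Y p) (\<phi> None) y b = 0"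
 proof (rule ccontr)
  assume "\<not> ?thesis"
  then obtain z where z: "pm Y p y z \<noteq> 0" "\<phi> None z b \<noteq> 0"
   using mm_nonzero[of "lab Y" "pm Y p" "\<phi> None" y b] by auto
  have "allowed Q X Y i None z b" using p z by (auto simp: Tot_def)
  then show False using pm_nonzero[OF wf z(1)] n by (auto simp: allowed_def)
 qed
next
 assume n: "(vx X b, e # p) \<notin> quiver_paths Q"
 show "mm (lab Y) (pm Y p) (\<phi> (Some e)) y b = 0"
 proof (rule ccontr)
  assume "\<not> ?thesis"
  then obtain z where z: "pm Y p y z \<noteq> 0" "\<phi> (Some e) z b \<noteq> 0"
   using mm_nonzero[of "lab Y" "pm Y p" "\<phi> (Some e)" y b] by auto
  have "allowed Q X Y i (Some e) z b" using p z by (auto simp: Tot_def)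
  then show False using pm_nonzero[OF wf z(1)] n by (auto simp: allowed_def path_Cons)
 qed
qed

lemma rmap_F:
 assumes wf: "wfc Q Y" and p: "\<phi> \<in> Tot Q X Y i" and "b \<in> lab X"
 shows "rmap X Y \<phi> y (b, p, False) = mm (lab Y) (pm Y p) (\<phi> None) y b"
  and "rmap X Y \<phi> y (b, e # p, True) = - mm (lab Y) (pm Y p) (\<phi> (Some e)) y b"
 using assms mm_pm_outside[OF wf p] by (auto simp: rmap_simps lab_res)

lemma rmap_ST:
 fixes X :: "('b, 'v, 'e, 'k::comm_ring_1) qcx" and Y :: "('c, 'v, 'e, 'k) qcx"
 assumes wf: "wfc Q X" "wfc Q Y" and p: "\<phi> \<in> Tot Q X Y i"
 shows "rmap X Y \<phi> \<in> ST (res X) Y i"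
 unfolding ST_def
proof (intro CollectI conjI allI rmap_HM[OF wf p] ext)
 fix e y and c :: "'b \<times> 'e list \<times> bool"
 obtain b p f where c: "c = (b, p, f)" by (cases c)
 have z: "rmap X Y \<phi> y t = 0" if "t \<notin> lab (res X)" for t y using that by (cases t) (auto simp: rmap_simps)
 have l: "mm (lab (res X)) (rmap X Y \<phi>) (aa (res X) e) y c = (if c \<in> lab (res X) then rmap X Y \<phi> y (b, p @ [e], f) else 0)"
  using res_col_aa[of X "rmap X Y \<phi>" y e b p f, OF wf(1) z] by (simp add: c)
 have "mm (lab Y) (aa Y e) (rmap X Y \<phi>) y c = (if c \<in> lab (res X) then rmap X Y \<phi> y (b, p @ [e], f) else 0)"
 proof (cases "c \<in> lab (res X)")
  case False
  then show ?thesis by (simp add: mm_def z)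
 next
  case True
  then have b: "b \<in> lab X" by (auto simp: c lab_res)
  show ?thesis
  proof (cases f)
   case False
   have "mm (lab Y) (aa Y e) (rmap X Y \<phi>) y c = mm (lab Y) (aa Y e) (mm (lab Y) (pm Y p) (\<phi> None)) y b"
    unfolding mm_def[of _ "aa Y e"] by (simp add: c False rmap_F(1)[OF wf(2) assms(3) b])
   also have "\<dots> = rmap X Y \<phi> y (b, p @ [e], f)"
    by (simp add: False rmap_F(1)[OF wf(2) assms(3) b] pm_snoc[OF wf(2)] mm_assoc)
   finally show ?thesis using True by simp
  next
   case f: True
   then obtain a q where p': "p = a # q" using True by (cases p) (auto simp: c lab_res)
   have "mm (lab Y) (aa Y e) (rmap X Y \<phi>) y c = - mm (lab Y) (aa Y e) (mm (lab Y) (pm Y q) (\<phi> (Some a))) y b"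
    unfolding mm_def[of _ "aa Y e"] by (simp add: c f p' rmap_F(2)[OF wf(2) assms(3) b] sum_negf)
   also have "\<dots> = rmap X Y \<phi> y (b, p @ [e], f)"
    by (simp add: f p' rmap_F(2)[OF wf(2) assms(3) b] pm_snoc[OF wf(2)] mm_assoc)
   finally show ?thesis using True by simp
  qed
 qed
 then show "mm (lab Y) (aa Y e) (rmap X Y \<phi>) y c = mm (lab (res X)) (rmap X Y \<phi>) (aa (res X) e) y c" using l by simp
qed

lemma D_Some:
 assumes p: "\<phi> \<in> Tot Q X Y i"
 shows "D X Y i \<phi> (Some e) z b = mm (lab Y) (dd Y) (\<phi> (Some e)) z b - sg i * mm (lab X) (\<phi> (Some e)) (dd X) z b
  + sg i * sg (dg X b) * (mm (lab Y) (aa Y e) (\<phi> None) z b - mm (lab X) (\<phi> None) (aa X e) z b)"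
proof -
 have "(\<Sum>y\<in>lab Y. sg (dg Y y) * aa Y e z y * \<phi> None y b) = sg i * sg (dg X b) * mm (lab Y) (aa Y e) (\<phi> None) z b"
  unfolding mm_def sum_distrib_left
 proof (intro sum.cong refl)
  fix y
  have "dg Y y = dg X b + i" if nz: "\<phi> None y b \<noteq> 0"
  proof -
   have "allowed Q X Y i None y b" using p nz by (simp add: Tot_def)
   then show ?thesis by (simp add: allowed_def)
  qed
  then show "sg (dg Y y) * aa Y e z y * \<phi> None y b = sg i * sg (dg X b) * (aa Y e z y * \<phi> None y b)"
   by (cases "\<phi> None y b = 0") (auto simp: sg_add mult_ac)
 qed
 moreover have "(\<Sum>y\<in>lab X. \<phi> None z y * (sg (dg X b) * aa X e y b)) = sg (dg X b) * mm (lab X) (\<phi> None) (aa X e) z b"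
  unfolding mm_def sum_distrib_left by (intro sum.cong refl) (rule mult.left_commute)
 ultimately show ?thesis
  unfolding D_def by (simp add: sc_def mm_def[of _ "dl Y (Some e)"] mm_def[of _ "\<phi> None" "dl X (Some e)"] algebra_simps)
qed

lemma D_None': "D X Y i \<phi> None z b = mm (lab Y) (dd Y) (\<phi> None) z b - sg i * mm (lab X) (\<phi> None) (dd X) z b"
 by (simp add: D_def sc_def)

lemma mm_mm_sum: "mm C f (mm B g h) y b = (\<Sum>b'\<in>B. mm C f g y b' * h b' b)"
 unfolding mm_assoc[symmetric] mm_def[of B "mm C f g"] ..

text \<open>Thus \<open>rmap\<close> is a map of complexes from cochains on \<open>X\<close> to
  strict maps on the resolution. Checked on \<open>b \<otimes> p\<close> it uses the components at
  the vertices; on \<open>b \<otimes> e \<otimes> p\<close> the commutator with the arrow comes from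
  the mixed part of the differential.\<close>

lemma rmap_D:
 fixes X :: "('b, 'v, 'e, 'k::comm_ring_1) qcx" and Y :: "('c, 'v, 'e, 'k) qcx"
 assumes wf: "wfc Q X" "wfc Q Y" and p: "\<phi> \<in> Tot Q X Y i"
 shows "D (res X) Y i (nm (rmap X Y \<phi>)) = nm (rmap X Y (D X Y i \<phi>))"
proof -
 have z: "rmap X Y \<phi> y t = 0" if "t \<notin> lab (res X)" for t y using that by (cases t) (auto simp: rmap_simps)
 have "D (res X) Y i (nm (rmap X Y \<phi>)) None y c = rmap X Y (D X Y i \<phi>) y c" for y c
 proof (cases "c \<in> lab (res X)")
  case False
  obtain b p f where c: "c = (b, p, f)" by (cases c)
  have "dd (res X) t c = 0" for t using False by (cases t) (auto simp: c dd_res)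
  then show ?thesis using False by (simp add: D_None' mm_def z) (simp add: c rmap_simps)
 next
  case True
  obtain b p f where c: "c = (b, p, f)" by (cases c)
  have b: "b \<in> lab X" using True by (auto simp: c lab_res)
  note rF = rmap_F[OF wf(2) p]
  show ?thesis
  proof (cases f)
   case False
   have 1: "mm (lab Y) (dd Y) (rmap X Y \<phi>) y c = mm (lab Y) (pm Y p) (mm (lab Y) (dd Y) (\<phi> None)) y b"
   proof -
    have "mm (lab Y) (dd Y) (rmap X Y \<phi>) y c = mm (lab Y) (dd Y) (mm (lab Y) (pm Y p) (\<phi> None)) y b"
     unfolding mm_def[of _ "dd Y"] by (simp add: c False rF(1)[OF b])
    then show ?thesis by (simp add: mm_assoc[symmetric] pm_dd[OF wf(2)])
   qed
   have 2: "mm (lab (res X)) (rmap X Y \<phi>) (dd (res X)) y c = mm (lab Y) (pm Y p) (mm (lab X) (\<phi> None) (dd X)) y b"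
    using res_col_dd[of X "rmap X Y \<phi>" y b p f, OF wf(1) z] True False
    by (simp add: c mm_mm_sum rF(1))
   have "rmap X Y (D X Y i \<phi>) y c = mm (lab Y) (pm Y p) (D X Y i \<phi> None) y b"
    using True False by (simp add: c rmap_simps)
   also have "\<dots> = mm (lab Y) (pm Y p) (mm (lab Y) (dd Y) (\<phi> None)) y b - sg i * mm (lab Y) (pm Y p) (mm (lab X) (\<phi> None) (dd X)) y b"
    unfolding mm_def[of _ "pm Y p"] D_None' by (simp add: right_diff_distrib sum_subtractf sum_distrib_left mult.left_commute)
   finally show ?thesis by (simp add: D_None' 1 2)
  next
   case f: True
   then obtain e q where p': "p = e # q" using True by (cases p) (auto simp: c lab_res)
   have 1: "mm (lab Y) (dd Y) (rmap X Y \<phi>) y c = - mm (lab Y) (pm Y q) (mm (lab Y) (dd Y) (\<phi> (Some e))) y b"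
   proof -
    have "mm (lab Y) (dd Y) (rmap X Y \<phi>) y c = - mm (lab Y) (dd Y) (mm (lab Y) (pm Y q) (\<phi> (Some e))) y b"
     unfolding mm_def[of _ "dd Y"] by (simp add: c f p' rF(2)[OF b] sum_negf)
    then show ?thesis by (simp add: mm_assoc[symmetric] pm_dd[OF wf(2)])
   qed
   have 2: "mm (lab (res X)) (rmap X Y \<phi>) (dd (res X)) y c = - mm (lab Y) (pm Y q) (mm (lab X) (\<phi> (Some e)) (dd X)) y b
     + sg (dg X b) * (mm (lab Y) (pm Y q) (mm (lab Y) (aa Y e) (\<phi> None)) y b - mm (lab Y) (pm Y q) (mm (lab X) (\<phi> None) (aa X e)) y b)"
    using res_col_dd[of X "rmap X Y \<phi>" y b p f, OF wf(1) z] True f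
    by (simp add: c p' mm_mm_sum[of "lab Y" _ "lab X"] mm_assoc rF b sum_negf)
   have "rmap X Y (D X Y i \<phi>) y c = - mm (lab Y) (pm Y q) (D X Y i \<phi> (Some e)) y b"
    using True f by (simp add: c p' rmap_simps)
   also have "\<dots> = - (mm (lab Y) (pm Y q) (mm (lab Y) (dd Y) (\<phi> (Some e))) y b - sg i * mm (lab Y) (pm Y q) (mm (lab X) (\<phi> (Some e)) (dd X)) y b
     + sg i * sg (dg X b) * (mm (lab Y) (pm Y q) (mm (lab Y) (aa Y e) (\<phi> None)) y b - mm (lab Y) (pm Y q) (mm (lab X) (\<phi> None) (aa X e)) y b))"
    unfolding mm_def[of _ "pm Y q"] D_Some[OF p]
    by (simp add: right_diff_distrib distrib_left sum_subtractf sum.distrib sum_distrib_left mult.left_commute)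
   finally show ?thesis by (simp add: D_None' 1 2 algebra_simps)
  qed
 qed
 then have "D (res X) Y i (nm (rmap X Y \<phi>)) None = rmap X Y (D X Y i \<phi>)" by (intro ext)
 then show ?thesis using ST_D[OF rmap_ST[OF wf p]] by simp
qed

end

section \<open>The augmentation of the resolution and its homotopy inverse\<close>

context fin_quiver
begin

lemma un_Some: "un X (Some e) = 0"
 by (intro ext) (simp add: un_def)

lemma HM_zero: "M \<in> HM X Y i ==> y \<notin> lab Y \<or> x \<notin> lab X ==> M y x = 0"
 unfolding HM_def by blast

text \<open>The inverse of the augmentation, sending \<open>b\<close> to
  \<open>b \<otimes> 1\<close>. This does not commute with arrows, and the components at the arrows,
  with values \<open>b \<otimes> e \<otimes> 1\<close>, correct the defect. So it is a morphism of
  the dg category that is not strict.\<close>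

definition rsec :: "('b, 'v, 'e, 'k::comm_ring_1) qcx => ('b \<times> 'e list \<times> bool, 'b, 'e, 'k) cochn" where
 "rsec X = (\<lambda>p t b. case p of
   None => if t = (b, [], False) \<and> t \<in> lab (res X) then 1 else 0
  | Some e => if t = (b, [e], True) \<and> t \<in> lab (res X) then - 1 else 0)"

lemma rsec_simps: "rsec X None t b = (if t = (b, [], False) \<and> t \<in> lab (res X) then 1 else 0)"
  "rsec X (Some e) t b = (if t = (b, [e], True) \<and> t \<in> lab (res X) then - 1 else 0)"
 by (simp_all add: rsec_def)

lemma rsec_Tot: "rsec X \<in> Tot Q X (res X) 0"
 by (auto simp: Tot_def allowed_def rsec_def lab_res path_Cons split: option.splits if_splits)

lemma mm_rsec:
 fixes X :: "('b, 'v, 'e, 'k::comm_ring_1) qcx"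
 assumes wf: "wfc Q X"
 shows "mm (lab (res X)) M (rsec X None) y b = (if (b, [], False) \<in> lab (res X) then M y (b, [], False) else 0)"
  and "mm (lab (res X)) M (rsec X (Some e)) y b = (if (b, [e], True) \<in> lab (res X) then - M y (b, [e], True) else 0)"
proof -
 have "M y t * rsec X None t b = (if t = (b, [], False) then M y t else 0)" if "t \<in> lab (res X)" for t
  using that by (auto simp: rsec_simps)
 then show "mm (lab (res X)) M (rsec X None) y b = (if (b, [], False) \<in> lab (res X) then M y (b, [], False) else 0)"
  using finite_res[OF wf] by (simp add: mm_def sum.delta)
 have "M y t * rsec X (Some e) t b = (if t = (b, [e], True) then - M y t else 0)" if "t \<in> lab (res X)" for t
  using that by (auto simp: rsec_simps)
 then show "mm (lab (res X)) M (rsec X (Some e)) y b = (if (b, [e], True) \<in> lab (res X) then - M y (b, [e], True) else 0)"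
  using finite_res[OF wf] by (simp add: mm_def sum.delta)
qed

lemma rsec_mm:
 fixes X :: "('b, 'v, 'e, 'k::comm_ring_1) qcx"
 assumes wf: "wfc Q X"
 shows "mm (lab X) (rsec X None) N (b', q, f) c = (if b' \<in> lab X \<and> q = [] \<and> \<not> f then N b' c else 0)"
  and "mm (lab X) (rsec X (Some e)) N (b', q, f) c = (if q = [e] \<and> f \<and> (b', q, f) \<in> lab (res X) then - N b' c else 0)"
proof -
 have "rsec X None (b', q, f) b * N b c = (if b = b' then if q = [] \<and> \<not> f then N b' c else 0 else 0)" if "b \<in> lab X" for b
  using that wf by (auto simp: rsec_simps lab_res wfc_def)
 then show "mm (lab X) (rsec X None) N (b', q, f) c = (if b' \<in> lab X \<and> q = [] \<and> \<not> f then N b' c else 0)"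
  using wfc_simps(1)[OF wf] by (simp add: mm_def sum.delta)
 have "rsec X (Some e) (b', q, f) b * N b c = (if b = b' then if q = [e] \<and> f \<and> (b', q, f) \<in> lab (res X) then - N b' c else 0 else 0)" for b
  by (auto simp: rsec_simps)
 moreover have "(b', q, f) \<in> lab (res X) ==> b' \<in> lab X" by (simp add: lab_res)
 ultimately show "mm (lab X) (rsec X (Some e)) N (b', q, f) c = (if q = [e] \<and> f \<and> (b', q, f) \<in> lab (res X) then - N b' c else 0)"
  using wfc_simps(1)[OF wf] by (auto simp: mm_def sum.delta)
qed

lemma rsec_Z:
 fixes X :: "('b, 'v, 'e, 'k::comm_ring_1) qcx"
 assumes wf: "wfc Q X"
 shows "rsec X \<in> Z Q X (res X) 0"
proof -
 have v: "vx X b \<in> verts Q" if "b \<in> lab X" for b using wf that by (auto simp: wfc_def)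
 have "D X (res X) 0 (rsec X) = 0"
 proof (rule cochn_eqI)
  show "D X (res X) 0 (rsec X) None = (0 :: 'e option => _) None"
  proof (intro ext)
   fix t :: "'b \<times> 'e list \<times> bool" and b
   obtain b' q f where t: "t = (b', q, f)" by (cases t)
   show "D X (res X) 0 (rsec X) None t b = (0 :: 'e option => _ => _ => 'k) None t b"
    using wfc_dd_simps[OF wf, of b' b] v
    by (auto simp: D_None' mm_rsec[OF wf] rsec_mm[OF wf] t dd_res lab_res)
  qed
  fix e
  show "D X (res X) 0 (rsec X) (Some e) = (0 :: 'e option => _) (Some e)"
  proof (intro ext)
   fix t :: "'b \<times> 'e list \<times> bool" and b
   obtain b' q f where t: "t = (b', q, f)" by (cases t)
   have L: "aa X e b' b \<noteq> 0 ==> (b, [e], True) \<in> lab (res X) \<and> b' \<in> lab X \<and> b \<in> lab X"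
    using wfc_aa[OF wf, of e b' b] v[of b'] by (auto simp: lab_res path_Cons)
   have L2: "dd X b' b \<noteq> 0 ==> (b', [e], True) \<in> lab (res X) \<longleftrightarrow> (b, [e], True) \<in> lab (res X)"
    using wfc_dd_simps[OF wf, of b' b] by (auto simp: lab_res)
   have L3: "(b, [e], True) \<in> lab (res X) ==> (b, [e], False) \<in> lab (res X) \<and> (b, [], False) \<in> lab (res X) \<and> b \<in> lab X"
    using wellformed(1)[of e] by (auto simp: lab_res path_Cons)
   have L4: "(b, [e], False) \<in> lab (res X) ==> (b, [e], True) \<in> lab (res X)"
    by (auto simp: lab_res)
   \<comment> \<open>\<open>A\<close> and \<open>B\<close> are the two composites with the arrow.
     Their difference is cancelled by the mixed part of the differential in \<open>E\<close>, and
     \<open>C\<close> cancels what remains of \<open>E\<close>.\<close>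
   have A: "mm (lab (res X)) (aa (res X) e) (rsec X None) t b = (if q = [e] \<and> \<not> f \<and> b' = b \<and> (b, [e], True) \<in> lab (res X) then 1 else 0)"
    using L3 L4 by (auto simp: mm_rsec[OF wf] t aa_res)
   have B: "mm (lab X) (rsec X None) (aa X e) t b = (if q = [] \<and> \<not> f then aa X e b' b else 0)"
    using L by (auto simp: rsec_mm[OF wf] t)
   have C: "mm (lab X) (rsec X (Some e)) (dd X) t b = (if q = [e] \<and> f \<and> (b, [e], True) \<in> lab (res X) then - dd X b' b else 0)"
    using L2 by (cases "dd X b' b = 0") (auto simp: rsec_mm[OF wf] t)
   have E: "mm (lab (res X)) (dd (res X)) (rsec X (Some e)) t b = (if (b, [e], True) \<in> lab (res X) then
     (if q = [e] \<and> f then - dd X b' b else 0) + (if \<not> f then - sg (dg X b) * ((if b' = b \<and> q = [e] then 1 else 0) - (if q = [] then aa X e b' b else 0)) else 0) else 0)"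
   proof (cases "(b, [e], True) \<in> lab (res X)")
    case True
    have "dd (res X) t (b, [e], True) = (if q = [e] \<and> f then dd X b' b else 0) + (if \<not> f then sg (dg X b) * ((if b' = b \<and> q = [e] then 1 else 0) - (if q = [] then aa X e b' b else 0)) else 0)"
    proof (cases "t \<in> lab (res X)")
     case t': True
     then show ?thesis using True by (auto simp: t dd_res)
    next
     case False
     have "q = [e] \<and> f ==> dd X b' b = 0" using False True L2 by (auto simp: t)
     moreover have "\<not> f ==> \<not> (b' = b \<and> q = [e])" using False True L3 by (auto simp: t)
     moreover have "\<not> f ==> q = [] ==> aa X e b' b = 0" using False L v by (auto simp: t lab_res)
     ultimately show ?thesis using False by (cases f) (auto simp: t dd_res)
    qed
    then show ?thesis using True by (simp add: mm_rsec[OF wf])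
   qed (simp add: mm_rsec[OF wf])
   have "(b, [e], True) \<notin> lab (res X) ==> aa X e b' b = 0" using L by auto
   then show "D X (res X) 0 (rsec X) (Some e) t b = (0 :: 'e option => _ => _ => 'k) (Some e) t b"
    unfolding D_Some[OF rsec_Tot] A B C E by auto
  qed
 qed
 then show ?thesis by (simp add: Z_def rsec_Tot)
qed

text \<open>The universal property of the resolution: every cochain on \<open>X\<close> factors
  through \<open>rsec\<close> by a strict map.\<close>

lemma rmap_rsec:
 fixes X :: "('b, 'v, 'e, 'k::comm_ring_1) qcx" and Y :: "('c, 'v, 'e, 'k) qcx"
 assumes wf: "wfc Q X" "wfc Q Y" and p: "\<phi> \<in> Tot Q X Y i"
 shows "cm (lab (res X)) (nm (rmap X Y \<phi>)) (rsec X) = \<phi>"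
proof (rule cochn_eqI)
 have al: "\<phi> o' y b \<noteq> 0 ==> allowed Q X Y i o' y b" for o' y b using p by (simp add: Tot_def)
 have v: "vx X b \<in> verts Q" if "b \<in> lab X" for b using wf(1) that by (auto simp: wfc_def)
 have one: "mm (lab Y) (un Y None) (\<phi> o') y b = \<phi> o' y b" for o' y b
 proof -
  have "un Y None y z * \<phi> o' z b = (if z = y then \<phi> o' y b else 0)" if "z \<in> lab Y" for z
   using that by (auto simp: un_def)
  moreover have "y \<notin> lab Y ==> \<phi> o' y b = 0" using al by (auto simp: allowed_def)
  ultimately show ?thesis using wfc_simps(1)[OF wf(2)] by (simp add: mm_def sum.delta)
 qed
 show "cm (lab (res X)) (nm (rmap X Y \<phi>)) (rsec X) None = \<phi> None"
 proof (intro ext)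
  fix y b
  show "cm (lab (res X)) (nm (rmap X Y \<phi>)) (rsec X) None y b = \<phi> None y b"
   using al[of None y b] v[of b] one[of None y b]
   by (auto simp: mm_rsec[OF wf(1)] rmap_simps lab_res allowed_def)
 qed
 fix e
 show "cm (lab (res X)) (nm (rmap X Y \<phi>)) (rsec X) (Some e) = \<phi> (Some e)"
 proof (intro ext)
  fix y b
  show "cm (lab (res X)) (nm (rmap X Y \<phi>)) (rsec X) (Some e) y b = \<phi> (Some e) y b"
   using al[of "Some e" y b] v[of b] one[of "Some e" y b] wellformed
   by (auto simp: mm_linear mm_rsec[OF wf(1)] rmap_simps lab_res allowed_def path_Cons)
 qed
qed

lemma drop_suffix: "drop (length p - length q) p = q \<longleftrightarrow> (\<exists>r. p = r @ q)"
proof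
 assume "drop (length p - length q) p = q"
 then have "p = take (length p - length q) p @ q" using append_take_drop_id[of "length p - length q" p] by simp
 then show "\<exists>r. p = r @ q" by blast
qed auto

text \<open>The contracting homotopy of the standard resolution. It sums over all ways of cutting
  the path into \<open>r @ q\<close> with \<open>q\<close> nonempty, lets \<open>r\<close> act on
  the basis element and keeps \<open>q\<close> in the flagged part.\<close>

definition rhom :: "('b, 'v, 'e, 'k::comm_ring_1) qcx => 'b \<times> 'e list \<times> bool => 'b \<times> 'e list \<times> bool => 'k" where
 "rhom X = (\<lambda>(b', q, g) (b, p, f). if g \<and> \<not> f \<and> q \<noteq> [] \<and> (b, p, f) \<in> lab (res X) \<and> drop (length p - length q) p = q
   then - sg (dg X b) * pm X (take (length p - length q) p) b' b else 0)"

lemma rhom_append: "rhom X (b', q, True) (b, r @ q, False) =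
  (if q \<noteq> [] \<and> (b, r @ q, False) \<in> lab (res X) then - sg (dg X b) * pm X r b' b else 0)"
 and rhom_other: "\<not> (\<exists>r. p = r @ q) ==> rhom X (b', q, g) (b, p, f) = 0"
 and rhom_flags: "f ==> rhom X (b', q, g) (b, p, f) = 0" "\<not> g ==> rhom X (b', q, g) (b, p, f) = 0"
  "rhom X (b', [], g) (b, p, f) = 0"
 by (auto simp: rhom_def drop_suffix)

lemma rhom_HM:
 fixes X :: "('b, 'v, 'e, 'k::comm_ring_1) qcx"
 assumes wf: "wfc Q X"
 shows "rhom X \<in> HM (res X) (res X) (- 1)"
 unfolding HM_def
proof (intro CollectI allI impI)
 fix t c :: "'b \<times> 'e list \<times> bool"
 assume nz: "rhom X t c \<noteq> 0"
 obtain b' q g where t: "t = (b', q, g)" by (cases t)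
 obtain b p f where c: "c = (b, p, f)" by (cases c)
 have fl: "g" "\<not> f" "q \<noteq> []" "\<exists>r. p = r @ q" using nz by (auto simp: t c rhom_def drop_suffix split: if_splits)
 then obtain r where r: "p = r @ q" by blast
 have L: "c \<in> lab (res X)" "pm X r b' b \<noteq> 0"
  using nz fl rhom_append[of X b' q b r] by (auto simp: t c r split: if_splits)
 show "t \<in> lab (res X) \<and> c \<in> lab (res X) \<and> vx (res X) t = vx (res X) c \<and> dg (res X) t = dg (res X) c + - 1"
  using pm_nonzero[OF wf L(2)] L(1) fl by (auto simp: t c r lab_res path_append)
qed

text \<open>On \<open>b \<otimes> p\<close> the sum over all cuts telescopes: each interior cut
  occurs twice with opposite signs, leaving the fully evaluated element minus
  \<open>b \<otimes> p\<close>.\<close>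

lemma rhom_homotopy:
 fixes X :: "('b, 'v, 'e, 'k::comm_ring_1) qcx"
 assumes wf: "wfc Q X"
 shows "mm (lab X) (rsec X None) (rmap X X (un X)) - un (res X) None =
  mm (lab (res X)) (dd (res X)) (rhom X) + mm (lab (res X)) (rhom X) (dd (res X))"
proof (intro ext)
 fix t c :: "'b \<times> 'e list \<times> bool"
 obtain b' q g where t: "t = (b', q, g)" by (cases t)
 obtain b p f where c: "c = (b, p, f)" by (cases c)
 note H = rhom_HM[OF wf]
 have zc: "rhom X u w = 0" if "w \<notin> lab (res X)" for u w using HM_zero[OF H] that by blast
 have zr: "rhom X u w = 0" if "u \<notin> lab (res X)" for u w using HM_zero[OF H] that by blast
 note dP = wfc_dd(1)[OF wfc_res[OF wf]]
 show "(mm (lab X) (rsec X None) (rmap X X (un X)) - un (res X) None) t c =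
  (mm (lab (res X)) (dd (res X)) (rhom X) + mm (lab (res X)) (rhom X) (dd (res X))) t c"
 proof (cases "t \<in> lab (res X) \<and> c \<in> lab (res X)")
  case False
  have "dd (res X) t u * rhom X u c = 0" "rhom X t u * dd (res X) u c = 0" for u
   using False zc[of c u] zr[of t u] HM_zero[OF dP, of t u] HM_zero[OF dP, of u c] by auto
  moreover have "un (res X) None t c = 0" using False by (auto simp: un_def)
  moreover have "mm (lab X) (rsec X None) (rmap X X (un X)) t c = 0"
  proof (cases "c \<in> lab (res X)")
   case True
   then have "t \<notin> lab (res X)" using False by simp
   then show ?thesis by (simp add: mm_def rsec_simps)
  qed (simp add: mm_def c rmap_simps)
  ultimately show ?thesis by (simp add: mm_def)
 next
  case True
  have b: "b' \<in> lab X" "b \<in> lab X" using True by (auto simp: t c lab_res)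
  have gq: "g ==> q \<noteq> []" and fp: "f ==> p \<noteq> []" using True by (auto simp: t c lab_res)
  have P: "mm (lab X) (rsec X None) (rmap X X (un X)) t c = (if q = [] \<and> \<not> g \<and> \<not> f then pm X p b' b else 0)"
  proof -
   have "rmap X X (un X) b' c = (if f then 0 else pm X p b' b)"
    using True by (simp add: c rmap_simps pm_un[OF wf] un_Some mm_linear)
   then show ?thesis using b by (simp add: t rsec_mm[OF wf])
  qed
  have U: "un (res X) None t c = (if b' = b \<and> q = p \<and> g = f then 1 else 0)" using True by (simp add: un_def t c)
  have row: "mm (lab (res X)) (dd (res X)) (rhom X) t c =
   (\<Sum>z\<in>lab X. dd X b' z * rhom X (z, q, g) c) + (if g then 0 else sg (dg X b') * rhom X (b', q, True) c
   - (\<Sum>e\<in>arcs Q. \<Sum>z\<in>lab X. sg (dg X z) * aa X e b' z * rhom X (z, e # q, True) c))"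
   unfolding t using True by (intro res_row_dd[OF wf] zr) (auto simp: t)
  have col: "mm (lab (res X)) (rhom X) (dd (res X)) t c =
   (\<Sum>z\<in>lab X. rhom X t (z, p, f) * dd X z b) + (if f then sg (dg X b) * (rhom X t (b, p, False)
   - (\<Sum>z\<in>lab X. rhom X t (z, tl p, False) * aa X (hd p) z b)) else 0)"
   unfolding c using True by (intro res_col_dd[OF wf] zc) (auto simp: c)
  have Lp: "dd X z b \<noteq> 0 ==> (z, p, False) \<in> lab (res X)" for z
   using True wfc_dd_simps[OF wf, of z b] by (auto simp: c lab_res)
  have Lt: "aa X (hd p) z b \<noteq> 0 ==> f ==> (z, tl p, False) \<in> lab (res X)" for z
   using True wfc_aa[OF wf, of "hd p" z b] by (cases p) (auto simp: c lab_res path_Cons)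
  have Lb: "(b, p, False) \<in> lab (res X)" using True by (auto simp: c lab_res)
  show ?thesis
  proof (cases g)
   case g: True
   have r0: "mm (lab (res X)) (dd (res X)) (rhom X) t c = (\<Sum>z\<in>lab X. dd X b' z * rhom X (z, q, True) c)"
    unfolding row using g by simp
   show ?thesis
   proof (cases f)
    case False
    \<comment> \<open>Both sums are supported on suffixes \<open>q\<close> of \<open>p\<close>.
      There they are the two composites of \<open>dd X\<close> and \<open>pm X r\<close>, with
      opposite signs because the differential raises the degree.\<close>
    have s0: "(\<Sum>z\<in>lab X. dd X b' z * rhom X (z, q, True) c) + (\<Sum>z\<in>lab X. rhom X t (z, p, f) * dd X z b) = 0"
    proof (cases "\<exists>r. p = r @ q")
     case True
     then obtain r where r: "p = r @ q" by blast
     have "(\<Sum>z\<in>lab X. dd X b' z * rhom X (z, q, True) c) = - sg (dg X b) * mm (lab X) (dd X) (pm X r) b' b"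
      unfolding mm_def sum_distrib_left using Lb gq[OF g] False
      by (intro sum.cong refl) (simp add: c r rhom_append mult.left_commute)
     moreover have "(\<Sum>z\<in>lab X. rhom X t (z, p, f) * dd X z b) = sg (dg X b) * mm (lab X) (pm X r) (dd X) b' b"
      unfolding mm_def sum_distrib_left
     proof (intro sum.cong refl)
      fix z
      show "rhom X t (z, p, f) * dd X z b = sg (dg X b) * (pm X r b' z * dd X z b)"
       using Lp[of z] wfc_dd_simps(4)[OF wf, of z b] gq[OF g] g False
       by (cases "dd X z b = 0") (auto simp: t r rhom_append sg_shift mult.assoc)
     qed
     ultimately show ?thesis by (simp add: pm_dd[OF wf])
    qed (simp add: c t rhom_other)
    show ?thesis unfolding plus_fun_apply minus_apply P U col r0 using s0 g False by simp
   next
    case f: True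
    obtain e p' where p': "p = e # p'" using fp[OF f] by (cases p) auto
    have r1: "(\<Sum>z\<in>lab X. dd X b' z * rhom X (z, q, True) c) = 0" "(\<Sum>z\<in>lab X. rhom X t (z, p, f) * dd X z b) = 0"
     using f by (simp_all add: c rhom_flags) (simp add: t rhom_flags)
    \<comment> \<open>The cuts of \<open>b \<otimes> p\<close> whose first part is not empty cancel
      the cuts of the remaining path, on whose basis element the first arrow has already acted. Only
      the empty first part survives and gives minus the identity.\<close>
    have m: "sg (dg X b) * (rhom X t (b, p, False) - (\<Sum>z\<in>lab X. rhom X t (z, tl p, False) * aa X (hd p) z b)) =
      - (if b' = b \<and> q = p then 1 else 0)"
    proof (cases "q = p")
     case True
     have "rhom X t (z, p', False) = 0" for z unfolding t by (rule rhom_other) (simp add: True p')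
     moreover have "rhom X t (b, [] @ p, False) = - sg (dg X b) * pm X [] b' b"
      unfolding t True using Lb g by (simp only: rhom_append[of X b' p b "[]"]) (simp add: p')
     ultimately show ?thesis using True b by (simp add: p' un_def)
    next
     case False
     show ?thesis
     proof (cases "\<exists>r. p' = r @ q")
      case True
      then obtain r where r: "p' = r @ q" by blast
      have 1: "rhom X t (b, p, False) = - sg (dg X b) * pm X (e # r) b' b"
       using rhom_append[of X b' q b "e # r"] Lb gq[OF g] g by (simp add: t p' r)
      have "(\<Sum>z\<in>lab X. rhom X t (z, tl p, False) * aa X (hd p) z b) = - sg (dg X b) * mm (lab X) (pm X r) (aa X e) b' b"
       unfolding mm_def sum_distrib_left
      proof (intro sum.cong refl)
       fix z
       show "rhom X t (z, tl p, False) * aa X (hd p) z b = - sg (dg X b) * (pm X r b' z * aa X e z b)"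
        using Lt[of z] wfc_aa(6)[OF wf, of e z b] gq[OF g] g f
        by (cases "aa X e z b = 0") (auto simp: t r p' rhom_append mult.assoc)
      qed
      then show ?thesis using 1 False by simp
     next
      case nr: False
      have "\<not> (\<exists>r. p = r @ q)" using nr False by (auto simp: p' Cons_eq_append_conv)
      then have "rhom X t (b, p, False) = 0" "rhom X t (z, p', False) = 0" for z
       using nr by (simp_all add: t rhom_other)
      then show ?thesis using False by (simp add: p')
     qed
    qed
    show ?thesis unfolding plus_fun_apply minus_apply P U col r0 r1 m using g f by simp
   qed
  next
   case g: False
   have c0: "mm (lab (res X)) (rhom X) (dd (res X)) t c = 0"
    unfolding col using g by (simp add: t rhom_flags)
   have r0: "(\<Sum>z\<in>lab X. dd X b' z * rhom X (z, q, g) c) = 0" using g by (simp add: c rhom_flags)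
   show ?thesis
   proof (cases f)
    case f: True
    have "mm (lab (res X)) (dd (res X)) (rhom X) t c = 0" unfolding row using f by (simp add: c rhom_flags)
    then show ?thesis unfolding plus_fun_apply minus_apply P U c0 using g f by simp
   next
    case f: False
    show ?thesis
    proof (cases "\<exists>r. p = r @ q")
     case nr: False
     have "\<not> (\<exists>r. p = r @ e # q)" for e
     proof
      assume "\<exists>r. p = r @ e # q"
      then obtain r where "p = (r @ [e]) @ q" by auto
      then show False using nr by blast
     qed
     then have "mm (lab (res X)) (dd (res X)) (rhom X) t c = 0"
      unfolding row r0 using nr by (simp add: c rhom_other)
     moreover have "q \<noteq> []" "q \<noteq> p" using nr by auto
     ultimately show ?thesis unfolding plus_fun_apply minus_apply P U c0 using g f by simp
    next
     case True
     then obtain r where r: "p = r @ q" by blast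
     have 1: "sg (dg X b') * rhom X (b', q, True) c = (if q \<noteq> [] then - pm X r b' b else 0)"
      using Lb f pm_nonzero[OF wf, of r b' b] by (cases "pm X r b' b = 0") (auto simp: c r rhom_append rhom_flags)
     have 2: "(\<Sum>e\<in>arcs Q. \<Sum>z\<in>lab X. sg (dg X z) * aa X e b' z * rhom X (z, e # q, True) c) = (if r = [] then 0 else - pm X r b' b)"
     \<comment> \<open>A flagged label with path \<open>e # q\<close> contributes only if
       \<open>e\<close> is the last arrow of \<open>r\<close>, so the double sum collapses to a
       single arrow.\<close>
     proof (cases r rule: rev_cases)
      case Nil
      then have "rhom X (z, e # q, True) c = 0" for z e unfolding c by (intro rhom_other) (auto simp: r)
      then show ?thesis by (simp add: Nil)
     next
      case (snoc r' a)
      have other: "rhom X (z, e # q, True) c = 0" if "e \<noteq> a" for z e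
       unfolding c using that by (intro rhom_other) (auto simp: r snoc)
      have a: "a \<in> arcs Q" using Lb by (auto simp: lab_res r snoc path_append path_Cons)
      have "(\<Sum>e\<in>arcs Q. \<Sum>z\<in>lab X. sg (dg X z) * aa X e b' z * rhom X (z, e # q, True) c) =
        (\<Sum>e\<in>arcs Q. if e = a then \<Sum>z\<in>lab X. sg (dg X z) * aa X a b' z * rhom X (z, a # q, True) c else 0)"
       by (intro sum.cong) (auto simp: other)
      also have "\<dots> = (\<Sum>z\<in>lab X. sg (dg X z) * aa X a b' z * rhom X (z, a # q, True) c)"
       using a fin_arcs by (simp add: sum.delta)
      also have "\<dots> = - mm (lab X) (aa X a) (pm X r') b' b"
       unfolding mm_def sum_negf[symmetric]
      proof (intro sum.cong refl)
       fix z
       have "rhom X (z, a # q, True) c = - sg (dg X b) * pm X r' z b"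
        using rhom_append[of X z "a # q" b r'] Lb f by (simp add: c r snoc)
       then show "sg (dg X z) * aa X a b' z * rhom X (z, a # q, True) c = - (aa X a b' z * pm X r' z b)"
        using pm_nonzero[OF wf, of r' z b] by (cases "pm X r' z b = 0") (auto simp: mult_ac)
      qed
      finally show ?thesis by (simp add: snoc pm_snoc[OF wf])
     qed
     have e: "(q = p) = (r = [])" by (auto simp: r)
     have m: "pm X [] b' b = (if b' = b then 1 else 0)" using b by (simp add: un_def)
     have pr: "pm X p b' b = pm X r b' b" if "q = []" using that by (simp add: r)
     show ?thesis
     proof (cases "r = []")
      case True
      then show ?thesis
       unfolding plus_fun_apply minus_apply P U c0 row r0 1 2 e using m pr g f by (cases "q = []") auto
     next
      case False
      then show ?thesis
       unfolding plus_fun_apply minus_apply P U c0 row r0 1 2 e using pr g f by (cases "q = []") auto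
     qed
    qed
   qed
  qed
 qed
qed

text \<open>The augmentation: the path acts on the basis element. The flagged part is killed because
  \<open>un\<close> has no components at arrows.\<close>

definition raug :: "('b, 'v, 'e, 'k::comm_ring_1) qcx => 'b => 'b \<times> 'e list \<times> bool => 'k" where
 "raug X = rmap X X (un X)"

lemma rmap_Z:
 fixes X :: "('b, 'v, 'e, 'k::comm_ring_1) qcx" and Y :: "('c, 'v, 'e, 'k) qcx"
 assumes wf: "wfc Q X" "wfc Q Y" and p: "\<phi> \<in> Z Q X Y i"
 shows "nm (rmap X Y \<phi>) \<in> Z Q (res X) Y i"
proof -
 have "rmap X Y 0 = 0" by (intro ext) (auto simp: rmap_def mm_linear)
 then have "D (res X) Y i (nm (rmap X Y \<phi>)) = 0"
  using p rmap_D[OF wf, of \<phi> i] by (simp add: Z_def nm_zero)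
 then show ?thesis using rmap_HM[OF wf, of \<phi> i] p by (simp add: Z_def nm_Tot)
qed

lemma raug_ST: "wfc Q X ==> raug X \<in> ST (res X) X 0"
 and raug_Z: "wfc Q X ==> nm (raug X) \<in> Z Q (res X) X 0"
 unfolding raug_def by (rule rmap_ST[OF _ _ un_Tot], assumption, assumption) (rule rmap_Z[OF _ _ un_Z])

lemma raug_hinv:
 fixes X :: "('b, 'v, 'e, 'k::comm_ring_1) qcx"
 assumes wf: "wfc Q X"
 shows "hinv Q (res X) X (nm (raug X))"
proof (rule hinv_of_vertices[OF wfc_res[OF wf] wf raug_Z[OF wf] rsec_Tot, of 0 "nm (rhom X)"])
 show "D X (res X) 0 (rsec X) None = 0" using rsec_Z[OF wf] by (simp add: Z_def)
 show "(cm (lab (res X)) (nm (raug X)) (rsec X) - un X - D X X (- 1) 0) None = 0"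
  using rmap_rsec[OF wf wf un_Tot] by (simp add: raug_def D_linear)
 show "(cm (lab X) (rsec X) (nm (raug X)) - un (res X) - D (res X) (res X) (- 1) (nm (rhom X))) None = 0"
  using rhom_homotopy[OF wf] by (simp add: raug_def D_None)
qed (auto simp: Tot_zero nm_Tot rhom_HM[OF wf])

text \<open>Both sides have the same composite with \<open>rsec\<close>, and \<open>rsec\<close>
  after the augmentation is the identity up to a coboundary. So every class becomes strict after
  pulling back to the resolution.\<close>

lemma rmap_class:
 fixes X :: "('b, 'v, 'e, 'k::comm_ring_1) qcx" and Y :: "('c, 'v, 'e, 'k) qcx"
 assumes wf: "wfc Q X" "wfc Q Y" and p: "\<phi> \<in> Z Q X Y 0"
 shows "cm (lab X) \<phi> (nm (raug X)) - nm (rmap X Y \<phi>) \<in> Bd Q (res X) Y 0"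
proof -
 note wr = wfc_res[OF wf(1)]
 let ?p = "nm (raug X)" and ?s = "rsec X" and ?R = "nm (rmap X Y \<phi>)"
 have ps: "cm (lab (res X)) ?p ?s = un X" unfolding raug_def by (rule rmap_rsec[OF wf(1) wf(1) un_Tot])
 have Rs: "cm (lab (res X)) ?R ?s = \<phi>" using p by (intro rmap_rsec[OF wf]) (auto simp: Z_def)
 note Z = raug_Z[OF wf(1)] rsec_Z[OF wf(1)] rmap_Z[OF wf p]
 have "cm (lab (res X)) ?p (cm (lab X) ?s ?p - un (res X)) = cm (lab X) (cm (lab (res X)) ?p ?s) ?p - ?p"
  by (simp add: cm_linear cm_assoc Z_wf_un(2)[OF wr Z(1)])
 also have "\<dots> = 0" by (simp add: ps Z_wf_un(1)[OF wf(1) Z(1)])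
 finally have "cm (lab (res X)) ?p (cm (lab X) ?s ?p - un (res X)) = 0" .
 then have sp: "cm (lab X) ?s ?p - un (res X) \<in> Bd Q (res X) (res X) 0"
  using Bd_zero by (intro hinv_cancel_left[OF wr wf(1) raug_hinv[OF wf(1)]] Z_diff Z0_cm[OF Z(2,1)] un_Z[OF wr]) auto
 have "cm (lab (res X)) (cm (lab X) \<phi> ?p - ?R) (cm (lab X) ?s ?p - un (res X)) \<in> Bd Q (res X) Y 0"
  by (intro Bd0_cm_right[OF _ sp] Z_diff Z0_cm[OF p Z(1)] Z(3))
 moreover have "cm (lab (res X)) (cm (lab X) \<phi> ?p - ?R) (cm (lab X) ?s ?p) = 0"
 proof -
  have "cm (lab (res X)) (cm (lab X) \<phi> ?p - ?R) ?s = 0"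
   by (simp add: cm_linear cm_assoc ps Rs Z_wf_un(2)[OF wf(1) p])
  then show ?thesis by (simp add: cm_assoc[symmetric] cm_linear)
 qed
 ultimately have "- (cm (lab X) \<phi> ?p - ?R) \<in> Bd Q (res X) Y 0"
  using Z_wf_un(2)[OF wr Z_diff[OF Z0_cm[OF p Z(1)] Z(3)]] by (simp add: cm_diff_right)
 from Bd_minus[OF this] show ?thesis by simp
qed

text \<open>A primitive of a strict map may have components at arrows and is then no homotopy of
  modules. On the resolution \<open>rmap\<close> turns it into a strict one.\<close>

lemma strict_null_homotopic:
 fixes X :: "('b, 'v, 'e, 'k::comm_ring_1) qcx" and Y :: "('c, 'v, 'e, 'k) qcx"
 assumes wf: "wfc Q X" "wfc Q Y" and M: "M \<in> ST X Y 0" "nm M \<in> Bd Q X Y 0"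
 shows "\<exists>h\<in>ST (res X) Y (- 1). mm (lab X) M (raug X) =
  mm (lab Y) (dd Y) h + mm (lab (res X)) h (dd (res X))"
proof -
 obtain \<beta> where b: "\<beta> \<in> Tot Q X Y (- 1)" "nm M = D X Y (- 1) \<beta>" using M(2) by (auto simp: Bd_def)
 have "rmap X Y (nm M) = mm (lab X) M (raug X)"
 proof (intro ext)
  fix y and c :: "'b \<times> 'e list \<times> bool"
  obtain b p f where c: "c = (b, p, f)" by (cases c)
  have "mm (lab X) M (raug X) y c = (if c \<in> lab (res X) then if f then 0 else mm (lab X) M (pm X p) y b else 0)"
   unfolding mm_def[of _ M] by (auto simp: raug_def c rmap_simps pm_un[OF wf(1)] un_Some mm_linear)
  then show "rmap X Y (nm M) y c = mm (lab X) M (raug X) y c"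
   using pm_ST[OF M(1) wf] by (auto simp: c rmap_simps mm_linear)
 qed
 moreover have "rmap X Y (nm M) = mm (lab Y) (dd Y) (rmap X Y \<beta>) + mm (lab (res X)) (rmap X Y \<beta>) (dd (res X))"
  using fun_cong[OF rmap_D[OF wf b(1)], of None] unfolding b(2)[symmetric] by (simp add: D_None)
 ultimately show ?thesis using rmap_ST[OF wf b(1)] by metis
qed

end

section \<open>Coordinates for complexes of modules\<close>

context fin_quiver
begin

abbreviation PP :: "'e list set" where
 "PP \<equiv> snd ` quiver_paths Q"

text \<open>The matrix by which an element of the path algebra acts.\<close>

definition am :: "('b, 'v, 'e, 'k::comm_ring_1) qcx => ('v \<times> 'e list => 'k) => 'b => 'b => 'k" where
 "am X r = (\<lambda>y x. \<Sum>p\<in>PP. r (vx X x, p) * pm X p y x)"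

lemma finite_PP: "finite PP"
 using fin_paths by simp

lemma carrier_path_algebra: "a \<in> carrier (path_algebra Q) \<longleftrightarrow> {w. a w \<noteq> 0} \<subseteq> quiver_paths Q"
 unfolding path_algebra_def using finite_subset[OF _ fin_paths] by auto

lemma am_add: "am X (\<lambda>w. r w + s w) = am X r + am X s"
 by (intro ext) (simp add: am_def distrib_right sum.distrib)

lemma am_const:
 fixes X :: "('b, 'v, 'e, 'k::field) qcx"
 assumes wf: "wfc Q X"
 shows "am X (\<lambda>(u, p). if u \<in> verts Q \<and> p = [] then l else 0) y x = l * un X None y x"
proof -
 have "am X (\<lambda>(u, p). if u \<in> verts Q \<and> p = [] then l else 0) y x = (\<Sum>p\<in>PP. if p = [] then l * un X None y x else 0)"
  unfolding am_def using wf by (intro sum.cong) (auto simp: un_def wfc_def)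
 also have "\<dots> = l * un X None y x"
 proof (cases "x \<in> lab X")
  case True
  then have "[] \<in> PP" using wf mem_paths[of "vx X x" "[]"] by (auto simp: wfc_def)
  then show ?thesis using finite_PP by (simp add: sum.delta)
 qed (auto simp: un_def intro: sum.neutral)
 finally show ?thesis .
qed

lemma am_ind:
 fixes X :: "('b, 'v, 'e, 'k::field) qcx"
 assumes "(u, q) \<in> quiver_paths Q"
 shows "am X (\<lambda>w. if w = (u, q) then 1 else 0) y x = (if vx X x = u then pm X q y x else 0)"
proof -
 have "am X (\<lambda>w. if w = (u, q) then 1 else 0) y x = (\<Sum>p\<in>PP. if p = q then if vx X x = u then pm X q y x else 0 else 0)"
  unfolding am_def by (intro sum.cong) auto
 then show ?thesis using finite_PP mem_paths[OF assms] by (simp add: sum.delta)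
qed

lemma path_arrow: "e \<in> arcs Q ==> (tail Q e, [e]) \<in> quiver_paths Q"
 using wellformed(2)[of e] by (auto simp: path_Cons)

lemma am_arrow:
 fixes X :: "('b, 'v, 'e, 'k::field) qcx"
 assumes wf: "wfc Q X" and e: "e \<in> arcs Q"
 shows "am X (\<lambda>w. if w = (tail Q e, [e]) then 1 else 0) = aa X e"
proof (intro ext)
 fix y x
 have "aa X e y x = 0" if "vx X x \<noteq> tail Q e" using wfc_aa(4)[OF wf, of e y x] that by auto
 then show "am X (\<lambda>w. if w = (tail Q e, [e]) then 1 else 0) y x = aa X e y x"
  unfolding am_ind[OF path_arrow[OF e]] by (simp add: aa_un[OF wf])
qed

text \<open>The order is reversed because modules are right modules. The convolution product is
  reindexed by pairs of paths, and pairs whose concatenation is no path have zero matrix.\<close>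

lemma am_mult:
 fixes X :: "('b, 'v, 'e, 'k::field) qcx"
 assumes wf: "wfc Q X"
 shows "am X (r \<otimes>\<^bsub>path_algebra Q\<^esub> s) = mm (lab X) (am X s) (am X r)"
proof (intro ext)
 fix y x
 let ?h = "\<lambda>(p, q). r (vx X x, p) * s (awlast (vx X x) p, q) * pm X (p @ q) y x"
 have cl: "take i w \<in> PP" "drop i w \<in> PP" if "w \<in> PP" for i w
 proof -
  obtain u where "(u, take i w @ drop i w) \<in> quiver_paths Q" using \<open>w \<in> PP\<close> by auto
  then show "take i w \<in> PP" "drop i w \<in> PP" unfolding path_append by (auto intro: mem_paths)
 qed
 have "am X (r \<otimes>\<^bsub>path_algebra Q\<^esub> s) y x = (\<Sum>w\<in>PP. \<Sum>i\<le>length w. ?h (take i w, drop i w))"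
  by (simp add: am_def path_algebra_def sum_distrib_right)
 also have "\<dots> = (\<Sum>(w, i)\<in>Sigma PP (\<lambda>w. {..length w}). ?h (take i w, drop i w))"
  using finite_PP by (intro sum.Sigma) auto
 also have "\<dots> = (\<Sum>t\<in>{(p, q). p \<in> PP \<and> q \<in> PP \<and> p @ q \<in> PP}. ?h t)"
  by (rule sum.reindex_bij_witness[of _ "\<lambda>(p, q). (p @ q, length p)" "\<lambda>(w, i). (take i w, drop i w)"])
   (auto intro: cl mem_paths simp del: append_take_drop_id simp add: append_take_drop_id)
 also have "\<dots> = (\<Sum>t\<in>PP \<times> PP. ?h t)"
 proof (rule sum.mono_neutral_left)
  show "\<forall>t\<in>PP \<times> PP - {(p, q). p \<in> PP \<and> q \<in> PP \<and> p @ q \<in> PP}. ?h t = 0"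
  proof
   fix t assume t: "t \<in> PP \<times> PP - {(p, q). p \<in> PP \<and> q \<in> PP \<and> p @ q \<in> PP}"
   obtain p q where pq: "t = (p, q)" by (cases t)
   then have "p @ q \<notin> PP" using t by auto
   then have "pm X (p @ q) y x = 0" using pm_nonzero[OF wf, of "p @ q" y x] mem_paths by blast
   then show "?h t = 0" by (simp add: pq)
  qed
 qed (use finite_PP in auto)
 also have "\<dots> = (\<Sum>p\<in>PP. \<Sum>q\<in>PP. \<Sum>z\<in>lab X. s (vx X z, q) * pm X q y z * (r (vx X x, p) * pm X p z x))"
  unfolding sum.cartesian_product[symmetric]
 proof (intro sum.cong refl)
  fix p q
  have e: "s (vx X z, q) * pm X q y z * (r (vx X x, p) * pm X p z x) = r (vx X x, p) * s (awlast (vx X x) p, q) * (pm X q y z * pm X p z x)" for z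
   using pm_nonzero[OF wf, of p z x] by (cases "pm X p z x = 0") (auto simp: mult_ac)
  show "r (vx X x, p) * s (awlast (vx X x) p, q) * pm X (p @ q) y x = (\<Sum>z\<in>lab X. s (vx X z, q) * pm X q y z * (r (vx X x, p) * pm X p z x))"
   unfolding pm_append[OF wf] mm_def sum_distrib_left by (intro sum.cong refl) (rule e[symmetric])
 qed
 also have "\<dots> = (\<Sum>p\<in>PP. \<Sum>z\<in>lab X. \<Sum>q\<in>PP. s (vx X z, q) * pm X q y z * (r (vx X x, p) * pm X p z x))"
  by (intro sum.cong refl) (rule sum.swap)
 also have "\<dots> = (\<Sum>z\<in>lab X. \<Sum>p\<in>PP. \<Sum>q\<in>PP. s (vx X z, q) * pm X q y z * (r (vx X x, p) * pm X p z x))"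
  by (rule sum.swap)
 also have "\<dots> = mm (lab X) (am X s) (am X r) y x"
  unfolding mm_def am_def sum_product by (rule sum.cong[OF refl], rule sum.swap)
 finally show "am X (r \<otimes>\<^bsub>path_algebra Q\<^esub> s) y x = mm (lab X) (am X s) (am X r) y x" .
qed

lemma am_HM_col: "wfc Q X ==> am X r y x \<noteq> 0 ==> y \<in> lab X \<and> x \<in> lab X \<and> dg X y = dg X x"
proof -
 assume wf: "wfc Q X" and "am X r y x \<noteq> 0"
 then obtain p where "pm X p y x \<noteq> 0"
  unfolding am_def using sum.neutral[of PP "\<lambda>p. r (vx X x, p) * pm X p y x"] by fastforce
 then show ?thesis using pm_nonzero[OF wf] by blast
qed

lemma am_ST:
 fixes X :: "('b, 'v, 'e, 'k::field) qcx" and Y :: "('c, 'v, 'e, 'k) qcx"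
 assumes M: "M \<in> ST X Y n" and wf: "wfc Q X" "wfc Q Y"
 shows "mm (lab Y) (am Y r) M = mm (lab X) M (am X r)"
proof (intro ext)
 fix y x
 have vM: "vx Y z = vx X x" if "M z x \<noteq> 0" for z using M that by (auto simp: ST_def HM_def)
 have "mm (lab Y) (am Y r) M y x = (\<Sum>z\<in>lab Y. \<Sum>p\<in>PP. r (vx X x, p) * (pm Y p y z * M z x))"
  unfolding mm_def am_def sum_distrib_right
 proof (intro sum.cong refl)
  fix z p
  show "r (vx Y z, p) * pm Y p y z * M z x = r (vx X x, p) * (pm Y p y z * M z x)"
   using vM[of z] by (cases "M z x = 0") auto
 qed
 also have "\<dots> = (\<Sum>p\<in>PP. r (vx X x, p) * mm (lab Y) (pm Y p) M y x)"
  by (subst sum.swap) (simp add: mm_def sum_distrib_left)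
 also have "\<dots> = (\<Sum>p\<in>PP. \<Sum>z\<in>lab X. M y z * (r (vx X x, p) * pm X p z x))"
  unfolding pm_ST[OF M wf] by (simp add: mm_def sum_distrib_left mult.left_commute)
 also have "\<dots> = mm (lab X) M (am X r) y x"
  by (subst sum.swap) (simp add: mm_def am_def sum_distrib_left)
 finally show "mm (lab Y) (am Y r) M y x = mm (lab X) M (am X r) y x" .
qed

text \<open>An isomorphism between a complex of modules and a complex in coordinates. Linearity of
  \<open>\<kappa>\<close> over the field is contained in its compatibility with the path
  algebra.\<close>

definition pres :: "('v \<times> 'e list => 'k::field, 'm) cochain => ('b, 'v, 'e, 'k) qcx => (int => 'm => 'b => 'k) => bool" where
 "pres X C \<kappa> \<longleftrightarrow> bounded_complex (path_algebra Q) X \<and> wfc Q C \<and>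
  (\<forall>i. bij_betw (\<kappa> i) (carrier (term_at X i)) (vec C i)) \<and>
  (\<forall>i. \<forall>x\<in>carrier (term_at X i). \<forall>y\<in>carrier (term_at X i). \<kappa> i (x \<oplus>\<^bsub>term_at X i\<^esub> y) = \<kappa> i x + \<kappa> i y) \<and>
  (\<forall>i. \<forall>r\<in>carrier (path_algebra Q). \<forall>x\<in>carrier (term_at X i).
    \<kappa> i (r \<odot>\<^bsub>term_at X i\<^esub> x) = mv (lab C) (am C r) (\<kappa> i x)) \<and>
  (\<forall>i. \<forall>x\<in>carrier (term_at X i). \<kappa> (i + 1) (diff_at X i x) = mv (lab C) (dd C) (\<kappa> i x))"

lemma ring_A: "ring (path_algebra Q)"
 using ring_path_algebra[OF wf_digraph_axioms fin_verts] .

lemma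
 assumes "pres X C \<kappa>"
 shows pres_bc: "bounded_complex (path_algebra Q) X"
  and pres_wf: "wfc Q C"
  and pres_module: "right_module (path_algebra Q) (term_at X i)"
  and pres_vec: "x \<in> carrier (term_at X i) ==> \<kappa> i x \<in> vec C i"
  and pres_inj: "x \<in> carrier (term_at X i) ==> y \<in> carrier (term_at X i) ==> \<kappa> i x = \<kappa> i y ==> x = y"
  and pres_surj: "c \<in> vec C i ==> \<exists>x\<in>carrier (term_at X i). \<kappa> i x = c"
  and pres_add: "x \<in> carrier (term_at X i) ==> y \<in> carrier (term_at X i) ==> \<kappa> i (x \<oplus>\<^bsub>term_at X i\<^esub> y) = \<kappa> i x + \<kappa> i y"
  and pres_act: "r \<in> carrier (path_algebra Q) ==> x \<in> carrier (term_at X i) ==>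
   \<kappa> i (r \<odot>\<^bsub>term_at X i\<^esub> x) = mv (lab C) (am C r) (\<kappa> i x)"
  and pres_diff: "x \<in> carrier (term_at X i) ==> \<kappa> (i + 1) (diff_at X i x) = mv (lab C) (dd C) (\<kappa> i x)"
  and pres_diff_hom: "diff_at X i \<in> rmod_hom (path_algebra Q) (term_at X i) (term_at X (i + 1))"
  and pres_diff_closed: "x \<in> carrier (term_at X i) ==> diff_at X i x \<in> carrier (term_at X (i + 1))"
proof -
 show bc: "bounded_complex (path_algebra Q) X" and "wfc Q C" using assms by (simp_all add: pres_def)
 show "right_module (path_algebra Q) (term_at X i)" using bc by (simp add: bounded_complex_def fg_right_module_def)
 have b: "bij_betw (\<kappa> i) (carrier (term_at X i)) (vec C i)" using assms by (simp add: pres_def)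
 show "x \<in> carrier (term_at X i) ==> \<kappa> i x \<in> vec C i" using bij_betwE[OF b] by blast
 show "x \<in> carrier (term_at X i) ==> y \<in> carrier (term_at X i) ==> \<kappa> i x = \<kappa> i y ==> x = y"
  by (rule inj_onD[OF bij_betw_imp_inj_on[OF b]])
 show "c \<in> vec C i ==> \<exists>x\<in>carrier (term_at X i). \<kappa> i x = c"
  unfolding bij_betw_imp_surj_on[OF b, symmetric] by blast
 show "x \<in> carrier (term_at X i) ==> y \<in> carrier (term_at X i) ==> \<kappa> i (x \<oplus>\<^bsub>term_at X i\<^esub> y) = \<kappa> i x + \<kappa> i y"
  "r \<in> carrier (path_algebra Q) ==> x \<in> carrier (term_at X i) ==>
   \<kappa> i (r \<odot>\<^bsub>term_at X i\<^esub> x) = mv (lab C) (am C r) (\<kappa> i x)"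
  "x \<in> carrier (term_at X i) ==> \<kappa> (i + 1) (diff_at X i x) = mv (lab C) (dd C) (\<kappa> i x)"
  using assms by (simp_all add: pres_def)
 show h: "diff_at X i \<in> rmod_hom (path_algebra Q) (term_at X i) (term_at X (i + 1))"
  using bc by (simp add: bounded_complex_def)
 show "x \<in> carrier (term_at X i) ==> diff_at X i x \<in> carrier (term_at X (i + 1))"
  using h by (auto simp: rmod_hom_def)
qed

lemma pres_group: "pres X C \<kappa> ==> abelian_group (term_at X i)"
 using pres_module right_module.axioms(2) by blast

lemma pres_zero: "pres X C \<kappa> ==> \<kappa> i \<zero>\<^bsub>term_at X i\<^esub> = 0"
 and pres_minus: "pres X C \<kappa> ==> x \<in> carrier (term_at X i) ==> \<kappa> i (\<ominus>\<^bsub>term_at X i\<^esub> x) = - \<kappa> i x"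
proof -
 assume p: "pres X C \<kappa>"
 interpret G: abelian_group "term_at X i" using pres_group[OF p] .
 have "\<kappa> i (\<zero>\<^bsub>term_at X i\<^esub> \<oplus>\<^bsub>term_at X i\<^esub> \<zero>\<^bsub>term_at X i\<^esub>) = \<kappa> i \<zero>\<^bsub>term_at X i\<^esub> + \<kappa> i \<zero>\<^bsub>term_at X i\<^esub>"
  by (rule pres_add[OF p]) auto
 then have "\<kappa> i \<zero>\<^bsub>term_at X i\<^esub> = \<kappa> i \<zero>\<^bsub>term_at X i\<^esub> + \<kappa> i \<zero>\<^bsub>term_at X i\<^esub>" by (simp only: G.l_zero[OF G.zero_closed])
 then show z: "\<kappa> i \<zero>\<^bsub>term_at X i\<^esub> = 0" by (simp only: add_cancel_right_right)
 assume x: "x \<in> carrier (term_at X i)"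
 have "\<kappa> i (\<ominus>\<^bsub>term_at X i\<^esub> x \<oplus>\<^bsub>term_at X i\<^esub> x) = \<kappa> i (\<ominus>\<^bsub>term_at X i\<^esub> x) + \<kappa> i x"
  using x by (intro pres_add[OF p]) auto
 then have "\<kappa> i (\<ominus>\<^bsub>term_at X i\<^esub> x) + \<kappa> i x = 0" using x by (simp only: G.l_neg z)
 then show "\<kappa> i (\<ominus>\<^bsub>term_at X i\<^esub> x) = - \<kappa> i x" by (rule eq_neg_iff_add_eq_0[THEN iffD2])
qed

text \<open>The field acts on a module only through these multiples of the unit, since modules carry
  no separate scalar multiplication.\<close>

definition scl :: "'k::field => 'v \<times> 'e list => 'k" where
 "scl l = (\<lambda>(u, p). if u \<in> verts Q \<and> p = [] then l else 0)"

lemma scl_carrier: "scl l \<in> carrier (path_algebra Q)"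
 unfolding carrier_path_algebra by (auto simp: scl_def split: if_splits)

lemma ind_carrier: "w \<in> quiver_paths Q ==> (\<lambda>w'. if w' = w then 1 else 0) \<in> carrier (path_algebra Q)"
 unfolding carrier_path_algebra by (auto split: if_splits)

lemma mv_am_scl: "wfc Q C ==> c \<in> vec C i ==> mv (lab C) (am C (scl l)) c = (\<lambda>x. l * c x)"
proof -
 assume a: "wfc Q C" "c \<in> vec C i"
 have "mv (lab C) (am C (scl l)) c = (\<lambda>y. l * mv (lab C) (un C None) c y)"
  unfolding scl_def mv_def am_const[OF a(1)] by (simp add: sum_distrib_left mult.assoc)
 then show ?thesis using mv_un[OF wfc_simps(1)[OF a(1)] a(2)] by simp
qed

definition ub :: "'b => 'b => 'k::field" where
 "ub x = (\<lambda>y. if y = x then 1 else 0)"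

lemma ub_vec: "x \<in> lab C ==> ub x \<in> vec C (dg C x)"
 by (auto simp: ub_def vec_def)

lemma mv_ub: "finite B ==> x \<in> B ==> mv B M (ub x) = (\<lambda>y. M y x)"
 by (auto simp: mv_def ub_def if_distrib cong: if_cong)

lemma linear_rep:
 fixes C :: "('b, 'v, 'e, 'k::field) qcx" and g :: "('b => 'k) => ('c => 'k)"
 assumes fin: "finite (lab C)"
  and add: "\<And>c c'. c \<in> vec C i ==> c' \<in> vec C i ==> g (c + c') = g c + g c'"
  and scale: "\<And>l c. c \<in> vec C i ==> g (\<lambda>x. l * c x) = (\<lambda>y. l * g c y)"
  and c: "c \<in> vec C i"
 shows "g c = mv (lab C) (\<lambda>y x. g (ub x) y) c"
proof -
 have "g (\<lambda>x. 0 * (0 :: 'b => 'k) x) = (\<lambda>y. 0 * g 0 y)" by (rule scale[OF vec_linear(4)])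
 then have z: "g (\<lambda>x. 0) = (\<lambda>y. 0)" by simp
 have ind: "finite F ==> F \<subseteq> {x \<in> lab C. dg C x = i} ==>
   g (\<lambda>x. if x \<in> F then c x else 0) = (\<lambda>y. \<Sum>x\<in>F. g (ub x) y * c x)" for F
 proof (induction F rule: finite_induct)
  case empty
  show ?case using z by simp
 next
  case (insert a F)
  have e: "(\<lambda>x. if x \<in> insert a F then c x else 0) = (\<lambda>x. c a * ub a x) + (\<lambda>x. if x \<in> F then c x else 0)"
   using insert(2) by (auto simp: fun_eq_iff ub_def)
  have u: "ub a \<in> vec C i" using insert(4) ub_vec[of a C] by auto
  have v: "(\<lambda>x. c a * ub a x) \<in> vec C i" "(\<lambda>x. if x \<in> F then c x else 0) \<in> vec C i"
   using insert(4) by (auto simp: vec_def ub_def)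
  show ?case unfolding e add[OF v] scale[OF u] insert.IH[OF subset_trans[OF subset_insertI insert(4)]]
   using insert(1,2) by (simp add: fun_eq_iff mult.commute)
 qed
 have "g (\<lambda>x. if x \<in> {x \<in> lab C. dg C x = i} then c x else 0) = (\<lambda>y. \<Sum>x\<in>{x \<in> lab C. dg C x = i}. g (ub x) y * c x)"
  by (rule ind) (simp_all add: fin)
 moreover have "(\<lambda>x. if x \<in> {x \<in> lab C. dg C x = i} then c x else 0) = c"
  using c by (auto simp: vec_def fun_eq_iff)
 moreover have "(\<Sum>x\<in>{x \<in> lab C. dg C x = i}. g (ub x) y * c x) = (\<Sum>x\<in>lab C. g (ub x) y * c x)" for y
  using c fin by (intro sum.mono_neutral_left) (auto simp: vec_def)
 ultimately show ?thesis by (simp add: mv_def)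
qed

text \<open>Families of module maps of degree \<open>n\<close> that ignore the differentials, so
  that chain maps and homotopies are handled alike, with \<open>n\<close> equal to zero and minus
  one.\<close>

definition fam :: "('v \<times> 'e list => 'k::field, 'm) cochain => ('v \<times> 'e list => 'k, 'n) cochain => int => (int => 'm => 'n) => bool" where
 "fam X Y n f \<longleftrightarrow> (\<forall>i. f i \<in> rmod_hom (path_algebra Q) (term_at X i) (term_at Y (i + n)))"

definition ki :: "('v \<times> 'e list => 'k::field, 'm) cochain => (int => 'm => 'b => 'k) => int => ('b => 'k) => 'm" where
 "ki X \<kappa> i = inv_into (carrier (term_at X i)) (\<kappa> i)"

lemma ki: "pres X C \<kappa> ==> c \<in> vec C i ==> ki X \<kappa> i c \<in> carrier (term_at X i)"
  "pres X C \<kappa> ==> c \<in> vec C i ==> \<kappa> i (ki X \<kappa> i c) = c"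
  "pres X C \<kappa> ==> x \<in> carrier (term_at X i) ==> ki X \<kappa> i (\<kappa> i x) = x"
proof -
 assume "pres X C \<kappa>"
 then have b: "bij_betw (\<kappa> i) (carrier (term_at X i)) (vec C i)" by (simp add: pres_def)
 then have s: "\<kappa> i ` carrier (term_at X i) = vec C i" by (rule bij_betw_imp_surj_on)
 show "c \<in> vec C i ==> ki X \<kappa> i c \<in> carrier (term_at X i)"
  unfolding ki_def by (rule inv_into_into) (simp add: s)
 show "c \<in> vec C i ==> \<kappa> i (ki X \<kappa> i c) = c"
  unfolding ki_def by (rule f_inv_into_f) (simp add: s)
 show "x \<in> carrier (term_at X i) ==> ki X \<kappa> i (\<kappa> i x) = x"
  unfolding ki_def by (rule inv_into_f_f[OF bij_betw_imp_inj_on[OF b]])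
qed

definition matf :: "('v \<times> 'e list => 'k::field, 'm) cochain => ('b, 'v, 'e, 'k) qcx => (int => 'm => 'b => 'k) =>
  (int => 'n => 'c => 'k) => int => (int => 'm => 'n) => 'c => 'b => 'k" where
 "matf X C \<kappa> \<kappa>' n f = (\<lambda>y x. if x \<in> lab C then \<kappa>' (dg C x + n) (f (dg C x) (ki X \<kappa> (dg C x) (ub x))) y else 0)"

lemma famD:
 assumes "fam X Y n f" "x \<in> carrier (term_at X i)"
 shows "f i x \<in> carrier (term_at Y (i + n))"
  and "y \<in> carrier (term_at X i) ==> f i (x \<oplus>\<^bsub>term_at X i\<^esub> y) = f i x \<oplus>\<^bsub>term_at Y (i + n)\<^esub> f i y"
  and "r \<in> carrier (path_algebra Q) ==> f i (r \<odot>\<^bsub>term_at X i\<^esub> x) = r \<odot>\<^bsub>term_at Y (i + n)\<^esub> f i x"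
 using assms unfolding fam_def rmod_hom_def by (fastforce simp: PiE_def Pi_def)+

lemma matf_apply:
 assumes p: "pres X C \<kappa>" and q: "pres Y C' \<kappa>'" and f: "fam X Y n f" and x: "x \<in> carrier (term_at X i)"
 shows "\<kappa>' (i + n) (f i x) = mv (lab C) (matf X C \<kappa> \<kappa>' n f) (\<kappa> i x)"
proof -
 interpret MX: right_module "path_algebra Q" "term_at X i" by (rule pres_module[OF p])
 define g where "g c = \<kappa>' (i + n) (f i (ki X \<kappa> i c))" for c
 note fin = wfc_simps(1)[OF pres_wf[OF p]]
 have "g (\<kappa> i x) = mv (lab C) (\<lambda>y x. g (ub x) y) (\<kappa> i x)"
 proof (rule linear_rep[OF fin])
  fix c c' assume c: "c \<in> vec C i" "c' \<in> vec C i"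
  have "ki X \<kappa> i (c + c') = ki X \<kappa> i c \<oplus>\<^bsub>term_at X i\<^esub> ki X \<kappa> i c'"
   using c by (intro pres_inj[OF p, of _ i]) (simp_all add: ki[OF p] vec_linear pres_add[OF p] MX.M.a_closed)
  then show "g (c + c') = g c + g c'"
   using c by (simp add: g_def famD[OF f] ki[OF p] pres_add[OF q])
 next
  fix l c assume c: "c \<in> vec C i"
  have lc: "(\<lambda>x. l * c x) \<in> vec C i" using c by (auto simp: vec_def)
  have "ki X \<kappa> i (\<lambda>x. l * c x) = scl l \<odot>\<^bsub>term_at X i\<^esub> ki X \<kappa> i c"
   using c lc by (intro pres_inj[OF p, of _ i])
    (simp_all add: ki[OF p] pres_act[OF p] scl_carrier MX.act_closed mv_am_scl[OF pres_wf[OF p]])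
  then show "g (\<lambda>x. l * c x) = (\<lambda>y. l * g c y)"
   using c by (simp add: g_def famD[OF f] ki[OF p] pres_act[OF q] scl_carrier
     mv_am_scl[OF pres_wf[OF q] pres_vec[OF q]])
 qed (rule pres_vec[OF p x])
 also have "\<dots> = mv (lab C) (matf X C \<kappa> \<kappa>' n f) (\<kappa> i x)"
 proof
  fix y
  have e: "g (ub z) y * \<kappa> i x z = matf X C \<kappa> \<kappa>' n f y z * \<kappa> i x z" if "z \<in> lab C" for z
   using pres_vec[OF p x] that by (cases "\<kappa> i x z = 0") (auto simp: vec_def matf_def g_def)
  show "mv (lab C) (\<lambda>y x. g (ub x) y) (\<kappa> i x) y = mv (lab C) (matf X C \<kappa> \<kappa>' n f) (\<kappa> i x) y"
   unfolding mv_def by (rule sum.cong[OF refl e])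
 qed
 finally show ?thesis by (simp add: g_def ki[OF p] x)
qed

lemma mat_eqI:
 assumes "\<And>x. x \<in> lab C ==> mv (lab C) M (ub x) = mv (lab C) N (ub x)" "finite (lab C)"
  "\<And>x y. x \<notin> lab C ==> M y x = 0" "\<And>x y. x \<notin> lab C ==> N y x = 0"
 shows "M = N"
proof (intro ext)
 fix y x
 show "M y x = N y x"
 proof (cases "x \<in> lab C")
  case True
  have "mv (lab C) M (ub x) y = mv (lab C) N (ub x) y" using assms(1)[OF True] by (rule fun_cong)
  then show ?thesis by (simp only: mv_ub[OF assms(2) True])
 qed (simp add: assms)
qed

text \<open>Compatibility with the idempotents of the vertices forces the matrix to preserve
  vertices, and compatibility with the arrows is strictness.\<close>

lemma matf_ST:
 fixes X :: "('v \<times> 'e list => 'k::field, 'm) cochain" and Y :: "('v \<times> 'e list => 'k, 'n) cochain"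
 assumes p: "pres X C \<kappa>" and q: "pres Y C' \<kappa>'" and f: "fam X Y n f"
 shows "matf X C \<kappa> \<kappa>' n f \<in> ST C C' n"
proof -
 let ?M = "matf X C \<kappa> \<kappa>' n f"
 note wf = pres_wf[OF p] pres_wf[OF q]
 note fin = wfc_simps(1)[OF wf(1)] wfc_simps(1)[OF wf(2)]
 have zM: "?M y x = 0" if "x \<notin> lab C" for x y using that by (simp add: matf_def)
 have vM: "(\<lambda>y. ?M y x) \<in> vec C' (dg C x + n)" if x: "x \<in> lab C" for x
 proof -
  have "(\<lambda>y. ?M y x) = \<kappa>' (dg C x + n) (f (dg C x) (ki X \<kappa> (dg C x) (ub x)))" using x by (simp add: matf_def)
  also have "\<dots> \<in> vec C' (dg C x + n)" by (rule pres_vec[OF q famD(1)[OF f ki(1)[OF p ub_vec[OF x]]]])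
  finally show ?thesis .
 qed
 have comm: "mm (lab C') (am C' r) ?M = mm (lab C) ?M (am C r)" if r: "r \<in> carrier (path_algebra Q)" for r
 proof (rule mat_eqI[OF _ fin(1)])
  fix x assume x: "x \<in> lab C"
  let ?i = "dg C x"
  let ?\<xi> = "ki X \<kappa> ?i (ub x)"
  interpret MX: right_module "path_algebra Q" "term_at X ?i" by (rule pres_module[OF p])
  note xi = ki(1,2)[OF p ub_vec[OF x]]
  have "mv (lab C) (mm (lab C') (am C' r) ?M) (ub x) = \<kappa>' (?i + n) (r \<odot>\<^bsub>term_at Y (?i + n)\<^esub> f ?i ?\<xi>)"
   using matf_apply[OF p q f xi(1)] by (simp add: mv_mv[symmetric] pres_act[OF q r famD(1)[OF f xi(1)]] xi(2))
  also have "\<dots> = \<kappa>' (?i + n) (f ?i (r \<odot>\<^bsub>term_at X ?i\<^esub> ?\<xi>))" by (simp add: famD(3)[OF f xi(1) r])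
  also have "\<dots> = mv (lab C) (mm (lab C) ?M (am C r)) (ub x)"
   using matf_apply[OF p q f MX.act_closed[OF r xi(1)]] by (simp add: mv_mv[symmetric] pres_act[OF p r xi(1)] xi(2))
  finally show "mv (lab C) (mm (lab C') (am C' r) ?M) (ub x) = mv (lab C) (mm (lab C) ?M (am C r)) (ub x)" .
 next
  fix x y assume x: "x \<notin> lab C"
  then show "mm (lab C') (am C' r) ?M y x = 0" by (simp add: mm_def zM)
  have "am C r z x = 0" for z using am_HM_col[OF wf(1), of r z x] x by blast
  then show "mm (lab C) ?M (am C r) y x = 0" by (simp add: mm_def)
 qed
 have vert: "vx C' y = vx C x" if nz: "?M y x \<noteq> 0" for y x
 proof (rule ccontr)
  assume ne: "vx C' y \<noteq> vx C x"
  have x: "x \<in> lab C" using zM nz by blast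
  then have yl: "y \<in> lab C'" using vM[OF x] nz by (auto simp: vec_def)
  have v: "(vx C x, []) \<in> quiver_paths Q" using wf(1) x by (auto simp: wfc_def)
  let ?r = "\<lambda>w. if w = (vx C x, []) then 1 else 0 :: 'k"
  have a: "am C' ?r y z = 0" for z
   unfolding am_ind[OF v] using ne by (auto simp: un_def)
  have b: "am C ?r z x = (if z = x then 1 else 0)" for z
   unfolding am_ind[OF v] using x by (auto simp: un_def)
  have "mm (lab C') (am C' ?r) ?M y x = 0" by (simp add: mm_def a)
  moreover have "mm (lab C) ?M (am C ?r) y x = ?M y x"
   unfolding mm_def b using x fin(1) by (simp add: if_distrib sum.delta cong: if_cong)
  ultimately show False using comm[OF ind_carrier[OF v]] nz by simp
 qed
 have HM: "?M \<in> HM C C' n"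
  unfolding HM_def
 proof (intro CollectI allI impI)
  fix y x assume nz: "?M y x \<noteq> 0"
  then have x: "x \<in> lab C" using zM by blast
  then show "y \<in> lab C' \<and> x \<in> lab C \<and> vx C' y = vx C x \<and> dg C' y = dg C x + n"
   using vM[OF x] nz vert[OF nz] by (auto simp: vec_def)
 qed
 moreover have "mm (lab C') (aa C' e) ?M = mm (lab C) ?M (aa C e)" for e
 proof (cases "e \<in> arcs Q")
  case True
  show ?thesis
   using comm[OF ind_carrier[OF path_arrow[OF True]]] by (simp add: am_arrow[OF _ True] wf)
 next
  case False
  then have "aa C e = 0" "aa C' e = 0" using wfc_aa(3)[OF wf(1), of e] wfc_aa(3)[OF wf(2), of e] by (auto simp: fun_eq_iff)
  then show ?thesis by (simp add: mm_linear)
 qed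
 ultimately show ?thesis by (simp add: ST_def)
qed

definition fmat :: "('v \<times> 'e list => 'k::field, 'm) cochain => ('b, 'v, 'e, 'k) qcx => (int => 'm => 'b => 'k) =>
  ('v \<times> 'e list => 'k, 'n) cochain => (int => 'n => 'c => 'k) => int => ('c => 'b => 'k) => int => 'm => 'n" where
 "fmat X C \<kappa> Y \<kappa>' n M = (\<lambda>i. \<lambda>x\<in>carrier (term_at X i). ki Y \<kappa>' (i + n) (mv (lab C) M (\<kappa> i x)))"

lemma fmat_apply:
 assumes p: "pres X C \<kappa>" and q: "pres Y C' \<kappa>'" and M: "M \<in> ST C C' n" and x: "x \<in> carrier (term_at X i)"
 shows "fmat X C \<kappa> Y \<kappa>' n M i x \<in> carrier (term_at Y (i + n))"
  and "\<kappa>' (i + n) (fmat X C \<kappa> Y \<kappa>' n M i x) = mv (lab C) M (\<kappa> i x)"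
proof -
 have "mv (lab C) M (\<kappa> i x) \<in> vec C' (i + n)"
  using M mv_vec[OF _ pres_vec[OF p x]] by (auto simp: ST_def)
 then show "fmat X C \<kappa> Y \<kappa>' n M i x \<in> carrier (term_at Y (i + n))"
  "\<kappa>' (i + n) (fmat X C \<kappa> Y \<kappa>' n M i x) = mv (lab C) M (\<kappa> i x)"
  using x by (simp_all add: fmat_def ki[OF q])
qed

lemma fmat_fam:
 assumes p: "pres X C \<kappa>" and q: "pres Y C' \<kappa>'" and M: "M \<in> ST C C' n"
 shows "fam X Y n (fmat X C \<kappa> Y \<kappa>' n M)"
 unfolding fam_def
proof
 fix i
 interpret MX: right_module "path_algebra Q" "term_at X i" by (rule pres_module[OF p])
 interpret MY: right_module "path_algebra Q" "term_at Y (i + n)" by (rule pres_module[OF q])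
 note F = fmat_apply[OF p q M]
 show "fmat X C \<kappa> Y \<kappa>' n M i \<in> rmod_hom (path_algebra Q) (term_at X i) (term_at Y (i + n))"
  unfolding rmod_hom_def
 proof (intro CollectI conjI ballI)
  show "fmat X C \<kappa> Y \<kappa>' n M i \<in> carrier (term_at X i) \<rightarrow>\<^sub>E carrier (term_at Y (i + n))"
   using F(1)[of _ i] by (auto simp: fmat_def)
  show "fmat X C \<kappa> Y \<kappa>' n M i (x \<oplus>\<^bsub>term_at X i\<^esub> y) = fmat X C \<kappa> Y \<kappa>' n M i x \<oplus>\<^bsub>term_at Y (i + n)\<^esub> fmat X C \<kappa> Y \<kappa>' n M i y"
   if "x \<in> carrier (term_at X i)" "y \<in> carrier (term_at X i)" for x y
   using that by (intro pres_inj[OF q, of _ "i + n"]) (simp_all add: F pres_add[OF q] pres_add[OF p] mv_linear MX.M.a_closed MY.M.a_closed)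
  show "fmat X C \<kappa> Y \<kappa>' n M i (r \<odot>\<^bsub>term_at X i\<^esub> x) = r \<odot>\<^bsub>term_at Y (i + n)\<^esub> fmat X C \<kappa> Y \<kappa>' n M i x"
   if "r \<in> carrier (path_algebra Q)" "x \<in> carrier (term_at X i)" for r x
   using that by (intro pres_inj[OF q, of _ "i + n"])
    (simp_all add: F MX.act_closed MY.act_closed pres_act[OF q] pres_act[OF p] mv_mv am_ST[OF M pres_wf[OF p] pres_wf[OF q]])
 qed
qed

lemma matf_unique:
 assumes p: "pres X C \<kappa>" and N: "N \<in> HM C C' n"
  and eq: "\<And>i x. x \<in> carrier (term_at X i) ==> \<kappa>' (i + n) (f i x) = mv (lab C) N (\<kappa> i x)"
 shows "matf X C \<kappa> \<kappa>' n f = N"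
proof (intro ext)
 fix y x
 show "matf X C \<kappa> \<kappa>' n f y x = N y x"
 proof (cases "x \<in> lab C")
  case True
  have "\<kappa>' (dg C x + n) (f (dg C x) (ki X \<kappa> (dg C x) (ub x))) = mv (lab C) N (ub x)"
   using eq[OF ki(1)[OF p ub_vec[OF True]]] ki(2)[OF p ub_vec[OF True]] by simp
  then show ?thesis using True by (simp add: matf_def mv_ub[OF wfc_simps(1)[OF pres_wf[OF p]] True])
 next
  case False
  then show ?thesis using N by (auto simp: matf_def HM_def)
 qed
qed

lemma matf_fmat:
 assumes p: "pres X C \<kappa>" and q: "pres Y C' \<kappa>'" and M: "M \<in> ST C C' n"
 shows "matf X C \<kappa> \<kappa>' n (fmat X C \<kappa> Y \<kappa>' n M) = M"
 using M by (intro matf_unique[OF p _ fmat_apply(2)[OF p q M]]) (auto simp: ST_def)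

end

section \<open>Generators of the path algebra\<close>

context fin_quiver
begin

definition ind :: "'v \<times> 'e list => 'v \<times> 'e list => 'k::field" where
 "ind w = (\<lambda>w'. if w' = w then 1 else 0)"

lemma ind_closed: "w \<in> quiver_paths Q ==> ind w \<in> carrier (path_algebra Q)"
 unfolding ind_def by (rule ind_carrier)

lemma path_algebra_simps:
 "(r \<otimes>\<^bsub>path_algebra Q\<^esub> s) (u, p) = (\<Sum>i\<le>length p. r (u, take i p) * s (awlast u (take i p), drop i p))"
 "(r \<oplus>\<^bsub>path_algebra Q\<^esub> s) = (\<lambda>w. r w + s w)"
 "\<zero>\<^bsub>path_algebra Q\<^esub> = (\<lambda>w. 0)"
 "\<one>\<^bsub>path_algebra Q\<^esub> = scl 1"
 by (simp_all add: path_algebra_def scl_def)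

lemma ind_mult:
 assumes "(u, p @ q) \<in> quiver_paths Q"
 shows "ind (u, p) \<otimes>\<^bsub>path_algebra Q\<^esub> ind (awlast u p, q) = (ind (u, p @ q) :: _ => 'k::field)"
proof (intro ext, clarify)
 fix u' p'
 have "(ind (u, p) \<otimes>\<^bsub>path_algebra Q\<^esub> ind (awlast u p, q)) (u', p') =
   (\<Sum>i\<le>length p'. if i = length p then (if (u', p') = (u, p @ q) then 1 else 0 :: 'k) else 0)"
  unfolding path_algebra_simps
 proof (intro sum.cong refl)
  fix i assume i: "i \<in> {..length p'}"
  show "ind (u, p) (u', take i p') * ind (awlast u p, q) (awlast u' (take i p'), drop i p') =
    (if i = length p then (if (u', p') = (u, p @ q) then 1 else 0 :: 'k) else 0)"
  proof (cases "take i p' = p \<and> u' = u")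
   case True
   then have "i = length p" using i by auto
   moreover have "p' = p @ drop i p'" using True append_take_drop_id[of i p'] by simp
   ultimately show ?thesis using True by (auto simp: ind_def)
  next
   case False
   then have r0: "\<not> (i = length p \<and> (u', p') = (u, p @ q))" by auto
   have l0: "ind (u, p) (u', take i p') = (0::'k)" using False by (auto simp: ind_def)
   show ?thesis using r0 by (auto simp: l0)
  qed
 qed
 then show "(ind (u, p) \<otimes>\<^bsub>path_algebra Q\<^esub> ind (awlast u p, q)) (u', p') = (ind (u, p @ q) :: _ => 'k) (u', p')"
  by (auto simp: ind_def sum.delta)
qed

lemma scl_mult:
 assumes "\<And>w. w \<notin> quiver_paths Q ==> r w = 0"
 shows "scl l \<otimes>\<^bsub>path_algebra Q\<^esub> r = (\<lambda>w. l * r w :: 'k::field)"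
proof (intro ext, clarify)
 fix u p
 have "(scl l \<otimes>\<^bsub>path_algebra Q\<^esub> r) (u, p) = (\<Sum>i\<le>length p. if i = 0 then l * r (u, p) else 0)"
  unfolding path_algebra_simps
 proof (intro sum.cong refl)
  fix i assume i: "i \<in> {..length p}"
  have "u \<in> verts Q" if "(u, p) \<in> quiver_paths Q" using that by (cases p) (auto simp: path_Cons)
  then show "scl l (u, take i p) * r (awlast u (take i p), drop i p) = (if i = 0 then l * r (u, p) else 0)"
   using i assms[of "(u, p)"] by (cases "i = 0") (auto simp: scl_def)
 qed
 then show "(scl l \<otimes>\<^bsub>path_algebra Q\<^esub> r) (u, p) = l * r (u, p)" by (simp add: sum.delta)
qed

text \<open>Scalars, idempotents of vertices and arrows generate the path algebra, so compatibility
  with its action needs to be checked on these only.\<close>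

lemma path_algebra_induct:
 fixes r :: "'v \<times> 'e list => 'k::field"
 assumes r: "r \<in> carrier (path_algebra Q)"
  and add: "\<And>a b. a \<in> carrier (path_algebra Q) ==> b \<in> carrier (path_algebra Q) ==> P a ==> P b ==> P (a \<oplus>\<^bsub>path_algebra Q\<^esub> b)"
  and mult: "\<And>a b. a \<in> carrier (path_algebra Q) ==> b \<in> carrier (path_algebra Q) ==> P a ==> P b ==> P (a \<otimes>\<^bsub>path_algebra Q\<^esub> b)"
  and scalar: "\<And>l. P (scl l)" and vert: "\<And>v. v \<in> verts Q ==> P (ind (v, []))"
  and arrow: "\<And>e. e \<in> arcs Q ==> P (ind (tail Q e, [e]))"
 shows "P r"
proof -
 have path: "(u, p) \<in> quiver_paths Q ==> P (ind (u, p))" for u p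
 proof (induction p arbitrary: u)
  case Nil
  then show ?case using vert by simp
 next
  case (Cons e p)
  then have e: "e \<in> arcs Q" "tail Q e = u" "(head Q e, p) \<in> quiver_paths Q" by (auto simp: path_Cons)
  have "P (ind (u, [e]) \<otimes>\<^bsub>path_algebra Q\<^esub> ind (awlast u [e], p))"
   using arrow[OF e(1)] Cons.IH[OF e(3)] path_arrow[OF e(1)] e by (intro mult ind_closed) auto
  then show ?case using ind_mult[where 'k = 'k, of u "[e]" p] Cons.prems by simp
 qed
 have "finite F ==> F \<subseteq> quiver_paths Q ==> (\<lambda>w. if w \<in> F then r w else 0) \<in> carrier (path_algebra Q) \<and> P (\<lambda>w. if w \<in> F then r w else 0)" for F
 proof (induction F rule: finite_induct)
  case empty
  have e: "(\<lambda>w. if w \<in> {} then r w else 0) = scl 0" by (auto simp: scl_def)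
  show ?case unfolding e using scalar[of 0] by (intro conjI scl_carrier)
 next
  case (insert w F)
  obtain u p where w: "w = (u, p)" by (cases w)
  have c: "scl (r w) \<otimes>\<^bsub>path_algebra Q\<^esub> ind w \<in> carrier (path_algebra Q)"
   using insert.prems by (intro ring.ring_simprules(5)[OF ring_A] scl_carrier ind_closed) auto
  have s: "scl (r w) \<otimes>\<^bsub>path_algebra Q\<^esub> ind w = (\<lambda>w'. if w' = w then r w else 0)"
   using insert.prems by (subst scl_mult) (auto simp: ind_def)
  have P1: "P (scl (r w) \<otimes>\<^bsub>path_algebra Q\<^esub> ind w)"
   using insert.prems path[of u p] by (intro mult scl_carrier ind_closed scalar) (auto simp: w)
  have sum: "(\<lambda>w'. if w' \<in> insert w F then r w' else 0) =
    (scl (r w) \<otimes>\<^bsub>path_algebra Q\<^esub> ind w) \<oplus>\<^bsub>path_algebra Q\<^esub> (\<lambda>w'. if w' \<in> F then r w' else 0)"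
   unfolding s path_algebra_simps using insert(2) by (intro ext) auto
  have IH: "(\<lambda>w. if w \<in> F then r w else 0) \<in> carrier (path_algebra Q)" "P (\<lambda>w. if w \<in> F then r w else 0)"
   using insert by auto
  show ?case unfolding sum by (intro conjI ring.ring_simprules(1)[OF ring_A] add c IH P1)
 qed
 from this[OF fin_paths] have "P (\<lambda>w. if w \<in> quiver_paths Q then r w else 0)" by simp
 moreover have "(\<lambda>w. if w \<in> quiver_paths Q then r w else 0) = r"
  using r unfolding carrier_path_algebra by (intro ext) auto
 ultimately show ?thesis by simp
qed

end

section \<open>Homogeneous bases of finitely generated modules\<close>

locale qmod = fin_quiver Q for Q :: "('v, 'e) pre_digraph" +
 fixes M :: "('v \<times> 'e list => 'k::field, 'm) module"
 assumes rm: "right_module (path_algebra Q) M"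
begin

sublocale RM: right_module "path_algebra Q" M
 by (rule rm)

definition lc :: "'m set => ('m => 'k) => 'm" where
 "lc F c = (\<Oplus>\<^bsub>M\<^esub>g\<in>F. scl (c g) \<odot>\<^bsub>M\<^esub> g)"

lemma scl_act_closed: "x \<in> carrier M ==> scl l \<odot>\<^bsub>M\<^esub> x \<in> carrier M"
 by (rule RM.act_closed[OF scl_carrier])

lemma scl_act:
 assumes x: "x \<in> carrier M"
 shows "scl (a + b) \<odot>\<^bsub>M\<^esub> x = scl a \<odot>\<^bsub>M\<^esub> x \<oplus>\<^bsub>M\<^esub> scl b \<odot>\<^bsub>M\<^esub> x"
  and "scl (a * b) \<odot>\<^bsub>M\<^esub> x = scl a \<odot>\<^bsub>M\<^esub> (scl b \<odot>\<^bsub>M\<^esub> x)"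
  and "scl 1 \<odot>\<^bsub>M\<^esub> x = x" and "scl 0 \<odot>\<^bsub>M\<^esub> x = \<zero>\<^bsub>M\<^esub>"
proof -
 have "scl a \<oplus>\<^bsub>path_algebra Q\<^esub> scl b = (scl (a + b) :: _ => 'k)" for a b
  unfolding path_algebra_simps by (auto simp: scl_def)
 then show add: "scl (a + b) \<odot>\<^bsub>M\<^esub> x = scl a \<odot>\<^bsub>M\<^esub> x \<oplus>\<^bsub>M\<^esub> scl b \<odot>\<^bsub>M\<^esub> x" for a b
  using RM.act_l_distr[OF scl_carrier scl_carrier x, of a b] by simp
 have "scl b \<otimes>\<^bsub>path_algebra Q\<^esub> scl a = (scl (a * b) :: _ => 'k)"
  by (subst scl_mult) (auto simp: scl_def)
 then show "scl (a * b) \<odot>\<^bsub>M\<^esub> x = scl a \<odot>\<^bsub>M\<^esub> (scl b \<odot>\<^bsub>M\<^esub> x)"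
  using RM.act_mult[OF scl_carrier scl_carrier x, of b a] by simp
 show "scl 1 \<odot>\<^bsub>M\<^esub> x = x" using RM.act_one[OF x] by (simp add: path_algebra_simps)
 have "scl 0 \<odot>\<^bsub>M\<^esub> x \<oplus>\<^bsub>M\<^esub> scl 0 \<odot>\<^bsub>M\<^esub> x = scl 0 \<odot>\<^bsub>M\<^esub> x" using add[of 0 0] by simp
 then show "scl 0 \<odot>\<^bsub>M\<^esub> x = \<zero>\<^bsub>M\<^esub>" using RM.M.add.r_cancel_one[OF scl_act_closed[OF x] scl_act_closed[OF x], of 0 0] by simp
qed

lemma scl_zero: "scl l \<odot>\<^bsub>M\<^esub> \<zero>\<^bsub>M\<^esub> = \<zero>\<^bsub>M\<^esub>"
proof -
 have "scl l \<odot>\<^bsub>M\<^esub> \<zero>\<^bsub>M\<^esub> = scl l \<odot>\<^bsub>M\<^esub> (scl 0 \<odot>\<^bsub>M\<^esub> \<zero>\<^bsub>M\<^esub>)" by (simp add: scl_act)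
 also have "\<dots> = scl (l * 0) \<odot>\<^bsub>M\<^esub> \<zero>\<^bsub>M\<^esub>" by (simp only: scl_act(2)[OF RM.M.zero_closed])
 finally show ?thesis by (simp add: scl_act)
qed

lemma lc_empty [simp]: "lc {} c = \<zero>\<^bsub>M\<^esub>"
 by (simp add: lc_def)

lemma lc_insert: "finite F ==> g \<notin> F ==> g \<in> carrier M ==> F \<subseteq> carrier M ==>
  lc (insert g F) c = scl (c g) \<odot>\<^bsub>M\<^esub> g \<oplus>\<^bsub>M\<^esub> lc F c"
 unfolding lc_def by (rule RM.M.finsum_insert) (auto intro: scl_act_closed)

lemma lc_closed: "F \<subseteq> carrier M ==> lc F c \<in> carrier M"
 unfolding lc_def by (rule RM.M.finsum_closed) (auto intro: scl_act_closed)

lemma lc_cong: "F \<subseteq> carrier M ==> (\<And>g. g \<in> F ==> c g = c' g) ==> lc F c = lc F c'"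
 unfolding lc_def by (rule RM.M.finsum_cong') (auto intro: scl_act_closed)

lemma lc_add: "finite F ==> F \<subseteq> carrier M ==> lc F (c + c') = lc F c \<oplus>\<^bsub>M\<^esub> lc F c'"
proof (induction F rule: finite_induct)
 case (insert g F)
 then show ?case
  by (simp add: lc_insert scl_act lc_closed scl_act_closed RM.M.a_ac RM.M.a_closed)
qed simp

lemma lc_scale: "finite F ==> F \<subseteq> carrier M ==> lc F (\<lambda>g. l * c g) = scl l \<odot>\<^bsub>M\<^esub> lc F c"
proof (induction F rule: finite_induct)
 case (insert g F)
 then show ?case
  by (simp add: lc_insert scl_act lc_closed scl_act_closed RM.act_r_distr scl_carrier)
qed (simp add: scl_zero)

lemma lc_single:
 assumes "finite F" "F \<subseteq> carrier M" "g \<in> F"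
 shows "lc F (\<lambda>h. if h = g then l else 0) = scl l \<odot>\<^bsub>M\<^esub> g"
proof -
 have z: "finite G ==> G \<subseteq> carrier M ==> g \<notin> G ==> lc G (\<lambda>h. if h = g then l else 0) = \<zero>\<^bsub>M\<^esub>" for G
  by (induction G rule: finite_induct) (auto simp: lc_insert scl_act)
 have G: "finite (F - {g})" "F - {g} \<subseteq> carrier M" "g \<in> carrier M" "g \<notin> F - {g}" using assms by auto
 have "insert g (F - {g}) = F" using assms(3) by auto
 then have "lc F (\<lambda>h. if h = g then l else 0) = lc (insert g (F - {g})) (\<lambda>h. if h = g then l else 0)" by simp
 also have "\<dots> = scl l \<odot>\<^bsub>M\<^esub> g \<oplus>\<^bsub>M\<^esub> lc (F - {g}) (\<lambda>h. if h = g then l else 0)"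
  using lc_insert[OF G(1,4,3,2), of "\<lambda>h. if h = g then l else 0"] by simp
 also have "lc (F - {g}) (\<lambda>h. if h = g then l else 0) = \<zero>\<^bsub>M\<^esub>" by (rule z[OF G(1,2,4)])
 finally show ?thesis using RM.M.r_zero[OF scl_act_closed[OF G(3)]] by simp
qed

text \<open>Elements concentrated at a single vertex. Coordinates need a basis of such elements
  because every label carries a vertex.\<close>

definition homog :: "'m set => bool" where
 "homog F \<longleftrightarrow> finite F \<and> F \<subseteq> carrier M \<and> (\<forall>g\<in>F. \<exists>v\<in>verts Q. ind (v, []) \<odot>\<^bsub>M\<^esub> g = g)"

definition spanning :: "'m set => bool" where
 "spanning F \<longleftrightarrow> (\<forall>x\<in>carrier M. \<exists>c. x = lc F c)"

text \<open>The products of finitely many generators with the finitely many paths span the module,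
  and the product with a path is fixed by the idempotent of its end point.\<close>

lemma spanning_exists:
 assumes "fg_right_module (path_algebra Q) M"
 shows "\<exists>F. homog F \<and> spanning F"
proof -
 obtain S where S: "finite S" "S \<subseteq> carrier M"
  "\<And>x. x \<in> carrier M ==> \<exists>c\<in>S \<rightarrow> carrier (path_algebra Q). x = (\<Oplus>\<^bsub>M\<^esub>s\<in>S. c s \<odot>\<^bsub>M\<^esub> s)"
  using assms by (auto simp: fg_right_module_def)
 define F where "F = (\<lambda>(w, s). ind w \<odot>\<^bsub>M\<^esub> s) ` (quiver_paths Q \<times> S)"
 have F: "finite F" "F \<subseteq> carrier M"
  using S fin_paths by (auto simp: F_def intro!: RM.act_closed ind_closed)
 have hom: "homog F"
  unfolding homog_def
 proof (intro conjI F ballI)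
  fix g assume "g \<in> F"
  then obtain u p s where g: "(u, p) \<in> quiver_paths Q" "s \<in> S" "g = ind (u, p) \<odot>\<^bsub>M\<^esub> s" by (auto simp: F_def)
  have v: "awlast u p \<in> verts Q" by (rule awlast_path_verts[OF g(1)])
  have s: "s \<in> carrier M" using g S by auto
  have "ind (awlast u p, []) \<odot>\<^bsub>M\<^esub> g = (ind (u, p) \<otimes>\<^bsub>path_algebra Q\<^esub> ind (awlast u p, [])) \<odot>\<^bsub>M\<^esub> s"
   unfolding g(3) using v by (intro RM.act_mult[symmetric] ind_closed g(1) s) simp
  also have "\<dots> = g" using ind_mult[where 'k = 'k, of u p "[]"] g by simp
  finally show "\<exists>v\<in>verts Q. ind (v, []) \<odot>\<^bsub>M\<^esub> g = g" using v by (intro bexI)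
 qed
 have sp_add: "\<exists>c. x \<oplus>\<^bsub>M\<^esub> y = lc F c" if xy: "\<exists>c. x = lc F c" "\<exists>c. y = lc F c" for x y
 proof -
  obtain c c' where "x = lc F c" "y = lc F c'" using xy by auto
  then have "x \<oplus>\<^bsub>M\<^esub> y = lc F (c + c')" by (simp only: lc_add[OF F])
  then show ?thesis by (intro exI)
 qed
 have zero: "\<exists>c. \<zero>\<^bsub>M\<^esub> = lc F c"
 proof -
  have "lc F (\<lambda>g. 0 * 0) = scl 0 \<odot>\<^bsub>M\<^esub> lc F (\<lambda>g. 0)" by (rule lc_scale[OF F])
  then have "\<zero>\<^bsub>M\<^esub> = lc F (\<lambda>g. 0 * 0)" by (simp only: scl_act(4)[OF lc_closed[OF F(2)]])
  then show ?thesis by (intro exI)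
 qed
 have el: "\<exists>c. r \<odot>\<^bsub>M\<^esub> s = lc F c" if r: "r \<in> carrier (path_algebra Q)" and s: "s \<in> S" for r s
 proof -
  have sM: "s \<in> carrier M" using s S by auto
  have "finite G ==> G \<subseteq> quiver_paths Q ==> (\<lambda>w. if w \<in> G then r w else 0) \<in> carrier (path_algebra Q) \<and>
   (\<exists>c. (\<lambda>w. if w \<in> G then r w else 0) \<odot>\<^bsub>M\<^esub> s = lc F c)" for G
  proof (induction G rule: finite_induct)
   case empty
   have e: "(\<lambda>w. if w \<in> {} then r w else 0) = scl 0" by (auto simp: scl_def)
   show ?case unfolding e scl_act(4)[OF sM] by (intro conjI scl_carrier zero)
  next
   case (insert w G)
   have w: "w \<in> quiver_paths Q" using insert.prems by simp
   have IH: "(\<lambda>w. if w \<in> G then r w else 0) \<in> carrier (path_algebra Q)" "\<exists>c. (\<lambda>w. if w \<in> G then r w else 0) \<odot>\<^bsub>M\<^esub> s = lc F c"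
    using insert by auto
   have c: "ind w \<otimes>\<^bsub>path_algebra Q\<^esub> scl (r w) \<in> carrier (path_algebra Q)"
    by (intro ring.ring_simprules(5)[OF ring_A] scl_carrier ind_closed w)
   \<comment> \<open>In a right module the second factor of a product acts last, so the scalar
     stands second and ends up as the coefficient of \<open>ind w\<close> applied to
     \<open>s\<close>.\<close>
   have iw: "ind w \<otimes>\<^bsub>path_algebra Q\<^esub> scl (r w) = (\<lambda>w'. if w' = w then r w else 0)"
   proof (intro ext, clarify)
    fix u p
    have "(ind w \<otimes>\<^bsub>path_algebra Q\<^esub> scl (r w)) (u, p) = (\<Sum>i\<le>length p. if i = length p then if (u, p) = w then r w else 0 else 0)"
     unfolding path_algebra_simps
    proof (intro sum.cong refl)
     fix i assume "i \<in> {..length p}"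
     then show "ind w (u, take i p) * scl (r w) (awlast u (take i p), drop i p) = (if i = length p then if (u, p) = w then r w else 0 else 0)"
      using w awlast_path_verts[of u p] by (auto simp: ind_def scl_def)
    qed
    then show "(ind w \<otimes>\<^bsub>path_algebra Q\<^esub> scl (r w)) (u, p) = (if (u, p) = w then r w else 0)" by (simp add: sum.delta)
   qed
   have gF: "ind w \<odot>\<^bsub>M\<^esub> s \<in> F" using w s by (auto simp: F_def)
   have "(ind w \<otimes>\<^bsub>path_algebra Q\<^esub> scl (r w)) \<odot>\<^bsub>M\<^esub> s = scl (r w) \<odot>\<^bsub>M\<^esub> (ind w \<odot>\<^bsub>M\<^esub> s)"
    by (rule RM.act_mult[OF ind_closed[OF w] scl_carrier sM])
   also have "\<dots> = lc F (\<lambda>h. if h = ind w \<odot>\<^bsub>M\<^esub> s then r w else 0)" by (rule lc_single[OF F gF, symmetric])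
   finally have e: "\<exists>c. (ind w \<otimes>\<^bsub>path_algebra Q\<^esub> scl (r w)) \<odot>\<^bsub>M\<^esub> s = lc F c" by (intro exI)
   have sum: "(\<lambda>w'. if w' \<in> insert w G then r w' else 0) =
    (ind w \<otimes>\<^bsub>path_algebra Q\<^esub> scl (r w)) \<oplus>\<^bsub>path_algebra Q\<^esub> (\<lambda>w'. if w' \<in> G then r w' else 0)"
    unfolding iw path_algebra_simps using insert(2) by auto
   show ?case
    unfolding sum using sp_add[OF e IH(2)] RM.act_l_distr[OF c IH(1) sM] ring.ring_simprules(1)[OF ring_A c IH(1)] by simp
  qed
  from this[OF fin_paths] have "\<exists>c. (\<lambda>w. if w \<in> quiver_paths Q then r w else 0) \<odot>\<^bsub>M\<^esub> s = lc F c" by simp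
  moreover have "(\<lambda>w. if w \<in> quiver_paths Q then r w else 0) = r"
   using r unfolding carrier_path_algebra by (intro ext) auto
  ultimately show ?thesis by simp
 qed
 have "spanning F"
  unfolding spanning_def
 proof
  fix x assume "x \<in> carrier M"
  then obtain c where c: "c \<in> S \<rightarrow> carrier (path_algebra Q)" "x = (\<Oplus>\<^bsub>M\<^esub>s\<in>S. c s \<odot>\<^bsub>M\<^esub> s)" using S(3) by auto
  have "finite T ==> T \<subseteq> S ==> \<exists>a. (\<Oplus>\<^bsub>M\<^esub>s\<in>T. c s \<odot>\<^bsub>M\<^esub> s) = lc F a" for T
  proof (induction T rule: finite_induct)
   case empty
   then show ?case using zero by simp
  next
   case (insert s T)
   have "(\<Oplus>\<^bsub>M\<^esub>s\<in>insert s T. c s \<odot>\<^bsub>M\<^esub> s) = c s \<odot>\<^bsub>M\<^esub> s \<oplus>\<^bsub>M\<^esub> (\<Oplus>\<^bsub>M\<^esub>s\<in>T. c s \<odot>\<^bsub>M\<^esub> s)"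
    using insert c S(2) by (intro RM.M.finsum_insert) (auto intro!: RM.act_closed)
   moreover have "\<exists>a. c s \<odot>\<^bsub>M\<^esub> s = lc F a" using insert c by (intro el) auto
   ultimately show ?case using insert sp_add by simp
  qed
  from this[OF S(1)] show "\<exists>c. x = lc F c" using c(2) by auto
 qed
 then show ?thesis using hom by blast
qed

text \<open>A homogeneous spanning set of least size is independent: an element with nonzero
  coefficient in a relation could be removed, and every subset stays homogeneous.\<close>

lemma basis_exists:
 assumes "fg_right_module (path_algebra Q) M"
 shows "\<exists>F. homog F \<and> spanning F \<and> (\<forall>c. lc F c = \<zero>\<^bsub>M\<^esub> --> (\<forall>g\<in>F. c g = 0))"
proof -
 obtain F where F: "homog F" "spanning F" and mn: "\<And>G. homog G \<and> spanning G ==> card F \<le> card G"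
  using ex_has_least_nat[of "\<lambda>F. homog F \<and> spanning F" _ card] spanning_exists[OF assms] by auto
 have fF: "finite F" "F \<subseteq> carrier M" using F by (auto simp: homog_def)
 have "c g = 0" if c: "lc F c = \<zero>\<^bsub>M\<^esub>" and g: "g \<in> F" for c g
 proof (rule ccontr)
  assume nz: "c g \<noteq> 0"
  let ?G = "F - {g}"
  have G: "finite ?G" "?G \<subseteq> carrier M" "g \<in> carrier M" using fF g by auto
  have ins: "lc F d = scl (d g) \<odot>\<^bsub>M\<^esub> g \<oplus>\<^bsub>M\<^esub> lc ?G d" for d
   using lc_insert[OF G(1) _ G(3,2), of d] insert_Diff[OF g] by simp
  have "spanning ?G"
   unfolding spanning_def
  proof
   fix x assume x: "x \<in> carrier M"
   then obtain d where d: "x = lc F d" using F(2) by (auto simp: spanning_def)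
   \<comment> \<open>Adding this multiple of the relation removes \<open>g\<close> from the
     expansion of \<open>x\<close>.\<close>
   define l where "l = - (d g / c g)"
   have "lc F (d + (\<lambda>h. l * c h)) = lc F d \<oplus>\<^bsub>M\<^esub> scl l \<odot>\<^bsub>M\<^esub> lc F c"
    by (simp only: lc_add[OF fF] lc_scale[OF fF])
   also have "\<dots> = x" using x by (simp add: c scl_zero d lc_closed[OF fF(2)])
   finally have "x = lc F (d + (\<lambda>h. l * c h))" ..
   also have "\<dots> = scl ((d + (\<lambda>h. l * c h)) g) \<odot>\<^bsub>M\<^esub> g \<oplus>\<^bsub>M\<^esub> lc ?G (d + (\<lambda>h. l * c h))" by (rule ins)
   also have "(d + (\<lambda>h. l * c h)) g = 0" using nz by (simp add: l_def)
   finally have "x = lc ?G (d + (\<lambda>h. l * c h))" by (simp only: scl_act(4)[OF G(3)] RM.M.l_zero[OF lc_closed[OF G(2)]])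
   then show "\<exists>c. x = lc ?G c" by (intro exI)
  qed
  moreover have "homog ?G" using F(1) by (auto simp: homog_def)
  ultimately have "card F \<le> card ?G" using mn by simp
  then show False using card_Diff1_less[OF fF(1) g] by simp
 qed
 then show ?thesis using F by blast
qed

end

context qmod
begin

definition basis :: "'m set => bool" where
 "basis F \<longleftrightarrow> homog F \<and> spanning F \<and> (\<forall>c. lc F c = \<zero>\<^bsub>M\<^esub> --> (\<forall>g\<in>F. c g = 0))"

text \<open>The condition outside \<open>F\<close> singles out one coefficient function, so that
  coordinates can be compared as functions.\<close>

definition co :: "'m set => 'm => 'm => 'k" where
 "co F x = (SOME c. (\<forall>g. g \<notin> F --> c g = 0) \<and> lc F c = x)"

lemma basis_simps:
 assumes "basis F"
 shows "finite F" "F \<subseteq> carrier M"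
 using assms by (auto simp: basis_def homog_def)

lemma lc_inj:
 assumes B: "basis F" and c: "\<And>g. g \<notin> F ==> c g = 0" "\<And>g. g \<notin> F ==> c' g = 0" and e: "lc F c = lc F c'"
 shows "c = c'"
proof -
 note F = basis_simps[OF B]
 note cl = lc_closed[OF F(2)]
 have "lc F (c + (\<lambda>g. - 1 * c' g)) = lc F c \<oplus>\<^bsub>M\<^esub> scl (- 1) \<odot>\<^bsub>M\<^esub> lc F c'"
  unfolding lc_add[OF F] lc_scale[OF F] ..
 also have "\<dots> = scl 1 \<odot>\<^bsub>M\<^esub> lc F c' \<oplus>\<^bsub>M\<^esub> scl (- 1) \<odot>\<^bsub>M\<^esub> lc F c'"
  unfolding e scl_act(3)[OF cl] ..
 also have "\<dots> = \<zero>\<^bsub>M\<^esub>" unfolding scl_act(1)[OF cl, symmetric] using scl_act(4)[OF cl] by simp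
 finally have "\<forall>g\<in>F. (c + (\<lambda>g. - 1 * c' g)) g = 0" using B unfolding basis_def by blast
 then have "c g = c' g" for g using c by (cases "g \<in> F") auto
 then show ?thesis by (rule ext)
qed

lemma co_exists:
 assumes B: "basis F" and x: "x \<in> carrier M"
 shows "\<exists>c. (\<forall>g. g \<notin> F --> c g = 0) \<and> lc F c = x"
proof -
 obtain c where c: "x = lc F c" using B x by (auto simp: basis_def spanning_def)
 have "lc F (\<lambda>g. if g \<in> F then c g else 0) = lc F c" by (rule lc_cong[OF basis_simps(2)[OF B]]) simp
 then show ?thesis using c by (intro exI[of _ "\<lambda>g. if g \<in> F then c g else 0"]) auto
qed

lemma
 assumes B: "basis F" and x: "x \<in> carrier M"
 shows co_outside: "g \<notin> F ==> co F x g = 0" and lc_co: "lc F (co F x) = x"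
 using someI_ex[OF co_exists[OF B x]] by (auto simp: co_def)

lemma co_lc:
 assumes B: "basis F" and c: "\<And>g. g \<notin> F ==> c g = 0"
 shows "co F (lc F c) = c"
proof -
 have x: "lc F c \<in> carrier M" by (rule lc_closed[OF basis_simps(2)[OF B]])
 show ?thesis by (rule lc_inj[OF B co_outside[OF B x] c lc_co[OF B x]])
qed

lemma co_add:
 assumes B: "basis F" and x: "x \<in> carrier M" and y: "y \<in> carrier M"
 shows "co F (x \<oplus>\<^bsub>M\<^esub> y) = co F x + co F y"
proof -
 have "co F (lc F (co F x + co F y)) = co F x + co F y"
  by (rule co_lc[OF B]) (simp add: co_outside[OF B] x y)
 then show ?thesis unfolding lc_add[OF basis_simps[OF B]] lc_co[OF B x] lc_co[OF B y] .
qed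

lemma co_scale:
 assumes B: "basis F" and x: "x \<in> carrier M"
 shows "co F (scl l \<odot>\<^bsub>M\<^esub> x) = (\<lambda>g. l * co F x g)"
proof -
 have "co F (lc F (\<lambda>g. l * co F x g)) = (\<lambda>g. l * co F x g)"
  by (rule co_lc[OF B]) (simp add: co_outside[OF B] x)
 then show ?thesis unfolding lc_scale[OF basis_simps[OF B]] lc_co[OF B x] .
qed

lemma co_base:
 assumes B: "basis F" and g: "g \<in> F"
 shows "co F g = (\<lambda>h. if h = g then 1 else 0)"
proof -
 have gM: "g \<in> carrier M" using g basis_simps[OF B] by auto
 have "lc F (\<lambda>h. if h = g then 1 else 0) = g"
  using lc_single[OF basis_simps[OF B] g, of 1] scl_act(3)[OF gM] by simp
 moreover have "co F (lc F (\<lambda>h. if h = g then 1 else 0)) = (\<lambda>h. if h = g then 1 else 0)"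
  using g by (intro co_lc[OF B]) auto
 ultimately show ?thesis by simp
qed

lemma co_inj: "basis F ==> x \<in> carrier M ==> y \<in> carrier M ==> co F x = co F y ==> x = y"
 using lc_co by metis

end

section \<open>Every bounded complex of modules has coordinates\<close>

context fin_quiver
begin

lemma qmodI: "right_module (path_algebra Q) M ==> qmod Q M"
 by (simp add: qmod_def qmod_axioms_def fin_quiver_axioms)

lemma coord_linear:
 fixes C :: "('b, 'v, 'e, 'k::field) qcx" and M :: "('v \<times> 'e list => 'k, 'm) module" and \<Phi> :: "'m => 'c => 'k"
 assumes rm: "right_module (path_algebra Q) M" and fin: "finite (lab C)"
  and bij: "bij_betw \<kappa> (carrier M) (vec C i)"
  and ka: "\<And>x y. x \<in> carrier M ==> y \<in> carrier M ==> \<kappa> (x \<oplus>\<^bsub>M\<^esub> y) = \<kappa> x + \<kappa> y"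
  and ks: "\<And>l x. x \<in> carrier M ==> \<kappa> (scl l \<odot>\<^bsub>M\<^esub> x) = (\<lambda>b. l * \<kappa> x b)"
  and Pa: "\<And>x y. x \<in> carrier M ==> y \<in> carrier M ==> \<Phi> (x \<oplus>\<^bsub>M\<^esub> y) = \<Phi> x + \<Phi> y"
  and Ps: "\<And>l x. x \<in> carrier M ==> \<Phi> (scl l \<odot>\<^bsub>M\<^esub> x) = (\<lambda>b. l * \<Phi> x b)"
  and N: "\<And>b y. b \<in> lab C ==> dg C b = i ==> \<exists>g\<in>carrier M. \<kappa> g = ub b \<and> \<Phi> g y = N y b"
  and x: "x \<in> carrier M"
 shows "\<Phi> x = mv (lab C) N (\<kappa> x)"
proof -
 interpret RM: right_module "path_algebra Q" M by (rule rm)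
 let ?inv = "inv_into (carrier M) \<kappa>"
 have img: "\<kappa> ` carrier M = vec C i" by (rule bij_betw_imp_surj_on[OF bij])
 have iv: "?inv c \<in> carrier M" "\<kappa> (?inv c) = c" if "c \<in> vec C i" for c
  using that inv_into_into[of c \<kappa> "carrier M"] f_inv_into_f[of c \<kappa> "carrier M"] unfolding img by auto
 have eq: "y = ?inv (\<kappa> y)" if "y \<in> carrier M" for y
  using inv_into_f_f[OF bij_betw_imp_inj_on[OF bij] that] by simp
 have kx: "\<kappa> x \<in> vec C i" using x img by blast
 have "\<Phi> (?inv (\<kappa> x)) = mv (lab C) (\<lambda>y b. \<Phi> (?inv (ub b)) y) (\<kappa> x)"
 proof (rule linear_rep[OF fin _ _ kx])
  fix c c' assume c: "c \<in> vec C i" "c' \<in> vec C i"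
  have "?inv (\<kappa> (?inv c \<oplus>\<^bsub>M\<^esub> ?inv c')) = ?inv c \<oplus>\<^bsub>M\<^esub> ?inv c'"
   by (rule eq[symmetric]) (intro RM.M.a_closed iv c)
  then have "?inv (c + c') = ?inv c \<oplus>\<^bsub>M\<^esub> ?inv c'" unfolding ka[OF iv(1)[OF c(1)] iv(1)[OF c(2)]] iv(2)[OF c(1)] iv(2)[OF c(2)] .
  then show "\<Phi> (?inv (c + c')) = \<Phi> (?inv c) + \<Phi> (?inv c')" using Pa[OF iv(1)[OF c(1)] iv(1)[OF c(2)]] by simp
 next
  fix l c assume c: "c \<in> vec C i"
  have "?inv (\<kappa> (scl l \<odot>\<^bsub>M\<^esub> ?inv c)) = scl l \<odot>\<^bsub>M\<^esub> ?inv c"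
   by (rule eq[symmetric]) (intro RM.act_closed scl_carrier iv c)
  then have "?inv (\<lambda>x. l * c x) = scl l \<odot>\<^bsub>M\<^esub> ?inv c" unfolding ks[OF iv(1)[OF c]] iv(2)[OF c] .
  then show "\<Phi> (?inv (\<lambda>x. l * c x)) = (\<lambda>y. l * \<Phi> (?inv c) y)" using Ps[OF iv(1)[OF c]] by simp
 qed
 also have "\<dots> = mv (lab C) N (\<kappa> x)"
 proof
  fix y
  show "mv (lab C) (\<lambda>y b. \<Phi> (?inv (ub b)) y) (\<kappa> x) y = mv (lab C) N (\<kappa> x) y"
   unfolding mv_def
  proof (rule sum.cong[OF refl])
   fix b assume b: "b \<in> lab C"
   show "\<Phi> (?inv (ub b)) y * \<kappa> x b = N y b * \<kappa> x b"
   proof (cases "dg C b = i")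
    case True
    then obtain g where g: "g \<in> carrier M" "\<kappa> g = ub b" "\<Phi> g y = N y b" using N[OF b, of y] by blast
    have "?inv (ub b) = g" using eq[OF g(1)] unfolding g(2) by simp
    then show ?thesis using g(3) by simp
   next
    case False
    then have "\<kappa> x b = 0" using kx by (auto simp: vec_def)
    then show ?thesis by simp
   qed
  qed
 qed
 finally show ?thesis using eq[OF x] by simp
qed

lemma ind_idem:
 assumes "(u, p) \<in> quiver_paths Q"
 shows "ind (w, []) \<otimes>\<^bsub>path_algebra Q\<^esub> ind (u, p) = (if w = u then ind (u, p) else scl 0 :: _ => 'k::field)"
proof (cases "w = u")
 case True
 then show ?thesis using ind_mult[where 'k = 'k, of u "[]" p] assms by simp
next
 case False
 have "(ind (w, []) \<otimes>\<^bsub>path_algebra Q\<^esub> ind (u, p)) (u', p') = (0 :: 'k)" for u' p'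
  unfolding path_algebra_simps using False by (intro sum.neutral) (auto simp: ind_def)
 then show ?thesis using False by (auto simp: scl_def)
qed

lemma ind_target:
 assumes "(u, p) \<in> quiver_paths Q"
 shows "ind (u, p) \<otimes>\<^bsub>path_algebra Q\<^esub> ind (awlast u p, []) = (ind (u, p) :: _ => 'k::field)"
 using ind_mult[where 'k = 'k, of u p "[]"] assms by simp

text \<open>The labels are pairs of a degree and an element of a homogeneous basis in that degree,
  the vertex of a label being one whose idempotent fixes the basis element. The matrices are read
  off from the differential and from the action of the arrows.\<close>

lemma pres_exists:
 fixes X :: "('v \<times> 'e list => 'k::field, 'm) cochain"
 assumes bc: "bounded_complex (path_algebra Q) X"
 shows "\<exists>(C :: (int \<times> 'm, 'v, 'e, 'k) qcx) \<kappa>. pres X C \<kappa>"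
proof -
 have rm: "right_module (path_algebra Q) (term_at X i)" and fg: "fg_right_module (path_algebra Q) (term_at X i)"
  and dh: "diff_at X i \<in> rmod_hom (path_algebra Q) (term_at X i) (term_at X (i + 1))" for i
  using bc by (simp_all add: bounded_complex_def fg_right_module_def)
 have qm: "qmod Q (term_at X i)" for i by (rule qmodI[OF rm])
 have "\<forall>i. \<exists>F. qmod.basis Q (term_at X i) F"
  using qmod.basis_exists[OF qm fg] unfolding qmod.basis_def[OF qm] by blast
 then obtain F where F: "\<And>i. qmod.basis Q (term_at X i) (F i)" unfolding choice_iff by blast
 note Fs = qmod.basis_simps[OF qm F]
 define co where "co i = qmod.co Q (term_at X i) (F i)" for i
 note co_add = qmod.co_add[OF qm F, folded co_def] and co_scale = qmod.co_scale[OF qm F, folded co_def]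
  and co_base = qmod.co_base[OF qm F, folded co_def] and co_outside = qmod.co_outside[OF qm F, folded co_def]
  and co_inj = qmod.co_inj[OF qm F, folded co_def] and co_lc = qmod.co_lc[OF qm F, folded co_def]
  and lc_closed = qmod.lc_closed[OF qm Fs(2)]
 have act_closed: "r \<in> carrier (path_algebra Q) ==> x \<in> carrier (term_at X i) ==> r \<odot>\<^bsub>term_at X i\<^esub> x \<in> carrier (term_at X i)" for r x i
  by (rule right_module.act_closed[OF rm])
 have add_closed: "x \<in> carrier (term_at X i) ==> y \<in> carrier (term_at X i) ==> x \<oplus>\<^bsub>term_at X i\<^esub> y \<in> carrier (term_at X i)" for x y i
  using abelian_monoid.a_closed[OF abelian_group.axioms(1)[OF right_module.axioms(2)[OF rm]]] .
 have d_closed: "x \<in> carrier (term_at X i) ==> diff_at X i x \<in> carrier (term_at X (i + 1))"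
  and d_add: "x \<in> carrier (term_at X i) ==> y \<in> carrier (term_at X i) ==>
   diff_at X i (x \<oplus>\<^bsub>term_at X i\<^esub> y) = diff_at X i x \<oplus>\<^bsub>term_at X (i + 1)\<^esub> diff_at X i y"
  and d_act: "r \<in> carrier (path_algebra Q) ==> x \<in> carrier (term_at X i) ==>
   diff_at X i (r \<odot>\<^bsub>term_at X i\<^esub> x) = r \<odot>\<^bsub>term_at X (i + 1)\<^esub> diff_at X i x" for i x y r
  using dh[of i] by (auto simp: rmod_hom_def)
 define \<kappa> :: "int => 'm => int \<times> 'm => 'k" where "\<kappa> i x = (\<lambda>(j, g). if j = i then co i x g else 0)" for i x
 define L where "L = {(i, g). g \<in> F i}"
 define vt where "vt b = (SOME v. v \<in> verts Q \<and> ind (v, []) \<odot>\<^bsub>term_at X (fst b)\<^esub> snd b = snd b)" for b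
 define C :: "(int \<times> 'm, 'v, 'e, 'k) qcx" where "C = \<lparr>lab = L, dg = fst, vx = vt,
   dd = (\<lambda>y b. if b \<in> L then \<kappa> (fst b + 1) (diff_at X (fst b) (snd b)) y else 0),
   aa = (\<lambda>e y b. if b \<in> L \<and> e \<in> arcs Q then \<kappa> (fst b) (ind (tail Q e, [e]) \<odot>\<^bsub>term_at X (fst b)\<^esub> snd b) y else 0)\<rparr>"
 have C: "lab C = L" "dg C = fst" "vx C = vt"
  "dd C = (\<lambda>y b. if b \<in> L then \<kappa> (fst b + 1) (diff_at X (fst b) (snd b)) y else 0)"
  "aa C = (\<lambda>e y b. if b \<in> L \<and> e \<in> arcs Q then \<kappa> (fst b) (ind (tail Q e, [e]) \<odot>\<^bsub>term_at X (fst b)\<^esub> snd b) y else 0)"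
  by (simp_all add: C_def)
 have vt: "vt b \<in> verts Q" "ind (vt b, []) \<odot>\<^bsub>term_at X (fst b)\<^esub> snd b = snd b" if "b \<in> L" for b
 proof -
  have "\<exists>v. v \<in> verts Q \<and> ind (v, []) \<odot>\<^bsub>term_at X (fst b)\<^esub> snd b = snd b"
   using F[of "fst b"] \<open>b \<in> L\<close> by (auto simp: qmod.basis_def[OF qm] qmod.homog_def[OF qm] L_def)
  then have "vt b \<in> verts Q \<and> ind (vt b, []) \<odot>\<^bsub>term_at X (fst b)\<^esub> snd b = snd b" unfolding vt_def by (rule someI_ex)
  then show "vt b \<in> verts Q" "ind (vt b, []) \<odot>\<^bsub>term_at X (fst b)\<^esub> snd b = snd b" by auto
 qed
 have Lc: "snd b \<in> carrier (term_at X (fst b))" if "b \<in> L" for b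
  using that Fs(2)[of "fst b"] by (auto simp: L_def)
 have fin: "finite L"
 proof -
  obtain a b where ab: "\<And>i. i < a \<or> b < i ==> carrier (term_at X i) = {\<zero>\<^bsub>term_at X i\<^esub>}"
   using bc unfolding bounded_complex_def by metis
  \<comment> \<open>In the degrees where the module is zero a basis has to be empty, as zero is not
    independent. This makes the set of labels finite.\<close>
  have e: "F i = {}" if i: "i < a \<or> b < i" for i
  proof (rule ccontr)
   assume "F i \<noteq> {}"
   then obtain g where g: "g \<in> F i" by auto
   then have gz: "g = \<zero>\<^bsub>term_at X i\<^esub>" using Fs(2)[of i] ab[OF i] by auto
   have gM: "g \<in> carrier (term_at X i)" using g Fs(2) by auto
   have "co i (scl 0 \<odot>\<^bsub>term_at X i\<^esub> g) = (\<lambda>h. 0 * co i g h)" by (rule co_scale[OF gM])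
   moreover have "scl 0 \<odot>\<^bsub>term_at X i\<^esub> g = g" unfolding qmod.scl_act(4)[OF qm gM] using gz by simp
   ultimately have "co i g g = 0" by simp
   then show False using co_base[OF g] by simp
  qed
  have "L \<subseteq> Sigma {a..b} F" using e by (force simp: L_def)
  then show ?thesis using Fs(1) by (auto intro: finite_subset)
 qed
 have kv: "\<kappa> i x \<in> vec C i" if "x \<in> carrier (term_at X i)" for i x
  using co_outside[OF that] by (auto simp: vec_def C \<kappa>_def L_def split: if_splits)
 have kvL: "y \<in> L" "fst y = i" if "x \<in> carrier (term_at X i)" "\<kappa> i x y \<noteq> 0" for i x y
  using kv[OF that(1)] that(2) unfolding vec_def C by blast+
 have kadd: "\<kappa> i (x \<oplus>\<^bsub>term_at X i\<^esub> y) = \<kappa> i x + \<kappa> i y" if "x \<in> carrier (term_at X i)" "y \<in> carrier (term_at X i)" for i x y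
  using co_add[OF that] by (auto simp: \<kappa>_def fun_eq_iff)
 have ksc: "\<kappa> i (scl l \<odot>\<^bsub>term_at X i\<^esub> x) = (\<lambda>b. l * \<kappa> i x b)" if "x \<in> carrier (term_at X i)" for i l x
  using co_scale[OF that] by (auto simp: \<kappa>_def fun_eq_iff)
 have kub: "\<kappa> (fst b) (snd b) = ub b" if "b \<in> L" for b
 proof -
  have "snd b \<in> F (fst b)" using that by (auto simp: L_def)
  then show ?thesis by (cases b) (auto simp: \<kappa>_def ub_def fun_eq_iff co_base)
 qed
 have kinj: "x = y" if "x \<in> carrier (term_at X i)" "y \<in> carrier (term_at X i)" "\<kappa> i x = \<kappa> i y" for i x y
 proof -
  have "co i x g = co i y g" for g using fun_cong[OF that(3), of "(i, g)"] by (simp add: \<kappa>_def)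
  then show ?thesis using co_inj[OF that(1,2)] by blast
 qed
 have bij: "bij_betw (\<kappa> i) (carrier (term_at X i)) (vec C i)" for i
  unfolding bij_betw_def
 proof
  show "inj_on (\<kappa> i) (carrier (term_at X i))" using kinj by (intro inj_onI)
  have "c \<in> \<kappa> i ` carrier (term_at X i)" if c: "c \<in> vec C i" for c
  proof
   let ?c = "\<lambda>g. c (i, g)"
   have "co i (qmod.lc Q (term_at X i) (F i) ?c) = ?c" using c by (intro co_lc) (auto simp: vec_def C L_def)
   then show "c = \<kappa> i (qmod.lc Q (term_at X i) (F i) ?c)" using c by (auto simp: \<kappa>_def vec_def C fun_eq_iff)
   show "qmod.lc Q (term_at X i) (F i) ?c \<in> carrier (term_at X i)" by (rule lc_closed)
  qed
  then show "\<kappa> i ` carrier (term_at X i) = vec C i" using kv by auto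
 qed
 have kz: "\<kappa> i \<zero>\<^bsub>term_at X i\<^esub> = 0" for i
 proof -
  have z: "\<zero>\<^bsub>term_at X i\<^esub> \<in> carrier (term_at X i)"
   using abelian_monoid.zero_closed[OF abelian_group.axioms(1)[OF right_module.axioms(2)[OF rm]]] .
  show ?thesis using ksc[OF z, of 0] unfolding qmod.scl_act(4)[OF qm z] by auto
 qed
 have coord: "\<Phi> x = mv L N (\<kappa> i x)"
  if A: "\<forall>x\<in>carrier (term_at X i). \<forall>y\<in>carrier (term_at X i). \<Phi> (x \<oplus>\<^bsub>term_at X i\<^esub> y) = \<Phi> x + \<Phi> y"
   "\<forall>l. \<forall>x\<in>carrier (term_at X i). \<Phi> (scl l \<odot>\<^bsub>term_at X i\<^esub> x) = (\<lambda>b. l * \<Phi> x b)"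
   "\<forall>b\<in>L. fst b = i --> (\<forall>y. \<Phi> (snd b) y = N y b)" and x: "x \<in> carrier (term_at X i)"
  for \<Phi> :: "'m => int \<times> 'm => 'k" and N i x
 proof (rule coord_linear[where C = C and N = N and \<Phi> = \<Phi>, OF rm _ bij, unfolded C(1)])
  show "\<exists>g\<in>carrier (term_at X i). \<kappa> i g = ub b \<and> \<Phi> g y = N y b" if b: "b \<in> L" "dg C b = i" for b y
  proof (intro bexI[of _ "snd b"] conjI)
   show "\<Phi> (snd b) y = N y b" using A(3)[THEN bspec, OF b(1)] b(2) unfolding C(2) by blast
  qed (use b kub[OF b(1)] Lc[OF b(1)] in \<open>simp_all add: C\<close>)
  show "\<kappa> i (x \<oplus>\<^bsub>term_at X i\<^esub> y) = \<kappa> i x + \<kappa> i y" if "x \<in> carrier (term_at X i)" "y \<in> carrier (term_at X i)" for x y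
   by (rule kadd[OF that])
  show "\<kappa> i (scl l \<odot>\<^bsub>term_at X i\<^esub> x) = (\<lambda>b. l * \<kappa> i x b)" if "x \<in> carrier (term_at X i)" for l x
   by (rule ksc[OF that])
 qed (use A x fin in auto)
 have kd: "\<kappa> (i + 1) (diff_at X i x) = mv L (dd C) (\<kappa> i x)" if x: "x \<in> carrier (term_at X i)" for i x
  by (rule coord[OF _ _ _ x]) (simp_all add: d_add kadd d_closed d_act scl_carrier ksc C plus_fun_def)
 have kact: "\<kappa> i (r \<odot>\<^bsub>term_at X i\<^esub> x) = mv L N (\<kappa> i x)"
  if r: "r \<in> carrier (path_algebra Q)" and x: "x \<in> carrier (term_at X i)"
   and N: "\<And>b y. b \<in> L ==> fst b = i ==> \<kappa> i (r \<odot>\<^bsub>term_at X i\<^esub> snd b) y = N y b" for r x i N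
 proof (rule coord[OF _ _ _ x]; intro ballI allI impI)
  fix b y assume "b \<in> L" "fst b = i"
  then show "\<kappa> i (r \<odot>\<^bsub>term_at X i\<^esub> snd b) y = N y b" by (rule N)
 next
  fix y z assume yz: "y \<in> carrier (term_at X i)" "z \<in> carrier (term_at X i)"
  show "\<kappa> i (r \<odot>\<^bsub>term_at X i\<^esub> (y \<oplus>\<^bsub>term_at X i\<^esub> z)) = \<kappa> i (r \<odot>\<^bsub>term_at X i\<^esub> y) + \<kappa> i (r \<odot>\<^bsub>term_at X i\<^esub> z)"
   unfolding right_module.act_r_distr[OF rm r yz] by (rule kadd[OF act_closed[OF r yz(1)] act_closed[OF r yz(2)]])
 next
  fix l y assume y: "y \<in> carrier (term_at X i)"
  \<comment> \<open>Scalars are central in the path algebra, so each of its elements acts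
    linearly.\<close>
  have c: "scl l \<otimes>\<^bsub>path_algebra Q\<^esub> r = r \<otimes>\<^bsub>path_algebra Q\<^esub> scl l"
  proof (intro ext, clarify)
   fix u p
   have rz: "r w = 0" if "w \<notin> quiver_paths Q" for w using r that unfolding carrier_path_algebra by auto
   have sm: "scl l \<otimes>\<^bsub>path_algebra Q\<^esub> r = (\<lambda>w. l * r w)" by (rule scl_mult) (rule rz)
   have "(r \<otimes>\<^bsub>path_algebra Q\<^esub> scl l) (u, p) = (\<Sum>j\<le>length p. if j = length p then l * r (u, p) else 0)"
    unfolding path_algebra_simps
   proof (intro sum.cong refl)
    fix j assume j: "j \<in> {..length p}"
    show "r (u, take j p) * scl l (awlast u (take j p), drop j p) = (if j = length p then l * r (u, p) else 0)"
     using j rz[of "(u, p)"] awlast_path_verts[of u p] by (cases "j = length p"; cases "(u, p) \<in> quiver_paths Q") (auto simp: scl_def)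
   qed
   then show "(scl l \<otimes>\<^bsub>path_algebra Q\<^esub> r) (u, p) = (r \<otimes>\<^bsub>path_algebra Q\<^esub> scl l) (u, p)"
    unfolding sm by (simp add: sum.delta)
  qed
  have "r \<odot>\<^bsub>term_at X i\<^esub> (scl l \<odot>\<^bsub>term_at X i\<^esub> y) = scl l \<odot>\<^bsub>term_at X i\<^esub> (r \<odot>\<^bsub>term_at X i\<^esub> y)"
   unfolding right_module.act_mult[OF rm scl_carrier r y, symmetric] right_module.act_mult[OF rm r scl_carrier y, symmetric] c ..
  then show "\<kappa> i (r \<odot>\<^bsub>term_at X i\<^esub> (scl l \<odot>\<^bsub>term_at X i\<^esub> y)) = (\<lambda>b. l * \<kappa> i (r \<odot>\<^bsub>term_at X i\<^esub> y) b)"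
   using ksc[OF act_closed[OF r y]] by simp
 qed
 have karr: "\<kappa> i (ind (tail Q e, [e]) \<odot>\<^bsub>term_at X i\<^esub> x) = mv L (aa C e) (\<kappa> i x)"
  if e: "e \<in> arcs Q" and x: "x \<in> carrier (term_at X i)" for e i x
  using e by (intro kact[OF ind_closed[OF path_arrow[OF e]] x]) (auto simp: C)
 have kvert: "\<kappa> i (ind (v, []) \<odot>\<^bsub>term_at X i\<^esub> x) = (\<lambda>y. if vt y = v then \<kappa> i x y else 0)"
  if v: "v \<in> verts Q" and x: "x \<in> carrier (term_at X i)" for v i x
 proof -
  have vp: "(v, []) \<in> quiver_paths Q" using v by simp
  let ?N = "\<lambda>y b. if y = b \<and> vt b = v then 1 else 0 :: 'k"
  have "\<kappa> i (ind (v, []) \<odot>\<^bsub>term_at X i\<^esub> x) = mv L ?N (\<kappa> i x)"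
  proof (rule kact[OF ind_closed[OF vp] x])
   fix b y assume b: "b \<in> L" "fst b = i"
   have bM: "snd b \<in> carrier (term_at X i)" using Lc[OF b(1)] b(2) by simp
   have wp: "(vt b, []) \<in> quiver_paths Q" using vt(1)[OF b(1)] by simp
   have "ind (v, []) \<odot>\<^bsub>term_at X i\<^esub> snd b = ind (v, []) \<odot>\<^bsub>term_at X i\<^esub> (ind (vt b, []) \<odot>\<^bsub>term_at X i\<^esub> snd b)"
    using vt(2)[OF b(1)] b(2) by simp
   also have "\<dots> = (if vt b = v then ind (v, []) else scl 0) \<odot>\<^bsub>term_at X i\<^esub> snd b"
    unfolding right_module.act_mult[OF rm ind_closed[OF wp] ind_closed[OF vp] bM, symmetric] ind_idem[OF vp] ..
   also have "\<dots> = (if vt b = v then snd b else \<zero>\<^bsub>term_at X i\<^esub>)"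
    using vt(2)[OF b(1)] b(2) qmod.scl_act(4)[OF qm bM] by auto
   finally have "\<kappa> i (ind (v, []) \<odot>\<^bsub>term_at X i\<^esub> snd b) = (if vt b = v then ub b else 0)"
    using kub[OF b(1)] b(2) kz by auto
   then show "\<kappa> i (ind (v, []) \<odot>\<^bsub>term_at X i\<^esub> snd b) y = ?N y b" by (auto simp: ub_def)
  qed
  also have "\<dots> = (\<lambda>y. if vt y = v then \<kappa> i x y else 0)"
  proof
   fix y
   have "mv L ?N (\<kappa> i x) y = (\<Sum>b\<in>L. if b = y then if vt y = v then \<kappa> i x y else 0 else 0)"
    unfolding mv_def by (intro sum.cong) auto
   then show "mv L ?N (\<kappa> i x) y = (if vt y = v then \<kappa> i x y else 0)"
    using fin kvL(1)[OF x, of y] by (cases "y \<in> L") (auto simp: sum.delta)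
  qed
  finally show ?thesis .
 qed
 \<comment> \<open>An element fixed by the idempotent of \<open>v\<close> has coordinates at
   \<open>v\<close> only. The conditions on vertices for the differential and the arrows both follow
   from this.\<close>
 have supp: "vt y = v" if x: "x \<in> carrier (term_at X i)" and v: "v \<in> verts Q" "ind (v, []) \<odot>\<^bsub>term_at X i\<^esub> x = x"
  and nz: "\<kappa> i x y \<noteq> 0" for i x v y
  using fun_cong[OF kvert[OF v(1) x], of y] nz unfolding v(2) by (auto split: if_splits)
 have ddub: "mv L (dd C) (ub b) = \<kappa> (fst b + 1) (diff_at X (fst b) (snd b))" if "b \<in> L" for b
  unfolding mv_ub[OF fin that] using that by (simp add: C)
 have aaub: "mv L (aa C e) (ub b) = \<kappa> (fst b) (ind (tail Q e, [e]) \<odot>\<^bsub>term_at X (fst b)\<^esub> snd b)" if "b \<in> L" "e \<in> arcs Q" for b e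
  unfolding mv_ub[OF fin that(1)] using that by (simp add: C)
 have arrM: "ind (tail Q e, [e]) \<odot>\<^bsub>term_at X i\<^esub> x \<in> carrier (term_at X i)" if "e \<in> arcs Q" "x \<in> carrier (term_at X i)" for e i x
  by (rule act_closed[OF ind_closed[OF path_arrow[OF that(1)]] that(2)])
 have "wfc Q C"
 proof (rule wfcI)
  show "finite (lab C)" "\<And>b. b \<in> lab C ==> vx C b \<in> verts Q" using fin vt(1) by (simp_all add: C)
  show "dd C \<in> HM C C 1"
   unfolding HM_def
  proof (intro CollectI allI impI)
   fix y b assume nz: "dd C y b \<noteq> 0"
   then have b: "b \<in> L" by (auto simp: C split: if_splits)
   have nz': "\<kappa> (fst b + 1) (diff_at X (fst b) (snd b)) y \<noteq> 0" using nz b by (simp add: C)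
   have "ind (vt b, []) \<odot>\<^bsub>term_at X (fst b + 1)\<^esub> diff_at X (fst b) (snd b) = diff_at X (fst b) (snd b)"
    using d_act[OF ind_closed Lc[OF b], of "(vt b, [])"] vt[OF b] by simp
   then have "vt y = vt b" using supp[OF d_closed[OF Lc[OF b]] vt(1)[OF b] _ nz'] by simp
   moreover have "y \<in> L" "fst y = fst b + 1" by (rule kvL[OF d_closed[OF Lc[OF b]] nz'])+
   ultimately show "y \<in> lab C \<and> b \<in> lab C \<and> vx C y = vx C b \<and> dg C y = dg C b + 1" using b by (simp add: C)
  qed
  show "mm (lab C) (dd C) (dd C) = 0"
  proof (rule mat_eqI[of C])
   fix b assume "b \<in> lab C"
   then have b: "b \<in> L" by (simp add: C)
   have "mv L (mm L (dd C) (dd C)) (ub b) = \<kappa> (fst b + 1 + 1) (diff_at X (fst b + 1) (diff_at X (fst b) (snd b)))"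
    unfolding mv_mv[symmetric] ddub[OF b] kd[OF d_closed[OF Lc[OF b]]] ..
   also have "\<dots> = 0" using bc Lc[OF b] by (simp add: bounded_complex_def kz)
   finally show "mv (lab C) (mm (lab C) (dd C) (dd C)) (ub b) = mv (lab C) 0 (ub b)" by (simp add: C(1) mv_linear)
  next
   fix x y assume "x \<notin> lab C"
   then show "mm (lab C) (dd C) (dd C) y x = 0" by (simp add: mm_def C)
  qed (simp_all add: C fin)
  show "y \<in> lab C \<and> b \<in> lab C \<and> e \<in> arcs Q \<and> tail Q e = vx C b \<and> head Q e = vx C y \<and> dg C y = dg C b"
   if nz: "aa C e y b \<noteq> 0" for e y b
  proof -
   have b: "b \<in> L" and e: "e \<in> arcs Q" using nz by (auto simp: C split: if_splits)
   let ?x = "ind (tail Q e, [e]) \<odot>\<^bsub>term_at X (fst b)\<^esub> snd b"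
   have nz': "\<kappa> (fst b) ?x y \<noteq> 0" using nz b e by (simp add: C)
   have xM: "?x \<in> carrier (term_at X (fst b))" by (rule arrM[OF e Lc[OF b]])
   note pe = path_arrow[OF e]
   have h: "head Q e \<in> verts Q" "tail Q e \<in> verts Q" using e by auto
   have "ind (head Q e, []) \<odot>\<^bsub>term_at X (fst b)\<^esub> ?x = ?x"
    using right_module.act_mult[OF rm ind_closed[OF pe] ind_closed Lc[OF b], of "(head Q e, [])"] ind_target[where 'k = 'k, OF pe] h by simp
   then have hd: "vt y = head Q e" using supp[OF xM h(1) _ nz'] by simp
   have wp: "(vt b, []) \<in> quiver_paths Q" using vt(1)[OF b] by simp
   have "?x = (ind (vt b, []) \<otimes>\<^bsub>path_algebra Q\<^esub> ind (tail Q e, [e])) \<odot>\<^bsub>term_at X (fst b)\<^esub> snd b"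
    unfolding right_module.act_mult[OF rm ind_closed[OF wp] ind_closed[OF pe] Lc[OF b]] vt(2)[OF b] ..
   then have "vt b \<noteq> tail Q e ==> ?x = \<zero>\<^bsub>term_at X (fst b)\<^esub>"
    unfolding ind_idem[OF pe] using qmod.scl_act(4)[OF qm Lc[OF b]] by simp
   then have "vt b = tail Q e" using nz' kz by (metis zero_fun_apply)
   moreover have "y \<in> L" "fst y = fst b" by (rule kvL[OF xM nz'])+
   ultimately show ?thesis using b e hd by (simp add: C)
  qed
  show "mm (lab C) (dd C) (aa C e) = mm (lab C) (aa C e) (dd C)" for e
  proof (cases "e \<in> arcs Q")
   case True
   show ?thesis
   proof (rule mat_eqI[of C])
    fix b assume "b \<in> lab C"
    then have b: "b \<in> L" by (simp add: C)
    have "mv L (mm L (dd C) (aa C e)) (ub b) = \<kappa> (fst b + 1) (diff_at X (fst b) (ind (tail Q e, [e]) \<odot>\<^bsub>term_at X (fst b)\<^esub> snd b))"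
     unfolding mv_mv[symmetric] aaub[OF b True] kd[OF arrM[OF True Lc[OF b]]] ..
    also have "\<dots> = \<kappa> (fst b + 1) (ind (tail Q e, [e]) \<odot>\<^bsub>term_at X (fst b + 1)\<^esub> diff_at X (fst b) (snd b))"
     unfolding d_act[OF ind_closed[OF path_arrow[OF True]] Lc[OF b]] ..
    also have "\<dots> = mv L (mm L (aa C e) (dd C)) (ub b)"
     unfolding mv_mv[symmetric] ddub[OF b] karr[OF True d_closed[OF Lc[OF b]]] ..
    finally show "mv (lab C) (mm (lab C) (dd C) (aa C e)) (ub b) = mv (lab C) (mm (lab C) (aa C e) (dd C)) (ub b)" by (simp only: C(1))
   next
    fix x y assume "x \<notin> lab C"
    then show "mm (lab C) (dd C) (aa C e) y x = 0" "mm (lab C) (aa C e) (dd C) y x = 0" by (simp_all add: mm_def C)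
   qed (simp add: C fin)
  next
   case False
   then have "aa C e = 0" by (auto simp: C fun_eq_iff)
   then show ?thesis by (simp add: mm_linear)
  qed
 qed
 note wf = this
 have act: "\<kappa> i (r \<odot>\<^bsub>term_at X i\<^esub> x) = mv (lab C) (am C r) (\<kappa> i x)"
  if r: "r \<in> carrier (path_algebra Q)" and x: "x \<in> carrier (term_at X i)" for r x i
 proof -
  have "\<forall>i. \<forall>x\<in>carrier (term_at X i). \<kappa> i (r \<odot>\<^bsub>term_at X i\<^esub> x) = mv (lab C) (am C r) (\<kappa> i x)"
  \<comment> \<open>Both sides respect sums and products of algebra elements, so it suffices to
    compare them on generators.\<close>
  proof (rule path_algebra_induct[OF r]; intro allI ballI)
   fix a b i x
   assume a: "a \<in> carrier (path_algebra Q)" and b: "b \<in> carrier (path_algebra Q)"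
    and Pa: "\<forall>i. \<forall>x\<in>carrier (term_at X i). \<kappa> i (a \<odot>\<^bsub>term_at X i\<^esub> x) = mv (lab C) (am C a) (\<kappa> i x)"
    and Pb: "\<forall>i. \<forall>x\<in>carrier (term_at X i). \<kappa> i (b \<odot>\<^bsub>term_at X i\<^esub> x) = mv (lab C) (am C b) (\<kappa> i x)"
    and x: "x \<in> carrier (term_at X i)"
   have ab: "am C (a \<oplus>\<^bsub>path_algebra Q\<^esub> b) = am C a + am C b" unfolding path_algebra_simps am_add ..
   show "\<kappa> i ((a \<oplus>\<^bsub>path_algebra Q\<^esub> b) \<odot>\<^bsub>term_at X i\<^esub> x) = mv (lab C) (am C (a \<oplus>\<^bsub>path_algebra Q\<^esub> b)) (\<kappa> i x)"
    unfolding right_module.act_l_distr[OF rm a b x] kadd[OF act_closed[OF a x] act_closed[OF b x]] ab mv_linear using Pa Pb x by simp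
   show "\<kappa> i ((a \<otimes>\<^bsub>path_algebra Q\<^esub> b) \<odot>\<^bsub>term_at X i\<^esub> x) = mv (lab C) (am C (a \<otimes>\<^bsub>path_algebra Q\<^esub> b)) (\<kappa> i x)"
    unfolding right_module.act_mult[OF rm a b x] am_mult[OF wf] mv_mv[symmetric] using Pa Pb x act_closed[OF a x] by simp
  next
   fix l i x assume x: "x \<in> carrier (term_at X i)"
   show "\<kappa> i (scl l \<odot>\<^bsub>term_at X i\<^esub> x) = mv (lab C) (am C (scl l)) (\<kappa> i x)"
    unfolding mv_am_scl[OF wf kv[OF x]] by (rule ksc[OF x])
  next
   fix v i x assume v: "v \<in> verts Q" and x: "x \<in> carrier (term_at X i)"
   have vp: "(v, []) \<in> quiver_paths Q" using v by simp
   have "mv L (am C (ind (v, []))) (\<kappa> i x) y = (if vt y = v then \<kappa> i x y else 0)" for y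
   proof -
    have "mv L (am C (ind (v, []))) (\<kappa> i x) y = (\<Sum>b\<in>L. if b = y then if vt y = v then \<kappa> i x y else 0 else 0)"
     unfolding mv_def ind_def am_ind[OF vp] by (intro sum.cong) (auto simp: un_def C)
    then show ?thesis using fin kvL(1)[OF x, of y] by (cases "y \<in> L") (auto simp: sum.delta)
   qed
   then show "\<kappa> i (ind (v, []) \<odot>\<^bsub>term_at X i\<^esub> x) = mv (lab C) (am C (ind (v, []))) (\<kappa> i x)"
    unfolding kvert[OF v x] C(1) by (intro ext) simp
  next
   fix e i x assume e: "e \<in> arcs Q" and x: "x \<in> carrier (term_at X i)"
   show "\<kappa> i (ind (tail Q e, [e]) \<odot>\<^bsub>term_at X i\<^esub> x) = mv (lab C) (am C (ind (tail Q e, [e]))) (\<kappa> i x)"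
    unfolding karr[OF e x] C(1) am_arrow[OF wf e, folded ind_def] ..
  qed
  then show ?thesis using x by blast
 qed
 have "pres X C \<kappa>"
  unfolding pres_def using bc wf bij kadd act kd by (simp add: C(1))
 then show ?thesis by blast
qed

end

section \<open>Realization of coordinates by modules, and the shift\<close>

context fin_quiver
begin

lemma mv_am_vec: "wfc Q C ==> c \<in> vec C i ==> mv (lab C) (am C r) c \<in> vec C i"
proof -
 assume wf: "wfc Q C" and c: "c \<in> vec C i"
 show ?thesis
  unfolding vec_def
 proof (intro CollectI allI impI)
  fix y assume "mv (lab C) (am C r) c y \<noteq> 0"
  then have "(\<Sum>x\<in>lab C. am C r y x * c x) \<noteq> 0" by (simp only: mv_def not_False_eq_True)
  then obtain x where "am C r y x * c x \<noteq> 0" by (rule sum.not_neutral_contains_not_neutral)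
  then have "am C r y x \<noteq> 0" "c x \<noteq> 0" by auto
  then show "y \<in> lab C \<and> dg C y = i" using am_HM_col[OF wf, of r y x] c by (auto simp: vec_def)
 qed
qed

lemma mv_am_dd: "wfc Q C ==> mv (lab C) (dd C) (mv (lab C) (am C r) c) = mv (lab C) (am C r) (mv (lab C) (dd C) c)"
 for C :: "('b, 'v, 'e, 'k::field) qcx"
proof -
 assume wf: "wfc Q C"
 have "dd C \<in> ST C C 1" using wfc_dd(1)[OF wf] wfc_comm[OF wf] by (simp add: ST_def)
 from am_ST[OF this wf wf, of r] show ?thesis by (simp add: mv_mv)
qed

text \<open>Every complex of representations in coordinates comes from a complex of modules with carriers
 in a given infinite power of the field.\<close>

lemma real_exists:
 fixes C :: "('b, 'v, 'e, 'k::field) qcx"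
 assumes wf: "wfc Q C"
 shows "\<exists>(X :: ('v \<times> 'e list => 'k, nat => 'k) cochain) \<kappa>. pres X C \<kappa>"
proof -
 let ?L = "lab C" and ?R = "path_algebra Q :: ('v \<times> 'e list => 'k) ring"
 have fin: "finite ?L" by (rule wfc_simps(1)[OF wf])
 have "\<exists>\<iota> :: 'b => nat. inj_on \<iota> ?L"
  using finite_imp_inj_to_nat_seg[OF fin] by (elim exE conjE) (rule exI)
 then obtain \<iota> :: "'b => nat" where \<iota>: "inj_on \<iota> ?L" by (elim exE)
 \<comment> \<open>Vectors are moved to functions on the natural numbers along an injection of the
   labels. Outside its image the value is zero, so that encoding and decoding are mutually inverse
   on vectors of the complex.\<close>
 define en :: "('b => 'k) => nat => 'k" where "en c = (\<lambda>m. if m \<in> \<iota> ` ?L then c (inv_into ?L \<iota> m) else 0)" for c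
 define de :: "(nat => 'k) => 'b => 'k" where "de f = (\<lambda>b. if b \<in> ?L then f (\<iota> b) else 0)" for f
 have de_en: "de (en c) = c" if "c \<in> vec C i" for c i
  using that inv_into_f_f[OF \<iota>] by (auto simp: de_def en_def vec_def fun_eq_iff)
 have en_add: "en c + en c' = en (c + c')" for c c' by (auto simp: en_def fun_eq_iff)
 have de_add: "de (f + g) = de f + de g" for f g by (auto simp: de_def fun_eq_iff)
 have en_zero: "en 0 = 0" by (auto simp: en_def fun_eq_iff)
 define T :: "int => ('v \<times> 'e list => 'k, nat => 'k) module" where "T i =
  \<lparr> carrier = en ` vec C i, mult = undefined, one = undefined, zero = 0, add = (+),
   smult = (\<lambda>r f. en (mv ?L (am C r) (de f))) \<rparr>" for i
 have T: "carrier (T i) = en ` vec C i" "\<zero>\<^bsub>T i\<^esub> = 0" "f \<oplus>\<^bsub>T i\<^esub> g = f + g" "r \<odot>\<^bsub>T i\<^esub> f = en (mv ?L (am C r) (de f))" for i f g r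
  by (simp_all add: T_def)
 have closed: "mv ?L (am C r) c \<in> vec C i" if "c \<in> vec C i" for r c i by (rule mv_am_vec[OF wf that])
 have ag: "abelian_group (T i)" for i
 proof (rule abelian_groupI)
  fix x assume "x \<in> carrier (T i)"
  then obtain c where c: "c \<in> vec C i" "x = en c" by (auto simp: T)
  show "\<exists>y\<in>carrier (T i). y \<oplus>\<^bsub>T i\<^esub> x = \<zero>\<^bsub>T i\<^esub>"
   using c vec_linear(3)[OF c(1)] en_add[of "- c" c] en_zero by (intro bexI[of _ "en (- c)"]) (auto simp: T)
 next
  fix x y assume "x \<in> carrier (T i)" "y \<in> carrier (T i)"
  then show "x \<oplus>\<^bsub>T i\<^esub> y \<in> carrier (T i)" by (auto simp: T en_add intro!: imageI vec_linear(1))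
 next
  show "\<zero>\<^bsub>T i\<^esub> \<in> carrier (T i)" unfolding T en_zero[symmetric] by (rule imageI[OF vec_linear(4)])
 qed (auto simp: T add.assoc add.commute)
 have rm: "right_module ?R (T i)" for i
 proof (intro right_module.intro ring_A ag right_module_axioms.intro)
  fix r s :: "'v \<times> 'e list => 'k" and x y
  assume "x \<in> carrier (T i)"
  then obtain c where c: "c \<in> vec C i" "x = en c" by (auto simp: T)
  show "r \<odot>\<^bsub>T i\<^esub> x \<in> carrier (T i)" using closed[OF c(1)] by (simp add: T c(2) de_en[OF c(1)])
  have "am C (r \<oplus>\<^bsub>?R\<^esub> s) = am C r + am C s" unfolding path_algebra_simps am_add ..
  then show "(r \<oplus>\<^bsub>?R\<^esub> s) \<odot>\<^bsub>T i\<^esub> x = r \<odot>\<^bsub>T i\<^esub> x \<oplus>\<^bsub>T i\<^esub> s \<odot>\<^bsub>T i\<^esub> x"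
   by (simp add: T c(2) de_en[OF c(1)] mv_linear en_add)
  show "(r \<otimes>\<^bsub>?R\<^esub> s) \<odot>\<^bsub>T i\<^esub> x = s \<odot>\<^bsub>T i\<^esub> (r \<odot>\<^bsub>T i\<^esub> x)"
   by (simp add: T c(2) de_en[OF c(1)] de_en[OF closed[OF c(1)]] am_mult[OF wf] mv_mv)
  show "\<one>\<^bsub>?R\<^esub> \<odot>\<^bsub>T i\<^esub> x = x"
   by (simp add: T c(2) de_en[OF c(1)] path_algebra_simps mv_am_scl[OF wf c(1)])
  assume "y \<in> carrier (T i)"
  then show "r \<odot>\<^bsub>T i\<^esub> (x \<oplus>\<^bsub>T i\<^esub> y) = r \<odot>\<^bsub>T i\<^esub> x \<oplus>\<^bsub>T i\<^esub> r \<odot>\<^bsub>T i\<^esub> y"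
   by (simp add: T de_add mv_linear en_add)
 qed
 have fg: "fg_right_module ?R (T i)" for i
 proof -
  interpret MT: right_module ?R "T i" by (rule rm)
  let ?Li = "{b \<in> ?L. dg C b = i}"
  let ?g = "\<lambda>b. en (ub b)"
  have uv: "ub b \<in> vec C i" if "b \<in> ?Li" for b using ub_vec[of b C] that by auto
  have inj: "inj_on ?g ?Li"
  proof (rule inj_onI)
   fix b b' assume b: "b \<in> ?Li" "b' \<in> ?Li" "en (ub b) = en (ub b')"
   then have "de (en (ub b)) b = de (en (ub b')) b" by simp
   then show "b = b'" unfolding de_en[OF uv[OF b(1)]] de_en[OF uv[OF b(2)]] by (simp add: ub_def split: if_splits)
  qed
  show ?thesis
   unfolding fg_right_module_def
  proof (intro conjI rm exI[of _ "?g ` ?Li"] ballI)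
   show "finite (?g ` ?Li)" "?g ` ?Li \<subseteq> carrier (T i)" using fin uv by (auto simp: T)
   fix x assume "x \<in> carrier (T i)"
   then obtain c where c: "c \<in> vec C i" "x = en c" by (auto simp: T)
   define s where "s f = scl (c (inv_into ?Li ?g f))" for f
   have tm: "s (?g b) \<odot>\<^bsub>T i\<^esub> ?g b = en (\<lambda>y. if y = b then c b else 0)" if b: "b \<in> ?Li" for b
   proof -
    have "(\<lambda>y. c b * ub b y) = (\<lambda>y. if y = b then c b else 0)" by (auto simp: ub_def)
    then show ?thesis using inv_into_f_f[OF inj b] by (simp add: s_def T de_en[OF uv[OF b]] mv_am_scl[OF wf uv[OF b]])
   qed
   have mem: "en (\<lambda>y. if y = b then c b else 0) \<in> carrier (T i)" if b: "b \<in> ?Li" for b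
    using b by (auto simp: T vec_def intro!: imageI)
   have "finite B ==> B \<subseteq> ?Li ==> (\<Oplus>\<^bsub>T i\<^esub>f\<in>?g ` B. s f \<odot>\<^bsub>T i\<^esub> f) = en (\<lambda>y. if y \<in> B then c y else 0)" for B
   proof (induction B rule: finite_induct)
    case empty
    have "(\<lambda>y. if y \<in> {} then c y else 0) = 0" by auto
    then show ?case using en_zero by (simp add: T(2))
   next
    case (insert b B)
    have b: "b \<in> ?Li" and B: "B \<subseteq> ?Li" using insert.prems by auto
    have nb: "?g b \<notin> ?g ` B" using inj_on_image_mem_iff[OF inj b B] insert(2) by simp
    have "(\<Oplus>\<^bsub>T i\<^esub>f\<in>insert (?g b) (?g ` B). s f \<odot>\<^bsub>T i\<^esub> f) = s (?g b) \<odot>\<^bsub>T i\<^esub> ?g b \<oplus>\<^bsub>T i\<^esub> (\<Oplus>\<^bsub>T i\<^esub>f\<in>?g ` B. s f \<odot>\<^bsub>T i\<^esub> f)"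
    proof (rule MT.M.finsum_insert[OF finite_imageI[OF insert(1)] nb])
     show "(\<lambda>f. s f \<odot>\<^bsub>T i\<^esub> f) \<in> ?g ` B \<rightarrow> carrier (T i)" using tm mem B by (auto simp: subset_iff)
     show "s (?g b) \<odot>\<^bsub>T i\<^esub> ?g b \<in> carrier (T i)" unfolding tm[OF b] by (rule mem[OF b])
    qed
    also have "\<dots> = en (\<lambda>y. if y \<in> insert b B then c y else 0)"
     unfolding tm[OF b] insert.IH[OF B] T(3) en_add using insert(2) by (intro arg_cong[of _ _ en] ext) auto
    finally show ?case by simp
   qed
   from this[of ?Li] have "(\<Oplus>\<^bsub>T i\<^esub>f\<in>?g ` ?Li. s f \<odot>\<^bsub>T i\<^esub> f) = en (\<lambda>y. if y \<in> ?Li then c y else 0)" using fin by simp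
   also have "(\<lambda>y. if y \<in> ?Li then c y else 0) = c" using c(1) by (auto simp: vec_def fun_eq_iff)
   finally have e: "x = (\<Oplus>\<^bsub>T i\<^esub>f\<in>?g ` ?Li. s f \<odot>\<^bsub>T i\<^esub> f)" using c(2) by simp
   show "\<exists>c\<in>?g ` ?Li \<rightarrow> carrier ?R. x = (\<Oplus>\<^bsub>T i\<^esub>s\<in>?g ` ?Li. c s \<odot>\<^bsub>T i\<^esub> s)"
   proof (intro bexI[of _ s])
    show "x = (\<Oplus>\<^bsub>T i\<^esub>f\<in>?g ` ?Li. s f \<odot>\<^bsub>T i\<^esub> f)" by (rule e)
   qed (auto simp: s_def scl_carrier)
  qed
 qed
 define X :: "('v \<times> 'e list => 'k, nat => 'k) cochain" where
  "X = \<lparr> term_at = T, diff_at = (\<lambda>i. \<lambda>f\<in>en ` vec C i. en (mv ?L (dd C) (de f))) \<rparr>"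
 have X: "term_at X i = T i" "c \<in> vec C i ==> diff_at X i (en c) = en (mv ?L (dd C) c)" for i c
  by (simp_all add: X_def de_en)
 have dv: "mv ?L (dd C) c \<in> vec C (i + 1)" if "c \<in> vec C i" for c i by (rule mv_vec[OF wfc_dd(1)[OF wf] that])
 have bc: "bounded_complex ?R X"
  unfolding bounded_complex_def X(1)
 proof (intro conjI allI fg ballI)
  fix i
  show "diff_at X i \<in> rmod_hom ?R (T i) (T (i + 1))"
   unfolding rmod_hom_def
  proof (intro CollectI conjI ballI)
   show "diff_at X i \<in> carrier (T i) \<rightarrow>\<^sub>E carrier (T (i + 1))"
    using dv by (auto simp: X_def T de_en)
   fix x assume "x \<in> carrier (T i)"
   then obtain c where c: "c \<in> vec C i" "x = en c" by (auto simp: T)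
   show "diff_at X i (r \<odot>\<^bsub>T i\<^esub> x) = r \<odot>\<^bsub>T (i + 1)\<^esub> diff_at X i x" for r
    by (simp add: c(2) X(2)[OF c(1)] T de_en[OF c(1)] X(2)[OF closed[OF c(1)]] de_en[OF dv[OF c(1)]] mv_am_dd[OF wf])
   fix y assume "y \<in> carrier (T i)"
   then obtain c' where c': "c' \<in> vec C i" "y = en c'" by (auto simp: T)
   show "diff_at X i (x \<oplus>\<^bsub>T i\<^esub> y) = diff_at X i x \<oplus>\<^bsub>T (i + 1)\<^esub> diff_at X i y"
    unfolding c(2) c'(2) T(3) en_add X(2)[OF c(1)] X(2)[OF c'(1)] X(2)[OF vec_linear(1)[OF c(1) c'(1)]] mv_linear ..
  qed
 next
  fix i x assume "x \<in> carrier (T i)"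
  then obtain c where c: "c \<in> vec C i" "x = en c" by (auto simp: T)
  show "diff_at X (i + 1) (diff_at X i x) = \<zero>\<^bsub>T (i + 1 + 1)\<^esub>"
   unfolding c(2) X(2)[OF c(1)] X(2)[OF dv[OF c(1)]] mv_mv wfc_dd(2)[OF wf] mv_linear en_zero T(2) ..
 next
  \<comment> \<open>Zero is inserted to give minimum and maximum a meaning when there are no
    labels.\<close>
  let ?S = "insert 0 (dg C ` ?L)"
  have "carrier (T i) = {0}" if i: "i < Min ?S \<or> Max ?S < i" for i
  proof -
   have "i \<noteq> dg C b" if b: "b \<in> ?L" for b
   proof -
    have "Min ?S \<le> dg C b" "dg C b \<le> Max ?S" using b fin by (auto intro: Min_le Max_ge)
    then show ?thesis using i by linarith
   qed
   then have "c = 0" if "c \<in> vec C i" for c :: "'b => 'k" using that by (auto simp: vec_def fun_eq_iff)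
   then have "vec C i = {0 :: 'b => 'k}" using vec_linear(4)[of C i] by (intro equalityI subsetI) simp_all
   then show ?thesis by (simp add: T en_zero)
  qed
  then show "\<exists>a b. \<forall>i. i < a \<or> b < i --> carrier (T i) = {\<zero>\<^bsub>T i\<^esub>}"
   unfolding T(2) by (intro exI[of _ "Min ?S"] exI[of _ "Max ?S"] allI impI)
 qed
 have "pres X C (\<lambda>i. de)"
  unfolding pres_def X(1)
 proof (intro conjI allI ballI bc wf)
  fix i
  show "bij_betw de (carrier (T i)) (vec C i)"
   unfolding T by (rule bij_betw_byWitness[of _ en]) (auto simp: de_en)
  fix x assume "x \<in> carrier (T i)"
  then obtain c where c: "c \<in> vec C i" "x = en c" by (auto simp: T)
  show "de (x \<oplus>\<^bsub>T i\<^esub> y) = de x + de y" for y by (simp add: T de_add)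
  show "de (r \<odot>\<^bsub>T i\<^esub> x) = mv ?L (am C r) (de x)" for r
   unfolding c(2) T(4) de_en[OF c(1)] by (rule de_en[OF closed[OF c(1)]])
  show "de (diff_at X i x) = mv ?L (dd C) (de x)"
   unfolding c(2) X(2)[OF c(1)] de_en[OF c(1)] by (rule de_en[OF dv[OF c(1)]])
 qed
 then show ?thesis by blast
qed

definition csh :: "('b, 'v, 'e, 'k::field) qcx => ('b, 'v, 'e, 'k) qcx" where
 "csh C = C\<lparr>dg := (\<lambda>x. dg C x - 1), dd := - dd C\<rparr>"

lemma csh_simps [simp]: "lab (csh C) = lab C" "dg (csh C) x = dg C x - 1" "vx (csh C) = vx C"
  "dd (csh C) = - dd C" "aa (csh C) = aa C"
 by (simp_all add: csh_def)

text \<open>The sign at the arrows depends on the degree and flips with it, so all of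
  \<open>dl\<close> changes sign and not only the differential. Cocycles and coboundaries of the
  shift are therefore those of the original complex in a neighbouring degree.\<close>

lemma dl_csh: "dl (csh C) = - dl C"
 by (intro cochn_eqI ext) (simp_all add: dl_def sg_shift)

lemma un_csh: "un (csh C) = un C"
 by (simp add: un_def)

lemma Tot_csh_right: "Tot Q X (csh Y) i = Tot Q X Y (i + 1)"
 and Tot_csh_left: "Tot Q (csh X) Y i = Tot Q X Y (i - 1)"
 by (auto simp: Tot_def allowed_def algebra_simps split: option.splits)

lemma wfc_csh: "wfc Q (csh C) \<longleftrightarrow> wfc Q C"
proof -
 have "Tot Q (csh C) (csh C) 1 = Tot Q C C 1"
  by (simp add: Tot_csh_right Tot_csh_left)
 moreover have "- dl C \<in> Tot Q C C 1 \<longleftrightarrow> dl C \<in> Tot Q C C 1"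
  using Tot_minus[of "dl C" Q C C 1] Tot_minus[of "- dl C" Q C C 1] by auto
 ultimately have "- dl C \<in> Tot Q (csh C) (csh C) 1 \<longleftrightarrow> dl C \<in> Tot Q C C 1" by simp
 then show ?thesis by (simp add: wfc_def dl_csh cm_linear)
qed

lemma D_csh_right: "D X (csh Y) i \<phi> = - D X Y (i + 1) \<phi>"
 and D_csh_left: "D (csh X) Y i \<phi> = D X Y (i - 1) \<phi>"
proof -
 show "D X (csh Y) i \<phi> = - D X Y (i + 1) \<phi>"
  unfolding D_def dl_csh cm_linear sg_shift sc_linear csh_simps by (simp only: minus_diff_eq) simp
 show "D (csh X) Y i \<phi> = D X Y (i - 1) \<phi>"
  unfolding D_def dl_csh cm_linear sg_shift sc_linear csh_simps ..
qed

lemma Z_csh_right: "Z Q X (csh Y) i = Z Q X Y (i + 1)"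
 and Z_csh_left: "Z Q (csh X) Y i = Z Q X Y (i - 1)"
 by (simp_all add: Z_def Tot_csh_right Tot_csh_left D_csh_right D_csh_left)

lemma Bd_csh_right: "Bd Q X (csh Y) i = Bd Q X Y (i + 1)"
 and Bd_csh_left: "Bd Q (csh X) Y i = Bd Q X Y (i - 1)"
proof -
 have "D X (csh Y) (i - 1) ` Tot Q X Y i = D X Y i ` Tot Q X Y i"
 proof -
  have "D X (csh Y) (i - 1) \<phi> = D X Y i (- \<phi>)" for \<phi>
   by (simp add: D_csh_right D_linear)
  then have "D X (csh Y) (i - 1) ` Tot Q X Y i = D X Y i ` uminus ` Tot Q X Y i" by (simp add: image_image)
  also have "uminus ` Tot Q X Y i = Tot Q X Y i"
  proof (intro equalityI subsetI)
   fix \<phi> assume "\<phi> \<in> Tot Q X Y i"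
   then have "- \<phi> \<in> Tot Q X Y i" by (rule Tot_minus)
   then have "- (- \<phi>) \<in> uminus ` Tot Q X Y i" by (rule imageI)
   then show "\<phi> \<in> uminus ` Tot Q X Y i" by (simp only: minus_minus)
  qed (auto simp: Tot_minus)
  finally show ?thesis .
 qed
 then show "Bd Q X (csh Y) i = Bd Q X Y (i + 1)" by (simp add: Bd_def Tot_csh_right)
 show "Bd Q (csh X) Y i = Bd Q X Y (i - 1)"
  unfolding Bd_def Tot_csh_left D_csh_left[abs_def] by simp
qed

lemma pm_csh: "pm (csh C) p = pm C p"
 by (induction p) (simp_all add: un_csh)

lemma pres_csh:
 assumes p: "pres X C \<kappa>"
 shows "pres (cshift X) (csh C) (\<lambda>i. \<kappa> (i + 1))"
proof -
 have am: "am (csh C) r = am C r" for r by (simp add: am_def pm_csh)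
 have vec: "vec (csh C) i = vec C (i + 1)" for i by (auto simp: vec_def)
 have S: "term_at (cshift X) i = term_at X (i + 1)"
  "x \<in> carrier (term_at X (i + 1)) ==> diff_at (cshift X) i x = \<ominus>\<^bsub>term_at X (i + 1 + 1)\<^esub> diff_at X (i + 1) x" for i x
  by (simp_all add: cshift_def)
 note bc = pres_bc[OF p]
 note G = pres_group[OF p]
 have ic: "\<ominus>\<^bsub>term_at X i\<^esub> x \<in> carrier (term_at X i)" if "x \<in> carrier (term_at X i)" for i x
  by (rule abelian_group.a_inv_closed[OF G that])
 have kd: "\<kappa> (i + 1 + 1) (diff_at (cshift X) i x) = - mv (lab C) (dd C) (\<kappa> (i + 1) x)"
  and dc: "diff_at (cshift X) i x \<in> carrier (term_at X (i + 1 + 1))" if x: "x \<in> carrier (term_at X (i + 1))" for i x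
  unfolding S(2)[OF x] by (simp_all only: pres_minus[OF p pres_diff_closed[OF p x]] pres_diff[OF p x] ic[OF pres_diff_closed[OF p x]])
 have "bounded_complex (path_algebra Q) (cshift X)"
  unfolding bounded_complex_def S(1)
 proof (intro conjI allI ballI)
  show "fg_right_module (path_algebra Q) (term_at X (i + 1))" for i using bc by (simp add: bounded_complex_def)
  show "diff_at (cshift X) i \<in> rmod_hom (path_algebra Q) (term_at X (i + 1)) (term_at X (i + 1 + 1))" for i
   unfolding rmod_hom_def
  proof (intro CollectI conjI ballI)
   interpret M1: right_module "path_algebra Q" "term_at X (i + 1)" by (rule pres_module[OF p])
   interpret M2: right_module "path_algebra Q" "term_at X (i + 1 + 1)" by (rule pres_module[OF p])
   show "diff_at (cshift X) i \<in> carrier (term_at X (i + 1)) \<rightarrow>\<^sub>E carrier (term_at X (i + 1 + 1))"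
    using dc[of _ i] by (intro PiE_I) (simp_all add: cshift_def)
   fix x assume x: "x \<in> carrier (term_at X (i + 1))"
   show "diff_at (cshift X) i (r \<odot>\<^bsub>term_at X (i + 1)\<^esub> x) = r \<odot>\<^bsub>term_at X (i + 1 + 1)\<^esub> diff_at (cshift X) i x"
    if r: "r \<in> carrier (path_algebra Q)" for r
   proof (rule pres_inj[OF p])
    show "diff_at (cshift X) i (r \<odot>\<^bsub>term_at X (i + 1)\<^esub> x) \<in> carrier (term_at X (i + 1 + 1))"
     "r \<odot>\<^bsub>term_at X (i + 1 + 1)\<^esub> diff_at (cshift X) i x \<in> carrier (term_at X (i + 1 + 1))"
     by (intro dc M1.act_closed M2.act_closed r x)+
    show "\<kappa> (i + 1 + 1) (diff_at (cshift X) i (r \<odot>\<^bsub>term_at X (i + 1)\<^esub> x)) = \<kappa> (i + 1 + 1) (r \<odot>\<^bsub>term_at X (i + 1 + 1)\<^esub> diff_at (cshift X) i x)"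
     unfolding kd[OF M1.act_closed[OF r x]] pres_act[OF p r x] pres_act[OF p r dc[OF x]] kd[OF x] mv_linear mv_am_dd[OF pres_wf[OF p]] ..
   qed
   show "diff_at (cshift X) i (x \<oplus>\<^bsub>term_at X (i + 1)\<^esub> y) = diff_at (cshift X) i x \<oplus>\<^bsub>term_at X (i + 1 + 1)\<^esub> diff_at (cshift X) i y"
    if y: "y \<in> carrier (term_at X (i + 1))" for y
   proof (rule pres_inj[OF p])
    show "diff_at (cshift X) i (x \<oplus>\<^bsub>term_at X (i + 1)\<^esub> y) \<in> carrier (term_at X (i + 1 + 1))"
     by (rule dc[OF M1.M.a_closed[OF x y]])
    show "diff_at (cshift X) i x \<oplus>\<^bsub>term_at X (i + 1 + 1)\<^esub> diff_at (cshift X) i y \<in> carrier (term_at X (i + 1 + 1))"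
     by (rule M2.M.a_closed[OF dc[OF x] dc[OF y]])
    have "\<kappa> (i + 1 + 1) (diff_at (cshift X) i (x \<oplus>\<^bsub>term_at X (i + 1)\<^esub> y)) =
      - mv (lab C) (dd C) (\<kappa> (i + 1) x + \<kappa> (i + 1) y)"
     unfolding kd[OF M1.M.a_closed[OF x y]] pres_add[OF p x y] ..
    also have "\<dots> = - mv (lab C) (dd C) (\<kappa> (i + 1) x) + - mv (lab C) (dd C) (\<kappa> (i + 1) y)"
     unfolding mv_linear(5) by (simp only: minus_add_distrib)
    also have "\<dots> = \<kappa> (i + 1 + 1) (diff_at (cshift X) i x \<oplus>\<^bsub>term_at X (i + 1 + 1)\<^esub> diff_at (cshift X) i y)"
     unfolding pres_add[OF p dc[OF x] dc[OF y]] kd[OF x] kd[OF y] ..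
    finally show "\<kappa> (i + 1 + 1) (diff_at (cshift X) i (x \<oplus>\<^bsub>term_at X (i + 1)\<^esub> y)) =
      \<kappa> (i + 1 + 1) (diff_at (cshift X) i x \<oplus>\<^bsub>term_at X (i + 1 + 1)\<^esub> diff_at (cshift X) i y)" .
   qed
  qed
  fix i x assume x: "x \<in> carrier (term_at X (i + 1))"
  show "diff_at (cshift X) (i + 1) (diff_at (cshift X) i x) = \<zero>\<^bsub>term_at X (i + 1 + 1 + 1)\<^esub>"
  proof (rule pres_inj[OF p])
   show "diff_at (cshift X) (i + 1) (diff_at (cshift X) i x) \<in> carrier (term_at X (i + 1 + 1 + 1))" by (intro dc x)
   show "\<zero>\<^bsub>term_at X (i + 1 + 1 + 1)\<^esub> \<in> carrier (term_at X (i + 1 + 1 + 1))"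
    by (rule abelian_monoid.zero_closed[OF abelian_group.axioms(1)[OF G]])
   have "\<kappa> (i + 1 + 1 + 1) (diff_at (cshift X) (i + 1) (diff_at (cshift X) i x)) =
     - mv (lab C) (dd C) (- mv (lab C) (dd C) (\<kappa> (i + 1) x))"
    using kd[OF dc[OF x]] unfolding kd[OF x] .
   also have "\<dots> = 0" unfolding mv_linear(7) mv_mv wfc_dd(2)[OF pres_wf[OF p]] mv_linear(4) by simp
   finally show "\<kappa> (i + 1 + 1 + 1) (diff_at (cshift X) (i + 1) (diff_at (cshift X) i x)) = \<kappa> (i + 1 + 1 + 1) \<zero>\<^bsub>term_at X (i + 1 + 1 + 1)\<^esub>"
    unfolding pres_zero[OF p] .
  qed
 next
  obtain a b where ab: "\<forall>i. i < a \<or> b < i --> carrier (term_at X i) = {\<zero>\<^bsub>term_at X i\<^esub>}"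
   using bc unfolding bounded_complex_def by blast
  show "\<exists>a b. \<forall>i. i < a \<or> b < i --> carrier (term_at X (i + 1)) = {\<zero>\<^bsub>term_at X (i + 1)\<^esub>}"
  proof (intro exI allI impI)
   fix i assume "i < a - 1 \<or> b < i"
   then have "i + 1 < a \<or> b < i + 1" by auto
   then show "carrier (term_at X (i + 1)) = {\<zero>\<^bsub>term_at X (i + 1)\<^esub>}" using ab by blast
  qed
 qed
 note bcs = this
 show ?thesis
  unfolding pres_def
 proof (intro conjI allI ballI)
  show "bounded_complex (path_algebra Q) (cshift X)" by (rule bcs)
  show "wfc Q (csh C)" unfolding wfc_csh by (rule pres_wf[OF p])
  show "bij_betw (\<kappa> (i + 1)) (carrier (term_at (cshift X) i)) (vec (csh C) i)" for i
   unfolding S(1) vec using p by (simp only: pres_def)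
  fix i x assume "x \<in> carrier (term_at (cshift X) i)"
  then have x: "x \<in> carrier (term_at X (i + 1))" by (simp only: S(1))
  show "\<kappa> (i + 1) (x \<oplus>\<^bsub>term_at (cshift X) i\<^esub> y) = \<kappa> (i + 1) x + \<kappa> (i + 1) y" if "y \<in> carrier (term_at (cshift X) i)" for y
   using pres_add[OF p x] that unfolding S(1) by blast
  show "\<kappa> (i + 1) (r \<odot>\<^bsub>term_at (cshift X) i\<^esub> x) = mv (lab (csh C)) (am (csh C) r) (\<kappa> (i + 1) x)" if "r \<in> carrier (path_algebra Q)" for r
   unfolding S(1) csh_simps am by (rule pres_act[OF p that x])
  show "\<kappa> (i + 1 + 1) (diff_at (cshift X) i x) = mv (lab (csh C)) (dd (csh C)) (\<kappa> (i + 1) x)"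
   unfolding csh_simps mv_linear(3) by (rule kd[OF x])
 qed
qed

end

section \<open>Morphisms of the derived category\<close>

context fin_quiver
begin

abbreviation PA :: "('v \<times> 'e list => 'k::field) ring" where
 "PA \<equiv> path_algebra Q"

lemma chain_maps_fam: "f \<in> chain_maps PA X Y ==> fam X Y 0 f"
 by (simp add: chain_maps_def fam_def)

lemma chain_mapsD:
 assumes "f \<in> chain_maps PA X Y" "x \<in> carrier (term_at X i)"
 shows "f i x \<in> carrier (term_at Y i)" "f (i + 1) (diff_at X i x) = diff_at Y i (f i x)"
 using assms famD(1)[OF chain_maps_fam[OF assms(1)] assms(2)] by (auto simp: chain_maps_def)

lemma mat0_apply:
 assumes "pres X C \<kappa>" "pres Y C' \<kappa>'" "f \<in> chain_maps PA X Y" "x \<in> carrier (term_at X i)"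
 shows "\<kappa>' i (f i x) = mv (lab C) (matf X C \<kappa> \<kappa>' 0 f) (\<kappa> i x)"
 using matf_apply[OF assms(1,2) chain_maps_fam[OF assms(3)] assms(4)] by simp

lemma mat0_ST:
 assumes "pres X C \<kappa>" "pres Y C' \<kappa>'" "f \<in> chain_maps PA X Y"
 shows "matf X C \<kappa> \<kappa>' 0 f \<in> ST C C' 0"
 by (rule matf_ST[OF assms(1,2) chain_maps_fam[OF assms(3)]])

lemma ST_HM: "M \<in> ST C C' i ==> M \<in> HM C C' i"
 by (simp add: ST_def)

lemma mat0_Z:
 assumes p: "pres X C \<kappa>" and q: "pres Y C' \<kappa>'" and f: "f \<in> chain_maps PA X Y"
 shows "nm (matf X C \<kappa> \<kappa>' 0 f) \<in> Z Q C C' 0"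
proof -
 let ?M = "matf X C \<kappa> \<kappa>' 0 f"
 note S = mat0_ST[OF p q f]
 note wf = pres_wf[OF p] pres_wf[OF q]
 have "mm (lab C') (dd C') ?M = mm (lab C) ?M (dd C)"
 proof (rule mat_eqI[of C])
  fix b assume b: "b \<in> lab C"
  let ?x = "ki X \<kappa> (dg C b) (ub b)"
  note x = ki(1,2)[OF p ub_vec[OF b]]
  have "mv (lab C) (mm (lab C') (dd C') ?M) (ub b) = \<kappa>' (dg C b + 1) (diff_at Y (dg C b) (f (dg C b) ?x))"
   unfolding pres_diff[OF q chain_mapsD(1)[OF f x(1)]] mat0_apply[OF p q f x(1)] x(2) mv_mv ..
  also have "\<dots> = \<kappa>' (dg C b + 1) (f (dg C b + 1) (diff_at X (dg C b) ?x))"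
   unfolding chain_mapsD(2)[OF f x(1)] ..
  also have "\<dots> = mv (lab C) (mm (lab C) ?M (dd C)) (ub b)"
   unfolding mat0_apply[OF p q f pres_diff_closed[OF p x(1)]] pres_diff[OF p x(1)] x(2) mv_mv ..
  finally show "mv (lab C) (mm (lab C') (dd C') ?M) (ub b) = mv (lab C) (mm (lab C) ?M (dd C)) (ub b)" .
 next
  fix x y assume x: "x \<notin> lab C"
  have "?M z x = 0" for z by (rule HM_zero[OF ST_HM[OF S]]) (use x in simp)
  then show "mm (lab C') (dd C') ?M y x = 0" by (simp add: mm_def)
  have "dd C z x = 0" for z by (rule HM_zero[OF wfc_dd(1)[OF wf(1)]]) (use x in simp)
  then show "mm (lab C) ?M (dd C) y x = 0" by (simp add: mm_def)
 qed (rule wfc_simps(1)[OF wf(1)])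
 then show ?thesis using ST_Z0[OF S] by simp
qed

lemma fmat_chain_map:
 assumes p: "pres X C \<kappa>" and q: "pres Y C' \<kappa>'" and M: "M \<in> ST C C' 0" "nm M \<in> Z Q C C' 0"
 shows "fmat X C \<kappa> Y \<kappa>' 0 M \<in> chain_maps PA X Y"
proof -
 note F = fmat_apply[OF p q M(1)]
 have c: "mm (lab C') (dd C') M = mm (lab C) M (dd C)" using ST_Z0[OF M(1)] M(2) by simp
 have "fmat X C \<kappa> Y \<kappa>' 0 M (i + 1) (diff_at X i x) = diff_at Y i (fmat X C \<kappa> Y \<kappa>' 0 M i x)"
  if x: "x \<in> carrier (term_at X i)" for i x
 proof (rule pres_inj[OF q, of _ "i + 1"])
  have y: "fmat X C \<kappa> Y \<kappa>' 0 M i x \<in> carrier (term_at Y i)" "\<kappa>' i (fmat X C \<kappa> Y \<kappa>' 0 M i x) = mv (lab C) M (\<kappa> i x)"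
   using F[OF x] by simp_all
  have z: "fmat X C \<kappa> Y \<kappa>' 0 M (i + 1) (diff_at X i x) \<in> carrier (term_at Y (i + 1))"
   "\<kappa>' (i + 1) (fmat X C \<kappa> Y \<kappa>' 0 M (i + 1) (diff_at X i x)) = mv (lab C) M (\<kappa> (i + 1) (diff_at X i x))"
   using F[OF pres_diff_closed[OF p x]] by simp_all
  show "fmat X C \<kappa> Y \<kappa>' 0 M (i + 1) (diff_at X i x) \<in> carrier (term_at Y (i + 1))" by (rule z(1))
  show "diff_at Y i (fmat X C \<kappa> Y \<kappa>' 0 M i x) \<in> carrier (term_at Y (i + 1))" by (rule pres_diff_closed[OF q y(1)])
  show "\<kappa>' (i + 1) (fmat X C \<kappa> Y \<kappa>' 0 M (i + 1) (diff_at X i x)) = \<kappa>' (i + 1) (diff_at Y i (fmat X C \<kappa> Y \<kappa>' 0 M i x))"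
   unfolding z(2) pres_diff[OF p x] pres_diff[OF q y(1)] y(2) mv_mv c ..
 qed
 then show ?thesis using fmat_fam[OF p q M(1)] by (simp add: chain_maps_def fam_def)
qed

lemma chain_comp_closed:
 assumes p: "pres X C \<kappa>" and f: "f \<in> chain_maps PA X Y" and g: "g \<in> chain_maps PA Y V"
 shows "chain_comp X g f \<in> chain_maps PA X V"
proof -
 note F = famD[OF chain_maps_fam[OF f], simplified] and G = famD[OF chain_maps_fam[OF g], simplified]
 have c: "chain_comp X g f i x = g i (f i x)" if "x \<in> carrier (term_at X i)" for i x
  using that by (simp add: chain_comp_def compose_def)
 show ?thesis
  unfolding chain_maps_def rmod_hom_def
 proof (intro CollectI conjI allI ballI)
  fix i
  interpret M: right_module PA "term_at X i" by (rule pres_module[OF p])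
  show "chain_comp X g f i \<in> carrier (term_at X i) \<rightarrow>\<^sub>E carrier (term_at V i)"
   using F(1) G(1) by (auto simp: chain_comp_def compose_def)
  fix x assume x: "x \<in> carrier (term_at X i)"
  show "chain_comp X g f (i + 1) (diff_at X i x) = diff_at V i (chain_comp X g f i x)"
   unfolding c[OF x] c[OF pres_diff_closed[OF p x]] chain_mapsD(2)[OF f x] by (rule chain_mapsD(2)[OF g F(1)[OF x]])
  show "chain_comp X g f i (r \<odot>\<^bsub>term_at X i\<^esub> x) = r \<odot>\<^bsub>term_at V i\<^esub> chain_comp X g f i x" if r: "r \<in> carrier PA" for r
   unfolding c[OF x] c[OF M.act_closed[OF r x]] F(3)[OF x r] by (rule G(3)[OF F(1)[OF x] r])
  show "chain_comp X g f i (x \<oplus>\<^bsub>term_at X i\<^esub> y) = chain_comp X g f i x \<oplus>\<^bsub>term_at V i\<^esub> chain_comp X g f i y"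
   if y: "y \<in> carrier (term_at X i)" for y
   unfolding c[OF x] c[OF y] c[OF M.M.a_closed[OF x y]] F(2)[OF x y] by (rule G(2)[OF F(1)[OF x] F(1)[OF y]])
 qed
qed

lemma chain_comp_assoc:
 "f \<in> chain_maps PA X Y ==> chain_comp X (chain_comp Y h g) f = chain_comp X h (chain_comp X g f)"
proof (intro ext)
 fix i x assume f: "f \<in> chain_maps PA X Y"
 show "chain_comp X (chain_comp Y h g) f i x = chain_comp X h (chain_comp X g f) i x"
  using chain_mapsD(1)[OF f, of x i] by (simp add: chain_comp_def compose_def)
qed

lemma mat0_comp:
 assumes p: "pres X C \<kappa>" and q: "pres Y C' \<kappa>'" and w: "pres V C'' \<kappa>''" and f: "f \<in> chain_maps PA X Y" and g: "g \<in> chain_maps PA Y V"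
 shows "matf X C \<kappa> \<kappa>'' 0 (chain_comp X g f) = mm (lab C') (matf Y C' \<kappa>' \<kappa>'' 0 g) (matf X C \<kappa> \<kappa>' 0 f)"
proof (rule matf_unique[OF p])
 show "mm (lab C') (matf Y C' \<kappa>' \<kappa>'' 0 g) (matf X C \<kappa> \<kappa>' 0 f) \<in> HM C C'' 0"
  using HM_mm[OF ST_HM[OF mat0_ST[OF q w g]] ST_HM[OF mat0_ST[OF p q f]]] by simp
 fix i x assume x: "x \<in> carrier (term_at X i)"
 have "chain_comp X g f i x = g i (f i x)" using x by (simp add: chain_comp_def compose_def)
 then show "\<kappa>'' (i + 0) (chain_comp X g f i x) = mv (lab C) (mm (lab C') (matf Y C' \<kappa>' \<kappa>'' 0 g) (matf X C \<kappa> \<kappa>' 0 f)) (\<kappa> i x)"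
  by (simp add: mat0_apply[OF q w g chain_mapsD(1)[OF f x]] mat0_apply[OF p q f x] mv_mv)
qed

lemma chain_id_closed:
 assumes p: "pres X C \<kappa>"
 shows "chain_id X \<in> chain_maps PA X X"
 unfolding chain_maps_def rmod_hom_def
proof (intro CollectI conjI allI ballI)
 fix i
 interpret M: right_module PA "term_at X i" by (rule pres_module[OF p])
 show "chain_id X i \<in> carrier (term_at X i) \<rightarrow>\<^sub>E carrier (term_at X i)" by (simp add: chain_id_def)
 fix x assume x: "x \<in> carrier (term_at X i)"
 show "chain_id X (i + 1) (diff_at X i x) = diff_at X i (chain_id X i x)"
  using x pres_diff_closed[OF p x] by (simp add: chain_id_def)
 show "chain_id X i (r \<odot>\<^bsub>term_at X i\<^esub> x) = r \<odot>\<^bsub>term_at X i\<^esub> chain_id X i x" if "r \<in> carrier PA" for r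
  using x M.act_closed[OF that x] by (simp add: chain_id_def)
 show "chain_id X i (x \<oplus>\<^bsub>term_at X i\<^esub> y) = chain_id X i x \<oplus>\<^bsub>term_at X i\<^esub> chain_id X i y" if "y \<in> carrier (term_at X i)" for y
  using x that M.M.a_closed[OF x that] by (simp add: chain_id_def)
qed

lemma mat0_id:
 assumes p: "pres X C \<kappa>"
 shows "matf X C \<kappa> \<kappa> 0 (chain_id X) = un C None"
 by (rule matf_unique[OF p HM_un])
  (simp add: chain_id_def mv_un[OF wfc_simps(1)[OF pres_wf[OF p]] pres_vec[OF p]])

lemma nm_un: "nm (un C None) = un C"
 by (rule cochn_eqI) (simp_all add: un_Some)

text \<open>A homotopy is a strict cochain of degree minus one. Its differential has no components
  at arrows, so it is a primitive of the difference of the two maps in the dg category.\<close>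

lemma homotopic_Bd:
 assumes p: "pres X C \<kappa>" and q: "pres Y C' \<kappa>'" and f: "f \<in> chain_maps PA X Y" and g: "g \<in> chain_maps PA X Y"
  and h: "homotopic PA X Y f g"
 shows "nm (matf X C \<kappa> \<kappa>' 0 f) - nm (matf X C \<kappa> \<kappa>' 0 g) \<in> Bd Q C C' 0"
proof -
 note wf = pres_wf[OF p] pres_wf[OF q]
 obtain h where h0: "(\<forall>i. h i \<in> rmod_hom PA (term_at X i) (term_at Y (i - 1))) \<and>
  (\<forall>i. \<forall>x\<in>carrier (term_at X i). f i x = g i x \<oplus>\<^bsub>term_at Y i\<^esub>
   (diff_at Y (i - 1) (h i x) \<oplus>\<^bsub>term_at Y i\<^esub> h (i + 1) (diff_at X i x)))"
  using h unfolding homotopic_def by (elim exE)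
 note hh = conjunct1[OF h0, THEN spec] and eq = conjunct2[OF h0, THEN spec, THEN bspec]
 have hf: "fam X Y (- 1) h" using hh by (simp add: fam_def)
 let ?H = "matf X C \<kappa> \<kappa>' (- 1) h"
 note HS = matf_ST[OF p q hf]
 have ha: "\<kappa>' (i - 1) (h i x) = mv (lab C) ?H (\<kappa> i x)" "h i x \<in> carrier (term_at Y (i - 1))" if "x \<in> carrier (term_at X i)" for i x
  using matf_apply[OF p q hf that] famD(1)[OF hf that] by simp_all
 let ?N = "matf X C \<kappa> \<kappa>' 0 g + (mm (lab C') (dd C') ?H + mm (lab C) ?H (dd C))"
 have "matf X C \<kappa> \<kappa>' 0 f = ?N"
 proof (rule matf_unique[OF p])
  have "mm (lab C') (dd C') ?H \<in> HM C C' 0" "mm (lab C) ?H (dd C) \<in> HM C C' 0"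
   using HM_mm[OF wfc_dd(1)[OF wf(2)] ST_HM[OF HS]] HM_mm[OF ST_HM[OF HS] wfc_dd(1)[OF wf(1)]] by simp_all
  then show "?N \<in> HM C C' 0" by (intro HM_linear ST_HM[OF mat0_ST[OF p q g]])
  fix i x assume x: "x \<in> carrier (term_at X i)"
  interpret G: abelian_group "term_at Y i" by (rule pres_group[OF q])
  have a: "diff_at Y (i - 1) (h i x) \<in> carrier (term_at Y i)" "\<kappa>' i (diff_at Y (i - 1) (h i x)) = mv (lab C') (dd C') (mv (lab C) ?H (\<kappa> i x))"
   using pres_diff_closed[OF q ha(2)[OF x]] pres_diff[OF q ha(2)[OF x]] ha(1)[OF x] by simp_all
  have b: "h (i + 1) (diff_at X i x) \<in> carrier (term_at Y i)" "\<kappa>' i (h (i + 1) (diff_at X i x)) = mv (lab C) ?H (mv (lab C) (dd C) (\<kappa> i x))"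
   using ha[OF pres_diff_closed[OF p x]] pres_diff[OF p x] by simp_all
  have "\<kappa>' i (f i x) = \<kappa>' i (g i x) + (\<kappa>' i (diff_at Y (i - 1) (h i x)) + \<kappa>' i (h (i + 1) (diff_at X i x)))"
   unfolding eq[OF x] pres_add[OF q chain_mapsD(1)[OF g x] G.a_closed[OF a(1) b(1)]] pres_add[OF q a(1) b(1)] ..
  also have "\<dots> = mv (lab C) ?N (\<kappa> i x)"
   unfolding a(2) b(2) mat0_apply[OF p q g x] mv_mv mv_linear ..
  finally show "\<kappa>' (i + 0) (f i x) = mv (lab C) ?N (\<kappa> i x)" by simp
 qed
 then have e: "nm (matf X C \<kappa> \<kappa>' 0 f) - nm (matf X C \<kappa> \<kappa>' 0 g) = nm (mm (lab C') (dd C') ?H + mm (lab C) ?H (dd C))"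
  by (simp add: nm_add)
 have "D C C' (- 1) (nm ?H) = nm (mm (lab C') (dd C') ?H + mm (lab C) ?H (dd C))"
  by (rule trans[OF ST_D[OF HS]]) (simp only: D_None nm_simps)
 then show ?thesis unfolding e using ST_HM[OF HS] by (intro Bd0I[of "nm ?H"]) (simp_all add: nm_Tot)
qed

text \<open>For the converse the primitive has to be strict. A coboundary of the dg category need
  not have a strict primitive, which is why morphisms are pulled back to a resolution.\<close>

lemma homotopicI:
 assumes p: "pres X C \<kappa>" and q: "pres Y C' \<kappa>'" and f: "f \<in> chain_maps PA X Y" and g: "g \<in> chain_maps PA X Y"
  and H: "H \<in> ST C C' (- 1)"
  and e: "matf X C \<kappa> \<kappa>' 0 f - matf X C \<kappa> \<kappa>' 0 g = mm (lab C') (dd C') H + mm (lab C) H (dd C)"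
 shows "homotopic PA X Y f g"
proof -
 define h where "h = fmat X C \<kappa> Y \<kappa>' (- 1) H"
 have hf: "fam X Y (- 1) h" unfolding h_def by (rule fmat_fam[OF p q H])
 have ha: "\<kappa>' (i - 1) (h i x) = mv (lab C) H (\<kappa> i x)" "h i x \<in> carrier (term_at Y (i - 1))" if "x \<in> carrier (term_at X i)" for i x
  using fmat_apply[OF p q H that] unfolding h_def by simp_all
 show ?thesis
  unfolding homotopic_def
 proof (intro exI[of _ h] conjI allI ballI)
  show "h i \<in> rmod_hom PA (term_at X i) (term_at Y (i - 1))" for i using hf by (simp add: fam_def)
  fix i x assume x: "x \<in> carrier (term_at X i)"
  interpret G: abelian_group "term_at Y i" by (rule pres_group[OF q])
  have a: "diff_at Y (i - 1) (h i x) \<in> carrier (term_at Y i)" "\<kappa>' i (diff_at Y (i - 1) (h i x)) = mv (lab C') (dd C') (mv (lab C) H (\<kappa> i x))"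
   using pres_diff_closed[OF q ha(2)[OF x]] pres_diff[OF q ha(2)[OF x]] ha(1)[OF x] by simp_all
  have b: "h (i + 1) (diff_at X i x) \<in> carrier (term_at Y i)" "\<kappa>' i (h (i + 1) (diff_at X i x)) = mv (lab C) H (mv (lab C) (dd C) (\<kappa> i x))"
   using ha[OF pres_diff_closed[OF p x]] pres_diff[OF p x] by simp_all
  note gx = chain_mapsD(1)[OF g x] and ab = G.a_closed[OF a(1) b(1)]
  have m: "matf X C \<kappa> \<kappa>' 0 f = matf X C \<kappa> \<kappa>' 0 g + (mm (lab C') (dd C') H + mm (lab C) H (dd C))"
   unfolding e[symmetric] by simp
  show "f i x = g i x \<oplus>\<^bsub>term_at Y i\<^esub> (diff_at Y (i - 1) (h i x) \<oplus>\<^bsub>term_at Y i\<^esub> h (i + 1) (diff_at X i x))"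
  proof (rule pres_inj[OF q chain_mapsD(1)[OF f x] G.a_closed[OF gx ab]])
   show "\<kappa>' i (f i x) = \<kappa>' i (g i x \<oplus>\<^bsub>term_at Y i\<^esub> (diff_at Y (i - 1) (h i x) \<oplus>\<^bsub>term_at Y i\<^esub> h (i + 1) (diff_at X i x)))"
    unfolding pres_add[OF q gx ab] pres_add[OF q a(1) b(1)] a(2) b(2) mat0_apply[OF p q g x] mat0_apply[OF p q f x] m mv_linear mv_mv ..
  qed
 qed
qed

text \<open>The coset of a cocycle, in coordinates.\<close>

definition coset :: "('v \<times> 'e list => 'k::field, 'm) cochain => ('b, 'v, 'e, 'k) qcx => (int => 'm => 'b => 'k) => int => 'm => 'm set" where
 "coset X C \<kappa> i x = {z \<in> carrier (term_at X i). \<exists>w\<in>vec C (i - 1). \<kappa> i z = mv (lab C) (dd C) w + \<kappa> i x}"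

section \<open>Cohomology and quasi-isomorphisms in coordinates\<close>

lemma coboundary:
 assumes p: "pres X C \<kappa>"
 shows "b \<in> coboundaries X i ==> b \<in> carrier (term_at X i) \<and> (\<exists>w\<in>vec C (i - 1). \<kappa> i b = mv (lab C) (dd C) w)"
  and "w \<in> vec C (i - 1) ==> \<exists>b\<in>coboundaries X i. b \<in> carrier (term_at X i) \<and> \<kappa> i b = mv (lab C) (dd C) w"
proof -
 have d: "diff_at X (i - 1) y \<in> carrier (term_at X i)" "\<kappa> i (diff_at X (i - 1) y) = mv (lab C) (dd C) (\<kappa> (i - 1) y)"
  if "y \<in> carrier (term_at X (i - 1))" for y
  using pres_diff_closed[OF p that] pres_diff[OF p that] by simp_all
 show "b \<in> coboundaries X i ==> b \<in> carrier (term_at X i) \<and> (\<exists>w\<in>vec C (i - 1). \<kappa> i b = mv (lab C) (dd C) w)"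
  unfolding coboundaries_def using d pres_vec[OF p] by blast
 assume "w \<in> vec C (i - 1)"
 then obtain y where y: "y \<in> carrier (term_at X (i - 1))" "\<kappa> (i - 1) y = w" using pres_surj[OF p] by blast
 then show "\<exists>b\<in>coboundaries X i. b \<in> carrier (term_at X i) \<and> \<kappa> i b = mv (lab C) (dd C) w"
  using d[OF y(1)] unfolding coboundaries_def by (intro bexI[OF _ imageI[OF y(1)]]) simp
qed

lemma cohomology_coset:
 assumes p: "pres X C \<kappa>"
 shows "cohomology X i = coset X C \<kappa> i ` cocycles X i"
proof -
 have c: "a_r_coset (term_at X i\<lparr>carrier := cocycles X i\<rparr>) (coboundaries X i) x = coset X C \<kappa> i x"
  if "x \<in> cocycles X i" for x
 proof -
  have x: "x \<in> carrier (term_at X i)" using that by (simp add: cocycles_def)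
  interpret G: abelian_group "term_at X i" by (rule pres_group[OF p])
  have "a_r_coset (term_at X i\<lparr>carrier := cocycles X i\<rparr>) (coboundaries X i) x = {b \<oplus>\<^bsub>term_at X i\<^esub> x | b. b \<in> coboundaries X i}"
   unfolding a_r_coset_def r_coset_def by auto
  also have "\<dots> = coset X C \<kappa> i x"
  proof (intro equalityI subsetI)
   fix z assume "z \<in> {b \<oplus>\<^bsub>term_at X i\<^esub> x | b. b \<in> coboundaries X i}"
   then obtain b where b: "b \<in> coboundaries X i" "z = b \<oplus>\<^bsub>term_at X i\<^esub> x" by blast
   then obtain w where w: "b \<in> carrier (term_at X i)" "w \<in> vec C (i - 1)" "\<kappa> i b = mv (lab C) (dd C) w"
    using coboundary(1)[OF p b(1)] by blast
   have "\<kappa> i z = mv (lab C) (dd C) w + \<kappa> i x" unfolding b(2) pres_add[OF p w(1) x] w(3) ..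
   then show "z \<in> coset X C \<kappa> i x" using G.a_closed[OF w(1) x] w(2) unfolding coset_def b(2) by blast
  next
   fix z assume "z \<in> coset X C \<kappa> i x"
   then obtain w where w: "z \<in> carrier (term_at X i)" "w \<in> vec C (i - 1)" "\<kappa> i z = mv (lab C) (dd C) w + \<kappa> i x"
    unfolding coset_def by blast
   obtain b where b: "b \<in> coboundaries X i" "b \<in> carrier (term_at X i)" "\<kappa> i b = mv (lab C) (dd C) w"
    using coboundary(2)[OF p w(2)] by blast
   have "z = b \<oplus>\<^bsub>term_at X i\<^esub> x"
    by (rule pres_inj[OF p w(1) G.a_closed[OF b(2) x]]) (simp add: pres_add[OF p b(2) x] b(3) w(3))
   then show "z \<in> {b \<oplus>\<^bsub>term_at X i\<^esub> x | b. b \<in> coboundaries X i}" using b(1) by blast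
  qed
  finally show ?thesis .
 qed
 have "cohomology X i = (\<Union>x\<in>cocycles X i. {a_r_coset (term_at X i\<lparr>carrier := cocycles X i\<rparr>) (coboundaries X i) x})"
  unfolding cohomology_def A_RCOSETS_def RCOSETS_def a_r_coset_def by simp
 then show ?thesis using c by auto
qed

lemma coset_eq:
 assumes p: "pres X C \<kappa>" and x: "x \<in> carrier (term_at X i)" and y: "y \<in> carrier (term_at X i)"
 shows "coset X C \<kappa> i x = coset X C \<kappa> i y \<longleftrightarrow> (\<exists>w\<in>vec C (i - 1). \<kappa> i x = mv (lab C) (dd C) w + \<kappa> i y)"
proof
 assume "coset X C \<kappa> i x = coset X C \<kappa> i y"
 moreover have "x \<in> coset X C \<kappa> i x"
  unfolding coset_def using x vec_linear(4)[of C "i - 1"] by (auto intro!: bexI[of _ 0] simp: mv_linear)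
 ultimately show "\<exists>w\<in>vec C (i - 1). \<kappa> i x = mv (lab C) (dd C) w + \<kappa> i y" unfolding coset_def by blast
next
 assume "\<exists>w\<in>vec C (i - 1). \<kappa> i x = mv (lab C) (dd C) w + \<kappa> i y"
 then obtain w where w: "w \<in> vec C (i - 1)" "\<kappa> i x = mv (lab C) (dd C) w + \<kappa> i y" by blast
 show "coset X C \<kappa> i x = coset X C \<kappa> i y"
  unfolding coset_def
 proof (intro equalityI subsetI CollectI conjI; elim CollectE conjE bexE)
  fix z v assume v: "v \<in> vec C (i - 1)" "\<kappa> i z = mv (lab C) (dd C) v + \<kappa> i x"
  have "\<kappa> i z = mv (lab C) (dd C) (v + w) + \<kappa> i y" unfolding v(2) w(2) mv_linear by (simp add: add.assoc)
  then show "\<exists>w\<in>vec C (i - 1). \<kappa> i z = mv (lab C) (dd C) w + \<kappa> i y" using vec_linear(1)[OF v(1) w(1)] by blast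
 next
  fix z v assume v: "v \<in> vec C (i - 1)" "\<kappa> i z = mv (lab C) (dd C) v + \<kappa> i y"
  have "\<kappa> i z = mv (lab C) (dd C) (v - w) + \<kappa> i x" unfolding v(2) w(2) mv_linear by simp
  then show "\<exists>w\<in>vec C (i - 1). \<kappa> i z = mv (lab C) (dd C) w + \<kappa> i x" using vec_linear(2)[OF v(1) w(1)] by blast
 qed simp_all
qed

lemma cohomology_map_coset:
 assumes p: "pres X C \<kappa>" and q: "pres Y C' \<kappa>'" and f: "f \<in> chain_maps PA X Y" and x: "x \<in> carrier (term_at X i)"
 shows "cohomology_map Y f i (coset X C \<kappa> i x) = coset Y C' \<kappa>' i (f i x)"
proof -
 let ?M = "matf X C \<kappa> \<kappa>' 0 f"
 interpret G: abelian_group "term_at Y i" by (rule pres_group[OF q])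
 note fx = chain_mapsD(1)[OF f x]
 have comm: "mm (lab C') (dd C') ?M = mm (lab C) ?M (dd C)" using Z0_None[OF mat0_Z[OF p q f]] by simp
 have "cohomology_map Y f i (coset X C \<kappa> i x) = {b \<oplus>\<^bsub>term_at Y i\<^esub> f i z | b z. b \<in> coboundaries Y i \<and> z \<in> coset X C \<kappa> i x}"
  unfolding cohomology_map_def set_add_def set_mult_def by auto
 also have "\<dots> = coset Y C' \<kappa>' i (f i x)"
 proof (intro equalityI subsetI)
  fix y assume "y \<in> {b \<oplus>\<^bsub>term_at Y i\<^esub> f i z | b z. b \<in> coboundaries Y i \<and> z \<in> coset X C \<kappa> i x}"
  then obtain b z where b: "b \<in> coboundaries Y i" and z: "z \<in> coset X C \<kappa> i x" and y: "y = b \<oplus>\<^bsub>term_at Y i\<^esub> f i z" by blast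
  obtain w where w: "z \<in> carrier (term_at X i)" "w \<in> vec C (i - 1)" "\<kappa> i z = mv (lab C) (dd C) w + \<kappa> i x"
   using z unfolding coset_def by blast
  obtain v where v: "b \<in> carrier (term_at Y i)" "v \<in> vec C' (i - 1)" "\<kappa>' i b = mv (lab C') (dd C') v"
   using coboundary(1)[OF q b] by blast
  note fz = chain_mapsD(1)[OF f w(1)]
  have Mw: "mv (lab C) ?M w \<in> vec C' (i - 1)" using mv_vec[OF ST_HM[OF mat0_ST[OF p q f]] w(2)] by simp
  have "\<kappa>' i y = mv (lab C') (dd C') (v + mv (lab C) ?M w) + \<kappa>' i (f i x)"
   unfolding y pres_add[OF q v(1) fz] v(3) mat0_apply[OF p q f w(1)] mat0_apply[OF p q f x] w(3) mv_linear mv_mv comm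
   by (simp add: add.assoc)
  then show "y \<in> coset Y C' \<kappa>' i (f i x)"
   unfolding coset_def using vec_linear(1)[OF v(2) Mw] G.a_closed[OF v(1) fz] y by blast
 next
  fix y assume "y \<in> coset Y C' \<kappa>' i (f i x)"
  then obtain w where w: "y \<in> carrier (term_at Y i)" "w \<in> vec C' (i - 1)" "\<kappa>' i y = mv (lab C') (dd C') w + \<kappa>' i (f i x)"
   unfolding coset_def by blast
  obtain b where b: "b \<in> coboundaries Y i" "b \<in> carrier (term_at Y i)" "\<kappa>' i b = mv (lab C') (dd C') w"
   using coboundary(2)[OF q w(2)] by blast
  have "y = b \<oplus>\<^bsub>term_at Y i\<^esub> f i x"
   by (rule pres_inj[OF q w(1) G.a_closed[OF b(2) fx]]) (simp add: pres_add[OF q b(2) fx] b(3) w(3))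
  moreover have "x \<in> coset X C \<kappa> i x"
   unfolding coset_def using x vec_linear(4)[of C "i - 1"] by (auto intro!: bexI[of _ 0] simp: mv_linear)
  ultimately show "y \<in> {b \<oplus>\<^bsub>term_at Y i\<^esub> f i z | b z. b \<in> coboundaries Y i \<and> z \<in> coset X C \<kappa> i x}" using b(1) by blast
 qed
 finally show ?thesis .
qed

lemma cocycle_iff:
 assumes p: "pres X C \<kappa>" and x: "x \<in> carrier (term_at X i)"
 shows "x \<in> cocycles X i \<longleftrightarrow> mv (lab C) (dd C) (\<kappa> i x) = 0"
proof -
 have z: "\<zero>\<^bsub>term_at X (i + 1)\<^esub> \<in> carrier (term_at X (i + 1))"
  by (rule abelian_monoid.zero_closed[OF abelian_group.axioms(1)[OF pres_group[OF p]]])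
 have "diff_at X i x = \<zero>\<^bsub>term_at X (i + 1)\<^esub> \<longleftrightarrow> \<kappa> (i + 1) (diff_at X i x) = 0"
  using pres_inj[OF p pres_diff_closed[OF p x] z] pres_zero[OF p, of "i + 1"] by auto
 then show ?thesis using x pres_diff[OF p x] by (simp add: cocycles_def)
qed

text \<open>Bijectivity on cosets amounts to injectivity and surjectivity on cohomology in
  coordinates, and over a field this is invertibility in the dg category.\<close>

lemma quasi_iso_iff:
 assumes p: "pres X C \<kappa>" and q: "pres Y C' \<kappa>'" and f: "f \<in> chain_maps PA X Y"
 shows "f \<in> quasi_isos PA X Y \<longleftrightarrow> hinv Q C C' (nm (matf X C \<kappa> \<kappa>' 0 f))"
proof -
 let ?M = "matf X C \<kappa> \<kappa>' 0 f"
 note wf = pres_wf[OF p] pres_wf[OF q]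
 have fc: "f i x \<in> cocycles Y i" if "x \<in> cocycles X i" for i x
 proof -
  have x: "x \<in> carrier (term_at X i)" "mv (lab C) (dd C) (\<kappa> i x) = 0" using that cocycle_iff[OF p] by (auto simp: cocycles_def)
  have "mv (lab C') (dd C') (\<kappa>' i (f i x)) = mv (lab C) ?M (mv (lab C) (dd C) (\<kappa> i x))"
   unfolding mat0_apply[OF p q f x(1)] mv_mv using Z0_None[OF mat0_Z[OF p q f]] by simp
  then show ?thesis using cocycle_iff[OF q chain_mapsD(1)[OF f x(1)]] x(2) by (simp add: mv_linear)
 qed
 have cc: "x \<in> carrier (term_at X i)" if "x \<in> cocycles X i" for i x using that by (simp add: cocycles_def)
 have bij: "bij_betw (cohomology_map Y f i) (cohomology X i) (cohomology Y i) \<longleftrightarrow>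
   (\<forall>x\<in>cocycles X i. \<forall>y\<in>cocycles X i. coset Y C' \<kappa>' i (f i x) = coset Y C' \<kappa>' i (f i y) --> coset X C \<kappa> i x = coset X C \<kappa> i y) \<and>
   (\<forall>y\<in>cocycles Y i. \<exists>x\<in>cocycles X i. coset Y C' \<kappa>' i y = coset Y C' \<kappa>' i (f i x))" (is "?B \<longleftrightarrow> ?I \<and> ?S") for i
 proof -
  have m: "cohomology_map Y f i (coset X C \<kappa> i x) = coset Y C' \<kappa>' i (f i x)" if "x \<in> cocycles X i" for x
   by (rule cohomology_map_coset[OF p q f cc[OF that]])
  have "inj_on (cohomology_map Y f i) (cohomology X i) \<longleftrightarrow> ?I"
   unfolding cohomology_coset[OF p] inj_on_def by (simp add: m)
  moreover have "cohomology_map Y f i ` cohomology X i = (\<lambda>x. coset Y C' \<kappa>' i (f i x)) ` cocycles X i"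
   unfolding cohomology_coset[OF p] image_image by (rule image_cong[OF refl m])
  moreover have "(\<lambda>x. coset Y C' \<kappa>' i (f i x)) ` cocycles X i = cohomology Y i \<longleftrightarrow> ?S"
   unfolding cohomology_coset[OF q]
  proof
   assume e: "(\<lambda>x. coset Y C' \<kappa>' i (f i x)) ` cocycles X i = coset Y C' \<kappa>' i ` cocycles Y i"
   show ?S
   proof
    fix y assume "y \<in> cocycles Y i"
    then have "coset Y C' \<kappa>' i y \<in> (\<lambda>x. coset Y C' \<kappa>' i (f i x)) ` cocycles X i" unfolding e by (rule imageI)
    then show "\<exists>x\<in>cocycles X i. coset Y C' \<kappa>' i y = coset Y C' \<kappa>' i (f i x)" by (elim imageE) (rule bexI)
   qed
  next
   assume S: ?S
   show "(\<lambda>x. coset Y C' \<kappa>' i (f i x)) ` cocycles X i = coset Y C' \<kappa>' i ` cocycles Y i"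
   proof (intro equalityI subsetI)
    fix c assume "c \<in> coset Y C' \<kappa>' i ` cocycles Y i"
    then show "c \<in> (\<lambda>x. coset Y C' \<kappa>' i (f i x)) ` cocycles X i" using S by auto
   qed (use fc in auto)
  qed
  ultimately show ?thesis unfolding bij_betw_def by simp
 qed
 have I: "(\<forall>i. \<forall>x\<in>cocycles X i. \<forall>y\<in>cocycles X i. coset Y C' \<kappa>' i (f i x) = coset Y C' \<kappa>' i (f i y) --> coset X C \<kappa> i x = coset X C \<kappa> i y)
   \<longleftrightarrow> inj_on_coho C C' ?M"
 proof
  assume L: "\<forall>i. \<forall>x\<in>cocycles X i. \<forall>y\<in>cocycles X i. coset Y C' \<kappa>' i (f i x) = coset Y C' \<kappa>' i (f i y) --> coset X C \<kappa> i x = coset X C \<kappa> i y"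
  show "inj_on_coho C C' ?M"
   unfolding inj_on_coho_def
  proof (intro allI ballI impI)
   fix i c assume c: "c \<in> vec C i" "mv (lab C) (dd C) c = 0" and "\<exists>y\<in>vec C' (i - 1). mv (lab C) ?M c = mv (lab C') (dd C') y"
   then obtain y where y: "y \<in> vec C' (i - 1)" "mv (lab C) ?M c = mv (lab C') (dd C') y" by blast
   obtain x where x: "x \<in> carrier (term_at X i)" "\<kappa> i x = c" using pres_surj[OF p c(1)] by blast
   have xc: "x \<in> cocycles X i" using cocycle_iff[OF p x(1)] x(2) c(2) by simp
   \<comment> \<open>Injectivity on cosets is applied to the pair of \<open>x\<close> and
     zero.\<close>
   let ?z = "\<zero>\<^bsub>term_at X i\<^esub>"
   have z: "?z \<in> carrier (term_at X i)" by (rule abelian_monoid.zero_closed[OF abelian_group.axioms(1)[OF pres_group[OF p]]])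
   have kz: "\<kappa> i ?z = 0" by (rule pres_zero[OF p])
   have zc: "?z \<in> cocycles X i" using cocycle_iff[OF p z] kz by (simp add: mv_linear)
   have "\<kappa>' i (f i x) = mv (lab C') (dd C') y + \<kappa>' i (f i ?z)"
    unfolding mat0_apply[OF p q f x(1)] mat0_apply[OF p q f z] kz x(2) y(2) mv_linear by simp
   then have "coset Y C' \<kappa>' i (f i x) = coset Y C' \<kappa>' i (f i ?z)"
    using coset_eq[OF q chain_mapsD(1)[OF f x(1)] chain_mapsD(1)[OF f z]] y(1) by blast
   then have "coset X C \<kappa> i x = coset X C \<kappa> i ?z" using L xc zc by blast
   then obtain w where "w \<in> vec C (i - 1)" "\<kappa> i x = mv (lab C) (dd C) w + \<kappa> i ?z" using coset_eq[OF p x(1) z] by blast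
   then show "\<exists>x\<in>vec C (i - 1). c = mv (lab C) (dd C) x" unfolding x(2) kz by auto
  qed
 next
  assume R: "inj_on_coho C C' ?M"
  show "\<forall>i. \<forall>x\<in>cocycles X i. \<forall>y\<in>cocycles X i. coset Y C' \<kappa>' i (f i x) = coset Y C' \<kappa>' i (f i y) --> coset X C \<kappa> i x = coset X C \<kappa> i y"
  proof (intro allI ballI impI)
   fix i x y assume xy: "x \<in> cocycles X i" "y \<in> cocycles X i" and e: "coset Y C' \<kappa>' i (f i x) = coset Y C' \<kappa>' i (f i y)"
   note x = cc[OF xy(1)] and y = cc[OF xy(2)]
   obtain w where w: "w \<in> vec C' (i - 1)" "\<kappa>' i (f i x) = mv (lab C') (dd C') w + \<kappa>' i (f i y)"
    using e coset_eq[OF q chain_mapsD(1)[OF f x] chain_mapsD(1)[OF f y]] by blast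
   have "mv (lab C) ?M (\<kappa> i x - \<kappa> i y) = mv (lab C') (dd C') w"
    using w(2) unfolding mat0_apply[OF p q f x] mat0_apply[OF p q f y] mv_linear by simp
   moreover have "mv (lab C) (dd C) (\<kappa> i x - \<kappa> i y) = 0"
    using cocycle_iff[OF p x] cocycle_iff[OF p y] xy by (simp add: mv_linear)
   ultimately obtain v where v: "v \<in> vec C (i - 1)" "\<kappa> i x - \<kappa> i y = mv (lab C) (dd C) v"
    using R[unfolded inj_on_coho_def, rule_format, OF vec_linear(2)[OF pres_vec[OF p x] pres_vec[OF p y]]] w(1) by blast
   have "\<kappa> i x = mv (lab C) (dd C) v + \<kappa> i y" unfolding v(2)[symmetric] by simp
   then show "coset X C \<kappa> i x = coset X C \<kappa> i y" using coset_eq[OF p x y] v(1) by blast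
  qed
 qed
 have S: "(\<forall>i. \<forall>y\<in>cocycles Y i. \<exists>x\<in>cocycles X i. coset Y C' \<kappa>' i y = coset Y C' \<kappa>' i (f i x)) \<longleftrightarrow> surj_on_coho C C' ?M"
 proof
  assume L: "\<forall>i. \<forall>y\<in>cocycles Y i. \<exists>x\<in>cocycles X i. coset Y C' \<kappa>' i y = coset Y C' \<kappa>' i (f i x)"
  show "surj_on_coho C C' ?M"
   unfolding surj_on_coho_def
  proof (intro allI ballI impI)
   fix i c assume c: "c \<in> vec C' i" "mv (lab C') (dd C') c = 0"
   obtain y where y: "y \<in> carrier (term_at Y i)" "\<kappa>' i y = c" using pres_surj[OF q c(1)] by blast
   have "y \<in> cocycles Y i" using cocycle_iff[OF q y(1)] y(2) c(2) by simp
   then obtain x where x: "x \<in> cocycles X i" "coset Y C' \<kappa>' i y = coset Y C' \<kappa>' i (f i x)" using L by blast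
   note xM = cc[OF x(1)]
   obtain w where w: "w \<in> vec C' (i - 1)" "\<kappa>' i y = mv (lab C') (dd C') w + \<kappa>' i (f i x)"
    using x(2) coset_eq[OF q y(1) chain_mapsD(1)[OF f xM]] by blast
   have "c = mv (lab C) ?M (\<kappa> i x) + mv (lab C') (dd C') w"
    using w(2) unfolding y(2) mat0_apply[OF p q f xM] by (simp only: add.commute)
   then show "\<exists>x\<in>vec C i. mv (lab C) (dd C) x = 0 \<and> (\<exists>y\<in>vec C' (i - 1). c = mv (lab C) ?M x + mv (lab C') (dd C') y)"
    using pres_vec[OF p xM] cocycle_iff[OF p xM] x(1) w(1) by blast
  qed
 next
  assume R: "surj_on_coho C C' ?M"
  show "\<forall>i. \<forall>y\<in>cocycles Y i. \<exists>x\<in>cocycles X i. coset Y C' \<kappa>' i y = coset Y C' \<kappa>' i (f i x)"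
  proof (intro allI ballI)
   fix i y assume y: "y \<in> cocycles Y i"
   then have yM: "y \<in> carrier (term_at Y i)" by (simp add: cocycles_def)
   have "mv (lab C') (dd C') (\<kappa>' i y) = 0" using cocycle_iff[OF q yM] y by simp
   then obtain c w where c: "c \<in> vec C i" "mv (lab C) (dd C) c = 0" "w \<in> vec C' (i - 1)" "\<kappa>' i y = mv (lab C) ?M c + mv (lab C') (dd C') w"
    using R[unfolded surj_on_coho_def, rule_format, OF pres_vec[OF q yM]] by blast
   obtain x where x: "x \<in> carrier (term_at X i)" "\<kappa> i x = c" using pres_surj[OF p c(1)] by blast
   have "\<kappa>' i y = mv (lab C') (dd C') w + \<kappa>' i (f i x)"
    using c(4) unfolding mat0_apply[OF p q f x(1)] x(2) by (simp only: add.commute)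
   then have "coset Y C' \<kappa>' i y = coset Y C' \<kappa>' i (f i x)"
    using coset_eq[OF q yM chain_mapsD(1)[OF f x(1)]] c(3) by blast
   moreover have "x \<in> cocycles X i" using cocycle_iff[OF p x(1)] x(2) c(2) by simp
   ultimately show "\<exists>x\<in>cocycles X i. coset Y C' \<kappa>' i y = coset Y C' \<kappa>' i (f i x)" by blast
  qed
 qed
 have "f \<in> quasi_isos PA X Y \<longleftrightarrow> inj_on_coho C C' ?M \<and> surj_on_coho C C' ?M"
 proof -
  have "f \<in> quasi_isos PA X Y \<longleftrightarrow> (\<forall>i. bij_betw (cohomology_map Y f i) (cohomology X i) (cohomology Y i))"
   using f by (simp only: quasi_isos_def mem_Collect_eq simp_thms)
  then show ?thesis by (simp only: bij all_conj_distrib I S)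
 qed
 moreover have "inj_on_coho C C' ?M \<and> surj_on_coho C C' ?M \<longleftrightarrow> hinv Q C C' (nm ?M)"
  using hinv_imp_coho[OF wf, of "nm ?M"] hinv_of_coho[OF wf mat0_Z[OF p q f]]
  unfolding nm_simps by blast
 ultimately show ?thesis by simp
qed

end

section \<open>Roofs and their classes in the dg category\<close>

context fin_quiver
begin

text \<open>One choice of coordinates is fixed for every object, so that classes attached to
  different roofs between the same objects can be compared.\<close>

definition CK :: "('v, 'e, 'k::field) derived_object => (int \<times> (nat => 'k), 'v, 'e, 'k) qcx \<times> (int => (nat => 'k) => int \<times> (nat => 'k) => 'k)" where
 "CK X = (SOME P. pres X (fst P) (snd P))"

definition CX :: "('v, 'e, 'k::field) derived_object => (int \<times> (nat => 'k), 'v, 'e, 'k) qcx" where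
 "CX X = fst (CK X)"

definition KX :: "('v, 'e, 'k::field) derived_object => int => (nat => 'k) => int \<times> (nat => 'k) => 'k" where
 "KX X = snd (CK X)"

lemma presX:
 fixes X :: "('v, 'e, 'k::field) derived_object"
 assumes "bounded_complex PA X"
 shows "pres X (CX X) (KX X)"
proof -
 obtain C :: "(int \<times> (nat => 'k), 'v, 'e, 'k) qcx" and \<kappa> where "pres X C \<kappa>"
  using pres_exists[OF assms] by (elim exE)
 then have "\<exists>P. pres X (fst P :: (int \<times> (nat => 'k), 'v, 'e, 'k) qcx) (snd P)" by (intro exI[of _ "(C, \<kappa>)"]) simp
 from someI_ex[OF this] show ?thesis unfolding CX_def KX_def CK_def .
qed

lemma wfX: "bounded_complex PA X ==> wfc Q (CX X)"
 by (rule pres_wf[OF presX])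

definition mt :: "('v, 'e, 'k::field) derived_object => ('v, 'e, 'k) derived_object => (int => (nat => 'k) => nat => 'k) =>
  (int \<times> (nat => 'k), int \<times> (nat => 'k), 'e, 'k) cochn" where
 "mt X Y f = nm (matf X (CX X) (KX X) (KX Y) 0 f)"

abbreviation cmp :: "('v, 'e, 'k::field) derived_object => (int \<times> (nat => 'k), int \<times> (nat => 'k), 'e, 'k) cochn =>
  (int \<times> (nat => 'k), int \<times> (nat => 'k), 'e, 'k) cochn => (int \<times> (nat => 'k), int \<times> (nat => 'k), 'e, 'k) cochn" where
 "cmp X \<equiv> cm (lab (CX X))"

abbreviation ZX :: "('v, 'e, 'k::field) derived_object => ('v, 'e, 'k) derived_object => int => (int \<times> (nat => 'k), int \<times> (nat => 'k), 'e, 'k) cochn set" where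
 "ZX X Y \<equiv> Z Q (CX X) (CX Y)"

abbreviation BX :: "('v, 'e, 'k::field) derived_object => ('v, 'e, 'k) derived_object => int => (int \<times> (nat => 'k), int \<times> (nat => 'k), 'e, 'k) cochn set" where
 "BX X Y \<equiv> Bd Q (CX X) (CX Y)"

abbreviation hX :: "('v, 'e, 'k::field) derived_object => ('v, 'e, 'k) derived_object => (int \<times> (nat => 'k), int \<times> (nat => 'k), 'e, 'k) cochn => bool" where
 "hX X Y \<equiv> hinv Q (CX X) (CX Y)"

abbreviation bcx :: "('v, 'e, 'k::field) derived_object => bool" where
 "bcx X \<equiv> bounded_complex PA X"

lemma mt_Z: "bcx X ==> bcx Y ==> f \<in> chain_maps PA X Y ==> mt X Y f \<in> ZX X Y 0"
 unfolding mt_def by (rule mat0_Z[OF presX presX])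

lemma mt_comp: "bcx X ==> bcx Y ==> bcx V ==> f \<in> chain_maps PA X Y ==> g \<in> chain_maps PA Y V ==>
  mt X V (chain_comp X g f) = cmp Y (mt Y V g) (mt X Y f)"
 unfolding mt_def nm_mm[symmetric] by (subst mat0_comp[OF presX presX presX]) simp_all

lemma mt_id: "bcx X ==> mt X X (chain_id X) = un (CX X)"
 unfolding mt_def by (simp add: mat0_id[OF presX] nm_un)

lemma cc: "bcx X ==> f \<in> chain_maps PA X Y ==> g \<in> chain_maps PA Y V ==> chain_comp X g f \<in> chain_maps PA X V"
 by (rule chain_comp_closed[OF presX])

lemma mt_homotopic: "bcx X ==> bcx Y ==> f \<in> chain_maps PA X Y ==> g \<in> chain_maps PA X Y ==> homotopic PA X Y f g ==>
  mt X Y f - mt X Y g \<in> BX X Y 0"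
 unfolding mt_def by (rule homotopic_Bd[OF presX presX])

lemma qi_iff: "bcx X ==> bcx Y ==> f \<in> quasi_isos PA X Y \<longleftrightarrow> f \<in> chain_maps PA X Y \<and> hX X Y (mt X Y f)"
 unfolding mt_def using quasi_iso_iff[OF presX presX, of X Y f] by (auto simp: quasi_isos_def)

text \<open>The identity map, read in two systems of coordinates, has two matrices that are strictly
  inverse to each other. So nothing below depends on the choice of coordinates.\<close>

lemma pres_change:
 fixes X :: "('v \<times> 'e list => 'k::field, 'm) cochain" and C :: "('b, 'v, 'e, 'k) qcx" and C' :: "('c, 'v, 'e, 'k) qcx"
 assumes p: "pres X C \<kappa>" and q: "pres X C' \<kappa>'"
 shows "hinv Q C C' (nm (matf X C \<kappa> \<kappa>' 0 (chain_id X)))"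
proof -
 note i = chain_id_closed[OF p]
 have ii: "chain_comp X (chain_id X) (chain_id X) = chain_id X" by (auto simp: chain_comp_def chain_id_def compose_def fun_eq_iff)
 have a: "cm (lab C') (nm (matf X C' \<kappa>' \<kappa> 0 (chain_id X))) (nm (matf X C \<kappa> \<kappa>' 0 (chain_id X))) = un C"
  unfolding nm_mm[symmetric] mat0_comp[OF p q p i i, symmetric] ii mat0_id[OF p] by (rule nm_un)
 have b: "cm (lab C) (nm (matf X C \<kappa> \<kappa>' 0 (chain_id X))) (nm (matf X C' \<kappa>' \<kappa> 0 (chain_id X))) = un C'"
  unfolding nm_mm[symmetric] mat0_comp[OF q p q i i, symmetric] ii mat0_id[OF q] by (rule nm_un)
 show ?thesis
  unfolding hinv_def
 proof (intro conjI bexI[of _ "nm (matf X C' \<kappa>' \<kappa> 0 (chain_id X))"] mat0_Z[OF p q i] mat0_Z[OF q p i])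
  show "cm (lab C') (nm (matf X C' \<kappa>' \<kappa> 0 (chain_id X))) (nm (matf X C \<kappa> \<kappa>' 0 (chain_id X))) - un C \<in> Bd Q C C 0"
   "cm (lab C) (nm (matf X C \<kappa> \<kappa>' 0 (chain_id X))) (nm (matf X C' \<kappa>' \<kappa> 0 (chain_id X))) - un C' \<in> Bd Q C' C' 0"
   unfolding a b by (simp_all add: Bd_zero)
 qed
qed

text \<open>On a suitable quasi-isomorphic complex, morphisms of the derived category are chain maps up to
 homotopy.\<close>

definition resolves :: "('v, 'e, 'k::field) derived_object => ('v, 'e, 'k) derived_object => (int => (nat => 'k) => nat => 'k) => bool" where
 "resolves X W p \<longleftrightarrow> bcx W \<and> p \<in> chain_maps PA W X \<and> hX W X (mt W X p) \<and>
  (\<forall>Y \<phi>. bcx Y --> \<phi> \<in> ZX X Y 0 --> (\<exists>g\<in>chain_maps PA W Y. cmp X \<phi> (mt W X p) - mt W Y g \<in> BX W Y 0)) \<and>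
  (\<forall>Y f g. bcx Y --> f \<in> chain_maps PA X Y --> g \<in> chain_maps PA X Y --> mt X Y f - mt X Y g \<in> BX X Y 0 -->
   homotopic PA W Y (chain_comp W f p) (chain_comp W g p))"

lemma resolvesD:
 assumes "resolves X W p"
 shows "bcx W" "p \<in> chain_maps PA W X" "hX W X (mt W X p)"
  "bcx Y ==> \<phi> \<in> ZX X Y 0 ==> \<exists>g\<in>chain_maps PA W Y. cmp X \<phi> (mt W X p) - mt W Y g \<in> BX W Y 0"
  "bcx Y ==> f \<in> chain_maps PA X Y ==> g \<in> chain_maps PA X Y ==> mt X Y f - mt X Y g \<in> BX X Y 0 ==>
   homotopic PA W Y (chain_comp W f p) (chain_comp W g p)"
 using assms unfolding resolves_def by (elim conjE; assumption | blast)+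

text \<open>\<open>W\<close> realizes the standard resolution of the coordinates of
  \<open>X\<close>. A class on \<open>X\<close> becomes a chain map by \<open>rmap_class\<close>,
  and homologous chain maps become homotopic by \<open>strict_null_homotopic\<close>.\<close>

lemma resolution:
 fixes X :: "('v, 'e, 'k::field) derived_object"
 assumes X: "bcx X"
 shows "\<exists>W p. resolves X W p"
proof -
 note pX = presX[OF X]
 note wf = pres_wf[OF pX]
 note wr = wfc_res[OF wf]
 obtain W :: "('v, 'e, 'k) derived_object" and \<kappa> where pW: "pres W (res (CX X)) \<kappa>" using real_exists[OF wr] by (elim exE)
 note W = pres_bc[OF pW]
 let ?p = "fmat W (res (CX X)) \<kappa> X (KX X) 0 (raug (CX X))"
 have pc: "?p \<in> chain_maps PA W X" by (rule fmat_chain_map[OF pW pX raug_ST[OF wf] raug_Z[OF wf]])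
 have mp: "matf W (res (CX X)) \<kappa> (KX X) 0 ?p = raug (CX X)" by (rule matf_fmat[OF pW pX raug_ST[OF wf]])
 have idW: "chain_id W \<in> chain_maps PA W W" by (rule chain_id_closed[OF pW])
 \<comment> \<open>The coordinates chosen for \<open>W\<close> need not be those of the resolution,
   so classes are compared through this invertible change of coordinates.\<close>
 let ?b = "nm (matf W (CX W) (KX W) \<kappa> 0 (chain_id W))"
 have hb: "hinv Q (CX W) (res (CX X)) ?b" by (rule pres_change[OF presX[OF W] pW])
 have base: "mt W Y g = cm (lab (res (CX X))) (nm (matf W (res (CX X)) \<kappa> (KX Y) 0 g)) ?b" if Y: "bcx Y" and g: "g \<in> chain_maps PA W Y" for Y g
 proof -
  have "chain_comp W g (chain_id W) i x = g i x" for i x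
   using g by (auto simp: chain_comp_def chain_id_def compose_def chain_maps_def rmod_hom_def PiE_def extensional_def)
  then have e: "chain_comp W g (chain_id W) = g" by (rule ext[OF ext])
  show ?thesis unfolding mt_def nm_mm[symmetric] mat0_comp[OF presX[OF W] pW presX[OF Y] idW g, symmetric] e ..
 qed
 show ?thesis
  unfolding resolves_def
 proof (intro exI[of _ W] exI[of _ ?p] conjI W pc allI impI)
  show "hX W X (mt W X ?p)"
   unfolding base[OF X pc] mp by (rule hinv_cm[OF wfX[OF W] wr wf raug_hinv[OF wf] hb])
 next
  fix Y :: "('v, 'e, 'k) derived_object" and \<phi> assume Y: "bcx Y" and \<phi>: "\<phi> \<in> ZX X Y 0"
  note pY = presX[OF Y]
  have T: "\<phi> \<in> Tot Q (CX X) (CX Y) 0" using \<phi> by (simp add: Z_def)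
  note RS = rmap_ST[OF wf wfX[OF Y] T] and RZ = rmap_Z[OF wf wfX[OF Y] \<phi>]
  let ?g = "fmat W (res (CX X)) \<kappa> Y (KX Y) 0 (rmap (CX X) (CX Y) \<phi>)"
  have gc: "?g \<in> chain_maps PA W Y" by (rule fmat_chain_map[OF pW pY RS RZ])
  have mg: "matf W (res (CX X)) \<kappa> (KX Y) 0 ?g = rmap (CX X) (CX Y) \<phi>" by (rule matf_fmat[OF pW pY RS])
  have "cm (lab (res (CX X))) (cm (lab (CX X)) \<phi> (nm (raug (CX X))) - nm (rmap (CX X) (CX Y) \<phi>)) ?b \<in> BX W Y 0"
   using hb rmap_class[OF wf wfX[OF Y] \<phi>] by (intro Bd0_cm_left) (auto simp: hinv_def)
  then have "cmp X \<phi> (mt W X ?p) - mt W Y ?g \<in> BX W Y 0"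
   unfolding base[OF X pc] base[OF Y gc] mp mg cm_diff_left cm_assoc .
  then show "\<exists>g\<in>chain_maps PA W Y. cmp X \<phi> (mt W X ?p) - mt W Y g \<in> BX W Y 0" using gc by (intro bexI)
 next
  fix Y :: "('v, 'e, 'k) derived_object" and f g assume Y: "bcx Y" and f: "f \<in> chain_maps PA X Y" and g: "g \<in> chain_maps PA X Y"
   and d: "mt X Y f - mt X Y g \<in> BX X Y 0"
  note pY = presX[OF Y]
  let ?F = "matf X (CX X) (KX X) (KX Y) 0 f" and ?G = "matf X (CX X) (KX X) (KX Y) 0 g"
  have ST: "?F - ?G \<in> ST (CX X) (CX Y) 0"
   using mat0_ST[OF pX pY f] mat0_ST[OF pX pY g] HM_linear(2) by (auto simp: ST_def mm_linear)
  have "nm (?F - ?G) \<in> BX X Y 0" using d by (simp add: mt_def nm_diff)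
  from strict_null_homotopic[OF wf wfX[OF Y] ST this]
  obtain h where h: "h \<in> ST (res (CX X)) (CX Y) (- 1)" "mm (lab (CX X)) (?F - ?G) (raug (CX X)) =
    mm (lab (CX Y)) (dd (CX Y)) h + mm (lab (res (CX X))) h (dd (res (CX X)))" by blast
  show "homotopic PA W Y (chain_comp W f ?p) (chain_comp W g ?p)"
  proof (rule homotopicI[OF pW pY chain_comp_closed[OF pW pc f] chain_comp_closed[OF pW pc g] h(1)])
   show "matf W (res (CX X)) \<kappa> (KX Y) 0 (chain_comp W f ?p) - matf W (res (CX X)) \<kappa> (KX Y) 0 (chain_comp W g ?p) =
    mm (lab (CX Y)) (dd (CX Y)) h + mm (lab (res (CX X))) h (dd (res (CX X)))"
    unfolding mat0_comp[OF pW pX pY pc f] mat0_comp[OF pW pX pY pc g] mp h(2)[symmetric] mm_linear ..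
  qed
 qed
qed

text \<open>The class \<open>\<phi>\<close> stands for the numerator composed with the inverse of
  the denominator. Writing the condition without the inverse avoids choosing one.\<close>

definition RC :: "((('v \<times> 'e list => 'k::field), nat => 'k) roof) => (int \<times> (nat => 'k), int \<times> (nat => 'k), 'e, 'k) cochn => bool" where
 "RC r \<phi> \<longleftrightarrow> is_roof PA r \<and> \<phi> \<in> ZX (src r) (tgt r) 0 \<and>
  cmp (src r) \<phi> (mt (apex r) (src r) (den r)) - mt (apex r) (tgt r) (num r) \<in> BX (apex r) (tgt r) 0"

lemma roofD:
 assumes "is_roof PA r"
 shows "bcx (src r)" "bcx (tgt r)" "bcx (apex r)" "den r \<in> chain_maps PA (apex r) (src r)"
  "num r \<in> chain_maps PA (apex r) (tgt r)" "hX (apex r) (src r) (mt (apex r) (src r) (den r))"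
  "mt (apex r) (src r) (den r) \<in> ZX (apex r) (src r) 0" "mt (apex r) (tgt r) (num r) \<in> ZX (apex r) (tgt r) 0"
proof -
 show b: "bcx (src r)" "bcx (tgt r)" "bcx (apex r)" and n: "num r \<in> chain_maps PA (apex r) (tgt r)"
  using assms by (auto simp: is_roof_def)
 have "den r \<in> quasi_isos PA (apex r) (src r)" using assms by (auto simp: is_roof_def)
 then show d: "den r \<in> chain_maps PA (apex r) (src r)" and "hX (apex r) (src r) (mt (apex r) (src r) (den r))"
  using qi_iff[OF b(3,1)] by auto
 show "mt (apex r) (src r) (den r) \<in> ZX (apex r) (src r) 0" "mt (apex r) (tgt r) (num r) \<in> ZX (apex r) (tgt r) 0"
  using mt_Z b d n by auto
qed

lemma Bd_trans: "a - b \<in> Bd Q X Y i ==> b - c \<in> Bd Q X Y i ==> a - c \<in> Bd Q X Y i"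
 using Bd_add[of "a - b" Q X Y i "b - c"] by simp

lemma Bd_swap: "a - b \<in> Bd Q X Y i ==> b - a \<in> Bd Q X Y i"
 using Bd_minus[of "a - b" Q X Y i] by simp

lemma RC_exists: "is_roof PA r ==> \<exists>\<phi>. RC r \<phi>"
proof -
 assume r: "is_roof PA r"
 note R = roofD[OF r]
 let ?d = "mt (apex r) (src r) (den r)" and ?n = "mt (apex r) (tgt r) (num r)"
 obtain \<psi> where \<psi>: "\<psi> \<in> ZX (src r) (apex r) 0" "cmp (src r) \<psi> ?d - un (CX (apex r)) \<in> BX (apex r) (apex r) 0"
  using R(6) by (rule hinvE)
 have "cmp (apex r) ?n (cmp (src r) \<psi> ?d - un (CX (apex r))) \<in> BX (apex r) (tgt r) 0"
  by (rule Bd0_cm_right[OF R(8) \<psi>(2)])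
 then have "cmp (src r) (cmp (apex r) ?n \<psi>) ?d - ?n \<in> BX (apex r) (tgt r) 0"
  unfolding cm_diff_right cm_assoc Z_wf_un(2)[OF wfX[OF R(3)] R(8)] .
 then have "RC r (cmp (apex r) ?n \<psi>)" unfolding RC_def using r Z0_cm[OF R(8) \<psi>(1)] by blast
 then show ?thesis by (intro exI)
qed

lemma RC_cong: "RC r \<phi> ==> \<psi> \<in> ZX (src r) (tgt r) 0 ==> \<phi> - \<psi> \<in> BX (src r) (tgt r) 0 ==> RC r \<psi>"
proof -
 assume a: "RC r \<phi>" "\<psi> \<in> ZX (src r) (tgt r) 0" "\<phi> - \<psi> \<in> BX (src r) (tgt r) 0"
 then have r: "is_roof PA r" by (simp add: RC_def)
 have "cmp (src r) (\<psi> - \<phi>) (mt (apex r) (src r) (den r)) \<in> BX (apex r) (tgt r) 0"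
  by (rule Bd0_cm_left[OF Bd_swap[OF a(3)] roofD(7)[OF r]])
 then show ?thesis using a(1,2) Bd_trans unfolding RC_def cm_diff_left by blast
qed

text \<open>After composition with the common denominator on \<open>W\<close> the two classes agree
  up to a coboundary, and this denominator is invertible and can be cancelled.\<close>

lemma roof_equiv_class:
 assumes e: "roof_equiv PA r r'" and c: "RC r \<phi>" "RC r' \<phi>'"
 shows "\<phi> - \<phi>' \<in> BX (src r) (tgt r) 0"
proof -
 have r: "is_roof PA r" "is_roof PA r'" and st: "src r' = src r" "tgt r' = tgt r"
  using e by (auto simp: roof_equiv_def)
 obtain W u u' where W: "bcx W" and u: "u \<in> chain_maps PA W (apex r)" "u' \<in> chain_maps PA W (apex r')"
  and q: "chain_comp W (den r) u \<in> quasi_isos PA W (src r)"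
  and h: "homotopic PA W (src r) (chain_comp W (den r) u) (chain_comp W (den r') u')"
   "homotopic PA W (tgt r) (chain_comp W (num r) u) (chain_comp W (num r') u')"
  using e unfolding roof_equiv_def by blast
 note R = roofD[OF r(1)] and R' = roofD[OF r(2), unfolded st]
 let ?d = "mt (apex r) (src r) (den r)" and ?n = "mt (apex r) (tgt r) (num r)" and ?u = "mt W (apex r) u"
 let ?d' = "mt (apex r') (src r) (den r')" and ?n' = "mt (apex r') (tgt r) (num r')" and ?u' = "mt W (apex r') u'"
 note uZ = mt_Z[OF W R(3) u(1)] and uZ' = mt_Z[OF W R'(3) u(2)]
 have D: "cmp (apex r) ?d ?u - cmp (apex r') ?d' ?u' \<in> BX W (src r) 0"
  using mt_homotopic[OF W R(1) cc[OF W u(1) R(4)] cc[OF W u(2) R'(4)] h(1)]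
  unfolding mt_comp[OF W R(3,1) u(1) R(4)] mt_comp[OF W R'(3,1) u(2) R'(4)] .
 have N: "cmp (apex r) ?n ?u - cmp (apex r') ?n' ?u' \<in> BX W (tgt r) 0"
  using mt_homotopic[OF W R(2) cc[OF W u(1) R(5)] cc[OF W u(2) R'(5)] h(2)]
  unfolding mt_comp[OF W R(3,2) u(1) R(5)] mt_comp[OF W R'(3,2) u(2) R'(5)] .
 have hq: "hX W (src r) (cmp (apex r) ?d ?u)"
  using q qi_iff[OF W R(1)] mt_comp[OF W R(3,1) u(1) R(4)] by simp
 have c1: "\<phi> \<in> ZX (src r) (tgt r) 0" "cmp (src r) \<phi> ?d - ?n \<in> BX (apex r) (tgt r) 0"
  and c2: "\<phi>' \<in> ZX (src r) (tgt r) 0" "cmp (src r) \<phi>' ?d' - ?n' \<in> BX (apex r') (tgt r) 0"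
  using c by (auto simp: RC_def st)
 have 1: "cmp (src r) \<phi> (cmp (apex r) ?d ?u) - cmp (apex r) ?n ?u \<in> BX W (tgt r) 0"
  using Bd0_cm_left[OF c1(2) uZ] unfolding cm_diff_left cm_assoc .
 have 2: "cmp (src r) \<phi>' (cmp (apex r') ?d' ?u') - cmp (apex r') ?n' ?u' \<in> BX W (tgt r) 0"
  using Bd0_cm_left[OF c2(2) uZ'] unfolding cm_diff_left cm_assoc .
 have 3: "cmp (src r) \<phi>' (cmp (apex r) ?d ?u) - cmp (src r) \<phi>' (cmp (apex r') ?d' ?u') \<in> BX W (tgt r) 0"
  using Bd0_cm_right[OF c2(1) D] unfolding cm_diff_right .
 have "cmp (src r) \<phi> (cmp (apex r) ?d ?u) - cmp (src r) \<phi>' (cmp (apex r) ?d ?u) \<in> BX W (tgt r) 0"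
  by (rule Bd_trans[OF Bd_trans[OF 1 N] Bd_trans[OF Bd_swap[OF 2] Bd_swap[OF 3]]])
 then have "cmp (src r) (\<phi> - \<phi>') (cmp (apex r) ?d ?u) \<in> BX W (tgt r) 0" unfolding cm_diff_left .
 then show ?thesis by (rule hinv_cancel_right[OF wfX[OF W] wfX[OF R(1)] hq Z_diff[OF c1(1) c2(1)]])
qed

lemma RC_unique: "RC r \<phi> ==> RC r \<phi>' ==> \<phi> - \<phi>' \<in> BX (src r) (tgt r) 0"
proof -
 assume c: "RC r \<phi>" "RC r \<phi>'"
 then have r: "is_roof PA r" by (simp add: RC_def)
 note R = roofD[OF r]
 let ?d = "mt (apex r) (src r) (den r)" and ?n = "mt (apex r) (tgt r) (num r)"
 have a: "\<phi> \<in> ZX (src r) (tgt r) 0" "\<phi>' \<in> ZX (src r) (tgt r) 0" "cmp (src r) \<phi> ?d - ?n \<in> BX (apex r) (tgt r) 0"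
  "cmp (src r) \<phi>' ?d - ?n \<in> BX (apex r) (tgt r) 0" using c by (auto simp: RC_def)
 have "cmp (src r) (\<phi> - \<phi>') ?d \<in> BX (apex r) (tgt r) 0"
  unfolding cm_diff_left by (rule Bd_trans[OF a(3) Bd_swap[OF a(4)]])
 then show ?thesis by (rule hinv_cancel_right[OF wfX[OF R(3)] wfX[OF R(1)] R(6) Z_diff[OF a(1,2)]])
qed

text \<open>Two classes with the same composite can be completed to a homotopy commutative square.\<close>

definition completes :: "('v, 'e, 'k::field) derived_object => ('v, 'e, 'k) derived_object => (int \<times> (nat => 'k), int \<times> (nat => 'k), 'e, 'k) cochn =>
  ('v, 'e, 'k) derived_object => (int => (nat => 'k) => nat => 'k) => (int => (nat => 'k) => nat => 'k) => bool" where
 "completes V V' s W u u' \<longleftrightarrow> bcx W \<and> u \<in> chain_maps PA W V \<and> u' \<in> chain_maps PA W V' \<and> hX W V (mt W V u) \<and>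
  (\<forall>Y f f'. bcx Y --> f \<in> chain_maps PA V Y --> f' \<in> chain_maps PA V' Y --> mt V Y f - cmp V' (mt V' Y f') s \<in> BX V Y 0 -->
   homotopic PA W Y (chain_comp W f u) (chain_comp W f' u'))"

lemma completesD:
 assumes "completes V V' s W u u'"
 shows "bcx W" "u \<in> chain_maps PA W V" "u' \<in> chain_maps PA W V'" "hX W V (mt W V u)"
  "bcx Y ==> f \<in> chain_maps PA V Y ==> f' \<in> chain_maps PA V' Y ==> mt V Y f - cmp V' (mt V' Y f') s \<in> BX V Y 0 ==>
   homotopic PA W Y (chain_comp W f u) (chain_comp W f' u')"
 using assms unfolding completes_def by (elim conjE; assumption | blast)+

text \<open>Two resolutions are stacked. The first represents the class \<open>s\<close> by a chain
  map, and the second turns equality up to coboundaries into actual homotopies.\<close>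

lemma ore:
 fixes V V' :: "('v, 'e, 'k::field) derived_object"
 assumes b: "bcx V" "bcx V'" and s: "s \<in> ZX V V' 0"
 shows "\<exists>W' u u'. completes V V' s W' u u'"
proof -
 obtain W p where "resolves V W p" using resolution[OF b(1)] by (elim exE)
 note W = resolvesD[OF this]
 obtain u0 where u0: "u0 \<in> chain_maps PA W V'" "cmp V s (mt W V p) - mt W V' u0 \<in> BX W V' 0" using W(4)[OF b(2) s] by (elim bexE)
 obtain W' p' where "resolves W W' p'" using resolution[OF W(1)] by (elim exE)
 note W' = resolvesD[OF this]
 show ?thesis
  unfolding completes_def
 proof (rule exI[of _ W'], rule exI[of _ "chain_comp W' p p'"], rule exI[of _ "chain_comp W' u0 p'"], intro conjI allI impI W'(1) cc[OF W'(1,2) W(2)] cc[OF W'(1,2) u0(1)])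
  show "hX W' V (mt W' V (chain_comp W' p p'))"
   unfolding mt_comp[OF W'(1) W(1) b(1) W'(2) W(2)] by (rule hinv_cm[OF wfX[OF W'(1)] wfX[OF W(1)] wfX[OF b(1)] W(3) W'(3)])
  fix Y :: "('v, 'e, 'k) derived_object" and f f' assume Y: "bcx Y" and f: "f \<in> chain_maps PA V Y" and f': "f' \<in> chain_maps PA V' Y"
   and d: "mt V Y f - cmp V' (mt V' Y f') s \<in> BX V Y 0"
  have pZ: "mt W V p \<in> ZX W V 0" by (rule mt_Z[OF W(1) b(1) W(2)])
  have 1: "cmp V (mt V Y f) (mt W V p) - cmp V' (mt V' Y f') (cmp V s (mt W V p)) \<in> BX W Y 0"
   using Bd0_cm_left[OF d pZ] unfolding cm_diff_left cm_assoc .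
  have 2: "cmp V' (mt V' Y f') (cmp V s (mt W V p)) - cmp V' (mt V' Y f') (mt W V' u0) \<in> BX W Y 0"
   using Bd0_cm_right[OF mt_Z[OF b(2) Y f'] u0(2)] unfolding cm_diff_right .
  have "mt W Y (chain_comp W f p) - mt W Y (chain_comp W f' u0) \<in> BX W Y 0"
   unfolding mt_comp[OF W(1) b(1) Y W(2) f] mt_comp[OF W(1) b(2) Y u0(1) f'] by (rule Bd_trans[OF 1 2])
  from W'(5)[OF Y cc[OF W(1,2) f] cc[OF W(1) u0(1) f'] this]
  show "homotopic PA W' Y (chain_comp W' f (chain_comp W' p p')) (chain_comp W' f' (chain_comp W' u0 p'))"
   unfolding chain_comp_assoc[OF W'(2)] .
 qed
qed

lemma class_roof_equiv:
 assumes c: "RC r \<phi>" "RC r' \<phi>'" and st: "src r' = src r" "tgt r' = tgt r" and d: "\<phi> - \<phi>' \<in> BX (src r) (tgt r) 0"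
 shows "roof_equiv PA r r'"
proof -
 have r: "is_roof PA r" "is_roof PA r'" using c by (auto simp: RC_def)
 note R = roofD[OF r(1)] and R' = roofD[OF r(2), unfolded st]
 let ?d = "mt (apex r) (src r) (den r)" and ?n = "mt (apex r) (tgt r) (num r)"
 let ?d' = "mt (apex r') (src r) (den r')" and ?n' = "mt (apex r') (tgt r) (num r')"
 have c1: "\<phi> \<in> ZX (src r) (tgt r) 0" "cmp (src r) \<phi> ?d - ?n \<in> BX (apex r) (tgt r) 0"
  and c2: "\<phi>' \<in> ZX (src r) (tgt r) 0" "cmp (src r) \<phi>' ?d' - ?n' \<in> BX (apex r') (tgt r) 0"
  using c by (auto simp: RC_def st)
 obtain \<sigma> where \<sigma>: "\<sigma> \<in> ZX (src r) (apex r') 0" "cmp (apex r') ?d' \<sigma> - un (CX (src r)) \<in> BX (src r) (src r) 0"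
  using R'(6) by (rule hinvE)
 \<comment> \<open>The denominator of \<open>r\<close> followed by an inverse of the denominator of
   \<open>r'\<close>. This is only a class, and completing it yields the chain maps of a common
   refinement of the two roofs.\<close>
 let ?s = "cmp (src r) \<sigma> ?d"
 have s: "?s \<in> ZX (apex r) (apex r') 0" by (rule Z0_cm[OF \<sigma>(1) R(7)])
 obtain W u u' where "completes (apex r) (apex r') ?s W u u'" using ore[OF R(3) R'(3) s] by (elim exE)
 note W = completesD[OF this]
 have ds: "cmp (apex r') ?d' ?s - ?d \<in> BX (apex r) (src r) 0"
  using Bd0_cm_left[OF \<sigma>(2) R(7)] unfolding cm_diff_left cm_assoc Z_wf_un(1)[OF wfX[OF R(1)] R(7)] .
 have 1: "cmp (src r) \<phi>' (cmp (apex r') ?d' ?s) - cmp (apex r') ?n' ?s \<in> BX (apex r) (tgt r) 0"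
  using Bd0_cm_left[OF c2(2) s] unfolding cm_diff_left cm_assoc .
 have 2: "cmp (src r) \<phi>' (cmp (apex r') ?d' ?s) - cmp (src r) \<phi>' ?d \<in> BX (apex r) (tgt r) 0"
  using Bd0_cm_right[OF c2(1) ds] unfolding cm_diff_right .
 have 3: "cmp (src r) \<phi> ?d - cmp (src r) \<phi>' ?d \<in> BX (apex r) (tgt r) 0"
  using Bd0_cm_left[OF d R(7)] unfolding cm_diff_left .
 have ns: "?n - cmp (apex r') ?n' ?s \<in> BX (apex r) (tgt r) 0"
  by (rule Bd_trans[OF Bd_trans[OF Bd_swap[OF c1(2)] 3] Bd_trans[OF Bd_swap[OF 2] 1]])
 have q: "chain_comp W (den r) u \<in> quasi_isos PA W (src r)"
  unfolding qi_iff[OF W(1) R(1)] mt_comp[OF W(1) R(3,1) W(2) R(4)]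
  using cc[OF W(1,2) R(4)] hinv_cm[OF wfX[OF W(1)] wfX[OF R(3)] wfX[OF R(1)] R(6) W(4)] by blast
 show ?thesis
  unfolding roof_equiv_def
 proof (intro conjI r st[symmetric] exI[of _ W] W(1) bexI[OF _ W(2)] bexI[OF _ W(3)] q)
  show "homotopic PA W (src r) (chain_comp W (den r) u) (chain_comp W (den r') u')"
   by (rule W(5)[OF R(1,4) R'(4) Bd_swap[OF ds]])
  show "homotopic PA W (tgt r) (chain_comp W (num r) u) (chain_comp W (num r') u')"
   by (rule W(5)[OF R(2,5) R'(5) ns])
 qed
qed

definition RS :: "('v, 'e, 'k::field) derived_object => ('v, 'e, 'k) derived_object => (int \<times> (nat => 'k), int \<times> (nat => 'k), 'e, 'k) cochn =>
  (('v \<times> 'e list => 'k, nat => 'k) roof) set" where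
 "RS X Y \<phi> = {r. RC r \<phi> \<and> src r = X \<and> tgt r = Y}"

text \<open>Equivalence of roofs is equality of classes up to coboundaries, so a morphism of the
  derived category is the set of all roofs with a given class.\<close>

lemma roof_class_RS:
 assumes c: "RC r \<phi>"
 shows "roof_class PA r = RS (src r) (tgt r) \<phi>"
proof (intro equalityI subsetI)
 fix r' assume "r' \<in> roof_class PA r"
 then have e: "roof_equiv PA r r'" by (simp add: roof_class_def)
 then have st: "src r' = src r" "tgt r' = tgt r" and r': "is_roof PA r'" by (auto simp: roof_equiv_def)
 obtain \<phi>' where c': "RC r' \<phi>'" using RC_exists[OF r'] by (elim exE)
 have "\<phi> \<in> ZX (src r') (tgt r') 0" using c by (simp add: RC_def st)
 from RC_cong[OF c' this] have "RC r' \<phi>" using Bd_swap[OF roof_equiv_class[OF e c c']] by (simp add: st)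
 then show "r' \<in> RS (src r) (tgt r) \<phi>" by (simp add: RS_def st)
next
 fix r' assume "r' \<in> RS (src r) (tgt r) \<phi>"
 then have c': "RC r' \<phi>" "src r' = src r" "tgt r' = tgt r" by (auto simp: RS_def)
 have "roof_equiv PA r r'" by (rule class_roof_equiv[OF c c']) (simp add: Bd_zero)
 then show "r' \<in> roof_class PA r" by (simp add: roof_class_def)
qed

text \<open>Every class comes from a roof, whose denominator is a resolution. Otherwise different
  classes could give the same empty set of roofs.\<close>

lemma RS_nonempty:
 assumes b: "bcx X" "bcx Y" and p: "\<phi> \<in> ZX X Y 0"
 shows "\<exists>r. RC r \<phi> \<and> src r = X \<and> tgt r = Y"
proof -
 obtain W p where "resolves X W p" using resolution[OF b(1)] by (elim exE)
 note W = resolvesD[OF this]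
 obtain g where g: "g \<in> chain_maps PA W Y" "cmp X \<phi> (mt W X p) - mt W Y g \<in> BX W Y 0" using W(4)[OF b(2) p] by (elim bexE)
 have "p \<in> quasi_isos PA W X" using qi_iff[OF W(1) b(1)] W(2,3) by blast
 then have "RC \<lparr>src = X, tgt = Y, apex = W, den = p, num = g\<rparr> \<phi>" using b W(1) g p by (simp add: RC_def is_roof_def)
 then show ?thesis by (intro exI[of _ "\<lparr>src = X, tgt = Y, apex = W, den = p, num = g\<rparr>"]) simp
qed

lemma RS_subset:
 assumes "\<phi> - \<psi> \<in> BX X Y 0" "\<psi> \<in> ZX X Y 0"
 shows "RS X Y \<phi> \<subseteq> RS X Y \<psi>"
proof
 fix r assume "r \<in> RS X Y \<phi>"
 then have r: "RC r \<phi>" "src r = X" "tgt r = Y" by (auto simp: RS_def)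
 have "RC r \<psi>" by (rule RC_cong[OF r(1)]) (simp_all add: r(2,3) assms)
 then show "r \<in> RS X Y \<psi>" using r(2,3) by (simp add: RS_def)
qed

lemma RS_eq_iff:
 assumes b: "bcx X" "bcx Y" and p: "\<phi> \<in> ZX X Y 0" "\<psi> \<in> ZX X Y 0"
 shows "RS X Y \<phi> = RS X Y \<psi> \<longleftrightarrow> \<phi> - \<psi> \<in> BX X Y 0"
proof
 assume e: "RS X Y \<phi> = RS X Y \<psi>"
 obtain r where r: "RC r \<phi>" "src r = X" "tgt r = Y" using RS_nonempty[OF b p(1)] by (elim exE conjE)
 then have "r \<in> RS X Y \<psi>" unfolding e[symmetric] by (simp add: RS_def)
 then have "RC r \<psi>" by (simp add: RS_def)
 from RC_unique[OF r(1) this] show "\<phi> - \<psi> \<in> BX X Y 0" unfolding r(2,3) .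
next
 assume d: "\<phi> - \<psi> \<in> BX X Y 0"
 show "RS X Y \<phi> = RS X Y \<psi>"
  by (intro equalityI RS_subset d Bd_swap[OF d] p)
qed

abbreviation DT :: "(('v, 'e, 'k::field) derived_object, (('v \<times> 'e list => 'k, nat => 'k) roof) set) tri_category" where
 "DT \<equiv> D_b_mod Q"

lemma DT_simps:
 "Obj DT = {X. bcx X}" "Hom DT X Y = {roof_class PA r | r. is_roof PA r \<and> src r = X \<and> tgt r = Y}"
 "Idn DT X = of_chain_map PA X X (chain_id X)" "Cmp DT = derived_comp PA" "Sh DT = cshift"
 by (simp_all add: D_b_mod_def bounded_derived_category_def derived_shift_category_def shift_category.extend_def)

lemma Hom_eq:
 assumes b: "bcx X" "bcx Y"
 shows "Hom DT X Y = RS X Y ` ZX X Y 0"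
proof (intro equalityI subsetI)
 fix h assume "h \<in> Hom DT X Y"
 then obtain r where r: "h = roof_class PA r" "is_roof PA r" "src r = X" "tgt r = Y" unfolding DT_simps by blast
 obtain \<phi> where p: "RC r \<phi>" using RC_exists[OF r(2)] by (elim exE)
 have "h = RS X Y \<phi>" using roof_class_RS[OF p] r by simp
 moreover have "\<phi> \<in> ZX X Y 0" using p r by (simp add: RC_def)
 ultimately show "h \<in> RS X Y ` ZX X Y 0" by (rule image_eqI)
next
 fix h assume "h \<in> RS X Y ` ZX X Y 0"
 then obtain \<phi> where p: "\<phi> \<in> ZX X Y 0" "h = RS X Y \<phi>" by blast
 obtain r where r: "RC r \<phi>" "src r = X" "tgt r = Y" using RS_nonempty[OF b p(1)] by (elim exE conjE)
 have "h = roof_class PA r" using roof_class_RS[OF r(1)] r p(2) by simp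
 then show "h \<in> Hom DT X Y" unfolding DT_simps using r by (auto simp: RC_def)
qed

lemma Hom_bcx: "h \<in> Hom DT X Y ==> bcx X \<and> bcx Y"
 unfolding DT_simps by (auto simp: is_roof_def)

lemma Idn_eq: "bcx X ==> Idn DT X = RS X X (un (CX X))"
proof -
 assume X: "bcx X"
 let ?r = "\<lparr>src = X, tgt = X, apex = X, den = chain_id X, num = chain_id X\<rparr>"
 have i: "chain_id X \<in> chain_maps PA X X" by (rule chain_id_closed[OF presX[OF X]])
 have q: "chain_id X \<in> quasi_isos PA X X" using qi_iff[OF X X] i mt_id[OF X] hinv_un[OF wfX[OF X]] by simp
 have "cmp X (un (CX X)) (un (CX X)) = un (CX X)" by (rule Z_wf_un(1)[OF wfX[OF X] un_Z[OF wfX[OF X]]])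
 then have "RC ?r (un (CX X))"
  using X i q un_Z[OF wfX[OF X]] Bd_zero by (simp add: RC_def is_roof_def mt_id[OF X])
 from roof_class_RS[OF this] show ?thesis unfolding DT_simps of_chain_map_def by simp
qed

text \<open>The composite is a union over all representatives and all completions to a square. Every
  such choice yields the product of the two classes, and \<open>ore\<close> provides at least one
  choice, so the union is a single class of roofs.\<close>

lemma Cmp_eq:
 assumes b: "bcx X" "bcx Y" "bcx V" and p: "\<phi> \<in> ZX X Y 0" and q: "\<psi> \<in> ZX Y V 0"
 shows "Cmp DT (RS Y V \<psi>) (RS X Y \<phi>) = RS X V (cmp Y \<psi> \<phi>)"
proof -
 have member: "roof_class PA \<lparr>src = src r, tgt = tgt r', apex = W, den = chain_comp W (den r) u, num = chain_comp W (num r') v\<rparr> =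
   RS X V (cmp Y \<psi> \<phi>)"
  if r: "r \<in> RS X Y \<phi>" and r': "r' \<in> RS Y V \<psi>" and W: "bcx W" and u: "u \<in> chain_maps PA W (apex r)" "hX W (apex r) (mt W (apex r) u)"
   and v: "v \<in> chain_maps PA W (apex r')" and h: "homotopic PA W (tgt r) (chain_comp W (num r) u) (chain_comp W (den r') v)"
  for r r' W u v
 proof -
  let ?r = "\<lparr>src = src r, tgt = tgt r', apex = W, den = chain_comp W (den r) u, num = chain_comp W (num r') v\<rparr>"
  have c: "RC r \<phi>" "RC r' \<psi>" and st: "src r = X" "tgt r = Y" "src r' = Y" "tgt r' = V" using r r' by (auto simp: RS_def)
  have ro: "is_roof PA r" "is_roof PA r'" using c by (auto simp: RC_def)
  note R = roofD[OF ro(1), unfolded st] and R' = roofD[OF ro(2), unfolded st]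
  let ?d = "mt (apex r) X (den r)" and ?n = "mt (apex r) Y (num r)" and ?u = "mt W (apex r) u"
  let ?d' = "mt (apex r') Y (den r')" and ?n' = "mt (apex r') V (num r')" and ?v = "mt W (apex r') v"
  have cs: "cmp X \<phi> ?d - ?n \<in> BX (apex r) Y 0" "cmp Y \<psi> ?d' - ?n' \<in> BX (apex r') V 0"
   using c by (auto simp: RC_def st)
  note uZ = mt_Z[OF W R(3) u(1)] and vZ = mt_Z[OF W R'(3) v]
  have H: "cmp (apex r) ?n ?u - cmp (apex r') ?d' ?v \<in> BX W Y 0"
   using mt_homotopic[OF W R(2) cc[OF W u(1) R(5)] cc[OF W v R'(4)] h[unfolded st]]
   unfolding mt_comp[OF W R(3,2) u(1) R(5)] mt_comp[OF W R'(3) R(2) v R'(4)] .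
  have 1: "cmp X \<phi> (cmp (apex r) ?d ?u) - cmp (apex r) ?n ?u \<in> BX W Y 0"
   using Bd0_cm_left[OF cs(1) uZ] unfolding cm_diff_left cm_assoc .
  have 2: "cmp Y \<psi> (cmp (apex r') ?d' ?v) - cmp (apex r') ?n' ?v \<in> BX W V 0"
   using Bd0_cm_left[OF cs(2) vZ] unfolding cm_diff_left cm_assoc .
  have 3: "cmp Y \<psi> (cmp X \<phi> (cmp (apex r) ?d ?u)) - cmp Y \<psi> (cmp (apex r') ?d' ?v) \<in> BX W V 0"
   using Bd0_cm_right[OF q Bd_trans[OF 1 H]] unfolding cm_diff_right .
  have e: "cmp X (cmp Y \<psi> \<phi>) (cmp (apex r) ?d ?u) - cmp (apex r') ?n' ?v \<in> BX W V 0"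
   unfolding cm_assoc[of _ _ \<psi>] by (rule Bd_trans[OF 3 2])
  have qi: "chain_comp W (den r) u \<in> quasi_isos PA W X"
   unfolding qi_iff[OF W R(1)] mt_comp[OF W R(3,1) u(1) R(4)]
   using cc[OF W u(1) R(4)] hinv_cm[OF wfX[OF W] wfX[OF R(3)] wfX[OF R(1)] R(6) u(2)] by blast
  have "is_roof PA ?r" using R(1) R'(2) W qi cc[OF W v R'(5)] by (simp add: is_roof_def st)
  then have "RC ?r (cmp Y \<psi> \<phi>)"
   unfolding RC_def using Z0_cm[OF q p] e by (simp add: st mt_comp[OF W R(3,1) u(1) R(4)] mt_comp[OF W R'(3,2) v R'(5)])
  from roof_class_RS[OF this] show ?thesis by (simp add: st)
 qed
 have all: "S = RS X V (cmp Y \<psi> \<phi>)"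
  if "S \<in> {roof_class PA \<lparr>src = src r, tgt = tgt r', apex = W, den = chain_comp W (den r) u, num = chain_comp W (num r') v\<rparr>
  | r r' W u v. r \<in> RS X Y \<phi> \<and> r' \<in> RS Y V \<psi> \<and> tgt r = src r' \<and> bcx W \<and>
    u \<in> quasi_isos PA W (apex r) \<and> v \<in> chain_maps PA W (apex r') \<and>
    homotopic PA W (tgt r) (chain_comp W (num r) u) (chain_comp W (den r') v)}" (is "S \<in> ?A") for S
 proof -
  obtain r r' W u v where S: "S = roof_class PA \<lparr>src = src r, tgt = tgt r', apex = W, den = chain_comp W (den r) u, num = chain_comp W (num r') v\<rparr>"
   and m: "r \<in> RS X Y \<phi>" "r' \<in> RS Y V \<psi>" "bcx W" "u \<in> quasi_isos PA W (apex r)" "v \<in> chain_maps PA W (apex r')"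
    "homotopic PA W (tgt r) (chain_comp W (num r) u) (chain_comp W (den r') v)"
   using \<open>S \<in> ?A\<close> by blast
  have "bcx (apex r)" using m(1) by (auto simp: RS_def RC_def is_roof_def)
  then have "u \<in> chain_maps PA W (apex r)" "hX W (apex r) (mt W (apex r) u)" using m(4) qi_iff[OF m(3)] by auto
  then show ?thesis unfolding S using member[OF m(1-3) _ _ m(5,6)] by blast
 qed
 obtain r where r: "RC r \<phi>" "src r = X" "tgt r = Y" using RS_nonempty[OF b(1,2) p] by (elim exE conjE)
 obtain r' where r': "RC r' \<psi>" "src r' = Y" "tgt r' = V" using RS_nonempty[OF b(2,3) q] by (elim exE conjE)
 have ro: "is_roof PA r" "is_roof PA r'" using r r' by (auto simp: RC_def)
 note R = roofD[OF ro(1), unfolded r(2,3)] and R' = roofD[OF ro(2), unfolded r'(2,3)]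
 obtain \<sigma> where \<sigma>: "\<sigma> \<in> ZX Y (apex r') 0" "cmp (apex r') (mt (apex r') Y (den r')) \<sigma> - un (CX Y) \<in> BX Y Y 0"
  using R'(6) by (rule hinvE)
 \<comment> \<open>The numerator of the first roof followed by an inverse of the denominator of the
   second. A completion of this class is the square needed for composing.\<close>
 let ?s = "cmp Y \<sigma> (mt (apex r) Y (num r))"
 have s: "?s \<in> ZX (apex r) (apex r') 0" by (rule Z0_cm[OF \<sigma>(1) R(8)])
 obtain W u v where "completes (apex r) (apex r') ?s W u v" using ore[OF R(3) R'(3) s] by (elim exE)
 note W = completesD[OF this]
 have "cmp (apex r') (mt (apex r') Y (den r')) ?s - mt (apex r) Y (num r) \<in> BX (apex r) Y 0"
  using Bd0_cm_left[OF \<sigma>(2) R(8)] unfolding cm_diff_left cm_assoc Z_wf_un(1)[OF wfX[OF R(2)] R(8)] .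
 from W(5)[OF R(2,5) R'(4) Bd_swap[OF this]]
 have h: "homotopic PA W Y (chain_comp W (num r) u) (chain_comp W (den r') v)" .
 have uq: "u \<in> quasi_isos PA W (apex r)" using qi_iff[OF W(1) R(3)] W(2,4) by blast
 let ?A = "{roof_class PA \<lparr>src = src r, tgt = tgt r', apex = W, den = chain_comp W (den r) u, num = chain_comp W (num r') v\<rparr>
  | r r' W u v. r \<in> RS X Y \<phi> \<and> r' \<in> RS Y V \<psi> \<and> tgt r = src r' \<and> bcx W \<and>
    u \<in> quasi_isos PA W (apex r) \<and> v \<in> chain_maps PA W (apex r') \<and>
    homotopic PA W (tgt r) (chain_comp W (num r) u) (chain_comp W (den r') v)}"
 have mem: "r \<in> RS X Y \<phi>" "r' \<in> RS Y V \<psi>" using r r' by (auto simp: RS_def)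
 have "roof_class PA \<lparr>src = src r, tgt = tgt r', apex = W, den = chain_comp W (den r) u, num = chain_comp W (num r') v\<rparr> \<in> ?A"
  by (rule CollectI, rule exI[of _ r], rule exI[of _ r'], rule exI[of _ W], rule exI[of _ u], rule exI[of _ v])
   (simp add: mem r r' W(1,3) uq h)
 then have "?A = {RS X V (cmp Y \<psi> \<phi>)}" using all by blast
 then show ?thesis unfolding DT_simps derived_comp_def by simp
qed

end

section \<open>Numerics in type D\<close>

text \<open>The edges of \<open>D\<^sub>n\<close> are numbered so that edge \<open>i\<close> joins
  \<open>anc n i\<close> to \<open>i + 1\<close>; thus \<open>n - 1\<close> and \<open>n\<close> are
  both attached to \<open>n - 2\<close>.\<close>

definition anc :: "nat => nat => nat" where
 "anc n i = (if i \<le> n - 2 then i else n - 2)"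

text \<open>The Euler form \<open>chi\<close> after numbering the vertices. The flag
  \<open>d i\<close> tells that the arrow on edge \<open>i\<close> points from
  \<open>anc n i\<close> to \<open>i + 1\<close>.\<close>

definition ch :: "nat => (nat => bool) => (nat => int) => (nat => int) => int" where
 "ch n d x y = (\<Sum>i=1..n. x i * y i) -
  (\<Sum>i=1..n - 1. if d i then x (anc n i) * y (i + 1) else x (i + 1) * y (anc n i))"

text \<open>Coordinates with respect to the standard orthogonal basis of the root lattice.\<close>

definition Ac :: "nat => (nat => int) => nat => int" where
 "Ac n x i = (if i = 1 then x 1 else if i \<le> n - 2 then x i - x (i - 1)
   else if i = n - 1 then x (n - 1) + x n - x (n - 2) else x n - x (n - 1))"

lemma ch_bilinear:
 "ch n d (\<lambda>i. u i + c * v i) y = ch n d u y + c * ch n d v y"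
 "ch n d y (\<lambda>i. u i + c * v i) = ch n d y u + c * ch n d y v"
proof -
 have a: "(\<Sum>i=1..n. (u i + c * v i) * y i) = (\<Sum>i=1..n. u i * y i) + c * (\<Sum>i=1..n. v i * y i)"
  "(\<Sum>i=1..n. y i * (u i + c * v i)) = (\<Sum>i=1..n. y i * u i) + c * (\<Sum>i=1..n. y i * v i)"
  unfolding sum_distrib_left sum.distrib[symmetric] by (auto simp: algebra_simps intro!: sum.cong)
 have b: "(\<Sum>i=1..n - 1. if d i then (u (anc n i) + c * v (anc n i)) * y (i + 1) else (u (i + 1) + c * v (i + 1)) * y (anc n i)) =
   (\<Sum>i=1..n - 1. if d i then u (anc n i) * y (i + 1) else u (i + 1) * y (anc n i)) +
   c * (\<Sum>i=1..n - 1. if d i then v (anc n i) * y (i + 1) else v (i + 1) * y (anc n i))"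
  "(\<Sum>i=1..n - 1. if d i then y (anc n i) * (u (i + 1) + c * v (i + 1)) else y (i + 1) * (u (anc n i) + c * v (anc n i))) =
   (\<Sum>i=1..n - 1. if d i then y (anc n i) * u (i + 1) else y (i + 1) * u (anc n i)) +
   c * (\<Sum>i=1..n - 1. if d i then y (anc n i) * v (i + 1) else y (i + 1) * v (anc n i))"
  unfolding sum_distrib_left sum.distrib[symmetric] by (auto simp: algebra_simps intro!: sum.cong)
 show "ch n d (\<lambda>i. u i + c * v i) y = ch n d u y + c * ch n d v y"
  "ch n d y (\<lambda>i. u i + c * v i) = ch n d y u + c * ch n d y v"
  unfolding ch_def a b by (simp_all add: algebra_simps)
qed

lemma Ac_linear: "Ac n (\<lambda>i. u i + c * v i) j = Ac n u j + c * Ac n v j"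
 by (simp add: Ac_def algebra_simps)

lemma chain_sum:
 fixes x y :: "nat => int"
 shows "(\<Sum>i=1..Suc m. if i = 1 then x 1 * y 1 else (x i - x (i - 1)) * (y i - y (i - 1))) =
  2 * (\<Sum>i=1..Suc m. x i * y i) - x (Suc m) * y (Suc m) - (\<Sum>i=1..m. x i * y (i + 1) + x (i + 1) * y i)"
 by (induction m) (simp_all add: algebra_simps)

text \<open>With simple roots \<open>e_i - e_(i+1)\<close> for \<open>i < n\<close> and
  \<open>e_(n-1) + e_n\<close>, a coefficient vector \<open>x\<close> has standard coordinates
  \<open>Ac n x\<close>. The symmetrised Euler form is the Cartan form, whatever the
  orientation.\<close>

lemma ch_sym:
 assumes "4 \<le> n"
 shows "ch n d x y + ch n d y x = (\<Sum>i=1..n. Ac n x i * Ac n y i)"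
proof -
 obtain m where n: "n = Suc (Suc (Suc m))" "m \<ge> 1" using assms by (intro that[of "n - 3"]) auto
 have e: "(\<Sum>i=1..n - 1. if d i then x (anc n i) * y (i + 1) else x (i + 1) * y (anc n i)) +
   (\<Sum>i=1..n - 1. if d i then y (anc n i) * x (i + 1) else y (i + 1) * x (anc n i)) =
   (\<Sum>i=1..Suc (Suc m). x (anc n i) * y (i + 1) + x (i + 1) * y (anc n i))"
  unfolding sum.distrib[symmetric] n(1) by (intro sum.cong) (auto simp: algebra_simps)
 have f: "(\<Sum>i=1..m. x (anc n i) * y (i + 1) + x (i + 1) * y (anc n i)) = (\<Sum>i=1..m. x i * y (i + 1) + x (i + 1) * y i)"
  by (intro sum.cong) (auto simp: anc_def n)
 have g: "(\<Sum>i=1..Suc m. Ac n x i * Ac n y i) =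
   (\<Sum>i=1..Suc m. if i = 1 then x 1 * y 1 else (x i - x (i - 1)) * (y i - y (i - 1)))"
  by (intro sum.cong) (auto simp: Ac_def n)
 have h: "(\<Sum>i=1..n. Ac n x i * Ac n y i) = (\<Sum>i=1..Suc m. Ac n x i * Ac n y i)
   + (x (m + 2) + x (m + 3) - x (m + 1)) * (y (m + 2) + y (m + 3) - y (m + 1))
   + (x (m + 3) - x (m + 2)) * (y (m + 3) - y (m + 2))"
  using n(2) unfolding n(1) by (simp add: Ac_def eval_nat_numeral)
 have k: "ch n d x y + ch n d y x = 2 * (\<Sum>i=1..n. x i * y i) - (\<Sum>i=1..Suc (Suc m). x (anc n i) * y (i + 1) + x (i + 1) * y (anc n i))"
  unfolding ch_def using e by (simp add: mult.commute)
 have l: "(\<Sum>i=1..Suc (Suc m). x (anc n i) * y (i + 1) + x (i + 1) * y (anc n i)) =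
   (\<Sum>i=1..m. x i * y (i + 1) + x (i + 1) * y i) + (x (m + 1) * y (m + 2) + x (m + 2) * y (m + 1))
   + (x (m + 1) * y (m + 3) + x (m + 3) * y (m + 1))"
  unfolding f[symmetric] by (simp add: anc_def n eval_nat_numeral)
 have o: "(\<Sum>i=1..n. x i * y i) = (\<Sum>i=1..Suc m. x i * y i) + x (m + 2) * y (m + 2) + x (m + 3) * y (m + 3)"
  unfolding n(1) by (simp add: numeral_eq_Suc)
 show ?thesis unfolding k l h g chain_sum o by (simp add: algebra_simps)
qed

text \<open>The roots of type D are the signed sums of two distinct standard basis vectors, so a
  root is recorded by its two-element support in either order.\<close>

definition root :: "nat => (nat => int) => nat => nat => bool" where
 "root n z p r \<longleftrightarrow> p \<in> {1..n} \<and> r \<in> {1..n} \<and> p \<noteq> r \<and> \<bar>z p\<bar> = 1 \<and> \<bar>z r\<bar> = 1 \<and> (\<forall>j\<in>{1..n}. j \<noteq> p --> j \<noteq> r --> z j = 0)"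

text \<open>An entry of absolute value at least two would already contribute four to the norm, so
  all nonzero entries are signs and there are exactly two of them.\<close>

lemma root_exists:
 assumes "(\<Sum>i=1..n. z i * z i) = 2"
 shows "\<exists>p r. root n z p r"
proof -
 have sq: "z i * z i = (if z i = 0 then 0 else 1)" if i: "i \<in> {1..n}" for i
 proof (rule ccontr)
  assume "z i * z i \<noteq> (if z i = 0 then 0 else 1)"
  then have z: "z i \<noteq> 0" "\<bar>z i\<bar> \<noteq> 1" 
   by (auto split: if_splits simp: abs_if)
  then have "2 * 2 \<le> \<bar>z i\<bar> * \<bar>z i\<bar>" by (intro mult_mono) auto
  then have "4 \<le> z i * z i" by simp
  moreover have "z i * z i \<le> (\<Sum>i=1..n. z i * z i)" using i by (intro member_le_sum) auto
  ultimately show False using assms by simp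
 qed
 let ?S = "{i \<in> {1..n}. z i \<noteq> 0}"
 have "(\<Sum>i=1..n. z i * z i) = (\<Sum>i=1..n. if z i = 0 then 0 else 1)" by (intro sum.cong sq) auto
 also have "\<dots> = (\<Sum>i\<in>?S. 1)" by (intro sum.mono_neutral_cong_right) auto
 finally have "card ?S = 2" using assms by simp
 then obtain p r where pr: "?S = {p, r}" "p \<noteq> r" by (auto simp: card_2_iff)
 have one: "\<bar>z i\<bar> = 1" if "i \<in> ?S" for i
 proof -
  have "z i * z i = 1" using sq[of i] that by auto
  then show ?thesis by (metis abs_mult_self_eq abs_zmult_eq_1 abs_1 mult.commute)
 qed
 have "p \<in> ?S" "r \<in> ?S" using pr by auto
 moreover have "z j = 0" if "j \<in> {1..n}" "j \<noteq> p" "j \<noteq> r" for j using that pr by blast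
 ultimately have "root n z p r" using pr(2) one by (auto simp: root_def)
 then show ?thesis by blast
qed

lemma root_swap: "root n z p r ==> root n z r p"
 by (auto simp: root_def)

lemma root_dot:
 assumes "root n z p r"
 shows "(\<Sum>i=1..n. z i * w i) = z p * w p + z r * (w r :: int)"
proof -
 have "(\<Sum>i=1..n. z i * w i) = (\<Sum>i\<in>{p, r}. z i * w i)"
  using assms by (intro sum.mono_neutral_right) (auto simp: root_def)
 then show ?thesis using assms by (simp add: root_def)
qed

lemma root_same_support:
 assumes u: "root n z p r" and v: "root n w p r'" and orth: "(\<Sum>i=1..n. z i * w i) = 0"
 shows "r' = r"
proof (rule ccontr)
 assume "r' \<noteq> r"
 then have "w r = 0" using u v by (auto simp: root_def)
 then have "z p * w p = 0" using orth root_dot[OF u, of w] by simp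
 then show False using u v by (auto simp: root_def)
qed

text \<open>Each of the three leaves meets the two-element support of \<open>c\<close>, so two of
  them share an index. Orthogonal roots sharing one index of their supports share the other as
  well.\<close>

lemma two_leaves:
 assumes c: "root n c p q" and l: "\<And>l. l \<in> L ==> (\<Sum>i=1..n. l i * l i) = 2 \<and> (\<Sum>i=1..n. c i * l i) \<noteq> 0"
  and orth: "\<And>l m. l \<in> L ==> m \<in> L ==> l \<noteq> m ==> (\<Sum>i=1..n. l i * m i) = 0" and card: "card L = 3"
 shows "\<exists>u\<in>L. \<exists>v\<in>L. u \<noteq> v \<and> (\<exists>s t. root n u s t \<and> root n v s t)"
proof -
 have meet: "\<exists>s\<in>{p, q}. \<exists>t. root n u s t" if u: "u \<in> L" for u
 proof -
  obtain a b where r: "root n u a b" using root_exists l[OF u] by blast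
  have "c p * u p + c q * u q \<noteq> 0" using l[OF u] root_dot[OF c, of u] by simp
  then have "u p \<noteq> 0 \<or> u q \<noteq> 0" by auto
  then obtain s where s: "s \<in> {p, q}" "u s \<noteq> 0" by auto
  then have "s = a \<or> s = b" using c r by (auto simp: root_def)
  then show ?thesis using s(1) r root_swap[OF r] by auto
 qed
 have "\<forall>u\<in>L. \<exists>s. s \<in> {p, q} \<and> (\<exists>t. root n u s t)" using meet by blast
 then obtain f where f: "\<And>u. u \<in> L ==> f u \<in> {p, q} \<and> (\<exists>t. root n u (f u) t)"
  unfolding bchoice_iff by blast
 have "\<not> inj_on f L"
 proof
  assume "inj_on f L"
  then have "card L \<le> card {p, q}" using f by (intro card_inj_on_le[of f]) auto
  then show False using card card_insert_le_m1[of 2 "{q}" p] by (simp add: card_insert_if split: if_splits)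
 qed
 then obtain u v where uv: "u \<in> L" "v \<in> L" "u \<noteq> v" "f u = f v" by (auto simp: inj_on_def)
 obtain t where t: "root n u (f u) t" using f[OF uv(1)] by blast
 obtain t' where t': "root n v (f u) t'" using f[OF uv(2)] uv(4) by auto
 have "t' = t" by (rule root_same_support[OF t t' orth[OF uv(1,2,3)]])
 then show ?thesis using uv t t' by blast
qed

text \<open>
 Two orthogonal roots with the same support span twice the two basis vectors of that support. At
 least one of them is different from a given index \<open>\<sigma>\<close>.
\<close>

lemma twice_basis_vector:
 assumes u: "root n z s t" and v: "root n w s t" and orth: "(\<Sum>i=1..n. z i * w i) = 0"
 shows "\<exists>c::int. \<exists>i\<in>{1..n}. i \<noteq> \<sigma> \<and> \<bar>z i + c * w i\<bar> = 2 \<and> (\<forall>j\<in>{1..n}. j \<noteq> i --> z j + c * w j = 0)"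
proof -
 have o: "z s * w s + z t * w t = 0" using orth root_dot[OF u, of w] by simp
 have st: "s \<in> {1..n}" "t \<in> {1..n}" "s \<noteq> t" using u by (auto simp: root_def)
 have vals: "z s = 1 \<or> z s = -1" "z t = 1 \<or> z t = -1" "w s = 1 \<or> w s = -1" "w t = 1 \<or> w t = -1"
  using u v by (auto simp: root_def)
 have z: "z j = 0" "w j = 0" if "j \<in> {1..n}" "j \<noteq> s" "j \<noteq> t" for j using u v that by (auto simp: root_def)
 \<comment> \<open>With this sign the entries at \<open>s\<close> add up and those at
   \<open>t\<close> cancel; with the opposite sign the roles are exchanged.\<close>
 let ?c = "z s * w s"
 have a: "\<bar>z s + ?c * w s\<bar> = 2" "z t + ?c * w t = 0" using vals o by auto
 have b: "\<bar>z t + - ?c * w t\<bar> = 2" "z s + - ?c * w s = 0" using vals o by auto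
 show ?thesis
 proof (cases "s = \<sigma>")
  case True
  show ?thesis
  proof (intro exI[of _ "- ?c"] bexI[of _ t] conjI ballI impI)
   show "z j + - ?c * w j = 0" if "j \<in> {1..n}" "j \<noteq> t" for j using that b z by (cases "j = s") auto
  qed (use st True b in auto)
 next
  case False
  show ?thesis
  proof (intro exI[of _ "?c"] bexI[of _ s] conjI ballI impI)
   show "z j + ?c * w j = 0" if "j \<in> {1..n}" "j \<noteq> s" for j using that a z by (cases "j = t") auto
  qed (use st False a in auto)
 qed
qed

text \<open>The configuration formed by the simple at the branch vertex and the simples at its neighbours.\<close>

definition star :: "nat => (nat => bool) => (nat => int) => (nat => int) set => bool" where
 "star n d c L \<longleftrightarrow> ch n d c c = 1 \<and> card L = 3 \<and>
  (\<forall>l\<in>L. ch n d l l = 1 \<and> ch n d c l + ch n d l c \<noteq> 0 \<and> (\<forall>m\<in>L. l \<noteq> m --> ch n d l m = 0))"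

lemma leaves_combination:
 assumes n: "4 \<le> n" and star: "star n d c L"
 shows "\<exists>u\<in>L. \<exists>v\<in>L. \<exists>c::int. \<exists>i\<in>{1..n}. i \<noteq> \<sigma> \<and> \<bar>Ac n (\<lambda>k. u k + c * v k) i\<bar> = 2 \<and>
  (\<forall>j\<in>{1..n}. j \<noteq> i --> Ac n (\<lambda>k. u k + c * v k) j = 0)"
proof -
 have qc: "ch n d c c = 1" and ql: "\<And>l. l \<in> L ==> ch n d l l = 1"
  and cl: "\<And>l. l \<in> L ==> ch n d c l + ch n d l c \<noteq> 0"
  and ll: "\<And>l m. l \<in> L ==> m \<in> L ==> l \<noteq> m ==> ch n d l m = 0" and card: "card L = 3"
  using star by (auto simp: star_def)
 have dot: "(\<Sum>i=1..n. Ac n x i * Ac n y i) = ch n d x y + ch n d y x" for x y by (rule ch_sym[OF n, symmetric])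
 have two: "(\<Sum>i=1..n. Ac n l i * Ac n l i) = 2" if "ch n d l l = 1" for l using that dot[of l l] by simp
 \<comment> \<open>Vectors of norm two that are orthogonal cannot coincide, so there are still three
   leaves after the passage to coordinates.\<close>
 have inj: "inj_on (Ac n) L"
 proof (rule inj_onI)
  fix l m assume lm: "l \<in> L" "m \<in> L" "Ac n l = Ac n m"
  show "l = m"
  proof (rule ccontr)
   assume ne: "l \<noteq> m"
   have "(\<Sum>i=1..n. Ac n l i * Ac n m i) = 0" using ll[OF lm(1,2) ne] ll[OF lm(2,1) ne[symmetric]] dot[of l m] by simp
   then show False using two[OF ql[OF lm(2)]] lm(3) by simp
  qed
 qed
 obtain p q where pq: "root n (Ac n c) p q" using root_exists two[OF qc] by blast
 have "\<exists>u\<in>Ac n ` L. \<exists>v\<in>Ac n ` L. u \<noteq> v \<and> (\<exists>s t. root n u s t \<and> root n v s t)"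
 proof (rule two_leaves[OF pq])
  show "card (Ac n ` L) = 3" using card_image[OF inj] card by simp
  show "(\<Sum>i=1..n. l i * l i) = 2 \<and> (\<Sum>i=1..n. Ac n c i * l i) \<noteq> 0" if "l \<in> Ac n ` L" for l
   using that two[OF ql] cl dot by auto
  show "(\<Sum>i=1..n. l i * m i) = 0" if im: "l \<in> Ac n ` L" "m \<in> Ac n ` L" "l \<noteq> m" for l m
  proof -
   obtain l' m' where lm: "l' \<in> L" "m' \<in> L" "l = Ac n l'" "m = Ac n m'" "l' \<noteq> m'" using im by auto
   show ?thesis unfolding lm dot using ll[OF lm(1,2,5)] ll[OF lm(2,1) lm(5)[symmetric]] by simp
  qed
 qed
 then obtain u v s t where uv: "u \<in> L" "v \<in> L" "Ac n u \<noteq> Ac n v" "root n (Ac n u) s t" "root n (Ac n v) s t" by auto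
 have ne: "u \<noteq> v" using uv(3) by auto
 have "(\<Sum>i=1..n. Ac n u i * Ac n v i) = 0" unfolding dot using ll[OF uv(1,2) ne] ll[OF uv(2,1) ne[symmetric]] by simp
 from twice_basis_vector[OF uv(4,5) this, of \<sigma>] show ?thesis
  unfolding Ac_linear using uv(1,2) by blast
qed

text \<open>The coordinates of a vector that is twice a basis vector, up to sign.\<close>

lemma twice_coords:
 assumes n: "4 \<le> n" and i: "i \<in> {1..n}" and v: "\<bar>Ac n x i\<bar> = 2" and zero: "\<forall>j\<in>{1..n}. j \<noteq> i --> Ac n x j = 0"
 shows "k \<in> {1..n - 2} ==> x k = (if i \<le> k then Ac n x i else 0)"
  and "\<bar>x n\<bar> = 1" and "\<bar>x (n - 1)\<bar> = 1"
  and "i \<noteq> n ==> x n = x (n - 1)" and "i \<noteq> n - 1 ==> x (n - 2) = x (n - 1) + x n"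
proof -
 have z: "Ac n x j = 0" if "j \<in> {1..n}" "j \<noteq> i" for j using that zero by simp
 have k: "k \<in> {1..n - 2} --> x k = (if i \<le> k then Ac n x i else 0)" for k
 proof (induction k)
  case (Suc k)
  show ?case
  proof
   assume k: "Suc k \<in> {1..n - 2}"
   show "x (Suc k) = (if i \<le> Suc k then Ac n x i else 0)"
   proof (cases "k = 0")
    case True
    then have "x (Suc k) = Ac n x 1" by (simp add: Ac_def)
    then show ?thesis using True i z[of 1] n by (cases "i = 1") auto
   next
    case False
    then have "x (Suc k) = x k + Ac n x (Suc k)" using k by (simp add: Ac_def)
    also have "x k = (if i \<le> k then Ac n x i else 0)" using Suc False k by simp
    finally show ?thesis using z[of "Suc k"] k by (cases "i = Suc k") auto
   qed
  qed
 qed simp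
 then show "k \<in> {1..n - 2} ==> x k = (if i \<le> k then Ac n x i else 0)" by blast
 have m: "x (n - 2) = (if i \<le> n - 2 then Ac n x i else 0)" using k[of "n - 2"] n by simp
 have n': "n - 1 \<noteq> 1" "\<not> n - 1 \<le> n - 2" "n \<noteq> 1" "\<not> n \<le> n - 2" "n \<noteq> n - 1" using n by auto
 have "Ac n x (n - 1) = x (n - 1) + x n - x (n - 2)" unfolding Ac_def by (simp only: n' if_False if_True refl)
 then have a: "x (n - 1) + x n = x (n - 2) + Ac n x (n - 1)" by simp
 have "Ac n x n = x n - x (n - 1)" unfolding Ac_def by (simp only: n' if_False)
 then have b: "x n = x (n - 1) + Ac n x n" by simp
 have zb: "i \<noteq> n ==> Ac n x n = 0" using z[of n] n by auto
 have za: "i \<noteq> n - 1 ==> Ac n x (n - 1) = 0" using z[of "n - 1"] n by auto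
 show "i \<noteq> n ==> x n = x (n - 1)" using b zb by simp
 show "i \<noteq> n - 1 ==> x (n - 2) = x (n - 1) + x n" using a za by simp
 have vv: "Ac n x i = 2 \<or> Ac n x i = -2" using v by linarith
 have cs: "i \<le> n - 2 \<or> i = n - 1 \<or> i = n" using i by auto
 have "\<bar>x n\<bar> = 1 \<and> \<bar>x (n - 1)\<bar> = 1"
  using cs
 proof (elim disjE)
  assume h: "i \<le> n - 2"
  then have "i \<noteq> n" "i \<noteq> n - 1" using n by auto
  then show ?thesis using a b m za zb vv h by auto
 next
  assume h: "i = n - 1"
  then have "i \<noteq> n" "\<not> i \<le> n - 2" using n by auto
  then show ?thesis using a b m zb vv h by auto
 next
  assume h: "i = n"
  then have "i \<noteq> n - 1" "\<not> i \<le> n - 2" using n by auto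
  then show ?thesis using a b m za vv h by auto
 qed
 then show "\<bar>x n\<bar> = 1" "\<bar>x (n - 1)\<bar> = 1" by auto
qed

text \<open>Products of two even coefficients vanish modulo 4. What is left are the terms that
  involve the vertices \<open>n - 1\<close> and \<open>n\<close>.\<close>

lemma ch_mod4:
 assumes n: "4 \<le> n" and x: "\<forall>k\<in>{1..n - 2}. even (x k)" and y: "\<forall>k\<in>{1..n - 2}. even (y k)"
 shows "4 dvd ch n d x y - (x (n - 1) * y (n - 1) + x n * y n
  - (if d (n - 2) then x (n - 2) * y (n - 1) else x (n - 1) * y (n - 2))
  - (if d (n - 1) then x (n - 2) * y n else x n * y (n - 2)))"
proof -
 obtain m where m: "n = Suc (Suc (Suc m))" using n by (intro that[of "n - 3"]) auto
 have ev: "4 dvd x k * y j" if "k \<in> {1..n - 2}" "j \<in> {1..n - 2}" for k j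
  using x[THEN bspec, OF that(1)] y[THEN bspec, OF that(2)] by (auto elim!: evenE)
 have s1: "4 dvd (\<Sum>i=1..Suc m. x i * y i)" using ev by (intro dvd_sum) (auto simp: m)
 have s2: "4 dvd (\<Sum>i=1..m. if d i then x (anc n i) * y (i + 1) else x (i + 1) * y (anc n i))"
  using ev by (intro dvd_sum) (auto simp: m anc_def)
 have "ch n d x y - (x (n - 1) * y (n - 1) + x n * y n
  - (if d (n - 2) then x (n - 2) * y (n - 1) else x (n - 1) * y (n - 2))
  - (if d (n - 1) then x (n - 2) * y n else x n * y (n - 2))) =
  (\<Sum>i=1..Suc m. x i * y i) - (\<Sum>i=1..m. if d i then x (anc n i) * y (i + 1) else x (i + 1) * y (anc n i))"
  unfolding ch_def by (simp add: m anc_def)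
 then show ?thesis using s1 s2 by (simp add: dvd_diff)
qed

text \<open>If both arrows of the fork point away from \<open>n - 2\<close>, or both towards it, the
  excluded vector is the doubled \<open>e_n\<close>, the difference of the last two simple roots,
  since the contributions of the two ends may then cancel. For opposite directions the corresponding
  vector is the doubled \<open>e_(n-1)\<close>.\<close>

definition special :: "nat => (nat => bool) => nat" where
 "special n d = (if d (n - 2) = d (n - 1) then n else n - 1)"

text \<open>Away from the exceptional index the terms at the fork combine to twice a product of
  signs modulo 4. The relation needed for this is \<open>x n = x (n - 1)\<close> if the two arrows
  are alike, and \<open>x (n - 2) = x (n - 1) + x n\<close> if they are opposite.\<close>

lemma ch_nonzero:
 assumes n: "4 \<le> n" and i: "i \<in> {1..n}" "i \<noteq> special n d" and j: "j \<in> {1..n}" "j \<noteq> special n d"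
  and vi: "\<bar>Ac n x i\<bar> = 2" "\<forall>k\<in>{1..n}. k \<noteq> i --> Ac n x k = 0"
  and vj: "\<bar>Ac n y j\<bar> = 2" "\<forall>k\<in>{1..n}. k \<noteq> j --> Ac n y k = 0"
 shows "ch n d x y \<noteq> 0"
proof
 assume z: "ch n d x y = 0"
 note X = twice_coords[OF n i(1) vi] and Y = twice_coords[OF n j(1) vj]
 have "Ac n x i = 2 \<or> Ac n x i = -2" "Ac n y j = 2 \<or> Ac n y j = -2" using vi(1) vj(1) by linarith+
 then have two: "even (Ac n x i)" "even (Ac n y j)" by auto
 have ex: "\<forall>k\<in>{1..n - 2}. even (x k)" using X(1) two by auto
 have ey: "\<forall>k\<in>{1..n - 2}. even (y k)" using Y(1) two by auto
 have m: "n - 2 \<in> {1..n - 2}" using n by auto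
 obtain a b where ab: "x (n - 2) = 2 * a" "y (n - 2) = 2 * b" using ex[THEN bspec, OF m] ey[THEN bspec, OF m] by (auto elim!: evenE)
 have four: "4 dvd (x (n - 1) * y (n - 1) + x n * y n
  - (if d (n - 2) then x (n - 2) * y (n - 1) else x (n - 1) * y (n - 2))
  - (if d (n - 1) then x (n - 2) * y n else x n * y (n - 2)))"
  using ch_mod4[OF n ex ey, where d = d] unfolding z by (simp only: diff_0 dvd_minus_iff)
 have vx: "x n = 1 \<or> x n = -1" "x (n - 1) = 1 \<or> x (n - 1) = -1" and vy: "y n = 1 \<or> y n = -1" "y (n - 1) = 1 \<or> y (n - 1) = -1"
  using X(2,3) Y(2,3) by auto
 show False
 proof (cases "d (n - 2) = d (n - 1)")
  case True
  then have "i \<noteq> n" "j \<noteq> n" using i j by (auto simp: special_def)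
  then have e: "x n = x (n - 1)" "y n = y (n - 1)" using X(4) Y(4) by auto
  define s t where "s = x (n - 1)" and "t = y (n - 1)"
  have "4 dvd s * t + s * t - (if d (n - 2) then 2 * a * t else s * (2 * b)) - (if d (n - 2) then 2 * a * t else s * (2 * b))"
   using four unfolding e True[symmetric] ab s_def t_def .
  then have "4 dvd (s * t + s * t - (if d (n - 2) then 2 * a * t else s * (2 * b)) - (if d (n - 2) then 2 * a * t else s * (2 * b)))
    + 4 * (if d (n - 2) then a * t else s * b)" by (rule dvd_add) simp
  also have "\<dots> = 2 * (s * t)" by simp
  finally have "4 dvd 2 * (s * t)" .
  then show False using vx(2) vy(2) unfolding s_def[symmetric] t_def[symmetric] by (elim disjE) simp_all
 next
  case False
  then have "i \<noteq> n - 1" "j \<noteq> n - 1" using i j by (auto simp: special_def)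
  then have e: "x (n - 2) = x (n - 1) + x n" "y (n - 2) = y (n - 1) + y n" using X(5) Y(5) by auto
  \<comment> \<open>For opposite directions, inserting the relations reduces the four terms to minus
    twice a product of two signs.\<close>
  have d: "d (n - 1) \<longleftrightarrow> \<not> d (n - 2)" using False by auto
  show False
   using four[unfolded e d] vx vy by (cases "d (n - 2)") (elim disjE; simp)+
 qed
qed

lemma no_orthogonal_stars:
 assumes n: "4 \<le> n" and s: "star n d c L" "star n d c' L'" and o: "\<And>l m. l \<in> L ==> m \<in> L' ==> ch n d l m = 0"
 shows False
proof -
 obtain u v a i where A: "u \<in> L" "v \<in> L" "i \<in> {1..n}" "i \<noteq> special n d" "\<bar>Ac n (\<lambda>k. u k + a * v k) i\<bar> = 2"
  "\<forall>j\<in>{1..n}. j \<noteq> i --> Ac n (\<lambda>k. u k + a * v k) j = 0"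
  using leaves_combination[OF n s(1), of "special n d"] by blast
 obtain u' v' a' i' where B: "u' \<in> L'" "v' \<in> L'" "i' \<in> {1..n}" "i' \<noteq> special n d" "\<bar>Ac n (\<lambda>k. u' k + a' * v' k) i'\<bar> = 2"
  "\<forall>j\<in>{1..n}. j \<noteq> i' --> Ac n (\<lambda>k. u' k + a' * v' k) j = 0"
  using leaves_combination[OF n s(2), of "special n d"] by blast
 have "ch n d (\<lambda>k. u k + a * v k) (\<lambda>k. u' k + a' * v' k) \<noteq> 0"
  by (rule ch_nonzero[OF n A(3,4) B(3,4) A(5,6) B(5,6)])
 then show False by (simp add: ch_bilinear o A B)
qed

section \<open>Quivers of type D\<close>

lemma (in wf_digraph) finite_paths_of_potential:
 fixes \<rho> :: "'a => int"
 assumes pot: "\<And>e. e \<in> arcs G ==> \<rho> (head G e) = \<rho> (tail G e) + 1"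
  and fin: "finite (verts G)" "finite (arcs G)"
 shows "finite (quiver_paths G)"
proof -
 \<comment> \<open>The potential grows along a path by the number of its arrows, so the spread of
   its finitely many values bounds the length of paths.\<close>
 have aw: "u \<in> verts G ==> set p \<subseteq> arcs G ==> cas u p v ==> v \<in> verts G \<and> \<rho> v = \<rho> u + int (length p)" for u p v
 proof (induction p arbitrary: u)
  case (Cons e p)
  then have e: "e \<in> arcs G" "tail G e = u" "cas (head G e) p v" "head G e \<in> verts G" by (auto simp: pre_digraph.cas.simps)
  have "v \<in> verts G \<and> \<rho> v = \<rho> (head G e) + int (length p)" using Cons.IH[OF e(4) _ e(3)] Cons.prems by auto
  then show ?case using pot[OF e(1)] e(2) by auto
 qed (auto simp: pre_digraph.cas.simps)
 define K where "K = nat (Max (\<rho> ` verts G) - Min (\<rho> ` verts G))"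
 have "quiver_paths G \<subseteq> verts G \<times> {p. set p \<subseteq> arcs G \<and> length p \<le> K}"
 proof
  fix w assume w: "w \<in> quiver_paths G"
  obtain u p where up: "w = (u, p)" by (cases w)
  obtain v where v: "u \<in> verts G" "set p \<subseteq> arcs G" "cas u p v" using w unfolding up by (auto simp: quiver_paths_def awalk_def)
  note a = aw[OF v]
  have "\<rho> v \<le> Max (\<rho> ` verts G)" by (intro Max_ge finite_imageI imageI fin(1) conjunct1[OF a])
  moreover have "Min (\<rho> ` verts G) \<le> \<rho> u" by (intro Min_le finite_imageI imageI fin(1) v(1))
  ultimately have "length p \<le> K" using a by (simp add: K_def)
  then show "w \<in> verts G \<times> {p. set p \<subseteq> arcs G \<and> length p \<le> K}" using v up by auto
 qed
 then show ?thesis using fin finite_lists_length_le[of "arcs G" K] by (auto intro: finite_subset)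
qed

lemma D_edges_bij:
 assumes n: "4 \<le> n"
 shows "bij_betw (\<lambda>i. {anc n i, i + 1}) {1..n - 1} (D_edges n)"
proof -
 have "inj_on (\<lambda>i. {anc n i, i + 1}) {1..n - 1}"
 proof (rule inj_onI)
  fix i j assume "i \<in> {1..n - 1}" "j \<in> {1..n - 1}" and e: "{anc n i, i + 1} = {anc n j, j + 1}"
  \<comment> \<open>The larger end point of an edge determines its number.\<close>
  have "anc n k < k + 1" for k by (auto simp: anc_def)
  then have m: "Max {anc n k, k + 1} = k + 1" for k by (simp add: max_def less_imp_le)
  have "Max {anc n i, i + 1} = Max {anc n j, j + 1}" unfolding e ..
  then show "i = j" unfolding m by simp
 qed
 moreover have "(\<lambda>i. {anc n i, i + 1}) ` {1..n - 1} = D_edges n"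
 proof -
  have "{1..n - 1} = insert (n - 1) {1..n - 2}" using n by auto
  moreover have "{anc n (n - 1), n - 1 + 1} = {n - 2, n}" using n by (simp add: anc_def)
  moreover have "(\<lambda>i. {anc n i, i + 1}) ` {1..n - 2} = {{i, i + 1} | i. 1 \<le> i \<and> i \<le> n - 2}"
   by (auto simp: anc_def image_iff)
  ultimately show ?thesis unfolding D_edges_def by (simp only: image_insert) auto
 qed
 ultimately show ?thesis by (simp add: bij_betw_def)
qed

definition arc_labelling :: "nat => ('v, 'e) pre_digraph => (nat => 'v) => (nat => 'e) => (nat => bool) => bool" where
 "arc_labelling n Q f \<epsilon> d \<longleftrightarrow> bij_betw f {1..n} (verts Q) \<and> bij_betw \<epsilon> {1..n - 1} (arcs Q) \<and>
  (\<forall>i\<in>{1..n - 1}. tail Q (\<epsilon> i) = (if d i then f (anc n i) else f (i + 1)) \<and>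
   head Q (\<epsilon> i) = (if d i then f (i + 1) else f (anc n i)))"

lemma dynkin_arcs:
 assumes n: "4 \<le> n" and D: "dynkin_type_D n Q"
 shows "\<exists>f \<epsilon> d. arc_labelling n Q f \<epsilon> d"
proof -
 obtain f where f: "bij_betw f {1..n} (verts Q)"
  and e: "bij_betw (\<lambda>e. {tail Q e, head Q e}) (arcs Q) ((\<lambda>E. f ` E) ` D_edges n)"
  using D by (auto simp: dynkin_type_D_def)
 have sub: "D_edges n \<subseteq> Pow {1..n}" using n by (auto simp: D_edges_def)
 have "inj_on (\<lambda>E. f ` E) (D_edges n)"
  using inj_on_image_Pow[OF bij_betw_imp_inj_on[OF f]] sub by (rule inj_on_subset)
 then have "bij_betw (\<lambda>E. f ` E) (D_edges n) ((\<lambda>E. f ` E) ` D_edges n)" by (rule inj_on_imp_bij_betw)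
 note bb = bij_betw_trans[OF bij_betw_trans[OF D_edges_bij[OF n] this] bij_betw_inv_into[OF e]]
 define \<epsilon> where eps: "\<epsilon> = inv_into (arcs Q) (\<lambda>e. {tail Q e, head Q e}) \<circ> ((\<lambda>E. f ` E) \<circ> (\<lambda>i. {anc n i, i + 1}))"
 have b: "bij_betw \<epsilon> {1..n - 1} (arcs Q)" unfolding eps by (rule bb)
 define d where "d i \<longleftrightarrow> tail Q (\<epsilon> i) = f (anc n i)" for i
 have "tail Q (\<epsilon> i) = (if d i then f (anc n i) else f (i + 1)) \<and>
   head Q (\<epsilon> i) = (if d i then f (i + 1) else f (anc n i))" if i: "i \<in> {1..n - 1}" for i
 proof -
  have "f ` {anc n i, i + 1} \<in> (\<lambda>E. f ` E) ` D_edges n" using bij_betwE[OF D_edges_bij[OF n]] i by blast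
  then have "{tail Q (\<epsilon> i), head Q (\<epsilon> i)} = f ` {anc n i, i + 1}"
   unfolding eps using bij_betw_inv_into_right[OF e] by simp
  then have "{tail Q (\<epsilon> i), head Q (\<epsilon> i)} = {f (anc n i), f (i + 1)}" by simp
  then show ?thesis unfolding d_def doubleton_eq_iff by auto
 qed
 then have "arc_labelling n Q f \<epsilon> d" unfolding arc_labelling_def using f b by blast
 then show ?thesis by blast
qed

lemma dynkin_fin_quiver:
 assumes n: "4 \<le> n" and D: "dynkin_type_D n Q"
 shows "fin_quiver Q"
proof -
 obtain f \<epsilon> d where lb: "arc_labelling n Q f \<epsilon> d" using dynkin_arcs[OF n D] by blast
 have f: "bij_betw f {1..n} (verts Q)" and b: "bij_betw \<epsilon> {1..n - 1} (arcs Q)" using lb by (auto simp: arc_labelling_def)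
 have e: "tail Q (\<epsilon> i) = (if d i then f (anc n i) else f (i + 1)) \<and>
   head Q (\<epsilon> i) = (if d i then f (i + 1) else f (anc n i))" if "i \<in> {1..n - 1}" for i
  using lb that unfolding arc_labelling_def by blast
 interpret wf_digraph Q by (rule dynkin_type_D_digraph[OF n D])
 have fin: "finite (verts Q)" "finite (arcs Q)" using bij_betw_finite[OF f] bij_betw_finite[OF b] by auto
 define s :: "nat => int" where "s i = (if d i then 1 else - 1)" for i
 \<comment> \<open>On a tree the potential is the sum of the orientation signs along the way from
   vertex \<open>1\<close>. Vertex \<open>n\<close> is reached through \<open>n - 2\<close>, whose
   own sum ends at \<open>n - 3\<close>.\<close>
 define r where "r i = (if i \<le> n - 1 then \<Sum>j=1..i - 1. s j else (\<Sum>j=1..n - 3. s j) + s (n - 1))" for i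
 have step: "r (i + 1) = r (anc n i) + s i" if i: "i \<in> {1..n - 1}" for i
 proof (cases "i = n - 1")
  case True
  have "\<not> n - 1 + 1 \<le> n - 1" "n - 2 \<le> n - 1" "\<not> n - 1 \<le> n - 2" "n - 2 - 1 = n - 3" using n by auto
  then show ?thesis unfolding True anc_def r_def by (simp only: if_False if_True)
 next
  case False
  then obtain k where k: "i = Suc k" "Suc k \<le> n - 2" using i by (cases i) auto
  then have "Suc (Suc k) \<le> n - 1" "Suc k \<le> n - 1" by auto
  then show ?thesis using k by (simp add: r_def anc_def)
 qed
 define \<rho> where "\<rho> v = r (inv_into {1..n} f v)" for v
 have rf: "\<rho> (f i) = r i" if "i \<in> {1..n}" for i
  unfolding \<rho>_def using inv_into_f_f[OF bij_betw_imp_inj_on[OF f] that] by simp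
 have "finite (quiver_paths Q)"
 proof (rule finite_paths_of_potential[OF _ fin])
  fix a assume "a \<in> arcs Q"
  then obtain i where i: "i \<in> {1..n - 1}" "a = \<epsilon> i" using bij_betw_imp_surj_on[OF b] by blast
  have "anc n i \<in> {1..n}" "i + 1 \<in> {1..n}" using i n by (auto simp: anc_def)
  then show "\<rho> (head Q a) = \<rho> (tail Q a) + 1"
   using e[OF i(1)] step[OF i(1)] rf by (auto simp: i(2) s_def)
 qed
 then show ?thesis using fin by unfold_locales
qed

lemma chi_dynkin:
 assumes n: "4 \<le> n" and D: "dynkin_type_D n Q"
 shows "\<exists>f d. \<forall>a b. chi Q a b = ch n d (\<lambda>i. a (f i)) (\<lambda>i. b (f i))"
proof -
 obtain f \<epsilon> d where lb: "arc_labelling n Q f \<epsilon> d" using dynkin_arcs[OF n D] by blast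
 have f: "bij_betw f {1..n} (verts Q)" and b: "bij_betw \<epsilon> {1..n - 1} (arcs Q)" using lb by (auto simp: arc_labelling_def)
 have e: "tail Q (\<epsilon> i) = (if d i then f (anc n i) else f (i + 1)) \<and>
   head Q (\<epsilon> i) = (if d i then f (i + 1) else f (anc n i))" if "i \<in> {1..n - 1}" for i
  using lb that unfolding arc_labelling_def by blast
 have "chi Q x y = ch n d (\<lambda>i. x (f i)) (\<lambda>i. y (f i))" for x y
 proof -
  have "(\<Sum>v\<in>verts Q. x v * y v) = (\<Sum>i=1..n. x (f i) * y (f i))"
   by (rule sum.reindex_bij_betw[OF f, symmetric])
  moreover have "(\<Sum>a\<in>arcs Q. x (tail Q a) * y (head Q a)) = (\<Sum>i=1..n - 1. x (tail Q (\<epsilon> i)) * y (head Q (\<epsilon> i)))"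
   by (rule sum.reindex_bij_betw[OF b, symmetric])
  moreover have "\<dots> = (\<Sum>i=1..n - 1. if d i then x (f (anc n i)) * y (f (i + 1)) else x (f (i + 1)) * y (f (anc n i)))"
   using e by (intro sum.cong) auto
  ultimately show ?thesis by (simp add: chi_def ch_def)
 qed
 then show ?thesis by blast
qed

text \<open>The branch vertex is \<open>n - 2\<close>, with neighbours \<open>n - 3\<close>,
  \<open>n - 1\<close> and \<open>n\<close>, of which the first exists by \<open>4 \<le> n\<close>.
  The last property says that each neighbour is joined to the branch vertex in exactly one
  direction.\<close>

lemma dynkin_branch:
 assumes n: "4 \<le> n" and D: "dynkin_type_D n Q"
 obtains c L where "c \<in> verts Q" "L \<subseteq> verts Q" "card L = 3" "c \<notin> L"
  "\<And>e. e \<in> arcs Q ==> tail Q e \<noteq> head Q e"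
  "\<And>e. e \<in> arcs Q ==> tail Q e \<in> L ==> head Q e \<notin> L"
  "\<And>v. v \<in> L ==> (\<exists>e\<in>arcs Q. tail Q e = c \<and> head Q e = v) \<longleftrightarrow> \<not> (\<exists>e\<in>arcs Q. tail Q e = v \<and> head Q e = c)"
proof -
 obtain f \<epsilon> d where lb: "arc_labelling n Q f \<epsilon> d" using dynkin_arcs[OF n D] by blast
 have f: "bij_betw f {1..n} (verts Q)" and b: "bij_betw \<epsilon> {1..n - 1} (arcs Q)" using lb by (auto simp: arc_labelling_def)
 have e: "tail Q (\<epsilon> i) = (if d i then f (anc n i) else f (i + 1)) \<and>
   head Q (\<epsilon> i) = (if d i then f (i + 1) else f (anc n i))" if "i \<in> {1..n - 1}" for i
  using lb that unfolding arc_labelling_def by blast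
 have inj: "f i = f j \<longleftrightarrow> i = j" if "i \<in> {1..n}" "j \<in> {1..n}" for i j
  using inj_on_eq_iff[OF bij_betw_imp_inj_on[OF f] that] .
 have arc: "\<exists>i\<in>{1..n - 1}. a = \<epsilon> i" if "a \<in> arcs Q" for a using that bij_betw_imp_surj_on[OF b] by blast
 have rng: "anc n i \<in> {1..n}" "i + 1 \<in> {1..n}" "anc n i < i + 1" if "i \<in> {1..n - 1}" for i using that n by (auto simp: anc_def)
 let ?I = "{n - 3, n - 1, n}"
 have I: "?I \<subseteq> {1..n}" "n - 2 \<in> {1..n}" "n - 2 \<notin> ?I" "card ?I = 3" using n by (auto simp: card_insert_if)
 have mem: "f i \<in> f ` ?I \<longleftrightarrow> i \<in> ?I" if "i \<in> {1..n}" for i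
  using inj_on_image_mem_iff[OF bij_betw_imp_inj_on[OF f] that I(1)] .
 show thesis
 proof (rule that[of "f (n - 2)" "f ` ?I"])
  show "f (n - 2) \<in> verts Q" "f ` ?I \<subseteq> verts Q"
   unfolding bij_betw_imp_surj_on[OF f, symmetric] by (rule imageI[OF I(2)], rule image_mono[OF I(1)])
  show "card (f ` ?I) = 3" using card_image[OF inj_on_subset[OF bij_betw_imp_inj_on[OF f] I(1)]] I(4) by simp
  show "f (n - 2) \<notin> f ` ?I" unfolding mem[OF I(2)] by (rule I(3))
  show "tail Q a \<noteq> head Q a" if a: "a \<in> arcs Q" for a
  proof
   assume h: "tail Q a = head Q a"
   obtain i where i: "i \<in> {1..n - 1}" "a = \<epsilon> i" using arc[OF a] by blast
   have "f (anc n i) = f (i + 1)" using h e[OF i(1)] unfolding i(2) by (cases "d i") auto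
   then show False using inj[OF rng(1,2)[OF i(1)]] rng(3)[OF i(1)] by simp
  qed
  show "head Q a \<notin> f ` ?I" if a: "a \<in> arcs Q" "tail Q a \<in> f ` ?I" for a
  proof
   assume h: "head Q a \<in> f ` ?I"
   obtain i where i: "i \<in> {1..n - 1}" "a = \<epsilon> i" using arc[OF a(1)] by blast
   have "f (anc n i) \<in> f ` ?I \<and> f (i + 1) \<in> f ` ?I" using a(2) h e[OF i(1)] unfolding i(2) by (cases "d i") auto
   then have "anc n i \<in> ?I \<and> i + 1 \<in> ?I" using mem[OF rng(1)[OF i(1)]] mem[OF rng(2)[OF i(1)]] by simp
   then show False using i(1) n by (auto simp: anc_def split: if_splits)
  qed
  show "(\<exists>a\<in>arcs Q. tail Q a = f (n - 2) \<and> head Q a = v) \<longleftrightarrow> \<not> (\<exists>a\<in>arcs Q. tail Q a = v \<and> head Q a = f (n - 2))"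
   if v: "v \<in> f ` ?I" for v
  proof -
   obtain k where k: "k \<in> ?I" "v = f k" using v by blast
   then have kn: "k \<in> {1..n}" using I(1) by blast
   \<comment> \<open>The number of the edge between \<open>n - 2\<close> and \<open>k\<close>: the
     neighbour \<open>n - 3\<close> is its lower end point, the other two are upper end
     points.\<close>
   define j where "j = (if k = n - 3 then n - 3 else k - 1)"
   have j: "j \<in> {1..n - 1}" "{anc n j, j + 1} = {n - 2, k}" using k(1) n by (auto simp: j_def anc_def)
   have uniq: "i = j" if "i \<in> {1..n - 1}" "{anc n i, i + 1} = {n - 2, k}" for i
    using inj_onD[OF bij_betw_imp_inj_on[OF D_edges_bij[OF n]], of i j] that j by simp
   have ends: "{tail Q (\<epsilon> i), head Q (\<epsilon> i)} = f ` {anc n i, i + 1}" if "i \<in> {1..n - 1}" for i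
    using e[OF that] by auto
   have only: "a = \<epsilon> j" if a: "a \<in> arcs Q" "{tail Q a, head Q a} = {f (n - 2), v}" for a
   proof -
    obtain i where i: "i \<in> {1..n - 1}" "a = \<epsilon> i" using arc[OF a(1)] by blast
    have "f ` {anc n i, i + 1} = f ` {n - 2, k}" using a(2) ends[OF i(1)] unfolding i(2) k(2) by simp
    then have "{anc n i, i + 1} = {n - 2, k}"
     using inj_on_image_eq_iff[OF bij_betw_imp_inj_on[OF f], of "{anc n i, i + 1}" "{n - 2, k}"] rng[OF i(1)] I(2) kn by simp
    then show ?thesis using uniq[OF i(1)] i(2) by simp
   qed
   have ej: "\<epsilon> j \<in> arcs Q" using bij_betwE[OF b] j(1) by blast
   have "{tail Q (\<epsilon> j), head Q (\<epsilon> j)} = {f (n - 2), v}" using ends[OF j(1)] unfolding j(2) k(2) by simp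
   then have alt: "(tail Q (\<epsilon> j) = f (n - 2) \<and> head Q (\<epsilon> j) = v) \<or> (tail Q (\<epsilon> j) = v \<and> head Q (\<epsilon> j) = f (n - 2))"
    by (simp add: doubleton_eq_iff)
   have ne: "f (n - 2) \<noteq> v" using I(3) k inj[OF I(2) kn] by auto
   have l: "(\<exists>a\<in>arcs Q. tail Q a = f (n - 2) \<and> head Q a = v) \<longleftrightarrow> tail Q (\<epsilon> j) = f (n - 2) \<and> head Q (\<epsilon> j) = v"
   proof
    assume "\<exists>a\<in>arcs Q. tail Q a = f (n - 2) \<and> head Q a = v"
    then obtain a where a: "a \<in> arcs Q" "tail Q a = f (n - 2)" "head Q a = v" by auto
    then have "a = \<epsilon> j" by (intro only) auto
    then show "tail Q (\<epsilon> j) = f (n - 2) \<and> head Q (\<epsilon> j) = v" using a by simp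
   qed (use ej in auto)
   have r: "(\<exists>a\<in>arcs Q. tail Q a = v \<and> head Q a = f (n - 2)) \<longleftrightarrow> tail Q (\<epsilon> j) = v \<and> head Q (\<epsilon> j) = f (n - 2)"
   proof
    assume "\<exists>a\<in>arcs Q. tail Q a = v \<and> head Q a = f (n - 2)"
    then obtain a where a: "a \<in> arcs Q" "tail Q a = v" "head Q a = f (n - 2)" by auto
    then have "a = \<epsilon> j" by (intro only) auto
    then show "tail Q (\<epsilon> j) = v \<and> head Q (\<epsilon> j) = f (n - 2)" using a by simp
   qed (use ej in auto)
   show ?thesis unfolding l r using alt ne by auto
  qed
 qed
qed

section \<open>Vanishing and Euler form\<close>

text \<open>The vanishing of all morphisms from \<open>X\<close> to the \<open>i\<close>-th shift of
  \<open>Y\<close> in the derived category.\<close>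

definition vq :: "('v, 'e) pre_digraph => ('b, 'v, 'e, 'k::comm_ring_1) qcx => ('c, 'v, 'e, 'k) qcx => int => bool" where
 "vq Q X Y i \<longleftrightarrow> Z Q X Y i \<subseteq> Bd Q X Y i"

definition hiso :: "('v, 'e) pre_digraph => ('b, 'v, 'e, 'k::comm_ring_1) qcx => ('c, 'v, 'e, 'k) qcx => bool" where
 "hiso Q X Y \<longleftrightarrow> wfc Q X \<and> wfc Q Y \<and> (\<exists>\<phi>. hinv Q X Y \<phi>)"

text \<open>Phrased by zero and invertible classes only, without scalars, so that an additive
  equivalence can transport it.\<close>

definition local_end :: "('v, 'e) pre_digraph => ('b, 'v, 'e, 'k::comm_ring_1) qcx => bool" where
 "local_end Q X \<longleftrightarrow> (\<forall>\<phi>\<in>Z Q X X 0. \<phi> \<in> Bd Q X X 0 \<or> hinv Q X X \<phi>)"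

lemma hiso_sym: "hiso Q X Y ==> hiso Q Y X"
 unfolding hiso_def hinv_def by blast

lemma hiso_refl: "wfc Q X ==> hiso Q X X"
 unfolding hiso_def using hinv_un by blast

lemma hiso_trans:
 assumes "hiso Q X Y" "hiso Q Y W"
 shows "hiso Q X W"
proof -
 obtain a where a: "hinv Q X Y a" using assms(1) by (auto simp: hiso_def)
 obtain b where b: "hinv Q Y W b" using assms(2) by (auto simp: hiso_def)
 have wf: "wfc Q X" "wfc Q Y" "wfc Q W" using assms by (auto simp: hiso_def)
 show ?thesis unfolding hiso_def by (intro conjI wf exI[of _ "cm (lab Y) b a"] hinv_cm[OF wf b a])
qed

lemma vq_transfer:
 assumes "hiso Q X X'" "hiso Q Y' Y" "vq Q X Y i"
 shows "vq Q X' Y' i"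
 unfolding vq_def
proof
 fix \<phi> assume p: "\<phi> \<in> Z Q X' Y' i"
 obtain a where a: "hinv Q X X' a" using assms(1) by (auto simp: hiso_def)
 obtain b where b: "hinv Q Y' Y b" using assms(2) by (auto simp: hiso_def)
 have wf: "wfc Q X" "wfc Q X'" "wfc Q Y'" "wfc Q Y" using assms by (auto simp: hiso_def)
 have aZ: "a \<in> Z Q X X' 0" and bZ: "b \<in> Z Q Y' Y 0" using a b by (auto simp: hinv_def)
 have pa: "cm (lab X') \<phi> a \<in> Z Q X Y' i" using Z_cm[OF p aZ] by simp
 have "cm (lab Y') b (cm (lab X') \<phi> a) \<in> Bd Q X Y i" using Z_cm[OF bZ pa] assms(3) by (auto simp: vq_def)
 from hinv_cancel_left[OF wf(3,4) b pa this] show "\<phi> \<in> Bd Q X' Y' i"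
  by (rule hinv_cancel_right[OF wf(1,2) a p])
qed

lemma vq_iff: "hiso Q X X' ==> hiso Q Y Y' ==> vq Q X Y i \<longleftrightarrow> vq Q X' Y' i"
 using vq_transfer[OF _ hiso_sym, of Q X X' Y Y' i] vq_transfer[OF hiso_sym, of Q X X' Y Y' i] by blast

lemma local_end_transfer:
 assumes "hiso Q X Y" "local_end Q X"
 shows "local_end Q Y"
 unfolding local_end_def
proof
 fix \<phi> assume p: "\<phi> \<in> Z Q Y Y 0"
 have wf: "wfc Q X" "wfc Q Y" using assms by (auto simp: hiso_def)
 obtain a where a: "hinv Q X Y a" using assms(1) by (auto simp: hiso_def)
 obtain b where ab: "a \<in> Z Q X Y 0" "b \<in> Z Q Y X 0" "cm (lab Y) b a - un X \<in> Bd Q X X 0" "cm (lab X) a b - un Y \<in> Bd Q Y Y 0"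
  using a by (rule hinvE)
 have b: "hinv Q Y X b" unfolding hinv_def using ab by blast
 let ?\<psi> = "cm (lab Y) b (cm (lab Y) \<phi> a)"
 note pa = Z0_cm[OF p ab(1)]
 have "?\<psi> \<in> Bd Q X X 0 \<or> hinv Q X X ?\<psi>" using Z0_cm[OF ab(2) pa] assms(2) unfolding local_end_def by blast
 then show "\<phi> \<in> Bd Q Y Y 0 \<or> hinv Q Y Y \<phi>"
 proof
  assume "?\<psi> \<in> Bd Q X X 0"
  from hinv_cancel_right[OF wf a p hinv_cancel_left[OF wf(2,1) b pa this]] show ?thesis ..
 next
  assume h: "hinv Q X X ?\<psi>"
  have h': "hinv Q Y Y (cm (lab X) (cm (lab X) a ?\<psi>) b)"
   by (rule hinv_cm[OF wf(2,1,2) hinv_cm[OF wf(1,1,2) a h] b])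
  \<comment> \<open>Transporting \<open>?\<psi>\<close> back gives \<open>\<phi>\<close> multiplied
    by \<open>?e\<close> on both sides, and \<open>?e\<close> is the identity up to a
    coboundary.\<close>
  let ?e = "cm (lab X) a b"
  have eZ: "?e \<in> Z Q Y Y 0" by (rule Z0_cm[OF ab(1,2)])
  have eq: "cm (lab X) (cm (lab X) a ?\<psi>) b = cm (lab Y) ?e (cm (lab Y) \<phi> ?e)" by (simp only: cm_assoc)
  have 1: "cm (lab Y) ?e (cm (lab Y) \<phi> ?e) - cm (lab Y) \<phi> ?e \<in> Bd Q Y Y 0"
   using Bd0_cm_left[OF ab(4) Z0_cm[OF p eZ]] unfolding cm_diff_left Z_wf_un(1)[OF wf(2) Z0_cm[OF p eZ]] .
  have 2: "cm (lab Y) \<phi> ?e - \<phi> \<in> Bd Q Y Y 0"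
   using Bd0_cm_right[OF p ab(4)] unfolding cm_diff_right Z_wf_un(2)[OF wf(2) p] .
  have "cm (lab X) (cm (lab X) a ?\<psi>) b - \<phi> \<in> Bd Q Y Y 0"
   unfolding eq using Bd_add[OF 1 2] by simp
  then show ?thesis using hinv_cong[OF wf(2,2) h'] by blast
 qed
qed

lemma un_Bd_vq: "wfc Q X ==> un X \<in> Bd Q X X 0 ==> vq Q X X 0"
 unfolding vq_def
proof
 fix \<phi> assume a: "wfc Q X" "un X \<in> Bd Q X X 0" and p: "\<phi> \<in> Z Q X X 0"
 show "\<phi> \<in> Bd Q X X 0" using Bd0_cm_right[OF p a(2)] unfolding Z_wf_un(2)[OF a(1) p] .
qed

section \<open>Simple representations\<close>

definition simp :: "'v => (unit, 'v, 'e, 'k::field) qcx" where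
 "simp v = \<lparr>lab = UNIV, dg = (\<lambda>_. 0), vx = (\<lambda>_. v), dd = 0, aa = (\<lambda>_. 0)\<rparr>"

lemma simp_simps [simp]: "lab (simp v) = UNIV" "dg (simp v) x = 0" "vx (simp v) x = v"
 by (simp_all add: simp_def)

lemma dl_simp [simp]: "dl (simp v) = 0"
 by (rule cochn_eqI) (simp_all add: simp_def dl_def fun_eq_iff)

lemma wfc_simp: "v \<in> verts Q ==> wfc Q (simp v)"
 by (simp add: wfc_def cm_linear Tot_zero)

lemma D_simp: "D (simp u) (simp v) i \<phi> = 0"
 by (simp add: D_def cm_linear sc_linear)

lemma Z_simp: "Z Q (simp u) (simp v) i = Tot Q (simp u) (simp v) i"
 and Bd_simp: "Bd Q (simp u) (simp v) i = {0}"
 using Tot_zero[of Q "simp u" "simp v" "i - 1"] by (auto simp: Z_def Bd_def D_simp)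

text \<open>Differentials and arrows of simple representations are zero, so every cochain is its own
  class: the identity in degree zero and one class for each arrow in degree one.\<close>

lemma vq_simp: "vq Q (simp u) (simp v :: (unit, 'v, 'e, 'k::field) qcx) i \<longleftrightarrow>
  \<not> (i = 0 \<and> u = v) \<and> \<not> (i = 1 \<and> (\<exists>e\<in>arcs Q. tail Q e = u \<and> head Q e = v))"
proof
 assume z: "vq Q (simp u) (simp v :: (unit, 'v, 'e, 'k) qcx) i"
 have no: "\<not> allowed Q (simp u) (simp v :: (unit, 'v, 'e, 'k) qcx) i p () ()" for p
 proof
  assume a: "allowed Q (simp u) (simp v :: (unit, 'v, 'e, 'k) qcx) i p () ()"
  then have "(mun (p, (), ()) :: (unit, unit, 'e, 'k) cochn) \<in> Tot Q (simp u) (simp v) i" by (auto simp: Tot_def mun_def)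
  then have "(mun (p, (), ()) :: (unit, unit, 'e, 'k) cochn) = 0" using z by (auto simp: vq_def Z_simp Bd_simp)
  then have "(mun (p, (), ()) :: (unit, unit, 'e, 'k) cochn) p () () = 0" by simp
  then show False by (simp add: mun_def)
 qed
 show "\<not> (i = 0 \<and> u = v) \<and> \<not> (i = 1 \<and> (\<exists>e\<in>arcs Q. tail Q e = u \<and> head Q e = v))"
  using no[of None] no[of "Some _"] by (auto simp: allowed_def)
next
 assume c: "\<not> (i = 0 \<and> u = v) \<and> \<not> (i = 1 \<and> (\<exists>e\<in>arcs Q. tail Q e = u \<and> head Q e = v))"
 then have no: "\<not> allowed Q (simp u) (simp v :: (unit, 'v, 'e, 'k) qcx) i p y x" for p y x by (auto simp: allowed_def split: option.splits)
 have "\<phi> = 0" if "\<phi> \<in> Tot Q (simp u) (simp v :: (unit, 'v, 'e, 'k) qcx) i" for \<phi>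
  using that no by (auto simp: Tot_def fun_eq_iff)
 then show "vq Q (simp u) (simp v :: (unit, 'v, 'e, 'k) qcx) i" by (auto simp: vq_def Z_simp Bd_simp)
qed

lemma local_end_simp: "v \<in> verts Q ==> local_end Q (simp v :: (unit, 'v, 'e, 'k::field) qcx)"
 unfolding local_end_def
proof
 let ?S = "simp v :: (unit, 'v, 'e, 'k) qcx"
 fix \<phi> assume v: "v \<in> verts Q" and p: "\<phi> \<in> Z Q ?S ?S 0"
 have T: "\<phi> \<in> Tot Q ?S ?S 0" using p by (simp add: Z_def)
 have e: "\<phi> = sc (\<phi> None () ()) (un ?S)"
 proof (rule cochn_eqI)
  show "\<phi> None = sc (\<phi> None () ()) (un ?S) None" by (auto simp: sc_def un_def fun_eq_iff)
  have "\<phi> (Some e) y x = 0" for e y x using T by (auto simp: Tot_def allowed_def)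
  then show "\<phi> (Some e) = sc (\<phi> None () ()) (un ?S) (Some e)" for e by (auto simp: sc_def un_def fun_eq_iff)
 qed
 note wf = wfc_simp[OF v]
 have uu: "cm (lab ?S) (un ?S) (un ?S) = un ?S" by (rule Z_wf_un(1)[OF wf un_Z[OF wf]])
 show "\<phi> \<in> Bd Q ?S ?S 0 \<or> hinv Q ?S ?S \<phi>"
 proof (cases "\<phi> None () () = 0")
  case True
  have "\<phi> = sc 0 (un ?S)" using e unfolding True .
  then have "\<phi> = 0" by (simp only: sc_0)
  then show ?thesis using Bd_zero by blast
 next
  case False
  let ?c = "\<phi> None () ()" and ?\<psi> = "sc (1 / \<phi> None () ()) (un ?S)"
  have a: "cm (lab ?S) ?\<psi> (sc ?c (un ?S)) = un ?S" "cm (lab ?S) (sc ?c (un ?S)) ?\<psi> = un ?S"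
   using False unfolding cm_sc_left cm_sc_right uu sc_sc by (simp_all add: sc_one)
  have "hinv Q ?S ?S (sc ?c (un ?S))"
   unfolding hinv_def
  proof (intro conjI bexI[of _ ?\<psi>] Z_sc un_Z wf)
   show "cm (lab ?S) ?\<psi> (sc ?c (un ?S)) - un ?S \<in> Bd Q ?S ?S 0" "cm (lab ?S) (sc ?c (un ?S)) ?\<psi> - un ?S \<in> Bd Q ?S ?S 0"
    unfolding a by (simp_all add: Bd_zero)
  qed
  then show ?thesis unfolding e[symmetric] by blast
 qed
qed

section \<open>Vanishing and isomorphism in the derived category\<close>

context fin_quiver
begin

lemma bcx_cshift: "bcx X ==> bcx (cshift X)"
 by (rule pres_bc[OF pres_csh[OF presX]])

lemma hiso_pres:
 assumes "pres X C \<kappa>" "pres X C' \<kappa>'"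
 shows "hiso Q C C'"
 unfolding hiso_def using pres_change[OF assms] pres_wf[OF assms(1)] pres_wf[OF assms(2)] by blast

lemma vq_shift:
 fixes X Y :: "('v, 'e, 'k::field) derived_object"
 assumes b: "bcx X" "bcx Y"
 shows "vq Q (CX X) (CX (cshift Y)) i \<longleftrightarrow> vq Q (CX X) (CX Y) (i + 1)"
  and "vq Q (CX (cshift X)) (CX Y) i \<longleftrightarrow> vq Q (CX X) (CX Y) (i - 1)"
proof -
 have h: "hiso Q (CX (cshift X)) (csh (CX X))" if "bcx X" for X :: "('v, 'e, 'k) derived_object"
  by (rule hiso_pres[OF presX[OF bcx_cshift[OF that]] pres_csh[OF presX[OF that]]])
 show "vq Q (CX X) (CX (cshift Y)) i \<longleftrightarrow> vq Q (CX X) (CX Y) (i + 1)"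
  unfolding vq_iff[OF hiso_refl[OF wfX[OF b(1)]] h[OF b(2)]] by (simp add: vq_def Z_csh_right Bd_csh_right)
 show "vq Q (CX (cshift X)) (CX Y) i \<longleftrightarrow> vq Q (CX X) (CX Y) (i - 1)"
  unfolding vq_iff[OF h[OF b(1)] hiso_refl[OF wfX[OF b(2)]]] by (simp add: vq_def Z_csh_left Bd_csh_left)
qed

text \<open>Positive degrees are reached by shifting the second object and negative degrees by
  shifting the first, so only the forward shift occurs.\<close>

lemma vq_all_degrees:
 assumes S: "\<And>X. X \<in> S ==> bcx X \<and> cshift X \<in> S" "\<And>Y. Y \<in> S' ==> bcx Y \<and> cshift Y \<in> S'"
  and v: "\<And>X Y. X \<in> S ==> Y \<in> S' ==> vq Q (CX X) (CX Y) 0" and XY: "X \<in> S" "Y \<in> S'"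
 shows "vq Q (CX X) (CX Y) i"
proof -
 have p: "\<forall>X\<in>S. \<forall>Y\<in>S'. vq Q (CX X) (CX Y) (int n)" for n
 proof (induction n)
  case (Suc n)
  show ?case
  proof (intro ballI)
   fix X Y assume XY: "X \<in> S" "Y \<in> S'"
   have "vq Q (CX X) (CX (cshift Y)) (int n)" using Suc XY S(2)[OF XY(2)] by blast
   then show "vq Q (CX X) (CX Y) (int (Suc n))" using vq_shift(1)[of X Y "int n"] S(1)[OF XY(1)] S(2)[OF XY(2)] by (simp add: add.commute)
  qed
 qed (use v in simp)
 have m: "\<forall>X\<in>S. \<forall>Y\<in>S'. vq Q (CX X) (CX Y) (- int n)" for n
 proof (induction n)
  case (Suc n)
  show ?case
  proof (intro ballI)
   fix X Y assume XY: "X \<in> S" "Y \<in> S'"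
   have e: "- int n - 1 = - int (Suc n)" by simp
   have "vq Q (CX (cshift X)) (CX Y) (- int n)" using Suc XY S(1)[OF XY(1)] by blast
   then show "vq Q (CX X) (CX Y) (- int (Suc n))" using vq_shift(2)[of X Y "- int n"] S(1)[OF XY(1)] S(2)[OF XY(2)] unfolding e by blast
  qed
 qed (use v in simp)
 show ?thesis using p m XY by (cases i rule: int_cases2) blast+
qed

text \<open>Having exactly one morphism expresses vanishing without mention of the zero morphism, in
  a form that any bijection preserves.\<close>

lemma singleton_Hom:
 assumes b: "bcx X" "bcx Y"
 shows "is_singleton (Hom DT X Y) \<longleftrightarrow> vq Q (CX X) (CX Y) 0"
proof
 assume "is_singleton (Hom DT X Y)"
 then obtain z where z: "RS X Y ` ZX X Y 0 = {z}" unfolding Hom_eq[OF b] by (auto simp: is_singleton_def)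
 show "vq Q (CX X) (CX Y) 0"
  unfolding vq_def
 proof
  fix \<phi> assume p: "\<phi> \<in> ZX X Y 0"
  have "RS X Y \<phi> \<in> {z}" "RS X Y 0 \<in> {z}" unfolding z[symmetric] using p Z_zero by blast+
  then have "RS X Y \<phi> = RS X Y 0" by simp
  then have "\<phi> - 0 \<in> BX X Y 0" using RS_eq_iff[OF b p Z_zero] by blast
  then show "\<phi> \<in> BX X Y 0" by simp
 qed
next
 assume v: "vq Q (CX X) (CX Y) 0"
 have c: "RS X Y \<phi> = RS X Y 0" if p: "\<phi> \<in> ZX X Y 0" for \<phi>
  unfolding RS_eq_iff[OF b p Z_zero] using v p by (auto simp: vq_def)
 have "RS X Y ` ZX X Y 0 = (\<lambda>_. RS X Y 0) ` ZX X Y 0" by (rule image_cong[OF refl c])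
 also have "\<dots> = {RS X Y 0}" by (rule image_constant[OF Z_zero])
 finally show "is_singleton (Hom DT X Y)" unfolding Hom_eq[OF b] by simp
qed

lemma iso_hiso:
 assumes i: "is_iso DT X Y f"
 shows "hiso Q (CX X) (CX Y)"
proof -
 obtain g where f: "f \<in> Hom DT X Y" and g: "g \<in> Hom DT Y X" "Cmp DT g f = Idn DT X" "Cmp DT f g = Idn DT Y"
  using i unfolding is_iso_def by blast
 have b: "bcx X" "bcx Y" using Hom_bcx[OF f] by auto
 obtain \<phi> where p: "\<phi> \<in> ZX X Y 0" "f = RS X Y \<phi>" using f unfolding Hom_eq[OF b] by blast
 obtain \<psi> where q: "\<psi> \<in> ZX Y X 0" "g = RS Y X \<psi>" using g(1) unfolding Hom_eq[OF b(2,1)] by blast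
 have "RS X X (cmp Y \<psi> \<phi>) = RS X X (un (CX X))"
  using g(2) unfolding p(2) q(2) Cmp_eq[OF b(1,2,1) p(1) q(1)] Idn_eq[OF b(1)] .
 then have 1: "cmp Y \<psi> \<phi> - un (CX X) \<in> BX X X 0"
  using RS_eq_iff[OF b(1,1) Z0_cm[OF q(1) p(1)] un_Z[OF wfX[OF b(1)]]] by blast
 have "RS Y Y (cmp X \<phi> \<psi>) = RS Y Y (un (CX Y))"
  using g(3) unfolding p(2) q(2) Cmp_eq[OF b(2,1,2) q(1) p(1)] Idn_eq[OF b(2)] .
 then have 2: "cmp X \<phi> \<psi> - un (CX Y) \<in> BX Y Y 0"
  using RS_eq_iff[OF b(2,2) Z0_cm[OF p(1) q(1)] un_Z[OF wfX[OF b(2)]]] by blast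
 show ?thesis unfolding hiso_def hinv_def using wfX[OF b(1)] wfX[OF b(2)] p(1) q(1) 1 2 by blast
qed

end

section \<open>Transport along an equivalence\<close>

text \<open>An equivalence from the full subcategory on \<open>U\<close> to the derived category of
  \<open>P\<close>, expressed by sets of morphisms, identities, composites and shifts. Linearity
  over the field is no part of it.\<close>

locale transport = Q: fin_quiver Q + P: fin_quiver P
 for Q :: "('v, 'e) pre_digraph" and P :: "('w, 'f) pre_digraph" +
 fixes U :: "('v, 'e, 'k::alg_closed_field) derived_object set" and F :: "('v, 'e, 'k) derived_object => ('w, 'f, 'k) derived_object"
  and F' :: "(('v \<times> 'e list => 'k, nat => 'k) roof) set => (('w \<times> 'f list => 'k, nat => 'k) roof) set"
 assumes U: "\<And>X. X \<in> U ==> Q.bcx X" "\<And>X. X \<in> U ==> cshift X \<in> U"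
  and F: "\<And>X. X \<in> U ==> P.bcx (F X)"
  and F_id: "\<And>X. X \<in> U ==> F' (Idn (D_b_mod Q) X) = Idn (D_b_mod P) (F X)"
  and F_comp: "\<And>X f g. X \<in> U ==> f \<in> Hom (D_b_mod Q) X X ==> g \<in> Hom (D_b_mod Q) X X ==>
   F' (Cmp (D_b_mod Q) g f) = Cmp (D_b_mod P) (F' g) (F' f)"
  and F_bij: "\<And>X Y. X \<in> U ==> Y \<in> U ==> bij_betw F' (Hom (D_b_mod Q) X Y) (Hom (D_b_mod P) (F X) (F Y))"
  and F_surj: "\<And>S. P.bcx S ==> \<exists>X\<in>U. \<exists>f. is_iso (D_b_mod P) (F X) S f"
  and F_shift: "\<And>X. X \<in> U ==> \<exists>f. is_iso (D_b_mod P) (F (cshift X)) (cshift (F X)) f"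
begin

lemma vq_zero:
 assumes "X \<in> U" "Y \<in> U"
 shows "vq Q (Q.CX X) (Q.CX Y) 0 \<longleftrightarrow> vq P (P.CX (F X)) (P.CX (F Y)) 0"
 unfolding Q.singleton_Hom[OF U(1)[OF assms(1)] U(1)[OF assms(2)], symmetric]
  P.singleton_Hom[OF F[OF assms(1)] F[OF assms(2)], symmetric] is_singleton_altdef
 using bij_betw_same_card[OF F_bij[OF assms]] by simp

lemma shift_hiso: "X \<in> U ==> hiso P (P.CX (F (cshift X))) (P.CX (cshift (F X)))"
 using F_shift P.iso_hiso by blast

lemma vq_step:
 assumes X: "X \<in> U" and Y: "Y \<in> U"
 shows "vq P (P.CX (F X)) (P.CX (F (cshift Y))) i \<longleftrightarrow> vq P (P.CX (F X)) (P.CX (F Y)) (i + 1)"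
  and "vq P (P.CX (F (cshift X))) (P.CX (F Y)) i \<longleftrightarrow> vq P (P.CX (F X)) (P.CX (F Y)) (i - 1)"
 unfolding vq_iff[OF hiso_refl[OF P.wfX[OF F[OF X]]] shift_hiso[OF Y]] vq_iff[OF shift_hiso[OF X] hiso_refl[OF P.wfX[OF F[OF Y]]]]
 by (rule P.vq_shift[OF F[OF X] F[OF Y]])+

text \<open>The functor commutes with the shift up to isomorphism, so the degree can be moved into
  the objects, where the bijection on morphisms of degree zero applies.\<close>

lemma vq_F:
 assumes XY: "X \<in> U" "Y \<in> U"
 shows "vq Q (Q.CX X) (Q.CX Y) i \<longleftrightarrow> vq P (P.CX (F X)) (P.CX (F Y)) i"
proof -
 have p: "\<forall>X\<in>U. \<forall>Y\<in>U. vq Q (Q.CX X) (Q.CX Y) (int n) \<longleftrightarrow> vq P (P.CX (F X)) (P.CX (F Y)) (int n)" for n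
 proof (induction n)
  case (Suc n)
  show ?case
  proof (intro ballI)
   fix X Y assume XY: "X \<in> U" "Y \<in> U"
   have e: "int (Suc n) = int n + 1" by simp
   show "vq Q (Q.CX X) (Q.CX Y) (int (Suc n)) \<longleftrightarrow> vq P (P.CX (F X)) (P.CX (F Y)) (int (Suc n))"
    unfolding e Q.vq_shift(1)[OF U(1)[OF XY(1)] U(1)[OF XY(2)], symmetric] vq_step(1)[OF XY, symmetric]
    using Suc XY(1) U(2)[OF XY(2)] by blast
  qed
 qed (use vq_zero in simp)
 have m: "\<forall>X\<in>U. \<forall>Y\<in>U. vq Q (Q.CX X) (Q.CX Y) (- int n) \<longleftrightarrow> vq P (P.CX (F X)) (P.CX (F Y)) (- int n)" for n
 proof (induction n)
  case (Suc n)
  show ?case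
  proof (intro ballI)
   fix X Y assume XY: "X \<in> U" "Y \<in> U"
   have e: "- int (Suc n) = - int n - 1" by simp
   show "vq Q (Q.CX X) (Q.CX Y) (- int (Suc n)) \<longleftrightarrow> vq P (P.CX (F X)) (P.CX (F Y)) (- int (Suc n))"
    unfolding e Q.vq_shift(2)[OF U(1)[OF XY(1)] U(1)[OF XY(2)], symmetric] vq_step(2)[OF XY, symmetric]
    using Suc XY(2) U(2)[OF XY(1)] by blast
  qed
 qed (use vq_zero in simp)
 show ?thesis using p m XY by (cases i rule: int_cases2) blast+
qed

text \<open>Invertible and zero endomorphisms are preserved; zero is the absorbing element.\<close>

lemma local_end_F:
 assumes X: "X \<in> U" and l: "local_end P (P.CX (F X))"
 shows "local_end Q (Q.CX X)"
 unfolding local_end_def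
proof
 note b = U(1)[OF X] and b' = F[OF X]
 note bij = F_bij[OF X X]
 note Fm = bij_betwE[OF bij, rule_format]
 have inj: "f = g" if "f \<in> Hom (D_b_mod Q) X X" "g \<in> Hom (D_b_mod Q) X X" "F' f = F' g" for f g
  by (rule inj_onD[OF bij_betw_imp_inj_on[OF bij] that(3,1,2)])
 have H: "Q.RS X X \<phi> \<in> Hom (D_b_mod Q) X X" if "\<phi> \<in> Q.ZX X X 0" for \<phi> unfolding Q.Hom_eq[OF b b] using that by (rule imageI)
 have get: "\<exists>\<phi>. \<phi> \<in> Q.ZX X X 0 \<and> F' (Q.RS X X \<phi>) = P.RS (F X) (F X) \<psi>" if "\<psi> \<in> P.ZX (F X) (F X) 0" for \<psi>
 proof -
  have "P.RS (F X) (F X) \<psi> \<in> F' ` Q.RS X X ` Q.ZX X X 0"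
   unfolding Q.Hom_eq[OF b b, symmetric] bij_betw_imp_surj_on[OF bij] P.Hom_eq[OF b' b'] using that by (rule imageI)
  then show ?thesis by auto
 qed
 have get': "\<exists>\<psi>. \<psi> \<in> P.ZX (F X) (F X) 0 \<and> F' (Q.RS X X \<phi>) = P.RS (F X) (F X) \<psi>" if "\<phi> \<in> Q.ZX X X 0" for \<phi>
  using Fm[OF H[OF that]] unfolding P.Hom_eq[OF b' b'] by blast
 fix \<phi> assume p: "\<phi> \<in> Q.ZX X X 0"
 obtain \<psi> where q: "\<psi> \<in> P.ZX (F X) (F X) 0" "F' (Q.RS X X \<phi>) = P.RS (F X) (F X) \<psi>" using get'[OF p] by blast
 note wf = Q.wfX[OF b] and wf' = P.wfX[OF b']
 have "\<psi> \<in> P.BX (F X) (F X) 0 \<or> P.hX (F X) (F X) \<psi>" using l q(1) unfolding local_end_def by blast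
 then show "\<phi> \<in> Q.BX X X 0 \<or> Q.hX X X \<phi>"
 proof
  assume B: "\<psi> \<in> P.BX (F X) (F X) 0"
  \<comment> \<open>Zero is preserved for multiplicative reasons. If \<open>\<omega>\<close> is sent
    to zero, then \<open>\<omega>\<close> times zero, which is zero, is sent to zero times the image
    of zero.\<close>
  have z0: "(0 :: (int \<times> (nat => 'k), int \<times> (nat => 'k), 'e, 'k) cochn) \<in> Q.ZX X X 0" by (rule Z_zero)
  obtain \<zeta> where z: "\<zeta> \<in> P.ZX (F X) (F X) 0" "F' (Q.RS X X 0) = P.RS (F X) (F X) \<zeta>" using get'[OF z0] by blast
  obtain \<omega> where w: "\<omega> \<in> Q.ZX X X 0" "F' (Q.RS X X \<omega>) = P.RS (F X) (F X) 0" using get[OF Z_zero] by blast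
  have "F' (Cmp (D_b_mod Q) (Q.RS X X \<omega>) (Q.RS X X 0)) = Cmp (D_b_mod P) (P.RS (F X) (F X) 0) (P.RS (F X) (F X) \<zeta>)"
   unfolding F_comp[OF X H[OF z0] H[OF w(1)]] w(2) z(2) ..
  then have "P.RS (F X) (F X) \<zeta> = P.RS (F X) (F X) 0"
   unfolding Q.Cmp_eq[OF b b b z0 w(1)] P.Cmp_eq[OF b' b' b' z(1) Z_zero] cm_linear z(2) .
  moreover have "P.RS (F X) (F X) \<psi> = P.RS (F X) (F X) 0"
   unfolding P.RS_eq_iff[OF b' b' q(1) Z_zero] using B by simp
  ultimately have "F' (Q.RS X X \<phi>) = F' (Q.RS X X 0)" unfolding q(2) z(2) by simp
  then have "Q.RS X X \<phi> = Q.RS X X 0" by (rule inj[OF H[OF p] H[OF z0]])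
  then have "\<phi> - 0 \<in> Q.BX X X 0" unfolding Q.RS_eq_iff[OF b b p z0] .
  then show ?thesis by simp
 next
  assume h: "P.hX (F X) (F X) \<psi>"
  obtain \<chi> where c: "\<chi> \<in> P.ZX (F X) (F X) 0" "P.cmp (F X) \<chi> \<psi> - un (P.CX (F X)) \<in> P.BX (F X) (F X) 0"
   "P.cmp (F X) \<psi> \<chi> - un (P.CX (F X)) \<in> P.BX (F X) (F X) 0" using h by (rule hinvE)
  obtain \<omega> where w: "\<omega> \<in> Q.ZX X X 0" "F' (Q.RS X X \<omega>) = P.RS (F X) (F X) \<chi>" using get[OF c(1)] by blast
  note uZ = un_Z[OF wf] and uZ' = un_Z[OF wf']
  have step: "Q.cmp X \<alpha> \<beta> - un (Q.CX X) \<in> Q.BX X X 0"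
   if a: "\<alpha> \<in> Q.ZX X X 0" "\<beta> \<in> Q.ZX X X 0" and a': "\<alpha>' \<in> P.ZX (F X) (F X) 0" "\<beta>' \<in> P.ZX (F X) (F X) 0"
    and e: "F' (Q.RS X X \<alpha>) = P.RS (F X) (F X) \<alpha>'" "F' (Q.RS X X \<beta>) = P.RS (F X) (F X) \<beta>'"
    and d: "P.cmp (F X) \<alpha>' \<beta>' - un (P.CX (F X)) \<in> P.BX (F X) (F X) 0" for \<alpha> \<beta> \<alpha>' \<beta>'
  proof -
   have "F' (Q.RS X X (Q.cmp X \<alpha> \<beta>)) = F' (Cmp (D_b_mod Q) (Q.RS X X \<alpha>) (Q.RS X X \<beta>))"
    unfolding Q.Cmp_eq[OF b b b a(2,1)] ..
   also have "\<dots> = P.RS (F X) (F X) (P.cmp (F X) \<alpha>' \<beta>')"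
    unfolding F_comp[OF X H[OF a(2)] H[OF a(1)]] e P.Cmp_eq[OF b' b' b' a'(2,1)] ..
   also have "\<dots> = P.RS (F X) (F X) (un (P.CX (F X)))"
    unfolding P.RS_eq_iff[OF b' b' Z0_cm[OF a'] uZ'] by (rule d)
   also have "\<dots> = F' (Q.RS X X (un (Q.CX X)))"
    unfolding P.Idn_eq[OF b', symmetric] Q.Idn_eq[OF b, symmetric] by (rule F_id[OF X, symmetric])
   finally have "F' (Q.RS X X (Q.cmp X \<alpha> \<beta>)) = F' (Q.RS X X (un (Q.CX X)))" .
   then have "Q.RS X X (Q.cmp X \<alpha> \<beta>) = Q.RS X X (un (Q.CX X))" by (rule inj[OF H[OF Z0_cm[OF a]] H[OF uZ]])
   then show ?thesis unfolding Q.RS_eq_iff[OF b b Z0_cm[OF a] uZ] .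
  qed
  have "Q.hX X X \<phi>"
   unfolding hinv_def using p w(1) step[OF w(1) p c(1) q(1) w(2) q(2) c(2)] step[OF p w(1) q(1) c(1) q(2) w(2) c(3)] by blast
  then show ?thesis ..
 qed
qed

lemma simple_preimage:
 assumes v: "v \<in> verts P"
 shows "\<exists>X\<in>U. hiso P (P.CX (F X)) (simp v :: (unit, 'w, 'f, 'k) qcx)"
proof -
 obtain S :: "('w, 'f, 'k) derived_object" and \<kappa> where S: "P.pres S (simp v :: (unit, 'w, 'f, 'k) qcx) \<kappa>"
  using P.real_exists[OF wfc_simp[OF v]] by (elim exE)
 note bS = P.pres_bc[OF S]
 obtain X f where X: "X \<in> U" "is_iso (D_b_mod P) (F X) S f" using F_surj[OF bS] by blast
 show ?thesis
  using hiso_trans[OF P.iso_hiso[OF X(2)] P.hiso_pres[OF P.presX[OF bS] S]] X(1) by blast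
qed

text \<open>The objects are preimages of the simples at the branch vertex and at its neighbours.
  Adjacent simples have extensions in exactly one direction, so the Euler form is negative one way
  and zero the other way, and the symmetrised value cannot vanish. Simples at different neighbours
  have no morphisms in any degree.\<close>

lemma Euler_star:
 assumes br: "c \<in> verts P" "L \<subseteq> verts P" "card L = 3" "c \<notin> L"
  "\<And>e. e \<in> arcs P ==> tail P e \<noteq> head P e"
  "\<And>e. e \<in> arcs P ==> tail P e \<in> L ==> head P e \<notin> L"
  "\<And>v. v \<in> L ==> (\<exists>e\<in>arcs P. tail P e = c \<and> head P e = v) \<longleftrightarrow> \<not> (\<exists>e\<in>arcs P. tail P e = v \<and> head P e = c)"
 shows "\<exists>G. (\<forall>v\<in>insert c L. G v \<in> U \<and> chi Q (Kc (Q.CX (G v))) (Kc (Q.CX (G v))) = 1) \<and>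
  (\<forall>v\<in>L. chi Q (Kc (Q.CX (G c))) (Kc (Q.CX (G v))) + chi Q (Kc (Q.CX (G v))) (Kc (Q.CX (G c))) \<noteq> 0) \<and>
  (\<forall>v\<in>L. \<forall>w\<in>L. v \<noteq> w --> chi Q (Kc (Q.CX (G v))) (Kc (Q.CX (G w))) = 0)"
proof -
 let ?s = "\<lambda>v. simp v :: (unit, 'w, 'f, 'k) qcx"
 have "\<forall>v\<in>verts P. \<exists>X. X \<in> U \<and> hiso P (P.CX (F X)) (?s v)" using simple_preimage by blast
 then have "\<exists>G. \<forall>v\<in>verts P. G v \<in> U \<and> hiso P (P.CX (F (G v))) (?s v)" by (rule bchoice)
 then obtain G where G: "\<forall>v\<in>verts P. G v \<in> U \<and> hiso P (P.CX (F (G v))) (?s v)" by (elim exE)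
 have GU: "G v \<in> U" and Gh: "hiso P (P.CX (F (G v))) (?s v)" if "v \<in> verts P" for v using G that by auto
 have van: "vq Q (Q.CX (G u)) (Q.CX (G v)) i \<longleftrightarrow>
   \<not> (i = 0 \<and> u = v) \<and> \<not> (i = 1 \<and> (\<exists>e\<in>arcs P. tail P e = u \<and> head P e = v))" if "u \<in> verts P" "v \<in> verts P" for u v i
  unfolding vq_F[OF GU[OF that(1)] GU[OF that(2)]] vq_iff[OF Gh[OF that(1)] Gh[OF that(2)]] by (rule vq_simp)
 have wf: "wfc Q (Q.CX (G v))" if "v \<in> verts P" for v by (rule Q.wfX[OF U(1)[OF GU[OF that]]])
 note fin = Q.fin_arcs Q.fin_verts
 have one: "chi Q (Kc (Q.CX (G v))) (Kc (Q.CX (G v))) = 1" if v: "v \<in> verts P" for v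
 proof (rule chi_one[OF wf[OF v] fin])
  have le: "local_end Q (Q.CX (G v))"
   by (rule local_end_F[OF GU[OF v] local_end_transfer[OF hiso_sym[OF Gh[OF v]] local_end_simp[OF v]]])
  \<comment> \<open>A self-extension of a simple would come from a loop, and there are none.\<close>
  show "Z Q (Q.CX (G v)) (Q.CX (G v)) i \<subseteq> Bd Q (Q.CX (G v)) (Q.CX (G v)) i" if "i \<noteq> 0" for i
   using van[OF v v, of i] that br(5) unfolding vq_def by metis
  show nu: "un (Q.CX (G v)) \<notin> Bd Q (Q.CX (G v)) (Q.CX (G v)) 0"
   using un_Bd_vq[OF wf[OF v]] van[OF v v, of 0] by blast
  show "\<exists>c. \<phi> - sc c (un (Q.CX (G v))) \<in> Bd Q (Q.CX (G v)) (Q.CX (G v)) 0" if p: "\<phi> \<in> Z Q (Q.CX (G v)) (Q.CX (G v)) 0" for \<phi>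
   by (rule division_end_scalar[OF wf[OF v] fin(1) p nu]) (use le in \<open>simp add: local_end_def\<close>)
 qed
 have zero: "chi Q (Kc (Q.CX (G u))) (Kc (Q.CX (G v))) = 0"
  if uv: "u \<in> verts P" "v \<in> verts P" "u \<noteq> v" and na: "\<not> (\<exists>e\<in>arcs P. tail P e = u \<and> head P e = v)" for u v
  by (rule chi_zero[OF wf[OF uv(1)] wf[OF uv(2)] fin]) (use van[OF uv(1,2)] uv(3) na in \<open>simp add: vq_def\<close>)
 have neg: "chi Q (Kc (Q.CX (G u))) (Kc (Q.CX (G v))) < 0"
  if uv: "u \<in> verts P" "v \<in> verts P" "u \<noteq> v" and na: "\<exists>e\<in>arcs P. tail P e = u \<and> head P e = v" for u v
  by (rule chi_neg[OF wf[OF uv(1)] wf[OF uv(2)] fin]) (use van[OF uv(1,2)] uv(3) na in \<open>simp_all add: vq_def\<close>)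
 show ?thesis
 proof (intro exI[of _ G] conjI ballI impI)
  fix v assume "v \<in> insert c L"
  then have v: "v \<in> verts P" using br(1,2) by blast
  show "G v \<in> U" "chi Q (Kc (Q.CX (G v))) (Kc (Q.CX (G v))) = 1" by (rule GU[OF v], rule one[OF v])
 next
  fix v assume vL: "v \<in> L"
  then have v: "v \<in> verts P" "c \<noteq> v" "v \<noteq> c" using br(2,4) by auto
  show "chi Q (Kc (Q.CX (G c))) (Kc (Q.CX (G v))) + chi Q (Kc (Q.CX (G v))) (Kc (Q.CX (G c))) \<noteq> 0"
  proof (cases "\<exists>e\<in>arcs P. tail P e = c \<and> head P e = v")
   case True
   then have "\<not> (\<exists>e\<in>arcs P. tail P e = v \<and> head P e = c)" using br(7)[OF vL] by blast
   then show ?thesis using neg[OF br(1) v(1,2) True] zero[OF v(1) br(1) v(3)] by simp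
  next
   case False
   then have "\<exists>e\<in>arcs P. tail P e = v \<and> head P e = c" using br(7)[OF vL] by blast
   then show ?thesis using neg[OF v(1) br(1) v(3)] zero[OF br(1) v(1,2) False] by simp
  qed
  fix w assume wL: "w \<in> L" and ne: "v \<noteq> w"
  have "\<not> (\<exists>e\<in>arcs P. tail P e = v \<and> head P e = w)" using br(6) vL wL by blast
  then show "chi Q (Kc (Q.CX (G v))) (Kc (Q.CX (G w))) = 0" using zero[OF v(1) _ ne] wL br(2) by blast
 qed
qed

end

text \<open>The numbering \<open>f\<close> and the orientation \<open>d\<close> of \<open>Q\<close>
  are fixed beforehand, so that the stars obtained from both subcategories refer to the same form
  and the same coordinates.\<close>

lemma Euler_star_of_summand:
 fixes Q :: "('v, 'e) pre_digraph" and P :: "('w, 'f) pre_digraph" and T1 :: "('v, 'e, 'k::alg_closed_field) derived_object set"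
 assumes n: "4 \<le> n" "dynkin_type_D n Q" and l: "4 \<le> l" "dynkin_type_D l P"
  and th: "thick_subcategory (D_b_mod Q) T1"
  and s: "has_direct_summand_equivalent_to (full_subcategory (D_b_mod Q) T1)
   (D_b_mod P :: (('w, 'f, 'k) derived_object, (('w \<times> 'f list => 'k, nat => 'k) roof) set) tri_category)"
  and ch: "\<And>a b. chi Q a b = ch n d (\<lambda>i. a (f i)) (\<lambda>i. b (f i))"
 shows "\<exists>c L. star n d c L \<and> (\<forall>x\<in>insert c L. \<exists>X\<in>T1. x = (\<lambda>i. Kc (fin_quiver.CX Q X) (f i)))"
proof -
 interpret Q: fin_quiver Q by (rule dynkin_fin_quiver[OF n])
 interpret P: fin_quiver P by (rule dynkin_fin_quiver[OF l])
 let ?D = "D_b_mod Q :: (('v, 'e, 'k) derived_object, (('v \<times> 'e list => 'k, nat => 'k) roof) set) tri_category"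
 let ?E = "D_b_mod P :: (('w, 'f, 'k) derived_object, (('w \<times> 'f list => 'k, nat => 'k) roof) set) tri_category"
 obtain U V where UV: "orthogonal_decomposition (full_subcategory ?D T1) U V"
  and eq: "triangle_equivalent (full_subcategory (full_subcategory ?D T1) U) ?E"
  using s unfolding has_direct_summand_equivalent_to_def by blast
 obtain F F' \<eta> where te: "triangle_equivalence (full_subcategory (full_subcategory ?D T1) U) ?E F F' \<eta>"
  using eq unfolding triangle_equivalent_def by blast
 have full: "Obj (full_subcategory (full_subcategory ?D T1) U) = U" "Hom (full_subcategory (full_subcategory ?D T1) U) = Hom ?D"
  "Idn (full_subcategory (full_subcategory ?D T1) U) = Idn ?D" "Cmp (full_subcategory (full_subcategory ?D T1) U) = Cmp ?D"
  "Sh (full_subcategory (full_subcategory ?D T1) U) = Sh ?D" "Obj (full_subcategory ?D T1) = T1" "Sh (full_subcategory ?D T1) = Sh ?D"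
  by (simp_all add: full_subcategory_def)
 have thU: "thick_subcategory (full_subcategory ?D T1) U" using UV by (simp add: orthogonal_decomposition_def)
 note thU' = thU[unfolded thick_subcategory_def full]
 have UT: "U \<subseteq> T1" by (rule conjunct1[OF thU'])
 have Ush: "\<And>X. X \<in> T1 ==> Sh ?D X \<in> U \<longleftrightarrow> X \<in> U"
  by (rule conjunct1[OF conjunct2[OF conjunct2[OF thU']], THEN bspec])
 have TO: "T1 \<subseteq> Obj ?D" using th unfolding thick_subcategory_def by blast
 note e1 = te[unfolded triangle_equivalence_def full]
 note e2 = conjunct2[OF e1] note e3 = conjunct2[OF e2] note e4 = conjunct2[OF e3] note e5 = conjunct2[OF e4]
 note e6 = conjunct2[OF e5] note e7 = conjunct2[OF e6]
 interpret transport Q P U F F'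
 proof
  fix X assume X: "X \<in> U"
  show "Q.bcx X" using X UT TO by (auto simp: Q.DT_simps)
  show "cshift X \<in> U" using X UT Ush[of X] by (auto simp: Q.DT_simps)
  have "F X \<in> Obj ?E" by (rule funcset_mem[OF conjunct1[OF e1] X])
  then show "P.bcx (F X)" by (simp add: P.DT_simps)
  show "F' (Idn ?D X) = Idn ?E (F X)" by (rule conjunct1[OF e2, THEN bspec, OF X])
  show "F' (Cmp ?D h g) = Cmp ?E (F' h) (F' g)" if "g \<in> Hom ?D X X" "h \<in> Hom ?D X X" for g h
   by (rule conjunct1[OF e3, THEN bspec, OF X, THEN bspec, OF X, THEN bspec, OF X, THEN bspec, OF that(1), THEN bspec, OF that(2)])
  show "bij_betw F' (Hom ?D X Y) (Hom ?E (F X) (F Y))" if "Y \<in> U" for Y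
   by (rule conjunct1[OF e5, THEN bspec, OF X, THEN bspec, OF that])
  have "is_iso ?E (F (Sh ?D X)) (Sh ?E (F X)) (\<eta> X)" by (rule conjunct1[OF e7, THEN bspec, OF X])
  then show "\<exists>g. is_iso ?E (F (cshift X)) (cshift (F X)) g" unfolding Q.DT_simps(5) P.DT_simps(5) by (intro exI)
 next
  fix Y :: "('w, 'f, 'k) derived_object" assume "P.bcx Y"
  then have "Y \<in> Obj ?E" by (simp add: P.DT_simps)
  with conjunct1[OF e6] show "\<exists>X\<in>U. \<exists>g. is_iso ?E (F X) Y g" by (rule bspec)
 qed
 show ?thesis
 proof (rule dynkin_branch[OF l])
 fix c L assume br: "c \<in> verts P" "L \<subseteq> verts P" "card L = 3" "c \<notin> L"
  "\<And>e. e \<in> arcs P ==> tail P e \<noteq> head P e"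
  "\<And>e. e \<in> arcs P ==> tail P e \<in> L ==> head P e \<notin> L"
  "\<And>v. v \<in> L ==> (\<exists>e\<in>arcs P. tail P e = c \<and> head P e = v) \<longleftrightarrow> \<not> (\<exists>e\<in>arcs P. tail P e = v \<and> head P e = c)"
 have Gex: "\<exists>G. (\<forall>v\<in>insert c L. G v \<in> U \<and> chi Q (Kc (Q.CX (G v))) (Kc (Q.CX (G v))) = 1) \<and>
  (\<forall>v\<in>L. chi Q (Kc (Q.CX (G c))) (Kc (Q.CX (G v))) + chi Q (Kc (Q.CX (G v))) (Kc (Q.CX (G c))) \<noteq> 0) \<and>
  (\<forall>v\<in>L. \<forall>w\<in>L. v \<noteq> w --> chi Q (Kc (Q.CX (G v))) (Kc (Q.CX (G w))) = 0)"
  by (rule Euler_star[where c = c and L = L]) (fact br)+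
 obtain G where G: "(\<forall>v\<in>insert c L. G v \<in> U \<and> chi Q (Kc (Q.CX (G v))) (Kc (Q.CX (G v))) = 1) \<and>
  (\<forall>v\<in>L. chi Q (Kc (Q.CX (G c))) (Kc (Q.CX (G v))) + chi Q (Kc (Q.CX (G v))) (Kc (Q.CX (G c))) \<noteq> 0) \<and>
  (\<forall>v\<in>L. \<forall>w\<in>L. v \<noteq> w --> chi Q (Kc (Q.CX (G v))) (Kc (Q.CX (G w))) = 0)"
  using Gex by (elim exE)
 define g where "g v = (\<lambda>i. Kc (Q.CX (G v)) (f i))" for v
 have chg: "chi Q (Kc (Q.CX (G v))) (Kc (Q.CX (G w))) = ch n d (g v) (g w)" for v w by (simp add: ch g_def)
 note G' = G[unfolded chg]
 have inj: "inj_on g L"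
 proof (rule inj_onI)
  fix v w assume vw: "v \<in> L" "w \<in> L" "g v = g w"
  show "v = w"
  proof (rule ccontr)
   assume "v \<noteq> w"
   then have "ch n d (g v) (g w) = 0" using G' vw by blast
   moreover have "ch n d (g v) (g v) = 1" using G' vw(1) by blast
   ultimately show False using vw(3) by simp
  qed
 qed
 have gs: "star n d (g c) (g ` L)"
  unfolding star_def
 proof (intro conjI ballI impI)
  show "ch n d (g c) (g c) = 1" using G' by blast
  show "card (g ` L) = 3" using card_image[OF inj] br(3) by simp
  fix x assume "x \<in> g ` L"
  then obtain v where v: "v \<in> L" "x = g v" by blast
  show "ch n d x x = 1" "ch n d (g c) x + ch n d x (g c) \<noteq> 0" using G' v by blast+
  fix y assume "y \<in> g ` L" "x \<noteq> y"
  then obtain w where w: "w \<in> L" "y = g w" "v \<noteq> w" using v by blast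
  then show "ch n d x y = 0" using G' v by blast
 qed
 have gm: "\<exists>X\<in>T1. x = (\<lambda>i. Kc (Q.CX X) (f i))" if x: "x \<in> insert (g c) (g ` L)" for x
 proof -
  obtain v where v: "v \<in> insert c L" "x = g v" using x by (elim insertE imageE) auto
  have "G v \<in> U" using conjunct1[OF G, THEN bspec, OF v(1)] by (rule conjunct1)
  then have "G v \<in> T1" by (rule subsetD[OF UT])
  then show ?thesis by (rule bexI[rotated]) (simp add: v(2) g_def)
 qed
 show ?thesis by (rule exI[of _ "g c"], rule exI[of _ "g ` L"], intro conjI ballI gs gm)
 qed
qed

theorem theorem1p4:
  fixes n :: nat
    and Q :: "('v, 'e) pre_digraph"
    and T1 T2 :: "('v, 'e, 'k::alg_closed_field) derived_object set"
  assumes "4 \<le> n"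
    and "dynkin_type_D n Q"
    and "semi_orthogonal_decomposition
           (D_b_mod Q :: (('v, 'e, 'k) derived_object, ('v, 'e, 'k) derived_morphism) tri_category)
           T1 T2"
  shows "\<exists>T\<in>{T1, T2}. \<forall>l\<ge>4. \<forall>Q' :: (nat, nat) pre_digraph. dynkin_type_D l Q' \<longrightarrow>
    \<not> has_direct_summand_equivalent_to
        (full_subcategory (D_b_mod Q :: (('v, 'e, 'k) derived_object, ('v, 'e, 'k) derived_morphism) tri_category) T)
        (D_b_mod Q' :: ((nat, nat, 'k) derived_object, (nat, nat, 'k) derived_morphism) tri_category)"
proof (rule ccontr)
 assume neg: "\<not> ?thesis"
 let ?D = "D_b_mod Q :: (('v, 'e, 'k) derived_object, ('v, 'e, 'k) derived_morphism) tri_category"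
 interpret Q: fin_quiver Q by (rule dynkin_fin_quiver[OF assms(1,2)])
 obtain f d where ch0: "\<forall>a b. chi Q a b = ch n d (\<lambda>i. a (f i)) (\<lambda>i. b (f i))"
  using chi_dynkin[OF assms(1,2)] by (elim exE)
 have th: "thick_subcategory ?D T1" "thick_subcategory ?D T2" and hv: "hom_vanish ?D T1 T2"
  using assms(3) by (auto simp: semi_orthogonal_decomposition_def)
 have st: "\<exists>c L. star n d c L \<and> (\<forall>x\<in>insert c L. \<exists>X\<in>T. x = (\<lambda>i. Kc (Q.CX X) (f i)))"
  if T: "T \<in> {T1, T2}" for T
 proof -
  have "\<not> (\<forall>l\<ge>4. \<forall>Q' :: (nat, nat) pre_digraph. dynkin_type_D l Q' -->
   \<not> has_direct_summand_equivalent_to (full_subcategory ?D T)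
    (D_b_mod Q' :: ((nat, nat, 'k) derived_object, (nat, nat, 'k) derived_morphism) tri_category))"
  proof
   assume all: "\<forall>l\<ge>4. \<forall>Q' :: (nat, nat) pre_digraph. dynkin_type_D l Q' -->
    \<not> has_direct_summand_equivalent_to (full_subcategory ?D T)
     (D_b_mod Q' :: ((nat, nat, 'k) derived_object, (nat, nat, 'k) derived_morphism) tri_category)"
   show False by (rule notE[OF neg], rule bexI[OF _ T], rule all)
  qed
  then obtain l and Q' :: "(nat, nat) pre_digraph" where l: "4 \<le> l" "dynkin_type_D l Q'"
   and s: "has_direct_summand_equivalent_to (full_subcategory ?D T)
    (D_b_mod Q' :: ((nat, nat, 'k) derived_object, (nat, nat, 'k) derived_morphism) tri_category)"
   unfolding not_all not_imp not_not by (elim exE conjE)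
  have "thick_subcategory ?D T" using T th by (elim insertE emptyE) simp_all
  note tT = this
  show ?thesis
  proof (rule Euler_star_of_summand[where f = f and d = d, OF assms(1,2) l tT s])
   show "chi Q a b = ch n d (\<lambda>i. a (f i)) (\<lambda>i. b (f i))" for a b by (rule ch0[THEN spec, THEN spec])
  qed
 qed
 have "T1 \<in> {T1, T2}" "T2 \<in> {T1, T2}" by simp_all
 note st12 = st[OF this(1)] st[OF this(2)]
 obtain c L where 1: "star n d c L" "\<forall>x\<in>insert c L. \<exists>X\<in>T1. x = (\<lambda>i. Kc (Q.CX X) (f i))" using st12(1) by (elim exE conjE)
 obtain c' L' where 2: "star n d c' L'" "\<forall>x\<in>insert c' L'. \<exists>X\<in>T2. x = (\<lambda>i. Kc (Q.CX X) (f i))" using st12(2) by (elim exE conjE)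
 have cl: "Q.bcx X \<and> cshift X \<in> T" if "thick_subcategory ?D T" "X \<in> T" for X T
  using that unfolding thick_subcategory_def Q.DT_simps by blast
 \<comment> \<open>The vanishing of morphisms is given in degree zero. It extends to all degrees
   because both subcategories are closed under shifts, and the Euler form between their classes
   becomes zero.\<close>
 have v: "vq Q (Q.CX X) (Q.CX Y) i" if XY: "X \<in> T1" "Y \<in> T2" for X Y i
 proof (rule Q.vq_all_degrees[OF cl[OF th(1)] cl[OF th(2)] _ XY])
  fix X Y assume XY: "X \<in> T1" "Y \<in> T2"
  have b: "Q.bcx X" "Q.bcx Y" using cl[OF th(1) XY(1)] cl[OF th(2) XY(2)] by auto
  have "is_singleton (Hom ?D X Y)" using hv XY by (auto simp: hom_vanish_def)
  then show "vq Q (Q.CX X) (Q.CX Y) 0" using Q.singleton_Hom[OF b] by blast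
 qed
 show False
 proof (rule no_orthogonal_stars[OF assms(1) 1(1) 2(1)])
  fix x y assume xy: "x \<in> L" "y \<in> L'"
  obtain X where X: "X \<in> T1" "x = (\<lambda>i. Kc (Q.CX X) (f i))" using 1(2)[THEN bspec, OF insertI2[OF xy(1)]] by (elim bexE)
  obtain Y where Y: "Y \<in> T2" "y = (\<lambda>i. Kc (Q.CX Y) (f i))" using 2(2)[THEN bspec, OF insertI2[OF xy(2)]] by (elim bexE)
  have b: "Q.bcx X" "Q.bcx Y" using cl[OF th(1) X(1)] cl[OF th(2) Y(1)] by auto
  have "chi Q (Kc (Q.CX X)) (Kc (Q.CX Y)) = 0"
   by (rule chi_zero[OF Q.wfX[OF b(1)] Q.wfX[OF b(2)] Q.fin_arcs Q.fin_verts]) (use v[OF X(1) Y(1)] in \<open>simp add: vq_def\<close>)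
  moreover have "chi Q (Kc (Q.CX X)) (Kc (Q.CX Y)) = ch n d x y" unfolding X(2) Y(2) by (rule ch0[THEN spec, THEN spec])
  ultimately show "ch n d x y = 0" by simp
 qed
qed

end
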